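(* Let $r,d\in\mathbb{N}$. There exists a randomized algorithm (unbiased: errors are permitted on both positive and negative instances) for the power problem in the free solvable group $S_{r,d}$ which, given words $u,v\in F(X_r)$, runs in quasi-linear time $\tilde O(|u|+|v|)$ and returns a correct answer with probability at least $$\left(1-\tfrac{1}{|u|+|v|}\right)^{1+\log_3(|u|+|v|)}.$$ Here a correct answer is some $k\in\mathbb{Z}$ with $u=v^k$ in $S_{r,d}$ if such $k$ exists, and $Fail$ otherwise.
   Context: $F=F(X_r)$ is the free group with basis $X_r=\{x_1,\dots,x_r\}$; elements are given as words over $X_r^{\pm}=\{x_1^{\pm1},\dots,x_r^{\pm1}\}$ and $|w|$ denotes word length. Put $F^{(0)}=F$, $F^{(i)}=[F^{(i-1)},F^{(i-1)}]$; the free solvable group of rank $r$ and class $d$ is $S_{r,d}=F/F^{(d)}$. Computational model: a random access machine with integers written in binary (adding two $n$-bit integers costs $O(n)$, multiplying them costs $O(n\log n\log\log n)$). Each letter of $X_r^{\pm}$ is encoded by a unique bit-string of length $\lceil\log_2 r\rceil+1$, a word by the concatenation of the codes of its letters, and a pair of words by using one additional separator letter. A randomized (Monte Carlo) algorithm additionally has access to a random number generator supplying uniformly random integers from prescribed intervals $[0,N]$; its running time bound is deterministic, its output may be incorrect, and probabilities are taken over its random choices. $\tilde O(n)$ (quasi-linear) means $O(n\log^k n)$ for some constant $k\in\mathbb{N}$. *)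

theory Defs
  imports
    "HOL-Algebra.Solvable_Groups"
    "HOL-Library.Landau_Symbols"
    "HOL-Library.Log_Nat"
    "HOL-Probability.Probability_Mass_Function"
begin

section \<open>Free solvable groups\<close>

text \<open>The pair \<open>(i, True)\<close> stands for the generator \<open>x\<^sub>i\<close>, and \<open>(i, False)\<close> for its inverse.\<close>

type_synonym letter = "nat \<times> bool"
type_synonym word = "letter list"

definition letters :: "nat \<Rightarrow> letter set" where
  "letters r = {1..r} \<times> UNIV"

definition words :: "nat \<Rightarrow> word set" where
  "words r = lists (letters r)"

definition inv_letter :: "letter \<Rightarrow> letter" where
  "inv_letter x = (fst x, \<not> snd x)"

fun cons_reduce :: "letter \<Rightarrow> word \<Rightarrow> word" where
  "cons_reduce x [] = [x]"
| "cons_reduce x (y # w) = (if y = inv_letter x then w else x # y # w)"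

definition free_reduce :: "word \<Rightarrow> word" where
  "free_reduce w = foldr cons_reduce w []"

definition reduced :: "word \<Rightarrow> bool" where
  "reduced w \<longleftrightarrow> (\<forall>i. Suc i < length w \<longrightarrow> w ! Suc i \<noteq> inv_letter (w ! i))"

text \<open>The free group is realised on the reduced words; an arbitrary word \<open>w\<close> represents
  the element \<open>free_reduce w\<close>.\<close>

definition free_group :: "nat \<Rightarrow> word monoid" where
  "free_group r =
     \<lparr>carrier = {w \<in> words r. reduced w}, monoid.mult = (\<lambda>u v. free_reduce (u @ v)), one = []\<rparr>"

definition derived_series :: "nat \<Rightarrow> nat \<Rightarrow> word set" where
  "derived_series r d = (derived (free_group r) ^^ d) (carrier (free_group r))"

definition free_solvable_group :: "nat \<Rightarrow> nat \<Rightarrow> word set monoid" where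
  "free_solvable_group r d = free_group r Mod derived_series r d"

definition solvable_class :: "nat \<Rightarrow> nat \<Rightarrow> word \<Rightarrow> word set" where
  "solvable_class r d w = derived_series r d #>\<^bsub>free_group r\<^esub> free_reduce w"

definition is_exponent :: "nat \<Rightarrow> nat \<Rightarrow> word \<Rightarrow> word \<Rightarrow> int \<Rightarrow> bool" where
  "is_exponent r d u v k \<longleftrightarrow>
     solvable_class r d u = solvable_class r d v [^]\<^bsub>free_solvable_group r d\<^esub> k"

text \<open>The answer \<open>None\<close> stands for \<open>Fail\<close>.\<close>

fun correct_answer :: "nat \<Rightarrow> nat \<Rightarrow> word \<Rightarrow> word \<Rightarrow> int option \<Rightarrow> bool" where
  "correct_answer r d u v (Some k) \<longleftrightarrow> is_exponent r d u v k"
| "correct_answer r d u v None \<longleftrightarrow> (\<nexists>k. is_exponent r d u v k)"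


section \<open>Randomized random access machines with binary integers\<close>

text \<open>A machine has registers, which its instructions address by constants, and a separate
  memory, which they address indirectly through registers.  Both hold arbitrary integers.\<close>

datatype instr =
    Const nat int            \<comment> \<open>\<open>R[a] := c\<close>\<close>
  | Copy nat nat             \<comment> \<open>\<open>R[a] := R[b]\<close>\<close>
  | Plus nat nat nat         \<comment> \<open>\<open>R[a] := R[b] + R[c]\<close>\<close>
  | Minus nat nat nat        \<comment> \<open>\<open>R[a] := R[b] - R[c]\<close>\<close>
  | Times nat nat nat        \<comment> \<open>\<open>R[a] := R[b] * R[c]\<close>\<close>
  | Load nat nat             \<comment> \<open>\<open>R[a] := M[R[b]]\<close>\<close>
  | Store nat nat            \<comment> \<open>\<open>M[R[a]] := R[b]\<close>\<close>
  | Jump nat                 \<comment> \<open>go to instruction \<open>l\<close>\<close>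
  | JumpPos nat nat          \<comment> \<open>if \<open>R[a] > 0\<close> go to instruction \<open>l\<close>\<close>
  | Random nat nat           \<comment> \<open>\<open>R[a] :=\<close> uniformly random element of \<open>[0, R[b]]\<close>\<close>

type_synonym program = "instr list"

record config =
  pc :: nat
  regs :: "nat \<Rightarrow> int"
  mem :: "nat \<Rightarrow> int"
  time :: nat

definition bit_size :: "int \<Rightarrow> nat" where
  "bit_size a = nat (bitlen \<bar>a\<bar>) + 1"

text \<open>Since \<open>floorlog 2 n = \<lfloor>log 2 n\<rfloor> + 1\<close> for positive \<open>n\<close>, this is of order
  \<open>n log n log log n\<close> but does not vanish for small \<open>n\<close>.\<close>

definition mul_cost :: "nat \<Rightarrow> nat" where
  "mul_cost n = n * floorlog 2 n * floorlog 2 (floorlog 2 n)"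

text \<open>The costs of the operations matter only up to constant factors, which are set to 1.
  Memory accesses are charged for the address as well as for the content.\<close>

fun cost :: "instr \<Rightarrow> config \<Rightarrow> nat" where
  "cost (Const a i) c = bit_size i"
| "cost (Copy a b) c = bit_size (regs c b)"
| "cost (Plus a b b') c = max (bit_size (regs c b)) (bit_size (regs c b'))"
| "cost (Minus a b b') c = max (bit_size (regs c b)) (bit_size (regs c b'))"
| "cost (Times a b b') c = mul_cost (max (bit_size (regs c b)) (bit_size (regs c b')))"
| "cost (Load a b) c = bit_size (regs c b) + bit_size (mem c (nat (regs c b)))"
| "cost (Store a b) c = bit_size (regs c a) + bit_size (regs c b)"
| "cost (Jump l) c = 1"
| "cost (JumpPos a l) c = bit_size (regs c a)"
| "cost (Random a b) c = bit_size (regs c b)"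

definition set_reg :: "nat \<Rightarrow> int \<Rightarrow> config \<Rightarrow> config" where
  "set_reg a i c = c\<lparr>pc := Suc (pc c), regs := (regs c)(a := i)\<rparr>"

text \<open>A negative address or random bound is read as 0.\<close>

fun exec :: "instr \<Rightarrow> config \<Rightarrow> config pmf" where
  "exec (Const a i) c = return_pmf (set_reg a i c)"
| "exec (Copy a b) c = return_pmf (set_reg a (regs c b) c)"
| "exec (Plus a b b') c = return_pmf (set_reg a (regs c b + regs c b') c)"
| "exec (Minus a b b') c = return_pmf (set_reg a (regs c b - regs c b') c)"
| "exec (Times a b b') c = return_pmf (set_reg a (regs c b * regs c b') c)"
| "exec (Load a b) c = return_pmf (set_reg a (mem c (nat (regs c b))) c)"
| "exec (Store a b) c =
     return_pmf (c\<lparr>pc := Suc (pc c), mem := (mem c)(nat (regs c a) := regs c b)\<rparr>)"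
| "exec (Jump l) c = return_pmf (c\<lparr>pc := l\<rparr>)"
| "exec (JumpPos a l) c = return_pmf (c\<lparr>pc := (if regs c a > 0 then l else Suc (pc c))\<rparr>)"
| "exec (Random a b) c = map_pmf (\<lambda>i. set_reg a i c) (pmf_of_set {0..max 0 (regs c b)})"

definition halted :: "program \<Rightarrow> config \<Rightarrow> bool" where
  "halted P c \<longleftrightarrow> pc c \<ge> length P"

definition step :: "program \<Rightarrow> config \<Rightarrow> config pmf" where
  "step P c =
     (if halted P c then return_pmf c
      else map_pmf (\<lambda>c'. c'\<lparr>time := time c + cost (P ! pc c) c\<rparr>) (exec (P ! pc c) c))"

fun run :: "program \<Rightarrow> nat \<Rightarrow> config \<Rightarrow> config pmf" where
  "run P 0 c = return_pmf c"
| "run P (Suc n) c = bind_pmf (run P n c) (step P)"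

text \<open>The input is given by its length in register 0 and its symbols in the memory cells
  \<open>0, 1, \<dots>\<close>; all other registers and cells are initially 0.  On halting, register 0 tells
  whether there is an answer (nonzero) or \<open>Fail\<close> (zero), and register 1 holds the answer.\<close>

definition init_config :: "int list \<Rightarrow> config" where
  "init_config s =
     \<lparr>pc = 0,
      regs = (\<lambda>a. if a = 0 then int (length s) else 0),
      mem = (\<lambda>a. if a < length s then s ! a else 0),
      time = 0\<rparr>"

definition answer :: "config \<Rightarrow> int option" where
  "answer c = (if regs c 0 = 0 then None else Some (regs c 1))"

text \<open>Whatever the random choices are, \<open>P\<close> halts on input \<open>s\<close> within time \<open>t\<close>; its output
  has distribution \<open>D\<close>.  The step count \<open>n\<close> is irrelevant once all runs have halted.\<close>

definition outputs_within :: "program \<Rightarrow> int list \<Rightarrow> nat \<Rightarrow> int option pmf \<Rightarrow> bool" where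
  "outputs_within P s t D \<longleftrightarrow>
     (\<exists>n. (\<forall>c \<in> set_pmf (run P n (init_config s)). halted P c \<and> time c \<le> t) \<and>
          D = map_pmf answer (run P n (init_config s)))"

definition quasi_linear :: "(nat \<Rightarrow> nat) \<Rightarrow> bool" where
  "quasi_linear T \<longleftrightarrow>
     (\<exists>k::nat. (\<lambda>n. real (T n)) \<in> O(\<lambda>n. real n * ln (real n) ^ k))"


section \<open>Encoding of words\<close>

definition letter_code :: "nat \<Rightarrow> (letter \<Rightarrow> bool list) \<Rightarrow> bool" where
  "letter_code r code \<longleftrightarrow>
     inj_on code (letters r) \<and> (\<forall>x \<in> letters r. length (code x) = ceillog2 r + 1)"

definition encode_word :: "(letter \<Rightarrow> bool list) \<Rightarrow> word \<Rightarrow> int list" where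
  "encode_word code w = map of_bool (concat (map code w))"

text \<open>The separator is a third input symbol 2 besides the bits 0 and 1: when \<open>r\<close> is a power of 2,
  the codes of the letters already use up all bit strings of the given length.\<close>

definition encode_pair :: "(letter \<Rightarrow> bool list) \<Rightarrow> word \<Rightarrow> word \<Rightarrow> int list" where
  "encode_pair code u v = encode_word code u @ [2] @ encode_word code v"

end

theory Submission
  imports Defs
begin

text \<open>
  Put \<open>D l\<close> for the \<open>l\<close>-th derived subgroup of the free group \<open>G\<close>.  A word \<open>w\<close> labels a walk in the Cayley
  graph of \<open>G / N\<close>, whose flow counts the signed traversals of each edge.  If \<open>N\<close> is normal, two words
  represent the same element modulo \<open>[N, N]\<close> if and only if their flows on the Cayley graph of \<open>G / N\<close>
  agree (\<open>derived_coset_eq_iff_word_flow_eq\<close>, the Magnus embedding).  The classes modulo \<open>D (l + 1)\<close> of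
  all prefixes of a word can therefore be compared as soon as those modulo \<open>D l\<close> can.

  The power problem reduces to such comparisons.  Let \<open>l < d\<close> be the first level such that \<open>u\<close> and \<open>v\<close>
  are not both in \<open>D (l + 1)\<close>; if there is none, any exponent will do.  Then \<open>u = v\<^sup>k\<close> holds modulo \<open>D d\<close> if and only if the flow of \<open>u\<close> on the
  Cayley graph of \<open>G / D l\<close> is \<open>k\<close> times that of \<open>v\<close>, and the commutator of \<open>u\<close> and \<open>v\<close> is trivial
  modulo \<open>D d\<close> (\<open>is_exponent_iff_flow\<close>).  Indeed, the first condition puts \<open>u v\<^sup>-\<^sup>k\<close> into \<open>D (l + 1)\<close>; and
  there an element that commutes with \<open>v\<close> modulo \<open>D d\<close> is trivial modulo \<open>D d\<close>, since conjugation by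
  \<open>v\<close> translates flows of finite support along an element of infinite order.  The first condition
  determines \<open>k\<close>, by means of any edge with nonzero flow of \<open>v\<close>.

  The program labels the prefixes of \<open>w = u v u\<inverse> v\<inverse>\<close> by identifiers that are equal if and only if
  the classes modulo \<open>D l\<close> are, for \<open>l = 0, \<dots>, d\<close>.  In one pass over \<open>w\<close>, it updates the flow of the
  prefix read so far, one edge per letter.  The flow is stored in the leaves of a binary tree of
  logarithmic height, whose nodes hold identifiers of the restrictions of the flow to the leaves below
  them.  The identifier of a node is looked up in a table under the identifiers of the two children, and a
  fresh one is entered if there is none.  Equal flows thus yield equal identifiers at the root and
  different flows different ones, without any randomness: the algorithm is deterministic and always
  correct, and the distribution of its answers is a point distribution.  A change of one leaf affects
  only the nodes above it, which makes for a logarithmic number of operations per letter, on integers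
  with a logarithmic number of bits.

  The program is written in a small structured language, for which total correctness is proved together
  with bounds on the number of steps and on the stored values (\<open>main_correct\<close>).  A compiler carries both
  over to the machine (\<open>compile_correct\<close>); the running time is estimated in
  \<open>quasi_linear_time_limit\<close>.
\<close>

section \<open>The free group on reduced words\<close>

lemma inv_letter_inv_letter [simp]: "inv_letter (inv_letter x) = x"
  by (simp add: inv_letter_def)

lemma inv_letter_neq [simp]: "inv_letter x \<noteq> x" "x \<noteq> inv_letter x"
  by (auto simp: inv_letter_def prod_eq_iff)

lemma inv_letter_in_letters [simp]: "inv_letter x \<in> letters r \<longleftrightarrow> x \<in> letters r"
  by (auto simp: inv_letter_def letters_def mem_Times_iff)

lemma reduced_Nil [simp]: "reduced []"
  by (simp add: reduced_def)

lemma reduced_singleton [simp]: "reduced [x]"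
  by (simp add: reduced_def)

lemma reduced_Cons_Cons [simp]:
  "reduced (x # y # w) \<longleftrightarrow> y \<noteq> inv_letter x \<and> reduced (y # w)"
proof
  assume *: "reduced (x # y # w)"
  have "y \<noteq> inv_letter x" using *[unfolded reduced_def, rule_format, of 0] by simp
  moreover have "reduced (y # w)" unfolding reduced_def
  proof (intro allI impI)
    fix i assume "Suc i < length (y # w)"
    then show "(y # w) ! Suc i \<noteq> inv_letter ((y # w) ! i)"
      using *[unfolded reduced_def, rule_format, of "Suc i"] by simp
  qed
  ultimately show "y \<noteq> inv_letter x \<and> reduced (y # w)" by simp
next
  assume *: "y \<noteq> inv_letter x \<and> reduced (y # w)"
  show "reduced (x # y # w)" unfolding reduced_def
  proof (intro allI impI)
    fix i assume i: "Suc i < length (x # y # w)"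
    show "(x # y # w) ! Suc i \<noteq> inv_letter ((x # y # w) ! i)"
    proof (cases i)
      case 0 then show ?thesis using * by simp
    next
      case (Suc k)
      then show ?thesis using * i unfolding reduced_def by auto
    qed
  qed
qed

lemma reduced_tl: "reduced (x # w) \<Longrightarrow> reduced w"
  by (cases w) auto

lemma cons_reduce_reduced: "reduced w \<Longrightarrow> reduced (cons_reduce x w)"
  by (cases w) (auto intro: reduced_tl)

text \<open>Reduction lets each letter act on the reduced words by \<open>cons_reduce\<close>, inverse letters acting inversely.
  Hence \<open>free_reduce\<close> is compatible with concatenation, from which associativity follows.\<close>

lemma cons_reduce_cancel: "reduced w \<Longrightarrow> cons_reduce x (cons_reduce (inv_letter x) w) = w"
proof (cases w)
  case (Cons y w')
  assume "reduced w"
  then show ?thesis using Cons by (cases w') auto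
qed simp

lemma foldr_cons_reduce_reduced: "reduced w \<Longrightarrow> reduced (foldr cons_reduce u w)"
  by (induction u) (auto intro: cons_reduce_reduced)

lemma reduced_free_reduce [simp]: "reduced (free_reduce w)"
  by (simp add: free_reduce_def foldr_cons_reduce_reduced)

lemma free_reduce_Nil [simp]: "free_reduce [] = []"
  by (simp add: free_reduce_def)

lemma free_reduce_Cons: "free_reduce (x # w) = cons_reduce x (free_reduce w)"
  by (simp add: free_reduce_def)

lemma free_reduce_append: "free_reduce (u @ v) = foldr cons_reduce u (free_reduce v)"
  by (simp add: free_reduce_def)

lemma free_reduce_id [simp]: "reduced w \<Longrightarrow> free_reduce w = w"
proof (induction w)
  case (Cons x w)
  then have "free_reduce w = w" by (auto intro: reduced_tl)
  then show ?case using Cons.prems by (cases w) (auto simp: free_reduce_Cons)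
qed simp

lemma foldr_cons_reduce_cons_reduce:
  "reduced w \<Longrightarrow> foldr cons_reduce (cons_reduce x u) w = cons_reduce x (foldr cons_reduce u w)"
proof (cases u)
  case (Cons y u')
  assume "reduced w"
  then have r: "reduced (foldr cons_reduce u' w)" by (rule foldr_cons_reduce_reduced)
  show ?thesis using Cons cons_reduce_cancel[OF r, of x] by auto
qed simp

lemma foldr_cons_reduce_free_reduce:
  "reduced w \<Longrightarrow> foldr cons_reduce (free_reduce u) w = foldr cons_reduce u w"
  by (induction u) (auto simp: free_reduce_Cons foldr_cons_reduce_cons_reduce)

lemma free_reduce_append_left [simp]: "free_reduce (free_reduce u @ v) = free_reduce (u @ v)"
  by (simp add: free_reduce_append foldr_cons_reduce_free_reduce)

lemma free_reduce_append_right [simp]: "free_reduce (u @ free_reduce v) = free_reduce (u @ v)"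
  by (simp add: free_reduce_append)

lemma words_Nil [simp]: "[] \<in> words r"
  by (simp add: words_def)

lemma words_Cons [simp]: "x # w \<in> words r \<longleftrightarrow> x \<in> letters r \<and> w \<in> words r"
  by (simp add: words_def)

lemma words_append [simp]: "u @ v \<in> words r \<longleftrightarrow> u \<in> words r \<and> v \<in> words r"
  by (simp add: words_def)

lemma cons_reduce_in_words: "x \<in> letters r \<Longrightarrow> w \<in> words r \<Longrightarrow> cons_reduce x w \<in> words r"
  by (cases w) auto

lemma free_reduce_in_words [simp]: "w \<in> words r \<Longrightarrow> free_reduce w \<in> words r"
  by (induction w) (auto simp: free_reduce_Cons intro: cons_reduce_in_words)

definition inv_word :: "word \<Rightarrow> word" where
  "inv_word w = rev (map inv_letter w)"

lemma inv_word_simps [simp]: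
  "inv_word [] = []"
  "inv_word (x # w) = inv_word w @ [inv_letter x]"
  "inv_word (u @ v) = inv_word v @ inv_word u"
  "inv_word (inv_word w) = w"
  "length (inv_word w) = length w"
  by (auto simp: inv_word_def rev_map comp_def)

lemma inv_word_in_words [simp]: "inv_word w \<in> words r \<longleftrightarrow> w \<in> words r"
  by (induction w) auto

lemma free_reduce_inv_word: "free_reduce (inv_word w @ w) = []"
proof (induction w)
  case (Cons x w)
  have "free_reduce (inv_word (x # w) @ x # w)
      = foldr cons_reduce (inv_word w) (cons_reduce (inv_letter x) (cons_reduce x (free_reduce w)))"
    by (simp add: free_reduce_def)
  also have "cons_reduce (inv_letter x) (cons_reduce x (free_reduce w)) = free_reduce w"
    using cons_reduce_cancel[of "free_reduce w" "inv_letter x"] by simp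
  finally show ?case using Cons.IH by (simp add: free_reduce_append)
qed simp

locale free_group_rank =
  fixes r :: nat
begin

abbreviation G :: "word monoid" where "G \<equiv> free_group r"

lemma carrier_G: "carrier G = {w \<in> words r. reduced w}"
  and mult_G: "u \<otimes>\<^bsub>G\<^esub> v = free_reduce (u @ v)"
  and one_G: "\<one>\<^bsub>G\<^esub> = []"
  by (simp_all add: free_group_def)

sublocale group G
proof (rule groupI)
  fix x assume x: "x \<in> carrier G"
  have "free_reduce (inv_word x) \<in> carrier G"
    using x by (simp add: carrier_G)
  moreover have "free_reduce (inv_word x) \<otimes>\<^bsub>G\<^esub> x = \<one>\<^bsub>G\<^esub>"
    by (simp add: mult_G one_G free_reduce_inv_word)
  ultimately show "\<exists>y\<in>carrier G. y \<otimes>\<^bsub>G\<^esub> x = \<one>\<^bsub>G\<^esub>" by blast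
qed (auto simp: carrier_G mult_G one_G)

lemma free_reduce_closed [simp]: "w \<in> words r \<Longrightarrow> free_reduce w \<in> carrier G"
  by (simp add: carrier_G)

lemma free_reduce_mult: "free_reduce (u @ v) = free_reduce u \<otimes>\<^bsub>G\<^esub> free_reduce v"
  by (simp add: mult_G)

lemma free_reduce_Cons_mult: "free_reduce (x # w) = [x] \<otimes>\<^bsub>G\<^esub> free_reduce w"
  by (metis append_Cons append_Nil free_reduce_append_right mult_G)

lemma free_reduce_inv:
  assumes "w \<in> words r" shows "free_reduce (inv_word w) = inv\<^bsub>G\<^esub> free_reduce w"
proof -
  have "free_reduce (inv_word w) \<otimes>\<^bsub>G\<^esub> free_reduce w = \<one>\<^bsub>G\<^esub>"
    by (simp add: mult_G one_G free_reduce_inv_word)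
  then show ?thesis using assms by (intro inv_equality [symmetric]) auto
qed

lemma letter_closed [simp]: "x \<in> letters r \<Longrightarrow> [x] \<in> carrier G"
  by (simp add: carrier_G)

lemma letter_inv: "x \<in> letters r \<Longrightarrow> inv\<^bsub>G\<^esub> [x] = [inv_letter x]"
  using free_reduce_inv[of "[x]"] by simp

end

section \<open>Flows of walks in Cayley graphs\<close>

type_synonym 'v edge = "'v \<times> nat"

definition flow :: "('e \<times> int) list \<Rightarrow> 'e \<Rightarrow> int" where
  "flow L e = (\<Sum>(e', s) \<leftarrow> L. if e' = e then s else 0)"

lemma flow_simps [simp]:
  "flow [] e = 0"
  "flow (p # L) e = (if fst p = e then snd p else 0) + flow L e"
  "flow (L @ L') e = flow L e + flow L' e"
  by (auto simp: flow_def case_prod_unfold)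

lemma flow_notin: "e \<notin> fst ` set L \<Longrightarrow> flow L e = 0"
  by (induction L) auto

definition reverse_steps :: "('e \<times> int) list \<Rightarrow> ('e \<times> int) list" where
  "reverse_steps L = rev (map (\<lambda>(e, s). (e, -s)) L)"

lemma flow_reverse_steps [simp]: "flow (reverse_steps L) e = - flow L e"
  by (induction L) (auto simp: reverse_steps_def)

text \<open>A walk without flow is built up from the empty walk by inserting
  traversals of an edge in both directions.\<close>

lemma zero_flow_induct [consumes 2, case_names Nil insert]:
  assumes "\<forall>p \<in> set L. snd p = 1 \<or> snd p = -1" "\<And>e. flow L e = 0"
  assumes Nil: "P []"
    and insert: "\<And>e s L1 L2. P (L1 @ L2) \<Longrightarrow> s = 1 \<or> s = -1 \<Longrightarrow>
       \<forall>p \<in> set (L1 @ L2). snd p = 1 \<or> snd p = -1 \<Longrightarrow> P ((e, s) # L1 @ (e, -s) # L2)"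
  shows "P L"
  using assms(1,2)
proof (induction L rule: length_induct)
  case (1 L)
  show ?case
  proof (cases L)
    case Nil then show ?thesis using \<open>P []\<close> by simp
  next
    case (Cons p L')
    obtain e s where p: "p = (e, s)" by (cases p)
    have s: "s = 1 \<or> s = -1" using 1(2) Cons p by auto
    have fl: "flow L' e = - s" using 1(3)[of e] Cons p by simp
    (* otherwise all traversals of e in L' have the sign s, which cannot cancel the first one *)
    have "(e, -s) \<in> set L'"
    proof (rule ccontr)
      assume nin: "(e, -s) \<notin> set L'"
      have "snd q = 1 \<or> snd q = -1" if "q \<in> set L'" for q using that 1(2) Cons by auto
      then have "s * flow L' e \<ge> 0" using nin
      proof (induction L')
        case (Cons q L')
        from Cons.prems have "fst q = e \<Longrightarrow> snd q = s"
          using s Cons.prems(1)[of q] by (cases q) auto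
        moreover have "s * flow L' e \<ge> 0" using Cons by auto
        ultimately show ?case using s by (auto simp: algebra_simps)
      qed simp
      then show False using fl s by auto
    qed
    then obtain L1 L2 where L': "L' = L1 @ (e, -s) # L2" by (meson split_list)
    have len: "length (L1 @ L2) < length L" by (simp add: Cons L')
    have f0: "flow (L1 @ L2) e' = 0" for e'
      using 1(3)[of e'] by (auto simp: Cons L' p split: if_splits)
    have sg: "\<forall>p \<in> set (L1 @ L2). snd p = 1 \<or> snd p = -1"
      using 1(2) by (auto simp: Cons L')
    have "P (L1 @ L2)" using 1(1) len f0 sg by blast
    then have "P ((e, s) # L1 @ (e, -s) # L2)" using s sg by (intro insert) auto
    then show ?thesis by (simp add: Cons L' p)
  qed
qed

lemma sum_steps_eq_flow:
  fixes g :: "'e \<Rightarrow> int"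
  assumes "finite E" "fst ` set L \<subseteq> E"
  shows "(\<Sum>(e, s) \<leftarrow> L. s * g e) = (\<Sum>e\<in>E. flow L e * g e)"
  using assms(2)
proof (induction L)
  case (Cons p L)
  obtain e s where p: "p = (e, s)" by (cases p)
  have "(\<Sum>e'\<in>E. flow (p # L) e' * g e') = (\<Sum>e'\<in>E. (if e' = e then s * g e' else 0) + flow L e' * g e')"
    by (intro sum.cong) (auto simp: p algebra_simps)
  also have "\<dots> = s * g e + (\<Sum>e'\<in>E. flow L e' * g e')"
    using Cons.prems assms(1) by (simp add: sum.distrib p)
  finally show ?case using Cons by (simp add: p)
qed simp

context free_group_rank
begin

lemma coset_eq_iff:
  assumes "subgroup N G" "a \<in> carrier G" "b \<in> carrier G"
  shows "N #>\<^bsub>G\<^esub> a = N #>\<^bsub>G\<^esub> b \<longleftrightarrow> a \<otimes>\<^bsub>G\<^esub> inv\<^bsub>G\<^esub> b \<in> N"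
proof -
  interpret N: subgroup N G by fact
  have "N #>\<^bsub>G\<^esub> a = N #>\<^bsub>G\<^esub> b \<longleftrightarrow> a \<in> N #>\<^bsub>G\<^esub> b"
    using assms by (metis repr_independence rcos_self)
  also have "\<dots> \<longleftrightarrow> a \<otimes>\<^bsub>G\<^esub> inv\<^bsub>G\<^esub> b \<in> N"
    using N.rcos_module[OF is_group assms(3) assms(2)] .
  finally show ?thesis .
qed

text \<open>The walk with label \<open>w\<close> from the vertex \<open>N g\<close> in the Cayley graph of the cosets of \<open>N\<close>.  The edge
  \<open>(N h, i)\<close> leads from \<open>N h\<close> to \<open>N h x\<^sub>i\<close>; the sign tells whether it is traversed forwards.\<close>

fun steps :: "word set \<Rightarrow> word \<Rightarrow> word \<Rightarrow> (word set edge \<times> int) list" where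
  "steps N g [] = []"
| "steps N g (x # w) =
     (if snd x then ((N #>\<^bsub>G\<^esub> g, fst x), 1) else ((N #>\<^bsub>G\<^esub> (g \<otimes>\<^bsub>G\<^esub> [x]), fst x), -1))
       # steps N (g \<otimes>\<^bsub>G\<^esub> [x]) w"

abbreviation word_flow :: "word set \<Rightarrow> word \<Rightarrow> word set edge \<Rightarrow> int" where
  "word_flow N w \<equiv> flow (steps N \<one>\<^bsub>G\<^esub> w)"

lemma steps_sign: "\<forall>p \<in> set (steps N g w). snd p = 1 \<or> snd p = -1"
  by (induction w arbitrary: g) auto

lemma steps_append:
  assumes "g \<in> carrier G" "a \<in> words r"
  shows "steps N g (a @ b) = steps N g a @ steps N (g \<otimes>\<^bsub>G\<^esub> free_reduce a) b"
  using assms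
proof (induction a arbitrary: g)
  case Nil
  then show ?case using r_one[of g] by (simp add: one_G)
next
  case (Cons x a)
  then have "(g \<otimes>\<^bsub>G\<^esub> [x]) \<otimes>\<^bsub>G\<^esub> free_reduce a = g \<otimes>\<^bsub>G\<^esub> free_reduce (x # a)"
    by (simp add: m_assoc free_reduce_Cons_mult)
  then show ?case using Cons by simp
qed

lemma steps_edges:
  assumes "g \<in> carrier G" "w \<in> words r"
  shows "fst ` set (steps N g w) \<subseteq> {(N #>\<^bsub>G\<^esub> h, i) | h i. h \<in> carrier G \<and> i \<in> {1..r}}"
  using assms
proof (induction w arbitrary: g)
  case (Cons x w)
  then have "g \<otimes>\<^bsub>G\<^esub> [x] \<in> carrier G" by simp
  moreover have "fst x \<in> {1..r}" using Cons.prems by (auto simp: letters_def)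
  ultimately show ?case using Cons by auto
qed simp

lemma steps_coset:
  assumes "N \<subseteq> carrier G" "g \<in> carrier G" "h \<in> carrier G" "w \<in> words r"
    and "N #>\<^bsub>G\<^esub> g = N #>\<^bsub>G\<^esub> h"
  shows "steps N g w = steps N h w"
  using assms(2-)
proof (induction w arbitrary: g h)
  case (Cons x w)
  have *: "N #>\<^bsub>G\<^esub> (g \<otimes>\<^bsub>G\<^esub> [x]) = N #>\<^bsub>G\<^esub> (h \<otimes>\<^bsub>G\<^esub> [x])"
    using Cons.prems assms(1) by (simp flip: coset_mult_assoc)
  then have "steps N (g \<otimes>\<^bsub>G\<^esub> [x]) w = steps N (h \<otimes>\<^bsub>G\<^esub> [x]) w"
    using Cons.prems by (intro Cons.IH) auto
  then show ?case using * Cons.prems by simp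
qed simp

lemma mult_letter_inv:
  assumes "g \<in> carrier G" "x \<in> letters r"
  shows "g \<otimes>\<^bsub>G\<^esub> [x] \<otimes>\<^bsub>G\<^esub> [inv_letter x] = g"
  using assms by (simp add: m_assoc flip: letter_inv)

lemma steps_inv_word:
  assumes "g \<in> carrier G" "w \<in> words r"
  shows "steps N (g \<otimes>\<^bsub>G\<^esub> free_reduce w) (inv_word w) = reverse_steps (steps N g w)"
  using assms
proof (induction w arbitrary: g)
  case Nil
  then show ?case by (simp add: reverse_steps_def)
next
  case (Cons x w)
  define h where "h = g \<otimes>\<^bsub>G\<^esub> [x]"
  have h: "h \<in> carrier G" using Cons.prems by (simp add: h_def)
  have 1: "g \<otimes>\<^bsub>G\<^esub> free_reduce (x # w) = h \<otimes>\<^bsub>G\<^esub> free_reduce w"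
    using Cons.prems by (simp add: h_def m_assoc free_reduce_Cons_mult)
  have 2: "h \<otimes>\<^bsub>G\<^esub> free_reduce w \<otimes>\<^bsub>G\<^esub> free_reduce (inv_word w) = h"
    using Cons.prems h by (simp add: free_reduce_inv m_assoc)
  have 3: "h \<otimes>\<^bsub>G\<^esub> [inv_letter x] = g" using Cons.prems by (simp add: h_def mult_letter_inv)
  have "steps N (h \<otimes>\<^bsub>G\<^esub> free_reduce w) (inv_word (x # w))
      = reverse_steps (steps N h w) @ steps N h [inv_letter x]"
    using Cons.prems Cons.IH[OF h] h 2 by (simp add: steps_append)
  also have "\<dots> = reverse_steps (steps N g (x # w))"
    using 3 by (auto simp: reverse_steps_def inv_letter_def h_def)
  finally show ?case using 1 by simp
qed

text \<open>Cancellation of a letter against its inverse removes traversals of one edge in both directions, so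
  that the flow depends only on the element of the free group.\<close>

lemma flow_steps_free_reduce:
  assumes "N \<subseteq> carrier G" "g \<in> carrier G" "w \<in> words r"
  shows "flow (steps N g (free_reduce w)) e = flow (steps N g w) e"
  using assms(2,3)
proof (induction w arbitrary: g)
  case (Cons x w)
  have g': "g \<otimes>\<^bsub>G\<^esub> [x] \<in> carrier G" using Cons.prems by simp
  have "flow (steps N g (cons_reduce x v)) e = flow (steps N g (x # v)) e" if "v \<in> words r" for v
  proof (cases "v \<noteq> [] \<and> hd v = inv_letter x")
    case True
    then obtain v' where v: "v = inv_letter x # v'" by (metis list.collapse)
    have 1: "g \<otimes>\<^bsub>G\<^esub> [x] \<otimes>\<^bsub>G\<^esub> [inv_letter x] = g"
      using Cons.prems by (simp add: mult_letter_inv)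
    have "flow (steps N g (x # v)) e = flow (steps N g v') e"
      using 1 by (auto simp: v inv_letter_def)
    then show ?thesis by (simp add: v)
  next
    case False
    then show ?thesis by (cases v) auto
  qed
  from this[of "free_reduce w"]
  show ?case using Cons g' by (simp add: free_reduce_Cons)
qed simp

lemma carrier_in_words: "g \<in> carrier G \<Longrightarrow> g \<in> words r"
  and carrier_free_reduce: "g \<in> carrier G \<Longrightarrow> free_reduce g = g"
  by (auto simp: carrier_G)

lemma flow_steps_mult:
  assumes "N \<subseteq> carrier G" "g \<in> carrier G" "a \<in> carrier G" "b \<in> carrier G"
  shows "flow (steps N g (a \<otimes>\<^bsub>G\<^esub> b)) e = flow (steps N g a) e + flow (steps N (g \<otimes>\<^bsub>G\<^esub> a) b) e"
  using assms by (simp add: mult_G[of a b] flow_steps_free_reduce carrier_in_words steps_append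
      carrier_free_reduce)

text \<open>Elements of \<open>N\<close> label closed walks.  On \<open>N\<close>, the flow is therefore a homomorphism to an abelian
  group, and vanishes on \<open>[N, N]\<close>.\<close>

lemma word_flow_mult:
  assumes "subgroup N G" "a \<in> N" "b \<in> carrier G"
  shows "word_flow N (a \<otimes>\<^bsub>G\<^esub> b) e = word_flow N a e + word_flow N b e"
proof -
  have sub: "N \<subseteq> carrier G" and a: "a \<in> carrier G" using assms subgroup.subset by blast+
  have "steps N (\<one>\<^bsub>G\<^esub> \<otimes>\<^bsub>G\<^esub> a) b = steps N \<one>\<^bsub>G\<^esub> b"
    using sub a assms by (intro steps_coset) (auto simp: carrier_in_words coset_join2)
  then show ?thesis using flow_steps_mult[OF sub one_closed a assms(3)] by simp
qed

lemma word_flow_one [simp]: "word_flow N \<one>\<^bsub>G\<^esub> e = 0"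
  by (simp add: one_G)

lemma word_flow_inv:
  assumes "subgroup N G" "a \<in> N"
  shows "word_flow N (inv\<^bsub>G\<^esub> a) e = - word_flow N a e"
proof -
  have "a \<in> carrier G" using assms subgroup.subset by blast
  then show ?thesis
    using word_flow_mult[OF assms, of "inv\<^bsub>G\<^esub> a" e] by simp
qed

lemma word_flow_derived:
  assumes N: "subgroup N G" and "a \<in> derived G N"
  shows "word_flow N a e = 0"
proof -
  interpret N: subgroup N G by fact
  let ?K = "{a \<in> N. \<forall>e. word_flow N a e = 0}"
  have "subgroup ?K G"
    by (rule subgroupI) (auto simp: word_flow_inv[OF N] word_flow_mult[OF N] intro!: exI[of _ "\<one>\<^bsub>G\<^esub>"])
  moreover have "derived_set G N \<subseteq> ?K"
    by (auto simp: word_flow_inv[OF N] word_flow_mult[OF N])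
  ultimately have "derived G N \<subseteq> ?K"
    unfolding derived_def by (rule generate_subgroup_incl [rotated])
  then show ?thesis using assms(2) by (cases e) auto
qed

text \<open>A telescoping sum: the differences of \<open>f\<close> along the edges of a walk add up to the difference between
  its endpoints.\<close>

lemma boundary_of_steps:
  fixes f :: "word set \<Rightarrow> int"
  assumes "N \<subseteq> carrier G" "g \<in> carrier G" "w \<in> words r"
  shows "(\<Sum>(e, s) \<leftarrow> steps N g w. s * (f (fst e #>\<^bsub>G\<^esub> [(snd e, True)]) - f (fst e)))
    = f (N #>\<^bsub>G\<^esub> (g \<otimes>\<^bsub>G\<^esub> free_reduce w)) - f (N #>\<^bsub>G\<^esub> g)"
  using assms(2,3)
proof (induction w arbitrary: g)
  case Nil
  then show ?case using r_one[of g] by (simp add: one_G)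
next
  case (Cons x w)
  define h where "h = g \<otimes>\<^bsub>G\<^esub> [x]"
  have h: "h \<in> carrier G" using Cons.prems by (simp add: h_def)
  have 1: "g \<otimes>\<^bsub>G\<^esub> free_reduce (x # w) = h \<otimes>\<^bsub>G\<^esub> free_reduce w"
    using Cons.prems by (simp add: h_def m_assoc free_reduce_Cons_mult)
  have 2: "h \<otimes>\<^bsub>G\<^esub> [inv_letter x] = g" using Cons.prems by (simp add: h_def mult_letter_inv)
  have 3: "N #>\<^bsub>G\<^esub> g #>\<^bsub>G\<^esub> [x] = N #>\<^bsub>G\<^esub> h"
    using Cons.prems assms(1) by (simp add: coset_mult_assoc h_def)
  have 4: "N #>\<^bsub>G\<^esub> h #>\<^bsub>G\<^esub> [inv_letter x] = N #>\<^bsub>G\<^esub> g"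
    using Cons.prems assms(1) h 2 by (simp add: coset_mult_assoc)
  have IH: "(\<Sum>(e, s) \<leftarrow> steps N h w. s * (f (fst e #>\<^bsub>G\<^esub> [(snd e, True)]) - f (fst e)))
    = f (N #>\<^bsub>G\<^esub> (h \<otimes>\<^bsub>G\<^esub> free_reduce w)) - f (N #>\<^bsub>G\<^esub> h)"
    using Cons h by simp
  have S: "steps N g (x # w) =
      (if snd x then ((N #>\<^bsub>G\<^esub> g, fst x), 1) else ((N #>\<^bsub>G\<^esub> h, fst x), -1)) # steps N h w"
    by (simp add: h_def)
  show ?case
  proof (cases x)
    case (Pair i b)
    then show ?thesis using IH 1 3 4 S by (cases b) (simp_all add: inv_letter_def del: steps.simps)
  qed
qed

text \<open>The sum of the differences of a function along a walk depends only on the flow.  For the indicator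
  function \<open>f\<close> of the endpoint of one walk, it tells whether the other has the same endpoint.\<close>

lemma word_flow_eq_imp_coset_eq:
  assumes N: "subgroup N G" and "a \<in> words r" "b \<in> words r"
    and eq: "\<And>e. word_flow N a e = word_flow N b e"
  shows "N #>\<^bsub>G\<^esub> free_reduce a = N #>\<^bsub>G\<^esub> free_reduce b"
proof -
  have sub: "N \<subseteq> carrier G" using N subgroup.subset by blast
  define f where "f v = (if v = N #>\<^bsub>G\<^esub> free_reduce a then 1 else (0::int))" for v
  define g where "g e = f (fst e #>\<^bsub>G\<^esub> [(snd e, True)]) - f (fst e)" for e :: "word set edge"
  define E where "E = fst ` (set (steps N \<one>\<^bsub>G\<^esub> a) \<union> set (steps N \<one>\<^bsub>G\<^esub> b))"
  have "(\<Sum>(e, s) \<leftarrow> steps N \<one>\<^bsub>G\<^esub> a. s * g e) = (\<Sum>(e, s) \<leftarrow> steps N \<one>\<^bsub>G\<^esub> b. s * g e)"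
    by (subst (1 2) sum_steps_eq_flow[of E]) (auto simp: E_def eq)
  then have "f (N #>\<^bsub>G\<^esub> free_reduce a) = f (N #>\<^bsub>G\<^esub> free_reduce b)"
    using assms sub by (simp add: g_def boundary_of_steps)
  then show ?thesis by (auto simp: f_def split: if_splits)
qed

text \<open>With representatives \<open>t v\<close> of the vertices, a walk with a label \<open>w\<close> is a product of elements
  \<open>t v x (t (v x))\<inverse>\<close> of \<open>N\<close>, one for each edge traversed, up to representatives of its endpoints.
  In the abelian group \<open>N / [N, N]\<close>, only the flow matters for such a product.\<close>

lemma word_flow_zero_imp_derived:
  assumes N: "N \<lhd> G" and w: "w \<in> words r" and wN: "free_reduce w \<in> N"
    and zero: "\<And>e. word_flow N w e = 0"
  shows "free_reduce w \<in> derived G N"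
proof -
  interpret N: normal N G by fact
  interpret K: normal "derived G N" G using N by (rule derived_is_normal)
  define t where "t v = (SOME g. g \<in> v)" for v :: "word set"
  have tN: "t (N #>\<^bsub>G\<^esub> g) \<otimes>\<^bsub>G\<^esub> inv\<^bsub>G\<^esub> g \<in> N" and tG: "t (N #>\<^bsub>G\<^esub> g) \<in> carrier G"
    if "g \<in> carrier G" for g
  proof -
    have "g \<in> N #>\<^bsub>G\<^esub> g" using that by (simp add: rcos_self N.subgroup_axioms)
    then have t: "t (N #>\<^bsub>G\<^esub> g) \<in> N #>\<^bsub>G\<^esub> g" unfolding t_def by (rule someI)
    then show "t (N #>\<^bsub>G\<^esub> g) \<in> carrier G"
      using that r_coset_subset_G[OF N.subset] by blast
    with t that show "t (N #>\<^bsub>G\<^esub> g) \<otimes>\<^bsub>G\<^esub> inv\<^bsub>G\<^esub> g \<in> N"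
      using N.rcos_module by auto
  qed
  define c where "c e = t (fst e) \<otimes>\<^bsub>G\<^esub> [(snd e, True)] \<otimes>\<^bsub>G\<^esub> inv\<^bsub>G\<^esub> t (fst e #>\<^bsub>G\<^esub> [(snd e, True)])"
    for e :: "word set edge"
  define P where "P L = foldr (\<lambda>(e, s) z. (if s = (1::int) then c e else inv\<^bsub>G\<^esub> c e) \<otimes>\<^bsub>G\<^esub> z) L \<one>\<^bsub>G\<^esub>" for L
  have P_simps: "P [] = \<one>\<^bsub>G\<^esub>" "P ((e, s) # L) = (if s = 1 then c e else inv\<^bsub>G\<^esub> c e) \<otimes>\<^bsub>G\<^esub> P L" for e s L
    by (simp_all add: P_def)
  define E where "E = {(N #>\<^bsub>G\<^esub> h, i) | h i. h \<in> carrier G \<and> i \<in> {1..r}}"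
  have c: "c e \<in> N" if e_in: "e \<in> E" for e
  proof -
    obtain g i where e: "e = (N #>\<^bsub>G\<^esub> g, i)" and g: "g \<in> carrier G" and i: "i \<in> {1..r}"
      using e_in unfolding E_def by blast
    define x where "x = [(i, True)]"
    have x: "x \<in> carrier G" using i unfolding x_def by (intro letter_closed) (simp add: letters_def)
    define a where "a = t (N #>\<^bsub>G\<^esub> g)"
    define b where "b = t (N #>\<^bsub>G\<^esub> (g \<otimes>\<^bsub>G\<^esub> x))"
    have ab: "a \<in> carrier G" "b \<in> carrier G" using g x tG by (auto simp: a_def b_def)
    have 1: "a \<otimes>\<^bsub>G\<^esub> inv\<^bsub>G\<^esub> g \<in> N" using tN[OF g] by (simp add: a_def)
    have "b \<otimes>\<^bsub>G\<^esub> inv\<^bsub>G\<^esub> (g \<otimes>\<^bsub>G\<^esub> x) \<in> N" using tN[of "g \<otimes>\<^bsub>G\<^esub> x"] g x by (simp add: b_def)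
    then have "inv\<^bsub>G\<^esub> (b \<otimes>\<^bsub>G\<^esub> inv\<^bsub>G\<^esub> (g \<otimes>\<^bsub>G\<^esub> x)) \<in> N" by simp
    then have "(a \<otimes>\<^bsub>G\<^esub> inv\<^bsub>G\<^esub> g) \<otimes>\<^bsub>G\<^esub> inv\<^bsub>G\<^esub> (b \<otimes>\<^bsub>G\<^esub> inv\<^bsub>G\<^esub> (g \<otimes>\<^bsub>G\<^esub> x)) \<in> N"
      using 1 by blast
    also have "inv\<^bsub>G\<^esub> (b \<otimes>\<^bsub>G\<^esub> inv\<^bsub>G\<^esub> (g \<otimes>\<^bsub>G\<^esub> x)) = (g \<otimes>\<^bsub>G\<^esub> x) \<otimes>\<^bsub>G\<^esub> inv\<^bsub>G\<^esub> b"
      using ab g x by (simp add: inv_mult_group)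
    also have "(a \<otimes>\<^bsub>G\<^esub> inv\<^bsub>G\<^esub> g) \<otimes>\<^bsub>G\<^esub> ((g \<otimes>\<^bsub>G\<^esub> x) \<otimes>\<^bsub>G\<^esub> inv\<^bsub>G\<^esub> b) = a \<otimes>\<^bsub>G\<^esub> x \<otimes>\<^bsub>G\<^esub> inv\<^bsub>G\<^esub> b"
      using ab g x by (simp add: m_assoc inv_solve_left')
    finally show "c e \<in> N" using g x
      by (simp add: c_def e a_def b_def coset_mult_assoc N.subset flip: x_def)
  qed
  have P_N: "P L \<in> N" if "fst ` set L \<subseteq> E" for L
    using that
  proof (induction L)
    case (Cons p L)
    obtain e s where p: "p = (e, s)" by (cases p)
    have "c e \<in> N" using Cons.prems p by (intro c) auto
    moreover have "P L \<in> N" using Cons by auto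
    ultimately show ?case by (auto simp: P_simps p)
  qed (simp add: P_simps)
  have P_append: "P (L @ L') = P L \<otimes>\<^bsub>G\<^esub> P L'" if "fst ` set (L @ L') \<subseteq> E" for L L'
    using that
  proof (induction L)
    case Nil
    then have "P L' \<in> N" by (intro P_N) auto
    then show ?case by (simp add: P_simps)
  next
    case (Cons p L)
    obtain e s where p: "p = (e, s)" by (cases p)
    have "c e \<in> N" using Cons.prems p by (intro c) auto
    moreover have "P L \<in> N" "P L' \<in> N" using Cons.prems by (auto intro!: P_N)
    ultimately show ?case using Cons by (simp add: P_simps p m_assoc)
  qed
  have P_steps: "P (steps N g w) =
      t (N #>\<^bsub>G\<^esub> g) \<otimes>\<^bsub>G\<^esub> free_reduce w \<otimes>\<^bsub>G\<^esub> inv\<^bsub>G\<^esub> t (N #>\<^bsub>G\<^esub> (g \<otimes>\<^bsub>G\<^esub> free_reduce w))"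
    if "g \<in> carrier G" "w \<in> words r" for g w
    using that
  proof (induction w arbitrary: g)
    case Nil
    then show ?case using tG[of g] r_one[of g] r_one[of "t (N #>\<^bsub>G\<^esub> g)"] r_inv[of "t (N #>\<^bsub>G\<^esub> g)"]
      unfolding one_G by (simp add: P_simps one_G)
  next
    case (Cons x w)
    define h where "h = g \<otimes>\<^bsub>G\<^esub> [x]"
    have g: "g \<in> carrier G" and h: "h \<in> carrier G" and x: "[x] \<in> carrier G"
      and w: "free_reduce w \<in> carrier G" using Cons.prems by (simp_all add: h_def)
    have 1: "g \<otimes>\<^bsub>G\<^esub> free_reduce (x # w) = h \<otimes>\<^bsub>G\<^esub> free_reduce w"
      using Cons.prems by (simp add: h_def m_assoc free_reduce_Cons_mult)
    have 2: "h \<otimes>\<^bsub>G\<^esub> [inv_letter x] = g" using Cons.prems by (simp add: h_def mult_letter_inv)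
    have 3: "N #>\<^bsub>G\<^esub> g #>\<^bsub>G\<^esub> [x] = N #>\<^bsub>G\<^esub> h"
      using g x by (simp add: coset_mult_assoc h_def N.subset)
    have 4: "N #>\<^bsub>G\<^esub> h #>\<^bsub>G\<^esub> [inv_letter x] = N #>\<^bsub>G\<^esub> g"
      using Cons.prems h 2 by (simp add: coset_mult_assoc N.subset)
    define a b d where "a = t (N #>\<^bsub>G\<^esub> g)" and "b = t (N #>\<^bsub>G\<^esub> h)"
      and "d = t (N #>\<^bsub>G\<^esub> (h \<otimes>\<^bsub>G\<^esub> free_reduce w))"
    have abd: "a \<in> carrier G" "b \<in> carrier G" "d \<in> carrier G"
      using g h w tG by (simp_all add: a_def b_def d_def)
    have IH: "P (steps N h w) = b \<otimes>\<^bsub>G\<^esub> free_reduce w \<otimes>\<^bsub>G\<^esub> inv\<^bsub>G\<^esub> d"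
      using Cons h by (simp add: b_def d_def)
    have S: "steps N g (x # w) =
        (if snd x then ((N #>\<^bsub>G\<^esub> g, fst x), 1) else ((N #>\<^bsub>G\<^esub> h, fst x), -1)) # steps N h w"
      by (simp add: h_def)
    have "P (steps N g (x # w)) = (a \<otimes>\<^bsub>G\<^esub> [x] \<otimes>\<^bsub>G\<^esub> inv\<^bsub>G\<^esub> b) \<otimes>\<^bsub>G\<^esub> P (steps N h w)"
    proof (cases x)
      case (Pair i s)
      show ?thesis
      proof (cases s)
        case True
        then show ?thesis using Pair 3 S by (simp add: P_simps c_def a_def b_def del: steps.simps)
      next
        case False
        have "inv\<^bsub>G\<^esub> (b \<otimes>\<^bsub>G\<^esub> [inv_letter x] \<otimes>\<^bsub>G\<^esub> inv\<^bsub>G\<^esub> a) = a \<otimes>\<^bsub>G\<^esub> ([x] \<otimes>\<^bsub>G\<^esub> inv\<^bsub>G\<^esub> b)"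
          using Cons.prems abd x by (simp add: inv_mult_group flip: letter_inv)
        then show ?thesis using Pair False 4 S abd x
          by (simp add: P_simps c_def a_def b_def inv_letter_def m_assoc del: steps.simps)
      qed
    qed
    also have "\<dots> = a \<otimes>\<^bsub>G\<^esub> ([x] \<otimes>\<^bsub>G\<^esub> free_reduce w) \<otimes>\<^bsub>G\<^esub> inv\<^bsub>G\<^esub> d"
      using abd x w by (simp add: IH m_assoc) (simp add: m_assoc[symmetric])
    finally show ?case unfolding 1 unfolding free_reduce_Cons_mult a_def d_def .
  qed
  have "fst ` set L \<subseteq> E \<longrightarrow> P L \<in> derived G N"
    if "\<forall>p \<in> set L. snd p = 1 \<or> snd p = -1" "\<And>e. flow L e = 0" for L
    using that
  proof (induction L rule: zero_flow_induct)
    case Nil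
    then show ?case by (simp add: P_simps)
  next
    case (insert e s L1 L2)
    show ?case
    proof
      assume E: "fst ` set ((e, s) # L1 @ (e, - s) # L2) \<subseteq> E"
      define a where "a = (if s = 1 then c e else inv\<^bsub>G\<^esub> c e)"
      have ce: "c e \<in> N" using E by (intro c) auto
      then have a: "a \<in> N" by (simp add: a_def)
      have inva: "(if - s = 1 then c e else inv\<^bsub>G\<^esub> c e) = inv\<^bsub>G\<^esub> a"
        using insert(2) ce by (auto simp: a_def)
      have P12: "P L1 \<in> N" "P L2 \<in> N" using E by (auto intro!: P_N)
      have P1: "P (L1 @ (e, - s) # L2) = P L1 \<otimes>\<^bsub>G\<^esub> (inv\<^bsub>G\<^esub> a \<otimes>\<^bsub>G\<^esub> P L2)"
        using E inva by (subst P_append) (auto simp: P_simps)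
      have G: "a \<in> carrier G" "P L1 \<in> carrier G" "P L2 \<in> carrier G" using a P12 by simp_all
      have "P ((e, s) # L1 @ (e, - s) # L2) = a \<otimes>\<^bsub>G\<^esub> (P L1 \<otimes>\<^bsub>G\<^esub> (inv\<^bsub>G\<^esub> a \<otimes>\<^bsub>G\<^esub> P L2))"
        unfolding P_simps P1 by (simp add: a_def)
      also have "\<dots> = (a \<otimes>\<^bsub>G\<^esub> P L1 \<otimes>\<^bsub>G\<^esub> inv\<^bsub>G\<^esub> a \<otimes>\<^bsub>G\<^esub> inv\<^bsub>G\<^esub> P L1) \<otimes>\<^bsub>G\<^esub> (P L1 \<otimes>\<^bsub>G\<^esub> P L2)"
        using G by (simp add: m_assoc) (simp add: m_assoc[symmetric])
      also have "\<dots> \<in> derived G N"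
      proof (rule K.m_closed)
        show "a \<otimes>\<^bsub>G\<^esub> P L1 \<otimes>\<^bsub>G\<^esub> inv\<^bsub>G\<^esub> a \<otimes>\<^bsub>G\<^esub> inv\<^bsub>G\<^esub> P L1 \<in> derived G N"
          unfolding derived_def using a P12 by (intro generate.incl) auto
        show "P L1 \<otimes>\<^bsub>G\<^esub> P L2 \<in> derived G N"
          using insert(1) E P_append[of L1 L2] by auto
      qed
      finally show "P ((e, s) # L1 @ (e, - s) # L2) \<in> derived G N" .
    qed
  qed
  from this[OF steps_sign zero] have P: "P (steps N \<one>\<^bsub>G\<^esub> w) \<in> derived G N"
    using steps_edges[OF one_closed w] unfolding E_def by blast
  define a where "a = t N"
  have N1: "N #>\<^bsub>G\<^esub> \<one>\<^bsub>G\<^esub> = N" "N #>\<^bsub>G\<^esub> free_reduce w = N"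
    using wN by (simp_all add: coset_join2 N.subgroup_axioms)
  have a: "a \<in> carrier G" using tG[of "\<one>\<^bsub>G\<^esub>"] by (simp add: N1 a_def)
  have "a \<otimes>\<^bsub>G\<^esub> free_reduce w \<otimes>\<^bsub>G\<^esub> inv\<^bsub>G\<^esub> a \<in> derived G N"
    using P w by (simp add: P_steps N1 a_def)
  from K.inv_op_closed1[OF a this] show ?thesis
    using a w by (simp add: m_assoc) (simp add: m_assoc[symmetric])
qed

text \<open>The Magnus embedding theorem, in terms of flows.  Words with the same flow have the same class modulo
  \<open>N\<close>, as the flow determines the endpoint; their quotient then lies in \<open>N\<close> and has no flow.\<close>

theorem derived_coset_eq_iff_word_flow_eq:
  assumes N: "N \<lhd> G" and a: "a \<in> words r" and b: "b \<in> words r"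
  shows "derived G N #>\<^bsub>G\<^esub> free_reduce a = derived G N #>\<^bsub>G\<^esub> free_reduce b
     \<longleftrightarrow> (\<forall>e. word_flow N a e = word_flow N b e)"
proof -
  interpret N: normal N G by fact
  interpret K: normal "derived G N" G using N by (rule derived_is_normal)
  have ab: "free_reduce a \<in> carrier G" "free_reduce b \<in> carrier G" using a b by simp_all
  define z where "z = free_reduce a \<otimes>\<^bsub>G\<^esub> inv\<^bsub>G\<^esub> free_reduce b"
  have z: "z \<in> carrier G" using ab by (simp add: z_def)
  have "z \<in> derived G N \<longleftrightarrow> (\<forall>e. word_flow N a e = word_flow N b e)"
  proof
    assume zK: "z \<in> derived G N"
    then have zN: "z \<in> N" using derived_incl[OF subset_refl N.subgroup_axioms] by blast
    have "z \<otimes>\<^bsub>G\<^esub> free_reduce b = free_reduce a" using ab by (simp add: z_def m_assoc)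
    then have "word_flow N (free_reduce a) e = word_flow N (free_reduce b) e" for e
      using word_flow_mult[OF N.subgroup_axioms zN ab(2), of e]
        word_flow_derived[OF N.subgroup_axioms zK, of e] by simp
    then show "\<forall>e. word_flow N a e = word_flow N b e"
      using a b by (simp add: flow_steps_free_reduce N.subset)
  next
    assume eq [rule_format]: "\<forall>e. word_flow N a e = word_flow N b e"
    then have coset: "N #>\<^bsub>G\<^esub> free_reduce a = N #>\<^bsub>G\<^esub> free_reduce b"
      using a b by (intro word_flow_eq_imp_coset_eq N.subgroup_axioms) auto
    then have zN: "z \<in> N" using ab by (simp add: coset_eq_iff N.subgroup_axioms z_def)
    have zab: "free_reduce (a @ inv_word b) = z"
      using b by (simp add: free_reduce_mult free_reduce_inv z_def)
    have "word_flow N (a @ inv_word b) e = 0" for e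
    proof -
      have "steps N (free_reduce a) (inv_word b) = steps N (free_reduce b) (inv_word b)"
        using coset ab b by (intro steps_coset) (auto simp: N.subset)
      also have "\<dots> = reverse_steps (steps N \<one>\<^bsub>G\<^esub> b)"
        using steps_inv_word[OF one_closed b] ab by simp
      finally show ?thesis using eq a ab by (simp add: steps_append)
    qed
    then show "z \<in> derived G N"
      using word_flow_zero_imp_derived[OF N, of "a @ inv_word b"] a b zab zN by auto
  qed
  then show ?thesis using ab by (simp add: coset_eq_iff K.subgroup_axioms z_def)
qed

end

section \<open>Powers in free solvable groups\<close>

context free_group_rank
begin

abbreviation D :: "nat \<Rightarrow> word set" where "D \<equiv> derived_series r"

lemma derived_series_0 [simp]: "D 0 = carrier G"
  and derived_series_Suc: "D (Suc l) = derived G (D l)"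
  by (simp_all add: derived_series_def)

lemma derived_series_normal: "D l \<lhd> G"
  by (induction l) (simp_all add: derived_series_Suc normal_self derived_is_normal)

lemma derived_series_subgroup: "subgroup (D l) G"
  using derived_series_normal normal_imp_subgroup by blast

lemma derived_series_antimono: "l \<le> m \<Longrightarrow> D m \<subseteq> D l"
  by (induction m rule: dec_induct)
    (auto simp: derived_series_Suc dest: derived_incl[OF subset_refl derived_series_subgroup, THEN subsetD])

lemma derived_series_carrier: "D l \<subseteq> carrier G"
  using derived_series_antimono[of 0 l] by simp

lemma solvable_class_eq_iff:
  assumes "a \<in> words r" "b \<in> words r"
  shows "solvable_class r l a = solvable_class r l b
     \<longleftrightarrow> free_reduce a \<otimes>\<^bsub>G\<^esub> inv\<^bsub>G\<^esub> free_reduce b \<in> D l"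
  using assms by (simp add: solvable_class_def coset_eq_iff derived_series_subgroup)

lemma solvable_class_Suc_eq_iff:
  assumes "a \<in> words r" "b \<in> words r"
  shows "solvable_class r (Suc l) a = solvable_class r (Suc l) b
     \<longleftrightarrow> (\<forall>e. word_flow (D l) a e = word_flow (D l) b e)"
  using assms derived_coset_eq_iff_word_flow_eq[OF derived_series_normal]
  by (simp add: solvable_class_def derived_series_Suc)

lemma mem_derived_series_Suc_iff:
  assumes "a \<in> carrier G"
  shows "a \<in> D (Suc l) \<longleftrightarrow> (\<forall>e. word_flow (D l) a e = 0)"
  using solvable_class_Suc_eq_iff[of a "[]" l] solvable_class_eq_iff[of a "[]" "Suc l"] assms
  by (simp add: carrier_in_words carrier_free_reduce flip: one_G)

lemma word_flow_int_pow:
  assumes N: "subgroup N G" and "a \<in> N"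
  shows "word_flow N (a [^]\<^bsub>G\<^esub> (k::int)) e = k * word_flow N a e"
proof -
  interpret N: subgroup N G by fact
  have a: "a \<in> carrier G" using assms by simp
  have nat: "word_flow N (a [^]\<^bsub>G\<^esub> (n::nat)) e = int n * word_flow N a e \<and> a [^]\<^bsub>G\<^esub> n \<in> N" for n
    using assms a by (induction n) (auto simp: word_flow_mult[OF N] algebra_simps)
  show ?thesis
  proof (cases "k \<ge> 0")
    case True
    then obtain n where "k = int n" using nonneg_int_cases by blast
    then show ?thesis using nat[of n] by (simp add: int_pow_int)
  next
    case False
    then obtain n where k: "k = - int n" by (metis int_cases2 nle_le of_nat_0_le_iff)
    then show ?thesis using nat[of n] a by (simp add: int_pow_neg_int word_flow_inv[OF N])
  qed
qed

text \<open>Free solvable groups are torsion free: at the level where \<open>v\<close> leaves the derived series,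
  its flow is nonzero, and that of \<open>v\<^sup>k\<close> is \<open>k\<close> times as large.\<close>

lemma int_pow_notin_derived_series:
  assumes "v \<in> carrier G" "v \<notin> D i" "i \<le> l" "k \<noteq> (0::int)"
  shows "v [^]\<^bsub>G\<^esub> k \<notin> D l"
proof -
  define j where "j = (LEAST j. v \<notin> D j)"
  have vj: "v \<notin> D j" unfolding j_def using assms(2) by (rule LeastI)
  have ji: "j \<le> i" unfolding j_def using assms(2) by (rule Least_le)
  have "j \<noteq> 0" using vj assms(1) by (intro notI) simp
  then obtain j' where j: "j = Suc j'" using not0_implies_Suc by blast
  have vj': "v \<in> D j'" using not_less_Least[of j' "\<lambda>j. v \<notin> D j"] j by (simp add: j_def)
  obtain e where "word_flow (D j') v e \<noteq> 0"
    using vj mem_derived_series_Suc_iff[OF assms(1), of j'] by (auto simp: j)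
  then have "word_flow (D j') (v [^]\<^bsub>G\<^esub> k) e \<noteq> 0"
    using assms(4) by (simp add: word_flow_int_pow[OF derived_series_subgroup vj'])
  then have "v [^]\<^bsub>G\<^esub> k \<notin> D j"
    using mem_derived_series_Suc_iff[of "v [^]\<^bsub>G\<^esub> k" j'] assms(1) j by fastforce
  then show ?thesis using derived_series_antimono[of j l] ji assms(3) by auto
qed

lemma normal_coset_left_cancel:
  assumes "N \<lhd> G" "h \<in> carrier G" "a \<in> carrier G" "b \<in> carrier G"
  shows "N #>\<^bsub>G\<^esub> (h \<otimes>\<^bsub>G\<^esub> a) = N #>\<^bsub>G\<^esub> (h \<otimes>\<^bsub>G\<^esub> b) \<longleftrightarrow> N #>\<^bsub>G\<^esub> a = N #>\<^bsub>G\<^esub> b"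
proof -
  interpret N: normal N G by fact
  define z where "z = a \<otimes>\<^bsub>G\<^esub> inv\<^bsub>G\<^esub> b"
  have z: "z \<in> carrier G" using assms by (simp add: z_def)
  have 1: "(h \<otimes>\<^bsub>G\<^esub> a) \<otimes>\<^bsub>G\<^esub> inv\<^bsub>G\<^esub> (h \<otimes>\<^bsub>G\<^esub> b) = h \<otimes>\<^bsub>G\<^esub> z \<otimes>\<^bsub>G\<^esub> inv\<^bsub>G\<^esub> h"
    using assms by (simp add: z_def inv_mult_group m_assoc)
  have "h \<otimes>\<^bsub>G\<^esub> z \<otimes>\<^bsub>G\<^esub> inv\<^bsub>G\<^esub> h \<in> N \<longleftrightarrow> z \<in> N"
  proof
    assume "h \<otimes>\<^bsub>G\<^esub> z \<otimes>\<^bsub>G\<^esub> inv\<^bsub>G\<^esub> h \<in> N"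
    from N.inv_op_closed1[OF assms(2) this] show "z \<in> N"
      using assms(2) z by (simp add: m_assoc) (simp add: m_assoc[symmetric])
  qed (use N.inv_op_closed2 assms in blast)
  then show ?thesis using assms 1
    by (simp add: coset_eq_iff N.subgroup_axioms flip: z_def)
qed

text \<open>As \<open>N\<close> is normal, multiplication by \<open>h\<close> from the left acts on its Cayley graph.\<close>

lemma flow_steps_translate:
  assumes "N \<lhd> G" "h \<in> carrier G" "g \<in> carrier G" "p \<in> carrier G" "w \<in> words r"
  shows "flow (steps N (h \<otimes>\<^bsub>G\<^esub> g) w) (N #>\<^bsub>G\<^esub> (h \<otimes>\<^bsub>G\<^esub> p), i) = flow (steps N g w) (N #>\<^bsub>G\<^esub> p, i)"
  using assms(3,5)
proof (induction w arbitrary: g)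
  case (Cons x w)
  have eq: "h \<otimes>\<^bsub>G\<^esub> g \<otimes>\<^bsub>G\<^esub> [x] = h \<otimes>\<^bsub>G\<^esub> (g \<otimes>\<^bsub>G\<^esub> [x])"
    using assms(2) Cons.prems by (simp add: m_assoc)
  have "flow (steps N (h \<otimes>\<^bsub>G\<^esub> (g \<otimes>\<^bsub>G\<^esub> [x])) w) (N #>\<^bsub>G\<^esub> (h \<otimes>\<^bsub>G\<^esub> p), i)
      = flow (steps N (g \<otimes>\<^bsub>G\<^esub> [x]) w) (N #>\<^bsub>G\<^esub> p, i)"
    using Cons by simp
  then show ?case using Cons.prems assms eq
    by (simp add: normal_coset_left_cancel)
qed simp

text \<open>If \<open>z\<close> lies in \<open>D l\<close>, then conjugation by \<open>v\<close> translates its flow by \<open>v\<close>.  As \<open>v\<close> has infinite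
  order modulo \<open>D l\<close>, no nonzero flow of a finite walk is invariant under this translation.\<close>

lemma commuting_in_derived_series_Suc:
  assumes v: "v \<in> carrier G" "v \<notin> D i" and z: "z \<in> D l" and il: "i \<le> l"
    and comm: "D (Suc l) #>\<^bsub>G\<^esub> (z \<otimes>\<^bsub>G\<^esub> v) = D (Suc l) #>\<^bsub>G\<^esub> (v \<otimes>\<^bsub>G\<^esub> z)"
  shows "z \<in> D (Suc l)"
proof (rule ccontr)
  assume zn: "z \<notin> D (Suc l)"
  interpret N: normal "D l" G by (rule derived_series_normal)
  have zG: "z \<in> carrier G" using z by simp
  let ?f = "word_flow (D l) z"
  obtain e where e: "?f e \<noteq> 0" using zn mem_derived_series_Suc_iff[OF zG, of l] by blast
  then have esteps: "e \<in> fst ` set (steps (D l) \<one>\<^bsub>G\<^esub> z)" using flow_notin by metis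
  then obtain p j where ep: "e = (D l #>\<^bsub>G\<^esub> p, j)" and p: "p \<in> carrier G"
    using steps_edges[OF one_closed carrier_in_words[OF zG], of "D l"] by blast
  have "word_flow (D l) (z \<otimes>\<^bsub>G\<^esub> v) e' = word_flow (D l) (v \<otimes>\<^bsub>G\<^esub> z) e'" for e'
    using comm solvable_class_Suc_eq_iff[of "z \<otimes>\<^bsub>G\<^esub> v" "v \<otimes>\<^bsub>G\<^esub> z" l] v(1) zG
    by (cases e') (simp add: carrier_in_words solvable_class_def carrier_free_reduce)
  then have inv: "flow (steps (D l) v z) e' = ?f e'" for e'
    using word_flow_mult[OF N.subgroup_axioms z v(1), of e']
      flow_steps_mult[OF N.subset one_closed v(1) zG, of e'] v(1) by simp
  have shift: "?f (D l #>\<^bsub>G\<^esub> (v \<otimes>\<^bsub>G\<^esub> q), j) = ?f (D l #>\<^bsub>G\<^esub> q, j)" if "q \<in> carrier G" for q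
    using flow_steps_translate[OF N.normal_axioms v(1) one_closed that carrier_in_words[OF zG], of j]
      inv v(1) by simp
  let ?e = "\<lambda>m::nat. (D l #>\<^bsub>G\<^esub> (v [^]\<^bsub>G\<^esub> m \<otimes>\<^bsub>G\<^esub> p), j)"
  have "?f (?e m) = ?f e" for m
  proof (induction m)
    case 0
    then show ?case using p by (simp add: ep)
  next
    case (Suc m)
    have "v [^]\<^bsub>G\<^esub> Suc m \<otimes>\<^bsub>G\<^esub> p = v \<otimes>\<^bsub>G\<^esub> (v [^]\<^bsub>G\<^esub> m \<otimes>\<^bsub>G\<^esub> p)"
      unfolding nat_pow_Suc2[OF v(1)] using v(1) p by (intro m_assoc) auto
    then show ?case using shift[of "v [^]\<^bsub>G\<^esub> m \<otimes>\<^bsub>G\<^esub> p"] Suc v(1) p by simp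
  qed
  then have "range ?e \<subseteq> fst ` set (steps (D l) \<one>\<^bsub>G\<^esub> z)"
    using e flow_notin by (metis (no_types, lifting) image_subsetI)
  then have "finite (range ?e)" using finite_subset by blast
  moreover have "inj ?e"
  proof (rule injI)
    fix m n :: nat
    assume "?e m = ?e n"
    then have "D l #>\<^bsub>G\<^esub> (v [^]\<^bsub>G\<^esub> m \<otimes>\<^bsub>G\<^esub> p) = D l #>\<^bsub>G\<^esub> (v [^]\<^bsub>G\<^esub> n \<otimes>\<^bsub>G\<^esub> p)" by simp
    then have "(v [^]\<^bsub>G\<^esub> m \<otimes>\<^bsub>G\<^esub> p) \<otimes>\<^bsub>G\<^esub> inv\<^bsub>G\<^esub> (v [^]\<^bsub>G\<^esub> n \<otimes>\<^bsub>G\<^esub> p) \<in> D l"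
      using v(1) p by (simp add: coset_eq_iff N.subgroup_axioms)
    also have "(v [^]\<^bsub>G\<^esub> m \<otimes>\<^bsub>G\<^esub> p) \<otimes>\<^bsub>G\<^esub> inv\<^bsub>G\<^esub> (v [^]\<^bsub>G\<^esub> n \<otimes>\<^bsub>G\<^esub> p) = v [^]\<^bsub>G\<^esub> m \<otimes>\<^bsub>G\<^esub> inv\<^bsub>G\<^esub> (v [^]\<^bsub>G\<^esub> n)"
      using v(1) p by (simp add: inv_mult_group m_assoc) (simp add: m_assoc[symmetric])
    also have "\<dots> = v [^]\<^bsub>G\<^esub> (int m - int n)"
      using v(1) by (simp add: int_pow_diff int_pow_int)
    finally show "m = n"
      using int_pow_notin_derived_series[OF v il, of "int m - int n"] by auto
  qed
  ultimately show False using finite_imageD infinite_UNIV_nat by blast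
qed

text \<open>The preceding lemma applies at each of the levels from \<open>i\<close> to \<open>d\<close> in turn.\<close>

lemma commuting_in_derived_series:
  assumes v: "v \<in> carrier G" "v \<notin> D i" and z: "z \<in> D i" and id: "i \<le> d"
    and comm: "D d #>\<^bsub>G\<^esub> (z \<otimes>\<^bsub>G\<^esub> v) = D d #>\<^bsub>G\<^esub> (v \<otimes>\<^bsub>G\<^esub> z)"
  shows "z \<in> D d"
proof -
  have zG: "z \<in> carrier G" using z derived_series_carrier by blast
  have "l \<le> d \<longrightarrow> z \<in> D l" if "i \<le> l" for l
    using that
  proof (induction l rule: dec_induct)
    case (step l)
    show ?case
    proof
      assume "Suc l \<le> d"
      then have "D d \<subseteq> D (Suc l)" by (rule derived_series_antimono)
      then have "D (Suc l) #>\<^bsub>G\<^esub> (z \<otimes>\<^bsub>G\<^esub> v) = D (Suc l) #>\<^bsub>G\<^esub> (v \<otimes>\<^bsub>G\<^esub> z)"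
        using comm v zG by (auto simp: coset_eq_iff derived_series_subgroup)
      then show "z \<in> D (Suc l)"
        using step \<open>Suc l \<le> d\<close> v by (intro commuting_in_derived_series_Suc[of v i]) auto
    qed
  qed (use z in simp)
  then show ?thesis using id by blast
qed

lemma is_exponent_iff:
  assumes "u \<in> words r" "v \<in> words r"
  shows "is_exponent r d u v k
    \<longleftrightarrow> free_reduce u \<otimes>\<^bsub>G\<^esub> inv\<^bsub>G\<^esub> (free_reduce v [^]\<^bsub>G\<^esub> k) \<in> D d"
proof -
  interpret N: normal "D d" G by (rule derived_series_normal)
  have "is_exponent r d u v k \<longleftrightarrow> D d #>\<^bsub>G\<^esub> free_reduce u = D d #>\<^bsub>G\<^esub> (free_reduce v [^]\<^bsub>G\<^esub> k)"
    using assms by (simp add: is_exponent_def free_solvable_group_def solvable_class_def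
        N.FactGroup_int_pow)
  then show ?thesis using assms by (simp add: coset_eq_iff N.subgroup_axioms)
qed

lemma is_exponent_trivial:
  assumes "u \<in> words r" "v \<in> words r" "free_reduce u \<in> D d" "free_reduce v \<in> D d"
  shows "is_exponent r d u v k"
  using assms derived_series_subgroup[of d]
  by (simp add: is_exponent_iff subgroup.m_closed subgroup.m_inv_closed subgroup_int_pow_closed)

text \<open>Put \<open>z = u v\<^sup>-\<^sup>k\<close>.  The first condition says that \<open>z\<close> lies in \<open>D (l + 1)\<close>, and the second one that \<open>z\<close>
  commutes with \<open>v\<close> modulo \<open>D d\<close>, since \<open>[u, v]\<close> and \<open>[z, v]\<close> are equal.  If \<open>v\<close> were in \<open>D (l + 1)\<close>, then so
  would be \<open>u = z v\<^sup>k\<close>; hence \<open>commuting_in_derived_series\<close> applies to \<open>z\<close>.\<close>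

theorem is_exponent_iff_flow:
  assumes u: "u \<in> words r" and v: "v \<in> words r" and ld: "l < d"
    and uv: "free_reduce u \<in> D l" "free_reduce v \<in> D l"
      "\<not> (free_reduce u \<in> D (Suc l) \<and> free_reduce v \<in> D (Suc l))"
  shows "is_exponent r d u v k \<longleftrightarrow>
    (\<forall>e. word_flow (D l) u e = k * word_flow (D l) v e) \<and>
    free_reduce (u @ v @ inv_word u @ inv_word v) \<in> D d"
proof -
  interpret N: normal "D d" G by (rule derived_series_normal)
  define U V where "U = free_reduce u" and "V = free_reduce v"
  have U: "U \<in> carrier G" and V: "V \<in> carrier G" using u v by (simp_all add: U_def V_def)
  define z where "z = U \<otimes>\<^bsub>G\<^esub> inv\<^bsub>G\<^esub> (V [^]\<^bsub>G\<^esub> k)"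
  have z: "z \<in> carrier G" using U V by (simp add: z_def)
  have Uz: "U = z \<otimes>\<^bsub>G\<^esub> V [^]\<^bsub>G\<^esub> k" using U V by (simp add: z_def m_assoc)
  have exp: "is_exponent r d u v k \<longleftrightarrow> z \<in> D d"
    using u v by (simp add: is_exponent_iff z_def U_def V_def)
  have zl: "z \<in> D l" using uv derived_series_subgroup[of l]
    by (simp add: z_def U_def V_def subgroup.m_closed subgroup.m_inv_closed subgroup_int_pow_closed)
  have "word_flow (D l) U e = word_flow (D l) z e + k * word_flow (D l) V e" for e
    using uv V unfolding Uz
    by (simp add: word_flow_mult[OF derived_series_subgroup zl] word_flow_int_pow[OF derived_series_subgroup] V_def)
  then have z_flow: "z \<in> D (Suc l) \<longleftrightarrow> (\<forall>e. word_flow (D l) u e = k * word_flow (D l) v e)"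
    using u v mem_derived_series_Suc_iff[OF z, of l]
    by (simp add: U_def V_def flow_steps_free_reduce derived_series_carrier)
  have comm1: "free_reduce (u @ v @ inv_word u @ inv_word v) = U \<otimes>\<^bsub>G\<^esub> V \<otimes>\<^bsub>G\<^esub> inv\<^bsub>G\<^esub> (V \<otimes>\<^bsub>G\<^esub> U)"
    using u v by (simp add: U_def V_def free_reduce_mult free_reduce_inv m_assoc inv_mult_group)
  have VkV: "V [^]\<^bsub>G\<^esub> k \<otimes>\<^bsub>G\<^esub> V = V \<otimes>\<^bsub>G\<^esub> V [^]\<^bsub>G\<^esub> k"
  proof -
    have "V [^]\<^bsub>G\<^esub> k \<otimes>\<^bsub>G\<^esub> V = V [^]\<^bsub>G\<^esub> (k + 1)" using V by (simp add: int_pow_mult int_pow_1)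
    also have "\<dots> = V [^]\<^bsub>G\<^esub> (1 + k)" by (simp add: add.commute)
    also have "\<dots> = V \<otimes>\<^bsub>G\<^esub> V [^]\<^bsub>G\<^esub> k" using V by (simp add: int_pow_mult int_pow_1)
    finally show ?thesis .
  qed
  have "U \<otimes>\<^bsub>G\<^esub> V = (z \<otimes>\<^bsub>G\<^esub> V) \<otimes>\<^bsub>G\<^esub> V [^]\<^bsub>G\<^esub> k"
    using V z VkV by (simp add: Uz m_assoc)
  moreover have "V \<otimes>\<^bsub>G\<^esub> U = (V \<otimes>\<^bsub>G\<^esub> z) \<otimes>\<^bsub>G\<^esub> V [^]\<^bsub>G\<^esub> k"
    using V z by (simp add: Uz m_assoc)
  ultimately have "U \<otimes>\<^bsub>G\<^esub> V \<otimes>\<^bsub>G\<^esub> inv\<^bsub>G\<^esub> (V \<otimes>\<^bsub>G\<^esub> U) = (z \<otimes>\<^bsub>G\<^esub> V) \<otimes>\<^bsub>G\<^esub> inv\<^bsub>G\<^esub> (V \<otimes>\<^bsub>G\<^esub> z)"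
    using V z by (simp add: inv_mult_group m_assoc) (simp add: m_assoc[symmetric])
  then have comm: "free_reduce (u @ v @ inv_word u @ inv_word v) \<in> D d
      \<longleftrightarrow> D d #>\<^bsub>G\<^esub> (z \<otimes>\<^bsub>G\<^esub> V) = D d #>\<^bsub>G\<^esub> (V \<otimes>\<^bsub>G\<^esub> z)"
    using V z by (simp add: comm1 coset_eq_iff N.subgroup_axioms)
  show ?thesis unfolding exp z_flow[symmetric] comm
  proof
    assume zd: "z \<in> D d"
    then have "D d #>\<^bsub>G\<^esub> z = D d" using z by (simp add: coset_join2 N.subgroup_axioms)
    then have "D d #>\<^bsub>G\<^esub> (z \<otimes>\<^bsub>G\<^esub> V) = D d #>\<^bsub>G\<^esub> V"
      using z V by (simp add: N.subset flip: coset_mult_assoc)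
    moreover have "D d #>\<^bsub>G\<^esub> (V \<otimes>\<^bsub>G\<^esub> z) = D d #>\<^bsub>G\<^esub> (V \<otimes>\<^bsub>G\<^esub> \<one>\<^bsub>G\<^esub>)"
      using z V \<open>D d #>\<^bsub>G\<^esub> z = D d\<close> by (subst normal_coset_left_cancel) (auto simp: N.normal_axioms N.subset)
    moreover have "z \<in> D (Suc l)" using zd derived_series_antimono[of "Suc l" d] ld by auto
    ultimately show "z \<in> D (Suc l) \<and> D d #>\<^bsub>G\<^esub> (z \<otimes>\<^bsub>G\<^esub> V) = D d #>\<^bsub>G\<^esub> (V \<otimes>\<^bsub>G\<^esub> z)"
      using V by simp
  next
    assume R: "z \<in> D (Suc l) \<and> D d #>\<^bsub>G\<^esub> (z \<otimes>\<^bsub>G\<^esub> V) = D d #>\<^bsub>G\<^esub> (V \<otimes>\<^bsub>G\<^esub> z)"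
    have "V \<notin> D (Suc l)"
    proof
      assume VN: "V \<in> D (Suc l)"
      then have "U \<in> D (Suc l)" unfolding Uz
        using R derived_series_subgroup[of "Suc l"] by (simp add: subgroup.m_closed subgroup_int_pow_closed)
      then show False using VN uv(3) by (simp add: U_def V_def)
    qed
    moreover have "z \<in> D (Suc l)" "Suc l \<le> d" using R ld by auto
    ultimately show "z \<in> D d"
      using commuting_in_derived_series[OF V] R by blast
  qed
qed

end

section \<open>Deterministic runs\<close>

fun det_exec :: "instr \<Rightarrow> config \<Rightarrow> config" where
  "det_exec (Const a i) c = set_reg a i c"
| "det_exec (Copy a b) c = set_reg a (regs c b) c"
| "det_exec (Plus a b b') c = set_reg a (regs c b + regs c b') c"
| "det_exec (Minus a b b') c = set_reg a (regs c b - regs c b') c"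
| "det_exec (Times a b b') c = set_reg a (regs c b * regs c b') c"
| "det_exec (Load a b) c = set_reg a (mem c (nat (regs c b))) c"
| "det_exec (Store a b) c = c\<lparr>pc := Suc (pc c), mem := (mem c)(nat (regs c a) := regs c b)\<rparr>"
| "det_exec (Jump l) c = c\<lparr>pc := l\<rparr>"
| "det_exec (JumpPos a l) c = c\<lparr>pc := (if regs c a > 0 then l else Suc (pc c))\<rparr>"
| "det_exec (Random a b) c = c"

definition det_step :: "program \<Rightarrow> config \<Rightarrow> config" where
  "det_step P c =
     (if halted P c then c else (det_exec (P ! pc c) c)\<lparr>time := time c + cost (P ! pc c) c\<rparr>)"

definition deterministic :: "program \<Rightarrow> bool" where
  "deterministic P \<longleftrightarrow> (\<forall>a b. Random a b \<notin> set P)"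

lemma run_deterministic:
  assumes "deterministic P"
  shows "run P n c = return_pmf ((det_step P ^^ n) c)"
proof (induction n)
  case (Suc n)
  have "step P c' = return_pmf (det_step P c')" for c'
  proof (cases "halted P c'")
    case False
    then have "P ! pc c' \<in> set P" by (simp add: halted_def)
    then have "\<nexists>a b. P ! pc c' = Random a b" using assms by (auto simp: deterministic_def)
    then show ?thesis using False
      by (cases "P ! pc c'") (auto simp: step_def det_step_def)
  qed (simp add: step_def det_step_def)
  then show ?case using Suc by (simp add: bind_return_pmf)
qed simp

definition code_at :: "program \<Rightarrow> nat \<Rightarrow> instr list \<Rightarrow> bool" where
  "code_at P i C \<longleftrightarrow> i + length C \<le> length P \<and> (\<forall>j < length C. P ! (i + j) = C ! j)"

lemma code_at_append: "code_at P i (C @ C') \<longleftrightarrow> code_at P i C \<and> code_at P (i + length C) C'"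
proof
  assume *: "code_at P i (C @ C')"
  have "P ! (i + length C + j) = C' ! j" if "j < length C'" for j
    using *[unfolded code_at_def, THEN conjunct2, rule_format, of "length C + j"] that
    by (simp add: add.assoc)
  moreover have "P ! (i + j) = C ! j" if "j < length C" for j
    using *[unfolded code_at_def, THEN conjunct2, rule_format, of j] that by (simp add: nth_append)
  ultimately show "code_at P i C \<and> code_at P (i + length C) C'"
    using * by (auto simp: code_at_def)
next
  assume *: "code_at P i C \<and> code_at P (i + length C) C'"
  show "code_at P i (C @ C')" unfolding code_at_def
  proof (intro conjI allI impI)
    fix j assume j: "j < length (C @ C')"
    show "P ! (i + j) = (C @ C') ! j"
    proof (cases "j < length C")
      case False
      then have "P ! (i + j) = C' ! (j - length C)"
        using *[THEN conjunct2, unfolded code_at_def, THEN conjunct2, rule_format, of "j - length C"] j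
        by simp
      then show ?thesis by (simp add: False nth_append)
    qed (use * in \<open>simp add: code_at_def nth_append\<close>)
  qed (use * in \<open>simp add: code_at_def\<close>)
qed

lemma code_at_Cons: "code_at P i (x # C) \<longleftrightarrow> code_at P i [x] \<and> code_at P (Suc i) C"
  using code_at_append[of P i "[x]" C] by simp

text \<open>\<open>K\<close> bounds the cost of each of the \<open>n\<close> steps.\<close>

definition reaches :: "program \<Rightarrow> nat \<Rightarrow> nat \<Rightarrow> config \<Rightarrow> config \<Rightarrow> bool" where
  "reaches P K n c c' \<longleftrightarrow> (det_step P ^^ n) c = c' \<and> time c' \<le> time c + n * K"

lemma reaches_add: "reaches P K m c c' \<Longrightarrow> reaches P K n c' c'' \<Longrightarrow> reaches P K (m + n) c c''"
  by (auto simp: reaches_def funpow_add add_mult_distrib add.commute[of m n] simp del: funpow.simps)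

lemma reaches_instr:
  assumes "code_at P (pc c) [x]" "cost x c \<le> K"
  shows "reaches P K 1 c ((det_exec x c)\<lparr>time := time c + cost x c\<rparr>)"
  using assms by (simp add: reaches_def code_at_def det_step_def halted_def)

section \<open>A structured language\<close>

text \<open>The language has variables, read access to the input, and a two-dimensional array of cells with
  nonnegative indices, from which all data structures are built.\<close>

datatype aexp =
    Lit int | Reg nat | Add aexp aexp | Sub aexp aexp | Mul aexp aexp
  | Inp aexp
  | Cell aexp aexp

datatype com =
    Assign nat aexp
  | Write aexp aexp aexp
  | Seq com com
  | If aexp com com
  | While aexp com

type_synonym store = "(nat \<Rightarrow> int) \<times> (int \<Rightarrow> int \<Rightarrow> int)"

fun aval :: "int list \<Rightarrow> store \<Rightarrow> aexp \<Rightarrow> int" where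
  "aval inp s (Lit i) = i"
| "aval inp s (Reg x) = fst s x"
| "aval inp s (Add a b) = aval inp s a + aval inp s b"
| "aval inp s (Sub a b) = aval inp s a - aval inp s b"
| "aval inp s (Mul a b) = aval inp s a * aval inp s b"
| "aval inp s (Inp a) = inp ! nat (aval inp s a)"
| "aval inp s (Cell a b) = snd s (aval inp s a) (aval inp s b)"

fun safe :: "int list \<Rightarrow> store \<Rightarrow> aexp \<Rightarrow> bool" where
  "safe inp s (Lit i) \<longleftrightarrow> True"
| "safe inp s (Reg x) \<longleftrightarrow> True"
| "safe inp s (Add a b) \<longleftrightarrow> safe inp s a \<and> safe inp s b"
| "safe inp s (Sub a b) \<longleftrightarrow> safe inp s a \<and> safe inp s b"
| "safe inp s (Mul a b) \<longleftrightarrow> safe inp s a \<and> safe inp s b"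
| "safe inp s (Inp a) \<longleftrightarrow> safe inp s a \<and> 0 \<le> aval inp s a \<and> aval inp s a < int (length inp)"
| "safe inp s (Cell a b) \<longleftrightarrow> safe inp s a \<and> safe inp s b \<and> 0 \<le> aval inp s a \<and> 0 \<le> aval inp s b"

text \<open>Only runs in which all values stored are bounded by \<open>X\<close>, and all indices are in range, are executions.
  A bound on their number of steps thus bounds the running time of the machine, whose costs depend on the
  sizes of the values.\<close>

inductive exec_com :: "int list \<Rightarrow> int \<Rightarrow> com \<Rightarrow> store \<Rightarrow> nat \<Rightarrow> store \<Rightarrow> bool" for inp X where
  Assign: "safe inp (R, M) e \<Longrightarrow> \<bar>aval inp (R, M) e\<bar> \<le> X \<Longrightarrow>
    exec_com inp X (Assign x e) (R, M) 1 (R(x := aval inp (R, M) e), M)"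
| Write: "safe inp (R, M) a \<Longrightarrow> safe inp (R, M) b \<Longrightarrow> safe inp (R, M) e \<Longrightarrow>
    0 \<le> aval inp (R, M) a \<Longrightarrow> 0 \<le> aval inp (R, M) b \<Longrightarrow> \<bar>aval inp (R, M) e\<bar> \<le> X \<Longrightarrow>
    exec_com inp X (Write a b e) (R, M) 1
      (R, M(aval inp (R, M) a := (M (aval inp (R, M) a))(aval inp (R, M) b := aval inp (R, M) e)))"
| Seq: "exec_com inp X c1 s n1 s' \<Longrightarrow> exec_com inp X c2 s' n2 s'' \<Longrightarrow>
    exec_com inp X (Seq c1 c2) s (n1 + n2) s''"
| IfTrue: "safe inp s e \<Longrightarrow> aval inp s e > 0 \<Longrightarrow> exec_com inp X c1 s n s' \<Longrightarrow>
    exec_com inp X (If e c1 c2) s (n + 1) s'"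
| IfFalse: "safe inp s e \<Longrightarrow> aval inp s e \<le> 0 \<Longrightarrow> exec_com inp X c2 s n s' \<Longrightarrow>
    exec_com inp X (If e c1 c2) s (n + 1) s'"
| WhileTrue: "safe inp s e \<Longrightarrow> aval inp s e > 0 \<Longrightarrow> exec_com inp X c s n1 s' \<Longrightarrow>
    exec_com inp X (While e c) s' n2 s'' \<Longrightarrow> exec_com inp X (While e c) s (1 + n1 + n2) s''"
| WhileFalse: "safe inp s e \<Longrightarrow> aval inp s e \<le> 0 \<Longrightarrow> exec_com inp X (While e c) s 1 s"

section \<open>Compilation\<close>

text \<open>Computes \<open>address\<close> (below) from the indices in the registers \<open>t\<close> and \<open>t + 1\<close> and the length of the input in
  register 0.\<close>

definition cell_address :: "nat \<Rightarrow> instr list" where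
  "cell_address t = [Plus (t + 1) t (t + 1), Times (t + 1) (t + 1) (t + 1), Plus t t (t + 1), Plus t t 0]"

lemma length_cell_address [simp]: "length (cell_address t) = 4"
  by (simp add: cell_address_def)

text \<open>The value of the expression ends up in register \<open>t\<close>; registers above \<open>t\<close> serve as a stack.\<close>

fun compile_aexp :: "nat \<Rightarrow> aexp \<Rightarrow> instr list" where
  "compile_aexp t (Lit i) = [Const t i]"
| "compile_aexp t (Reg x) = [Copy t x]"
| "compile_aexp t (Add a b) = compile_aexp t a @ compile_aexp (t + 1) b @ [Plus t t (t + 1)]"
| "compile_aexp t (Sub a b) = compile_aexp t a @ compile_aexp (t + 1) b @ [Minus t t (t + 1)]"
| "compile_aexp t (Mul a b) = compile_aexp t a @ compile_aexp (t + 1) b @ [Times t t (t + 1)]"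
| "compile_aexp t (Inp a) = compile_aexp t a @ [Load t t]"
| "compile_aexp t (Cell a b) =
     compile_aexp t a @ compile_aexp (t + 1) b @ cell_address t @ [Load t t]"

fun compile :: "nat \<Rightarrow> nat \<Rightarrow> com \<Rightarrow> instr list" where
  "compile t i (Assign x e) = compile_aexp t e @ [Copy x t]"
| "compile t i (Write a b e) = compile_aexp t a @ compile_aexp (t + 1) b @ cell_address t
     @ compile_aexp (t + 1) e @ [Store t (t + 1)]"
| "compile t i (Seq c1 c2) = (let C1 = compile t i c1 in C1 @ compile t (i + length C1) c2)"
| "compile t i (If e c1 c2) =
     (let E = compile_aexp t e;
          C2 = compile t (i + length E + 1) c2;
          C1 = compile t (i + length E + 1 + length C2 + 1) c1
      in E @ [JumpPos t (i + length E + 1 + length C2 + 1)] @ C2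
         @ [Jump (i + length E + 1 + length C2 + 1 + length C1)] @ C1)"
| "compile t i (While e c) =
     (let E = compile_aexp t e; C = compile t (i + length E + 2) c
      in E @ [JumpPos t (i + length E + 2), Jump (i + length E + 2 + length C + 1)] @ C @ [Jump i])"

fun aexp_vars :: "aexp \<Rightarrow> nat set" where
  "aexp_vars (Lit i) = {}"
| "aexp_vars (Reg x) = {x}"
| "aexp_vars (Add a b) = aexp_vars a \<union> aexp_vars b"
| "aexp_vars (Sub a b) = aexp_vars a \<union> aexp_vars b"
| "aexp_vars (Mul a b) = aexp_vars a \<union> aexp_vars b"
| "aexp_vars (Inp a) = aexp_vars a"
| "aexp_vars (Cell a b) = aexp_vars a \<union> aexp_vars b"

text \<open>Register 0 holds the length of the input, on which the addresses of the cells depend; the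
  registers from \<open>t\<close> onwards hold intermediate results.\<close>

fun wf_com :: "nat \<Rightarrow> com \<Rightarrow> bool" where
  "wf_com t (Assign x e) \<longleftrightarrow> x \<noteq> 0 \<and> x < t \<and> aexp_vars e \<subseteq> {..<t}"
| "wf_com t (Write a b e) \<longleftrightarrow> aexp_vars a \<union> aexp_vars b \<union> aexp_vars e \<subseteq> {..<t}"
| "wf_com t (Seq c1 c2) \<longleftrightarrow> wf_com t c1 \<and> wf_com t c2"
| "wf_com t (If e c1 c2) \<longleftrightarrow> aexp_vars e \<subseteq> {..<t} \<and> wf_com t c1 \<and> wf_com t c2"
| "wf_com t (While e c) \<longleftrightarrow> aexp_vars e \<subseteq> {..<t} \<and> wf_com t c"

text \<open>All intermediate values in the evaluation of \<open>e\<close> are bounded by \<open>X ^ weight e\<close> if \<open>X\<close> bounds the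
  contents of the store.\<close>

fun weight :: "aexp \<Rightarrow> nat" where
  "weight (Lit i) = nat \<bar>i\<bar> + 1"
| "weight (Reg x) = 1"
| "weight (Add a b) = weight a + weight b"
| "weight (Sub a b) = weight a + weight b"
| "weight (Mul a b) = weight a + weight b"
| "weight (Inp a) = weight a"
| "weight (Cell a b) = 3 * (weight a + weight b) + 1"

fun com_weight :: "com \<Rightarrow> nat" where
  "com_weight (Assign x e) = weight e"
| "com_weight (Write a b e) = max (weight (Cell a b)) (weight e)"
| "com_weight (Seq c1 c2) = max (com_weight c1) (com_weight c2)"
| "com_weight (If e c1 c2) = max (weight e) (max (com_weight c1) (com_weight c2))"
| "com_weight (While e c) = max (weight e) (com_weight c)"

lemma weight_pos: "weight e \<ge> 1"
  by (induction e) auto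

text \<open>An injection from pairs of nonnegative integers to the memory behind the input, as
  \<open>a \<le> a + b < (a + b + 1)\<^sup>2 - (a + b)\<^sup>2\<close>.  It is polynomial in \<open>a\<close> and \<open>b\<close>, so that addresses have about
  the same number of bits as the indices.\<close>

definition address :: "nat \<Rightarrow> int \<Rightarrow> int \<Rightarrow> int" where
  "address l a b = a + (a + b) * (a + b) + int l"

lemma address_inj:
  assumes "a \<ge> 0" "b \<ge> 0" "a' \<ge> 0" "b' \<ge> 0" "address l a b = address l a' b'"
  shows "a = a' \<and> b = b'"
proof -
  have *: "\<not> x + y < x' + y'"
    if "x \<ge> 0" "y \<ge> 0" "x' \<ge> 0" "y' \<ge> 0" "address l x y = address l x' y'" for x y x' y' :: int
  proof
    assume "x + y < x' + y'"
    then have "(x + y + 1) * (x + y + 1) \<le> (x' + y') * (x' + y')"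
      using that by (intro mult_mono) auto
    then have "x + (x + y) * (x + y) < x' + (x' + y') * (x' + y')"
      using that by (simp add: algebra_simps)
    then show False using that by (simp add: address_def)
  qed
  have "a + b = a' + b'" using *[of a b a' b'] *[of a' b' a b] assms by auto
  then show ?thesis using assms by (auto simp: address_def)
qed

lemma address_ge: "a \<ge> 0 \<Longrightarrow> b \<ge> 0 \<Longrightarrow> address l a b \<ge> int l"
  by (simp add: address_def)

definition bounded_store :: "nat \<Rightarrow> int \<Rightarrow> store \<Rightarrow> bool" where
  "bounded_store t X s \<longleftrightarrow>
     (\<forall>x < t. \<bar>fst s x\<bar> \<le> X) \<and> (\<forall>a \<ge> 0. \<forall>b \<ge> 0. \<bar>snd s a b\<bar> \<le> X)"

definition represents :: "nat \<Rightarrow> int list \<Rightarrow> store \<Rightarrow> config \<Rightarrow> bool" where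
  "represents t inp s c \<longleftrightarrow>
     (\<forall>x < t. regs c x = fst s x) \<and>
     (\<forall>a \<ge> 0. \<forall>b \<ge> 0. mem c (nat (address (length inp) a b)) = snd s a b) \<and>
     (\<forall>i < length inp. mem c i = inp ! i) \<and> fst s 0 = int (length inp)"

lemma bit_size_mono: "\<bar>a\<bar> \<le> \<bar>b\<bar> \<Longrightarrow> bit_size a \<le> bit_size b"
  unfolding bit_size_def bitlen_def by (intro add_mono nat_mono) (auto intro!: floorlog_mono)

lemma bit_size_pos: "bit_size a \<ge> 1"
  by (simp add: bit_size_def)

lemma mul_cost_mono: "m \<le> n \<Longrightarrow> mul_cost m \<le> mul_cost n"
  unfolding mul_cost_def by (intro mult_le_mono floorlog_mono) auto

lemma floorlog_pos: "n \<ge> 1 \<Longrightarrow> floorlog 2 n \<ge> 1"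
  by (simp add: floorlog_def)

lemma mul_cost_ge: "n \<ge> 1 \<Longrightarrow> n \<le> mul_cost n"
  using floorlog_pos[of n] floorlog_pos[of "floorlog 2 n"] mult_le_mono[of n "n * floorlog 2 n" 1 "floorlog 2 (floorlog 2 n)"]
  by (simp add: mul_cost_def)

text \<open>The factor 2 covers memory accesses, which are charged for both the address and the content.\<close>

definition instr_cost :: "int \<Rightarrow> nat \<Rightarrow> nat" where
  "instr_cost X W = 2 * mul_cost (bit_size (X ^ W))"

locale compiled =
  fixes P :: program and t :: nat and inp :: "int list" and X :: int and W :: nat
  assumes X2: "X \<ge> 2" and inp_le: "\<And>a. a \<in> set inp \<Longrightarrow> \<bar>a\<bar> \<le> X" and len_le: "int (length inp) \<le> X"
    and t_pos: "t > 0"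
begin

abbreviation "K \<equiv> instr_cost X W"

lemma pow_mono: "a \<le> b \<Longrightarrow> X ^ a \<le> X ^ b"
  using X2 by (simp add: power_increasing)

lemma pow_ge2: "a \<ge> 1 \<Longrightarrow> X ^ a \<ge> 2"
  using pow_mono[of 1 a] X2 by simp

lemma pow_add_le: "a \<ge> 1 \<Longrightarrow> b \<ge> 1 \<Longrightarrow> x \<le> X ^ a \<Longrightarrow> y \<le> X ^ b \<Longrightarrow> x + y \<le> X ^ (a + b)"
proof -
  assume *: "a \<ge> 1" "b \<ge> 1" "x \<le> X ^ a" "y \<le> X ^ b"
  have "0 \<le> (X ^ a - 1) * (X ^ b - 1) - 1"
    using mult_mono[of 1 "X ^ a - 1" 1 "X ^ b - 1"] pow_ge2[OF *(1)] pow_ge2[OF *(2)] by simp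
  then show ?thesis using * by (simp add: algebra_simps power_add)
qed

lemma abs_add_le:
  assumes "a \<ge> 1" "b \<ge> 1" "\<bar>x\<bar> \<le> X ^ a" "\<bar>y\<bar> \<le> X ^ b"
  shows "\<bar>x + y\<bar> \<le> X ^ (a + b)" "\<bar>x - y\<bar> \<le> X ^ (a + b)"
  using pow_add_le[OF assms] abs_triangle_ineq[of x y] abs_triangle_ineq4[of x y] by linarith+

lemma abs_mult_le:
  assumes "\<bar>x\<bar> \<le> X ^ a" "\<bar>y\<bar> \<le> X ^ b"
  shows "\<bar>x * y\<bar> \<le> X ^ (a + b)"
  using assms X2 by (auto simp: abs_mult power_add intro!: mult_mono)

text \<open>The sum of two numbers of size at least 2 is at most their product.  Operations therefore add up the
  exponents of \<open>X\<close> at worst, except for \<open>Cell\<close>, the address of which is also taken into account.\<close>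

lemma aval_le:
  assumes "bounded_store t X s" "safe inp s e" "aexp_vars e \<subseteq> {..<t}"
  shows "\<bar>aval inp s e\<bar> \<le> X ^ weight e"
  using assms
proof (induction e)
  case (Lit i)
  have "\<bar>i\<bar> \<le> 2 ^ nat \<bar>i\<bar>" using less_exp[of "nat \<bar>i\<bar>"]
    by (metis abs_ge_zero int_nat_eq less_imp_le of_nat_less_iff of_nat_numeral of_nat_power)
  also have "\<dots> \<le> X ^ nat \<bar>i\<bar>" using X2 by (intro power_mono) auto
  also have "\<dots> \<le> X ^ weight (Lit i)" by (intro pow_mono) simp
  finally show ?case by simp
next
  case (Inp a)
  then have "inp ! nat (aval inp s a) \<in> set inp" by (intro nth_mem) auto
  then have "\<bar>aval inp s (Inp a)\<bar> \<le> X ^ 1" using inp_le by simp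
  also have "\<dots> \<le> X ^ weight (Inp a)" using weight_pos by (intro pow_mono) auto
  finally show ?case .
next
  case (Cell a b)
  then have "\<bar>aval inp s (Cell a b)\<bar> \<le> X ^ 1" by (auto simp: bounded_store_def)
  also have "\<dots> \<le> X ^ weight (Cell a b)" by (intro pow_mono) auto
  finally show ?case .
qed (auto simp: bounded_store_def weight_pos intro: abs_add_le[OF weight_pos weight_pos] abs_mult_le)

lemma address_le:
  assumes "wa \<ge> 1" "wb \<ge> 1" "\<bar>a\<bar> \<le> X ^ wa" "\<bar>b\<bar> \<le> X ^ wb"
  shows "\<bar>a + b\<bar> \<le> X ^ (3 * (wa + wb) + 1)" "\<bar>(a + b) * (a + b)\<bar> \<le> X ^ (3 * (wa + wb) + 1)"
    "\<bar>a + (a + b) * (a + b)\<bar> \<le> X ^ (3 * (wa + wb) + 1)"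
    "\<bar>address (length inp) a b\<bar> \<le> X ^ (3 * (wa + wb) + 1)"
proof -
  have 1: "\<bar>a + b\<bar> \<le> X ^ (wa + wb)" using assms by (intro abs_add_le)
  have 2: "\<bar>(a + b) * (a + b)\<bar> \<le> X ^ ((wa + wb) + (wa + wb))" by (intro abs_mult_le 1)
  have 3: "\<bar>a + (a + b) * (a + b)\<bar> \<le> X ^ (wa + ((wa + wb) + (wa + wb)))"
    using assms 2 by (intro abs_add_le) auto
  have 4: "\<bar>address (length inp) a b\<bar> \<le> X ^ (wa + ((wa + wb) + (wa + wb)) + 1)"
    using abs_add_le(1)[OF _ _ 3, of 1 "int (length inp)"] len_le assms(1) by (simp add: address_def)
  show "\<bar>a + b\<bar> \<le> X ^ (3 * (wa + wb) + 1)" by (rule order.trans[OF 1 pow_mono]) simp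
  show "\<bar>(a + b) * (a + b)\<bar> \<le> X ^ (3 * (wa + wb) + 1)" by (rule order.trans[OF 2 pow_mono]) simp
  show "\<bar>a + (a + b) * (a + b)\<bar> \<le> X ^ (3 * (wa + wb) + 1)" by (rule order.trans[OF 3 pow_mono]) simp
  show "\<bar>address (length inp) a b\<bar> \<le> X ^ (3 * (wa + wb) + 1)" by (rule order.trans[OF 4 pow_mono]) simp
qed

lemma bit_size_le: "\<bar>a\<bar> \<le> X ^ W \<Longrightarrow> bit_size a \<le> mul_cost (bit_size (X ^ W))"
  using bit_size_mono[of a "X ^ W"] mul_cost_ge[OF bit_size_pos, of "X ^ W"] by linarith

lemma cost_le:
  shows "\<bar>i\<bar> \<le> X ^ W \<Longrightarrow> cost (Const x i) c \<le> K"
    "\<bar>regs c y\<bar> \<le> X ^ W \<Longrightarrow> cost (Copy x y) c \<le> K"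
    "\<bar>regs c y\<bar> \<le> X ^ W \<Longrightarrow> \<bar>regs c z\<bar> \<le> X ^ W \<Longrightarrow> cost (Plus x y z) c \<le> K"
    "\<bar>regs c y\<bar> \<le> X ^ W \<Longrightarrow> \<bar>regs c z\<bar> \<le> X ^ W \<Longrightarrow> cost (Minus x y z) c \<le> K"
    "\<bar>regs c y\<bar> \<le> X ^ W \<Longrightarrow> \<bar>regs c z\<bar> \<le> X ^ W \<Longrightarrow> cost (Times x y z) c \<le> K"
    "\<bar>regs c y\<bar> \<le> X ^ W \<Longrightarrow> \<bar>mem c (nat (regs c y))\<bar> \<le> X ^ W \<Longrightarrow> cost (Load x y) c \<le> K"
    "\<bar>regs c x\<bar> \<le> X ^ W \<Longrightarrow> \<bar>regs c y\<bar> \<le> X ^ W \<Longrightarrow> cost (Store x y) c \<le> K"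
    "cost (Jump l) c \<le> K"
    "\<bar>regs c x\<bar> \<le> X ^ W \<Longrightarrow> cost (JumpPos x l) c \<le> K"
proof -
  have le: "\<bar>a\<bar> \<le> X ^ W \<Longrightarrow> bit_size a \<le> bit_size (X ^ W)" for a by (rule bit_size_mono) simp
  show "\<bar>regs c y\<bar> \<le> X ^ W \<Longrightarrow> \<bar>regs c z\<bar> \<le> X ^ W \<Longrightarrow> cost (Times x y z) c \<le> K"
    using mul_cost_mono[of "max (bit_size (regs c y)) (bit_size (regs c z))" "bit_size (X ^ W)"] le
    by (auto simp: instr_cost_def)
  show "cost (Jump l) c \<le> K"
    using mul_cost_ge[OF bit_size_pos, of "X ^ W"] bit_size_pos[of "X ^ W"]
    by (simp add: instr_cost_def del: One_nat_def)
qed (use bit_size_le in \<open>fastforce simp: instr_cost_def dest: bit_size_le\<close>)+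


definition evaluates :: "nat \<Rightarrow> config \<Rightarrow> nat \<Rightarrow> int \<Rightarrow> config \<Rightarrow> bool" where
  "evaluates t' c n v c' \<longleftrightarrow> reaches P K n c c' \<and> pc c' = pc c + n \<and> mem c' = mem c \<and>
     (\<forall>x < t'. regs c' x = regs c x) \<and> regs c' t' = v"

lemma represents_evaluates:
  "represents t inp s c \<Longrightarrow> evaluates t' c n v c' \<Longrightarrow> t \<le> t' \<Longrightarrow> represents t inp s c'"
  by (auto simp: represents_def evaluates_def)

lemma evaluates_binary:
  assumes 1: "evaluates t' c n1 a c1" and 2: "evaluates (t' + 1) c1 n2 b c2"
    and code: "code_at P (pc c + n1 + n2) [x]"
    and x: "det_exec x c2 = set_reg t' v c2" "cost x c2 \<le> K"
  shows "\<exists>c'. evaluates t' c (n1 + n2 + 1) v c'"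
proof -
  let ?c = "(det_exec x c2)\<lparr>time := time c2 + cost x c2\<rparr>"
  have "pc c2 = pc c + n1 + n2" using 1 2 by (simp add: evaluates_def)
  then have "reaches P K 1 c2 ?c" using code x by (intro reaches_instr) auto
  then have "reaches P K (n1 + n2 + 1) c ?c"
    using 1 2 unfolding evaluates_def by (metis reaches_add)
  then have "evaluates t' c (n1 + n2 + 1) v ?c"
    using 1 2 by (auto simp: evaluates_def x set_reg_def)
  then show ?thesis by blast
qed

lemma evaluates_cell_address:
  assumes 1: "evaluates t' c n1 a c1" and 2: "evaluates (t' + 1) c1 n2 b c2"
    and rep: "represents t inp s c" and t': "t \<le> t'"
    and code: "code_at P (pc c + n1 + n2) (cell_address t')"
    and le: "wa \<ge> 1" "wb \<ge> 1" "\<bar>a\<bar> \<le> X ^ wa" "\<bar>b\<bar> \<le> X ^ wb" "3 * (wa + wb) + 1 \<le> W"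
  shows "\<exists>c'. evaluates t' c (n1 + n2 + 4) (address (length inp) a b) c'"
proof -
  note bounds = address_le[OF le(1-4), THEN order.trans, OF pow_mono[OF le(5)]]
  have ab: "\<bar>a\<bar> \<le> X ^ W" "\<bar>b\<bar> \<le> X ^ W"
    using le pow_mono[of wa W] pow_mono[of wb W] by auto
  have regs2: "regs c2 t' = a" "regs c2 (t' + 1) = b" using 1 2 by (auto simp: evaluates_def)
  have pc2: "pc c2 = pc c + n1 + n2" using 1 2 by (simp add: evaluates_def)
  have reg0: "regs c2 0 = int (length inp)" using 1 2 rep t_pos t' by (simp add: evaluates_def represents_def)
  have codes: "code_at P (pc c2) [Plus (t' + 1) t' (t' + 1)]"
    "code_at P (Suc (pc c2)) [Times (t' + 1) (t' + 1) (t' + 1)]"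
    "code_at P (Suc (Suc (pc c2))) [Plus t' t' (t' + 1)]"
    "code_at P (Suc (Suc (Suc (pc c2)))) [Plus t' t' 0]"
    using code unfolding cell_address_def pc2 by (metis code_at_Cons)+
  define c3 where "c3 = (let x = Plus (t' + 1) t' (t' + 1) in (det_exec x c2)\<lparr>time := time c2 + cost x c2\<rparr>)"
  have c3: "pc c3 = Suc (pc c2)" "regs c3 = (regs c2)(t' + 1 := a + b)" "mem c3 = mem c2"
    by (simp_all add: c3_def Let_def set_reg_def regs2 del: One_nat_def)
  have r3: "reaches P K 1 c2 c3" unfolding c3_def Let_def
    using codes ab regs2 by (intro reaches_instr cost_le) auto
  define c4 where "c4 = (let x = Times (t' + 1) (t' + 1) (t' + 1) in (det_exec x c3)\<lparr>time := time c3 + cost x c3\<rparr>)"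
  have c4: "pc c4 = Suc (Suc (pc c2))" "regs c4 = (regs c2)(t' + 1 := (a + b) * (a + b))" "mem c4 = mem c2"
    by (simp_all add: c4_def Let_def set_reg_def c3 del: One_nat_def)
  have r4: "reaches P K 1 c3 c4" unfolding c4_def Let_def
    using codes bounds c3 by (intro reaches_instr cost_le) auto
  define c5 where "c5 = (let x = Plus t' t' (t' + 1) in (det_exec x c4)\<lparr>time := time c4 + cost x c4\<rparr>)"
  have c5: "pc c5 = Suc (Suc (Suc (pc c2)))" "mem c5 = mem c2"
    "regs c5 = (regs c2)(t' + 1 := (a + b) * (a + b), t' := a + (a + b) * (a + b))"
    by (simp_all add: c5_def Let_def set_reg_def c4 regs2 del: One_nat_def)
  have r5: "reaches P K 1 c4 c5" unfolding c5_def Let_def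
    using codes bounds ab c4 regs2 by (intro reaches_instr cost_le) auto
  define c6 where "c6 = (let x = Plus t' t' 0 in (det_exec x c5)\<lparr>time := time c5 + cost x c5\<rparr>)"
  have t0: "t' \<noteq> 0" using t' t_pos by simp
  have c6: "pc c6 = pc c2 + 4" "mem c6 = mem c2"
    "regs c6 = (regs c2)(t' + 1 := (a + b) * (a + b), t' := address (length inp) a b)"
    using t0 by (auto simp: c6_def Let_def set_reg_def c5 reg0 address_def fun_eq_iff)
  have "\<bar>int (length inp)\<bar> \<le> X ^ W" using len_le pow_mono[of 1 W] le by simp
  then have r6: "reaches P K 1 c5 c6" unfolding c6_def Let_def
    using codes bounds c5 reg0 t0 by (intro reaches_instr cost_le) auto
  have "reaches P K (n1 + (n2 + (1 + (1 + (1 + 1))))) c c6"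
    using 1 2 r3 r4 r5 r6 unfolding evaluates_def by (blast intro: reaches_add)
  then have "reaches P K (n1 + n2 + 4) c c6" by (simp add: eval_nat_numeral)
  then have "evaluates t' c (n1 + n2 + 4) (address (length inp) a b) c6"
    using 1 2 by (auto simp: evaluates_def c6)
  then show ?thesis by blast
qed

lemma evaluates_load:
  assumes 1: "evaluates t' c n a c1" and code: "code_at P (pc c + n) [Load t' t']"
    and "\<bar>a\<bar> \<le> X ^ W" "mem c (nat a) = v" "\<bar>v\<bar> \<le> X ^ W"
  shows "\<exists>c'. evaluates t' c (n + 1) v c'"
proof -
  let ?c = "(det_exec (Load t' t') c1)\<lparr>time := time c1 + cost (Load t' t') c1\<rparr>"
  have "reaches P K 1 c1 ?c" using 1 assms by (intro reaches_instr cost_le) (auto simp: evaluates_def)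
  then have "reaches P K (n + 1) c ?c" using 1 unfolding evaluates_def by (metis reaches_add)
  then have "evaluates t' c (n + 1) v ?c"
    using 1 assms by (auto simp: evaluates_def set_reg_def)
  then show ?thesis by blast
qed

lemma compile_aexp_correct:
  assumes "code_at P (pc c) (compile_aexp t' e)" "represents t inp s c" "t \<le> t'"
    "safe inp s e" "aexp_vars e \<subseteq> {..<t}" "bounded_store t X s" "weight e \<le> W"
  shows "\<exists>c'. evaluates t' c (length (compile_aexp t' e)) (aval inp s e) c'"
  using assms
proof (induction e arbitrary: t' c)
  case (Lit i)
  have "\<bar>i\<bar> \<le> X ^ W" using aval_le[of s "Lit i"] Lit pow_mono[of "weight (Lit i)" W] by simp
  then have "reaches P K 1 c ((det_exec (Const t' i) c)\<lparr>time := time c + cost (Const t' i) c\<rparr>)"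
    using Lit by (intro reaches_instr cost_le) auto
  then show ?case by (auto simp: evaluates_def set_reg_def intro!: exI)
next
  case (Reg x)
  have v: "\<bar>regs c x\<bar> \<le> X ^ W" "regs c x = fst s x"
    using aval_le[of s "Reg x"] Reg pow_mono[of 1 W] by (auto simp: represents_def)
  then have "reaches P K 1 c ((det_exec (Copy t' x) c)\<lparr>time := time c + cost (Copy t' x) c\<rparr>)"
    using Reg by (intro reaches_instr cost_le) auto
  then show ?case using v by (auto simp: evaluates_def set_reg_def intro!: exI)
next
  case (Add a b)
  let ?A = "compile_aexp t' a" and ?B = "compile_aexp (t' + 1) b"
  obtain c1 where c1: "evaluates t' c (length ?A) (aval inp s a) c1"
    using Add.IH(1)[of c t'] Add.prems by (auto simp: code_at_append)
  obtain c2 where c2: "evaluates (t' + 1) c1 (length ?B) (aval inp s b) c2"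
    using Add.IH(2)[of c1 "t' + 1"] Add.prems represents_evaluates[OF Add.prems(2) c1] c1
    by (auto simp: code_at_append evaluates_def)
  have le: "\<bar>aval inp s a\<bar> \<le> X ^ W" "\<bar>aval inp s b\<bar> \<le> X ^ W"
    using aval_le[of s a] aval_le[of s b] Add.prems pow_mono[of "weight a" W] pow_mono[of "weight b" W] by auto
  have r: "regs c2 t' = aval inp s a" "regs c2 (t' + 1) = aval inp s b"
    using c1 c2 by (auto simp: evaluates_def)
  have code: "code_at P (pc c + length ?A + length ?B) [Plus t' t' (t' + 1)]"
    using Add.prems by (simp add: code_at_append add.assoc)
  have "det_exec (Plus t' t' (t' + 1)) c2 = set_reg t' (aval inp s (Add a b)) c2"
    by (simp only: det_exec.simps aval.simps r)
  from evaluates_binary[OF c1 c2 code this] show ?case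
    using cost_le(3)[of c2 t' "t' + 1", unfolded r, OF le] by simp
next
  case (Sub a b)
  let ?A = "compile_aexp t' a" and ?B = "compile_aexp (t' + 1) b"
  obtain c1 where c1: "evaluates t' c (length ?A) (aval inp s a) c1"
    using Sub.IH(1)[of c t'] Sub.prems by (auto simp: code_at_append)
  obtain c2 where c2: "evaluates (t' + 1) c1 (length ?B) (aval inp s b) c2"
    using Sub.IH(2)[of c1 "t' + 1"] Sub.prems represents_evaluates[OF Sub.prems(2) c1] c1
    by (auto simp: code_at_append evaluates_def)
  have le: "\<bar>aval inp s a\<bar> \<le> X ^ W" "\<bar>aval inp s b\<bar> \<le> X ^ W"
    using aval_le[of s a] aval_le[of s b] Sub.prems pow_mono[of "weight a" W] pow_mono[of "weight b" W] by auto
  have r: "regs c2 t' = aval inp s a" "regs c2 (t' + 1) = aval inp s b"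
    using c1 c2 by (auto simp: evaluates_def)
  have code: "code_at P (pc c + length ?A + length ?B) [Minus t' t' (t' + 1)]"
    using Sub.prems by (simp add: code_at_append add.assoc)
  have "det_exec (Minus t' t' (t' + 1)) c2 = set_reg t' (aval inp s (Sub a b)) c2"
    by (simp only: det_exec.simps aval.simps r)
  from evaluates_binary[OF c1 c2 code this] show ?case
    using cost_le(4)[of c2 t' "t' + 1", unfolded r, OF le] by simp
next
  case (Mul a b)
  let ?A = "compile_aexp t' a" and ?B = "compile_aexp (t' + 1) b"
  obtain c1 where c1: "evaluates t' c (length ?A) (aval inp s a) c1"
    using Mul.IH(1)[of c t'] Mul.prems by (auto simp: code_at_append)
  obtain c2 where c2: "evaluates (t' + 1) c1 (length ?B) (aval inp s b) c2"
    using Mul.IH(2)[of c1 "t' + 1"] Mul.prems represents_evaluates[OF Mul.prems(2) c1] c1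
    by (auto simp: code_at_append evaluates_def)
  have le: "\<bar>aval inp s a\<bar> \<le> X ^ W" "\<bar>aval inp s b\<bar> \<le> X ^ W"
    using aval_le[of s a] aval_le[of s b] Mul.prems pow_mono[of "weight a" W] pow_mono[of "weight b" W] by auto
  have r: "regs c2 t' = aval inp s a" "regs c2 (t' + 1) = aval inp s b"
    using c1 c2 by (auto simp: evaluates_def)
  have code: "code_at P (pc c + length ?A + length ?B) [Times t' t' (t' + 1)]"
    using Mul.prems by (simp add: code_at_append add.assoc)
  have "det_exec (Times t' t' (t' + 1)) c2 = set_reg t' (aval inp s (Mul a b)) c2"
    by (simp only: det_exec.simps aval.simps r)
  from evaluates_binary[OF c1 c2 code this] show ?case
    using cost_le(5)[of c2 t' "t' + 1", unfolded r, OF le] by simp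
next
  case (Inp a)
  obtain c1 where c1: "evaluates t' c (length (compile_aexp t' a)) (aval inp s a) c1"
    using Inp.IH[of c t'] Inp.prems by (auto simp: code_at_append)
  have "\<bar>aval inp s a\<bar> \<le> X ^ W" "\<bar>aval inp s (Inp a)\<bar> \<le> X ^ W"
    using aval_le[of s a] aval_le[of s "Inp a"] Inp.prems pow_mono[of "weight a" W] by auto
  moreover have "mem c (nat (aval inp s a)) = aval inp s (Inp a)"
    using Inp.prems by (simp add: represents_def nat_less_iff)
  ultimately show ?case using evaluates_load[OF c1] Inp.prems by (simp add: code_at_append)
next
  case (Cell a b)
  let ?A = "compile_aexp t' a" and ?B = "compile_aexp (t' + 1) b"
  obtain c1 where c1: "evaluates t' c (length ?A) (aval inp s a) c1"
    using Cell.IH(1)[of c t'] Cell.prems by (auto simp: code_at_append)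
  obtain c2 where c2: "evaluates (t' + 1) c1 (length ?B) (aval inp s b) c2"
    using Cell.IH(2)[of c1 "t' + 1"] Cell.prems represents_evaluates[OF Cell.prems(2) c1] c1
    by (auto simp: code_at_append evaluates_def)
  have le: "\<bar>aval inp s a\<bar> \<le> X ^ weight a" "\<bar>aval inp s b\<bar> \<le> X ^ weight b"
    using aval_le[of s a] aval_le[of s b] Cell.prems by auto
  let ?ad = "address (length inp) (aval inp s a) (aval inp s b)"
  obtain c3 where c3: "evaluates t' c (length ?A + length ?B + 4) ?ad c3"
    using evaluates_cell_address[OF c1 c2 Cell.prems(2,3) _ weight_pos weight_pos le] Cell.prems
    by (auto simp: code_at_append add.assoc)
  have "\<bar>?ad\<bar> \<le> X ^ W"
    using address_le(4)[OF weight_pos weight_pos le] pow_mono[of "weight (Cell a b)" W] Cell.prems(7) by simp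
  moreover have "\<bar>aval inp s (Cell a b)\<bar> \<le> X ^ W"
    using aval_le[of s "Cell a b"] Cell.prems pow_mono[of "weight (Cell a b)" W] by auto
  moreover have "mem c (nat ?ad) = aval inp s (Cell a b)"
    using Cell.prems by (simp add: represents_def)
  moreover have "code_at P (pc c + (length ?A + length ?B + 4)) [Load t' t']"
    using Cell.prems(1) by (simp add: code_at_append add.assoc)
  ultimately have "\<exists>c'. evaluates t' c (length ?A + length ?B + 4 + 1) (aval inp s (Cell a b)) c'"
    by (intro evaluates_load[OF c3])
  then show ?case by (simp add: ac_simps)
qed

lemma represents_assign:
  "represents t inp (R, M) c \<Longrightarrow> x \<noteq> 0 \<Longrightarrow> (\<forall>y < t. regs c' y = (if y = x then v else regs c y)) \<Longrightarrow>
    mem c' = mem c \<Longrightarrow> represents t inp (R(x := v), M) c'"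
  by (auto simp: represents_def)

lemma represents_write:
  assumes "represents t inp (R, M) c" "a \<ge> 0" "b \<ge> 0" "\<forall>y < t. regs c' y = regs c y"
    and "mem c' = (mem c)(nat (address (length inp) a b) := v)"
  shows "represents t inp (R, M(a := (M a)(b := v))) c'"
proof -
  have "nat (address (length inp) a b) \<noteq> i" if "i < length inp" for i
    using address_ge[OF assms(2,3), of "length inp"] that by linarith
  moreover have "nat (address (length inp) a' b') = nat (address (length inp) a b) \<longleftrightarrow> a' = a \<and> b' = b"
    if "a' \<ge> 0" "b' \<ge> 0" for a' b'
    using address_inj[of a' b' a b] assms(2,3) that
      address_ge[OF assms(2,3), of "length inp"] address_ge[OF that, of "length inp"]
    by (metis nat_eq_iff2 of_nat_0_le_iff order.trans)
  ultimately show ?thesis using assms by (auto simp: represents_def)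
qed

end

context compiled
begin

definition simulates :: "config \<Rightarrow> nat \<Rightarrow> store \<Rightarrow> nat \<Rightarrow> config \<Rightarrow> bool" where
  "simulates g m s l g' \<longleftrightarrow> reaches P K m g g' \<and> represents t inp s g' \<and> pc g' = l"

lemma simulates_reaches:
  "reaches P K m g g1 \<Longrightarrow> simulates g1 n s l g' \<Longrightarrow> simulates g (m + n) s l g'"
  by (auto simp: simulates_def intro: reaches_add)

lemma jump_correct:
  assumes "code_at P (pc g) [Jump l]" "represents t inp s g"
  shows "\<exists>g'. simulates g 1 s l g'"
proof -
  have "reaches P K 1 g ((det_exec (Jump l) g)\<lparr>time := time g + cost (Jump l) g\<rparr>)"
    using assms by (intro reaches_instr cost_le)
  then show ?thesis using assms(2)
    by (intro exI[of _ "(det_exec (Jump l) g)\<lparr>time := time g + cost (Jump l) g\<rparr>"])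
      (simp add: simulates_def represents_def)
qed

lemma condition_correct:
  assumes code: "code_at P (pc g) (compile_aexp t e @ [JumpPos t l])" and rep: "represents t inp s g"
    and e: "safe inp s e" "aexp_vars e \<subseteq> {..<t}" "bounded_store t X s" "weight e \<le> W"
  shows "\<exists>g'. simulates g (length (compile_aexp t e) + 1) s
      (if aval inp s e > 0 then l else pc g + length (compile_aexp t e) + 1) g'"
proof -
  obtain g1 where g1: "evaluates t g (length (compile_aexp t e)) (aval inp s e) g1"
    using compile_aexp_correct[of g t e s] assms by (auto simp: code_at_append)
  have le: "\<bar>aval inp s e\<bar> \<le> X ^ W"
    using aval_le[OF e(3,1,2)] pow_mono[OF e(4)] by linarith
  let ?g = "(det_exec (JumpPos t l) g1)\<lparr>time := time g1 + cost (JumpPos t l) g1\<rparr>"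
  have "reaches P K 1 g1 ?g"
    using g1 code le by (intro reaches_instr cost_le) (auto simp: evaluates_def code_at_append)
  then have "reaches P K (length (compile_aexp t e) + 1) g ?g"
    using g1 unfolding evaluates_def by (blast intro: reaches_add)
  moreover have "represents t inp s ?g"
    using represents_evaluates[OF rep g1] by (simp add: represents_def)
  ultimately have "simulates g (length (compile_aexp t e) + 1) s
      (if aval inp s e > 0 then l else pc g + length (compile_aexp t e) + 1) ?g"
    using g1 by (auto simp: simulates_def evaluates_def)
  then show ?thesis by blast
qed

lemma assign_correct:
  assumes code: "code_at P (pc g) (compile_aexp t e @ [Copy x t])" and rep: "represents t inp (R, M) g"
    and e: "safe inp (R, M) e" "aexp_vars e \<subseteq> {..<t}" "bounded_store t X (R, M)" "weight e \<le> W"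
    and x: "x \<noteq> 0" "x < t"
  shows "\<exists>g'. simulates g (length (compile_aexp t e) + 1) (R(x := aval inp (R, M) e), M)
      (pc g + length (compile_aexp t e) + 1) g'"
proof -
  obtain g1 where g1: "evaluates t g (length (compile_aexp t e)) (aval inp (R, M) e) g1"
    using compile_aexp_correct[of g t e "(R, M)"] assms by (auto simp: code_at_append)
  have le: "\<bar>aval inp (R, M) e\<bar> \<le> X ^ W"
    using aval_le[OF e(3,1,2)] pow_mono[OF e(4)] by linarith
  let ?g = "(det_exec (Copy x t) g1)\<lparr>time := time g1 + cost (Copy x t) g1\<rparr>"
  have "reaches P K 1 g1 ?g"
    using g1 code le by (intro reaches_instr cost_le) (auto simp: evaluates_def code_at_append)
  then have "reaches P K (length (compile_aexp t e) + 1) g ?g"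
    using g1 unfolding evaluates_def by (blast intro: reaches_add)
  moreover have "represents t inp (R(x := aval inp (R, M) e), M) ?g"
    using g1 x by (intro represents_assign[OF rep]) (auto simp: evaluates_def set_reg_def)
  ultimately have "simulates g (length (compile_aexp t e) + 1) (R(x := aval inp (R, M) e), M)
      (pc g + length (compile_aexp t e) + 1) ?g"
    using g1 by (auto simp: simulates_def evaluates_def set_reg_def)
  then show ?thesis by blast
qed

lemma write_correct:
  assumes code: "code_at P (pc g) (compile t (pc g) (Write a b e))" and rep: "represents t inp (R, M) g"
    and safe: "safe inp (R, M) a" "safe inp (R, M) b" "safe inp (R, M) e"
    and pos: "0 \<le> aval inp (R, M) a" "0 \<le> aval inp (R, M) b"
    and wf: "wf_com t (Write a b e)" and bd: "bounded_store t X (R, M)" and W: "com_weight (Write a b e) \<le> W"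
  shows "\<exists>g'. simulates g (length (compile t (pc g) (Write a b e)))
      (R, M(aval inp (R, M) a := (M (aval inp (R, M) a))(aval inp (R, M) b := aval inp (R, M) e)))
      (pc g + length (compile t (pc g) (Write a b e))) g'"
proof -
  let ?s = "(R, M)"
  let ?A = "compile_aexp t a" and ?B = "compile_aexp (t + 1) b" and ?E = "compile_aexp (t + 1) e"
  have W': "3 * (weight a + weight b) + 1 \<le> W" "weight e \<le> W" "weight a \<le> W" "weight b \<le> W" using W by auto
  have vars: "aexp_vars a \<subseteq> {..<t}" "aexp_vars b \<subseteq> {..<t}" "aexp_vars e \<subseteq> {..<t}" using wf by auto
  have codes: "code_at P (pc g) ?A" "code_at P (pc g + length ?A) ?B"
    "code_at P (pc g + length ?A + length ?B) (cell_address t)"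
    "code_at P (pc g + (length ?A + length ?B + 4)) ?E"
    "code_at P (pc g + (length ?A + length ?B + 4 + length ?E)) [Store t (t + 1)]"
    using code by (simp_all add: code_at_append add.assoc)
  obtain g1 where g1: "evaluates t g (length ?A) (aval inp ?s a) g1"
    using compile_aexp_correct[OF codes(1) rep] safe vars bd W' by auto
  have "pc g1 = pc g + length ?A" using g1 by (simp add: evaluates_def)
  then obtain g2 where g2: "evaluates (t + 1) g1 (length ?B) (aval inp ?s b) g2"
    using compile_aexp_correct[of g1 "t + 1" b ?s] codes(2) represents_evaluates[OF rep g1] safe vars bd W'
    by auto
  have le: "\<bar>aval inp ?s a\<bar> \<le> X ^ weight a" "\<bar>aval inp ?s b\<bar> \<le> X ^ weight b"
    using aval_le[OF bd] safe vars by auto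
  let ?ad = "address (length inp) (aval inp ?s a) (aval inp ?s b)"
  obtain g3 where g3: "evaluates t g (length ?A + length ?B + 4) ?ad g3"
    using evaluates_cell_address[OF g1 g2 rep order.refl codes(3) weight_pos weight_pos le W'(1)] by blast
  have "pc g3 = pc g + (length ?A + length ?B + 4)" using g3 by (simp add: evaluates_def)
  then obtain g4 where g4: "evaluates (t + 1) g3 (length ?E) (aval inp ?s e) g4"
    using compile_aexp_correct[of g3 "t + 1" e ?s] codes(4) represents_evaluates[OF rep g3] safe vars bd W'
    by auto
  have le4: "\<bar>?ad\<bar> \<le> X ^ W" "\<bar>aval inp ?s e\<bar> \<le> X ^ W"
    using address_le(4)[OF weight_pos weight_pos le] pow_mono[OF W'(1)]
      aval_le[OF bd, of e] safe vars pow_mono[OF W'(2)] by auto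
  have regs4: "regs g4 t = ?ad" "regs g4 (t + 1) = aval inp ?s e" "\<forall>y<t. regs g4 y = regs g y"
    "mem g4 = mem g" "pc g4 = pc g + (length ?A + length ?B + 4 + length ?E)"
    using g3 g4 by (auto simp: evaluates_def)
  let ?g = "(det_exec (Store t (t + 1)) g4)\<lparr>time := time g4 + cost (Store t (t + 1)) g4\<rparr>"
  have "reaches P K 1 g4 ?g"
    using codes(5) regs4 le4 by (intro reaches_instr cost_le) simp_all
  then have "reaches P K (length ?A + length ?B + 4 + length ?E + 1) g ?g"
    using g3 g4 unfolding evaluates_def by (blast intro: reaches_add)
  moreover have "represents t inp
      (R, M(aval inp ?s a := (M (aval inp ?s a))(aval inp ?s b := aval inp ?s e))) ?g"
    using regs4 pos by (intro represents_write[OF rep]) auto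
  ultimately have "simulates g (length ?A + length ?B + 4 + length ?E + 1)
      (R, M(aval inp ?s a := (M (aval inp ?s a))(aval inp ?s b := aval inp ?s e)))
      (pc g + (length ?A + length ?B + 4 + length ?E + 1)) ?g"
    using regs4 by (simp add: simulates_def)
  moreover have "length (compile t (pc g) (Write a b e)) = length ?A + length ?B + 4 + length ?E + 1" by simp
  ultimately show ?thesis by metis
qed

text \<open>Each of the \<open>n\<close> steps of the command runs through each instruction of its code at most once, which
  gives the bound on the number \<open>m\<close> of machine steps.\<close>

theorem compile_correct:
  assumes "exec_com inp X c s n s'"
    and "code_at P (pc g) (compile t (pc g) c)" "represents t inp s g" "bounded_store t X s"
      "wf_com t c" "com_weight c \<le> W"
  shows "\<exists>m g'. m \<le> n * length (compile t (pc g) c) \<and>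
    simulates g m s' (pc g + length (compile t (pc g) c)) g' \<and> bounded_store t X s'"
  using assms
proof (induction arbitrary: g rule: exec_com.induct)
  case (Assign R M e x)
  have "bounded_store t X (R(x := aval inp (R, M) e), M)"
    using Assign by (auto simp: bounded_store_def)
  moreover obtain g' where "simulates g (length (compile_aexp t e) + 1) (R(x := aval inp (R, M) e), M)
      (pc g + length (compile_aexp t e) + 1) g'"
    using assign_correct[of g e x R M] Assign by auto
  ultimately show ?case by (intro exI[of _ "length (compile_aexp t e) + 1"] exI[of _ g']) simp
next
  case (Write R M a b e)
  have "bounded_store t X (R, M(aval inp (R, M) a := (M (aval inp (R, M) a))(aval inp (R, M) b := aval inp (R, M) e)))"
    using Write by (auto simp: bounded_store_def)
  moreover obtain g' where "simulates g (length (compile t (pc g) (Write a b e)))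
      (R, M(aval inp (R, M) a := (M (aval inp (R, M) a))(aval inp (R, M) b := aval inp (R, M) e)))
      (pc g + length (compile t (pc g) (Write a b e))) g'"
    using write_correct[of g a b e R M] Write by blast
  ultimately show ?case
    by (intro exI[of _ "length (compile t (pc g) (Write a b e))"] exI[of _ g']) (simp del: compile.simps)
next
  case (Seq c1 s n1 s' c2 n2 s'')
  let ?C1 = "compile t (pc g) c1"
  let ?C2 = "compile t (pc g + length ?C1) c2"
  obtain m1 g1 where 1: "m1 \<le> n1 * length ?C1" "simulates g m1 s' (pc g + length ?C1) g1" "bounded_store t X s'"
    using Seq.IH(1)[of g] Seq.prems by (auto simp: Let_def code_at_append)
  then have g1: "pc g1 = pc g + length ?C1" "represents t inp s' g1" "reaches P K m1 g g1"
    by (auto simp: simulates_def)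
  obtain m2 g2 where 2: "m2 \<le> n2 * length ?C2" "simulates g1 m2 s'' (pc g1 + length ?C2) g2" "bounded_store t X s''"
    using Seq.IH(2)[of g1] Seq.prems 1 g1 by (auto simp: Let_def code_at_append)
  have "m1 + m2 \<le> (n1 + n2) * (length ?C1 + length ?C2)"
    using 1(1) 2(1) by (simp add: algebra_simps)
  moreover have "simulates g (m1 + m2) s'' (pc g + (length ?C1 + length ?C2)) g2"
    using simulates_reaches[OF g1(3) 2(2)] g1(1) by (simp add: add.assoc)
  ultimately show ?case using 2(3) by (auto simp: Let_def)
next
  case (IfTrue s e c1 n s' c2)
  let ?E = "compile_aexp t e"
  let ?C2 = "compile t (pc g + length ?E + 1) c2"
  let ?l = "pc g + length ?E + 1 + length ?C2 + 1"
  let ?C1 = "compile t ?l c1"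
  let ?C = "compile t (pc g) (If e c1 c2)"
  have C: "?C = ?E @ [JumpPos t ?l] @ ?C2 @ [Jump (?l + length ?C1)] @ ?C1" by (simp add: Let_def)
  have code1: "code_at P (pc g) (?E @ [JumpPos t ?l])" "code_at P ?l ?C1"
    using IfTrue.prems(1) unfolding C code_at_append by simp_all
  obtain g1 where g1: "simulates g (length ?E + 1) s ?l g1"
    using condition_correct[OF code1(1) IfTrue.prems(2)] IfTrue by auto
  obtain m g2 where 2: "m \<le> n * length ?C1" "simulates g1 m s' (pc g1 + length ?C1) g2" "bounded_store t X s'"
    using IfTrue.IH[of g1] IfTrue.prems g1 code1 by (auto simp: simulates_def)
  have "length ?E + 1 + m \<le> (n + 1) * length ?C" using 2(1) unfolding C by (simp add: algebra_simps)
  moreover have "simulates g (length ?E + 1 + m) s' (pc g + length ?C) g2"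
    using simulates_reaches[OF _ 2(2), of "length ?E + 1" g] g1 unfolding C
    by (simp add: simulates_def algebra_simps)
  ultimately show ?case using 2(3) by blast
next
  case (IfFalse s e c2 n s' c1)
  let ?E = "compile_aexp t e"
  let ?C2 = "compile t (pc g + length ?E + 1) c2"
  let ?l = "pc g + length ?E + 1 + length ?C2 + 1"
  let ?C1 = "compile t ?l c1"
  let ?C = "compile t (pc g) (If e c1 c2)"
  have C: "?C = ?E @ [JumpPos t ?l] @ ?C2 @ [Jump (?l + length ?C1)] @ ?C1" by (simp add: Let_def)
  have code1: "code_at P (pc g) (?E @ [JumpPos t ?l])" "code_at P (pc g + length ?E + 1) ?C2"
    "code_at P (pc g + length ?E + 1 + length ?C2) [Jump (?l + length ?C1)]"
    using IfFalse.prems(1) unfolding C code_at_append by simp_all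
  obtain g1 where g1: "simulates g (length ?E + 1) s (pc g + length ?E + 1) g1"
    using condition_correct[OF code1(1) IfFalse.prems(2)] IfFalse by auto
  obtain m g2 where 2: "m \<le> n * length ?C2" "simulates g1 m s' (pc g1 + length ?C2) g2" "bounded_store t X s'"
    using IfFalse.IH[of g1] IfFalse.prems g1 code1 by (auto simp: simulates_def)
  have pc2: "pc g2 = pc g + length ?E + 1 + length ?C2" "represents t inp s' g2"
    using 2(2) g1 by (auto simp: simulates_def)
  obtain g3 where 3: "simulates g2 1 s' (?l + length ?C1) g3"
    using jump_correct[of g2 "?l + length ?C1" s'] code1(3) pc2 by auto
  have "length ?E + 1 + m + 1 \<le> (n + 1) * length ?C" using 2(1) unfolding C by (simp add: algebra_simps)
  moreover have "reaches P K (length ?E + 1 + m) g g2"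
    using g1 2(2) reaches_add[of P K "length ?E + 1" g g1 m g2] by (simp add: simulates_def)
  then have "simulates g (length ?E + 1 + m + 1) s' (pc g + length ?C) g3"
    using simulates_reaches[OF _ 3] unfolding C by (simp add: algebra_simps)
  ultimately show ?case using 2(3) by blast
next
  case (WhileTrue s e c n1 s' n2 s'')
  let ?E = "compile_aexp t e"
  let ?B = "compile t (pc g + length ?E + 2) c"
  let ?C = "compile t (pc g) (While e c)"
  let ?end = "pc g + length ?E + 2 + length ?B + 1"
  have C: "?C = ?E @ [JumpPos t (pc g + length ?E + 2)] @ [Jump ?end] @ ?B @ [Jump (pc g)]"
    by (simp add: Let_def)
  have code1: "code_at P (pc g) (?E @ [JumpPos t (pc g + length ?E + 2)])"
    "code_at P (pc g + length ?E + 2) ?B" "code_at P (pc g + length ?E + 2 + length ?B) [Jump (pc g)]"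
    using WhileTrue.prems(1) unfolding C code_at_append by simp_all
  obtain g1 where g1: "simulates g (length ?E + 1) s (pc g + length ?E + 2) g1"
    using condition_correct[OF code1(1) WhileTrue.prems(2)] WhileTrue by auto
  obtain m g2 where 2: "m \<le> n1 * length ?B" "simulates g1 m s' (pc g1 + length ?B) g2" "bounded_store t X s'"
    using WhileTrue.IH(1)[of g1] WhileTrue.prems g1 code1 by (auto simp: simulates_def)
  have pc2: "pc g2 = pc g + length ?E + 2 + length ?B" "represents t inp s' g2"
    using 2(2) g1 by (auto simp: simulates_def)
  obtain g3 where 3: "simulates g2 1 s' (pc g) g3"
    using jump_correct[of g2 "pc g" s'] code1(3) pc2 by auto
  then have pc3: "pc g3 = pc g" "represents t inp s' g3" by (auto simp: simulates_def)
  obtain m' g4 where 4: "m' \<le> n2 * length ?C" "simulates g3 m' s'' (pc g + length ?C) g4" "bounded_store t X s''"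
    using WhileTrue.IH(2)[of g3, unfolded pc3] pc3 WhileTrue.prems 2(3) by blast
  have "m \<le> n1 * length ?C" using 2(1) unfolding C by (simp add: algebra_simps)
  moreover have "length ?E + 1 + 1 \<le> length ?C" unfolding C by simp
  ultimately have "length ?E + 1 + m + 1 + m' \<le> (1 + n1 + n2) * length ?C"
    using 4(1) by (simp add: add_mult_distrib)
  moreover have "reaches P K (length ?E + 1 + m + 1) g g3"
    using g1 2(2) 3 reaches_add[OF reaches_add[of P K "length ?E + 1" g g1 m g2], of 1 g3]
    by (simp add: simulates_def)
  then have "simulates g (length ?E + 1 + m + 1 + m') s'' (pc g + length ?C) g4"
    by (rule simulates_reaches[OF _ 4(2)])
  ultimately show ?case using 4(3) by blast
next
  case (WhileFalse s e c)
  let ?E = "compile_aexp t e"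
  let ?B = "compile t (pc g + length ?E + 2) c"
  let ?C = "compile t (pc g) (While e c)"
  let ?end = "pc g + length ?E + 2 + length ?B + 1"
  have C: "?C = ?E @ [JumpPos t (pc g + length ?E + 2)] @ [Jump ?end] @ ?B @ [Jump (pc g)]"
    by (simp add: Let_def)
  have code1: "code_at P (pc g) (?E @ [JumpPos t (pc g + length ?E + 2)])"
    "code_at P (pc g + length ?E + 1) [Jump ?end]"
    using WhileFalse.prems(1) unfolding C code_at_append by simp_all
  obtain g1 where g1: "simulates g (length ?E + 1) s (pc g + length ?E + 1) g1"
    using condition_correct[OF code1(1) WhileFalse.prems(2)] WhileFalse by auto
  then have "pc g1 = pc g + length ?E + 1" "represents t inp s g1" by (auto simp: simulates_def)
  then obtain g2 where 2: "simulates g1 1 s ?end g2"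
    using jump_correct[of g1 ?end s] code1(2) by auto
  have "simulates g (length ?E + 1 + 1) s (pc g + length ?C) g2"
    using simulates_reaches[OF _ 2, of "length ?E + 1" g] g1 unfolding C by (simp add: simulates_def)
  moreover have "length ?E + 1 + 1 \<le> 1 * length ?C" unfolding C by simp
  ultimately show ?case using WhileFalse.prems by blast
qed

end

section \<open>Total correctness with running times\<close>

definition terminates :: "int list \<Rightarrow> int \<Rightarrow> com \<Rightarrow> store \<Rightarrow> nat \<Rightarrow> (store \<Rightarrow> bool) \<Rightarrow> bool" where
  "terminates inp X c s n Q \<longleftrightarrow> (\<exists>m s'. exec_com inp X c s m s' \<and> m \<le> n \<and> Q s')"

lemma terminates_Assign:
  assumes "safe inp (R, M) e" "\<bar>aval inp (R, M) e\<bar> \<le> X" "Q (R(x := aval inp (R, M) e), M)"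
  shows "terminates inp X (Assign x e) (R, M) 1 Q"
  using assms exec_com.Assign unfolding terminates_def by blast

lemma terminates_Write:
  assumes "safe inp (R, M) a" "safe inp (R, M) b" "safe inp (R, M) e"
    "0 \<le> aval inp (R, M) a" "0 \<le> aval inp (R, M) b" "\<bar>aval inp (R, M) e\<bar> \<le> X"
    "Q (R, M(aval inp (R, M) a := (M (aval inp (R, M) a))(aval inp (R, M) b := aval inp (R, M) e)))"
  shows "terminates inp X (Write a b e) (R, M) 1 Q"
  using assms exec_com.Write unfolding terminates_def by blast

lemma terminates_Seq:
  assumes "terminates inp X c1 s n1 (\<lambda>s'. terminates inp X c2 s' n2 Q)"
  shows "terminates inp X (Seq c1 c2) s (n1 + n2) Q"
  using assms exec_com.Seq unfolding terminates_def by (meson add_mono)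

lemma terminates_If:
  assumes "safe inp s e" "aval inp s e > 0 \<Longrightarrow> terminates inp X c1 s n Q"
    "aval inp s e \<le> 0 \<Longrightarrow> terminates inp X c2 s n Q"
  shows "terminates inp X (If e c1 c2) s (n + 1) Q"
  using assms exec_com.IfTrue exec_com.IfFalse unfolding terminates_def
  by (metis add_le_cancel_right linorder_not_le)

lemma terminates_mono:
  assumes "terminates inp X c s m Q" "m \<le> n" "\<And>s. Q s \<Longrightarrow> Q' s"
  shows "terminates inp X c s n Q'"
  using assms unfolding terminates_def by (meson order.trans)

lemma terminates_Seq_via:
  assumes "terminates inp X c1 s n1 A" "\<And>s'. A s' \<Longrightarrow> terminates inp X c2 s' n2 Q"
  shows "terminates inp X (Seq c1 c2) s (n1 + n2) Q"
  using assms by (intro terminates_Seq terminates_mono[OF assms(1) order.refl])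

text \<open>\<open>I k s\<close> says that at most \<open>k\<close> iterations remain.\<close>

lemma terminates_While:
  assumes I: "I k s"
    and safe: "\<And>k s. I k s \<Longrightarrow> safe inp s e"
    and body: "\<And>k s. I k s \<Longrightarrow> aval inp s e > 0 \<Longrightarrow> k > 0 \<and> terminates inp X c s n (I (k - 1))"
    and exit: "\<And>k s. I k s \<Longrightarrow> aval inp s e \<le> 0 \<Longrightarrow> Q s"
  shows "terminates inp X (While e c) s (k * (n + 1) + 1) Q"
  using I
proof (induction k arbitrary: s)
  case 0
  then have "aval inp s e \<le> 0" using body[of 0 s] by fastforce
  then show ?case using 0 safe[OF 0] exit[OF 0] exec_com.WhileFalse unfolding terminates_def by fastforce
next
  case (Suc k)
  show ?case
  proof (cases "aval inp s e > 0")
    case True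
    then obtain m s' where 1: "exec_com inp X c s m s'" "m \<le> n" "I k s'"
      using body[OF Suc.prems] by (auto simp: terminates_def)
    then obtain m' s'' where 2: "exec_com inp X (While e c) s' m' s''" "m' \<le> k * (n + 1) + 1" "Q s''"
      using Suc.IH[OF 1(3)] unfolding terminates_def by blast
    have "1 + m + m' \<le> Suc k * (n + 1) + 1" using 1 2 by simp
    then show ?thesis
      using exec_com.WhileTrue[OF safe[OF Suc.prems] True 1(1) 2(1)] 2(3) unfolding terminates_def by blast
  next
    case False
    then show ?thesis
      using safe[OF Suc.prems] exit[OF Suc.prems] exec_com.WhileFalse unfolding terminates_def
      by (meson le_add2 linorder_not_le)
  qed
qed


fun loop_free :: "com \<Rightarrow> bool" where
  "loop_free (Seq c1 c2) \<longleftrightarrow> loop_free c1 \<and> loop_free c2"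
| "loop_free (If e c1 c2) \<longleftrightarrow> loop_free c1 \<and> loop_free c2"
| "loop_free (While e c) \<longleftrightarrow> False"
| "loop_free _ \<longleftrightarrow> True"

fun loop_free_time :: "com \<Rightarrow> nat" where
  "loop_free_time (Seq c1 c2) = loop_free_time c1 + loop_free_time c2"
| "loop_free_time (If e c1 c2) = max (loop_free_time c1) (loop_free_time c2) + 1"
| "loop_free_time _ = 1"

text \<open>Loops are treated by \<open>terminates_While\<close>; everything between them by weakest preconditions, which the
  simplifier evaluates.\<close>

fun wp :: "int list \<Rightarrow> int \<Rightarrow> com \<Rightarrow> (store \<Rightarrow> bool) \<Rightarrow> store \<Rightarrow> bool" where
  "wp inp X (Assign x e) Q s \<longleftrightarrow>
     safe inp s e \<and> \<bar>aval inp s e\<bar> \<le> X \<and> Q ((fst s)(x := aval inp s e), snd s)"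
| "wp inp X (Write a b e) Q s \<longleftrightarrow> safe inp s a \<and> safe inp s b \<and> safe inp s e \<and>
     0 \<le> aval inp s a \<and> 0 \<le> aval inp s b \<and> \<bar>aval inp s e\<bar> \<le> X \<and>
     Q (fst s, (snd s)(aval inp s a := (snd s (aval inp s a))(aval inp s b := aval inp s e)))"
| "wp inp X (Seq c1 c2) Q s \<longleftrightarrow> wp inp X c1 (wp inp X c2 Q) s"
| "wp inp X (If e c1 c2) Q s \<longleftrightarrow> safe inp s e \<and>
     (if aval inp s e > 0 then wp inp X c1 Q s else wp inp X c2 Q s)"
| "wp inp X (While e c) Q s \<longleftrightarrow> False"

lemma wp_terminates:
  "loop_free c \<Longrightarrow> wp inp X c Q s \<Longrightarrow> terminates inp X c s (loop_free_time c) Q"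
proof (induction c arbitrary: s Q)
  case (Assign x e)
  then show ?case by (cases s) (auto intro: terminates_Assign[unfolded One_nat_def])
next
  case (Write a b e)
  then show ?case by (cases s) (auto intro: terminates_Write[unfolded One_nat_def])
next
  case (Seq c1 c2)
  then have "terminates inp X c1 s (loop_free_time c1) (wp inp X c2 Q)" by simp
  then have "terminates inp X c1 s (loop_free_time c1) (\<lambda>s'. terminates inp X c2 s' (loop_free_time c2) Q)"
    by (rule terminates_mono) (use Seq in auto)
  then show ?case by (simp add: terminates_Seq)
next
  case (If e c1 c2)
  have "terminates inp X (com.If e c1 c2) s (max (loop_free_time c1) (loop_free_time c2) + 1) Q"
  proof (rule terminates_If)
    assume "aval inp s e > 0"
    with If show "terminates inp X c1 s (max (loop_free_time c1) (loop_free_time c2)) Q"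
      by (intro terminates_mono[OF If.IH(1)]) auto
  next
    assume "aval inp s e \<le> 0"
    with If show "terminates inp X c2 s (max (loop_free_time c1) (loop_free_time c2)) Q"
      by (intro terminates_mono[OF If.IH(2)]) auto
  qed (use If in simp)
  then show ?case by simp
qed simp

lemma loop_free_terminates:
  "wp inp X b Q s \<Longrightarrow> loop_free b \<Longrightarrow> loop_free_time b \<le> n \<Longrightarrow> terminates inp X b s n Q"
  by (rule terminates_mono[OF wp_terminates]) auto

fun seq :: "com list \<Rightarrow> com" where
  "seq [] = Assign 1 (Lit 0)"
| "seq [c] = c"
| "seq (c # cs) = Seq c (seq cs)"

section \<open>Flows of labelled walks\<close>

text \<open>The flow of a walk whose \<open>t\<close>-th step has the label \<open>E t\<close> and the sign \<open>c t\<close>.\<close>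

definition label_flow :: "(nat \<Rightarrow> 'e) \<Rightarrow> (nat \<Rightarrow> int) \<Rightarrow> nat \<Rightarrow> 'e \<Rightarrow> int" where
  "label_flow E c n e = (\<Sum>t<n. if E t = e then c t else 0)"

lemma label_flow_0 [simp]: "label_flow E c 0 e = 0"
  and label_flow_Suc: "label_flow E c (Suc n) e = label_flow E c n e + (if E n = e then c n else 0)"
  by (simp_all add: label_flow_def)

lemma label_flow_cong:
  "(\<And>t. t < n \<Longrightarrow> E t = E' t) \<Longrightarrow> (\<And>t. t < n \<Longrightarrow> c t = c' t) \<Longrightarrow> label_flow E c n e = label_flow E' c' n e"
  unfolding label_flow_def by (intro sum.cong) auto

lemma label_flow_prefix:
  assumes "i \<le> n"
  shows "label_flow E c i e = label_flow E (\<lambda>t. if t < i then c t else 0) n e"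
proof -
  have "label_flow E (\<lambda>t. if t < i then c t else 0) n e
      = (\<Sum>t\<in>{..<n}. if t \<in> {..<i} then (if E t = e then c t else 0) else 0)"
    unfolding label_flow_def by (intro sum.cong) auto
  also have "\<dots> = (\<Sum>t\<in>{..<n} \<inter> {..<i}. if E t = e then c t else 0)"
    by (intro sum.inter_restrict [symmetric]) simp
  also have "{..<n} \<inter> {..<i} = {..<i}" using assms by auto
  finally show ?thesis by (simp add: label_flow_def)
qed

lemma label_flow_diff:
  "label_flow E c n e - label_flow E c' n e = label_flow E (\<lambda>t. c t - c' t) n e"
  unfolding label_flow_def by (subst sum_subtractf [symmetric], intro sum.cong) auto

lemma label_flow_mult:
  "k * label_flow E c n e = label_flow E (\<lambda>t. k * c t) n e"
  unfolding label_flow_def by (subst sum_distrib_left, intro sum.cong) auto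

lemma label_flow_abs_le:
  assumes "\<And>t. t < n \<Longrightarrow> \<bar>c t\<bar> \<le> 1"
  shows "\<bar>label_flow E c n e\<bar> \<le> int n"
proof -
  have "\<bar>label_flow E c n e\<bar> \<le> (\<Sum>t<n. \<bar>if E t = e then c t else 0\<bar>)"
    unfolding label_flow_def by (rule sum_abs)
  also have "\<dots> \<le> (\<Sum>t<n. 1)" using assms by (intro sum_mono) auto
  finally show ?thesis by simp
qed

text \<open>Whether a flow vanishes depends only on which labels agree.  This allows for the replacement of cosets
  by the integers that the program uses.\<close>

lemma label_flow_zero_iff:
  assumes "\<And>s t. s < n \<Longrightarrow> t < n \<Longrightarrow> E s = E t \<longleftrightarrow> E' s = E' t"
  shows "(\<forall>e. label_flow E c n e = 0) \<longleftrightarrow> (\<forall>e. label_flow E' c n e = 0)"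
proof -
  have *: "label_flow E' c n e = 0"
    if "\<And>s t. s < n \<Longrightarrow> t < n \<Longrightarrow> E s = E t \<longleftrightarrow> E' s = E' t" "\<forall>e. label_flow E c n e = 0"
    for e and E :: "nat \<Rightarrow> 'x" and E' :: "nat \<Rightarrow> 'y"
  proof (cases "\<exists>s<n. E' s = e")
    case True
    then obtain s where s: "s < n" "E' s = e" by blast
    have "label_flow E' c n e = label_flow E c n (E s)"
      unfolding label_flow_def using s that(1)[OF _ s(1)] by (intro sum.cong) auto
    then show ?thesis using that(2) by simp
  next
    case False
    then show ?thesis unfolding label_flow_def by (intro sum.neutral) auto
  qed
  show ?thesis using *[of E E'] *[of E' E] assms by blast
qed

text \<open>The edge of the \<open>t\<close>-th step when the vertices are represented by \<open>I\<close> and the letters by integers: an inverse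
  letter traverses backwards the edge that starts at the next vertex.\<close>

definition walk_edge :: "(nat \<Rightarrow> 'v) \<Rightarrow> (nat \<Rightarrow> int) \<Rightarrow> nat \<Rightarrow> 'v \<times> int" where
  "walk_edge I L t = (if L t > 0 then I t else I (Suc t), \<bar>L t\<bar>)"

lemma walk_edge_eq_iff:
  assumes "\<And>s t. s \<le> n \<Longrightarrow> t \<le> n \<Longrightarrow> I s = I t \<longleftrightarrow> J s = J t" "s < n" "t < n"
  shows "walk_edge I L s = walk_edge I L t \<longleftrightarrow> walk_edge J L s = walk_edge J L t"
  using assms(2,3) by (auto simp: walk_edge_def assms(1))

definition letter_int :: "letter \<Rightarrow> int" where
  "letter_int x = (if snd x then int (fst x) else - int (fst x))"

lemma letter_int_letters:
  "x \<in> letters r \<Longrightarrow> letter_int x \<noteq> 0 \<and> \<bar>letter_int x\<bar> \<in> {1..int r}"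
  by (auto simp: letters_def letter_int_def)

lemma letter_int_inv: "letter_int (inv_letter x) = - letter_int x"
  by (simp add: letter_int_def inv_letter_def)

definition word_ints :: "word \<Rightarrow> nat \<Rightarrow> int" where
  "word_ints w t = letter_int (w ! t)"

context free_group_rank
begin

lemma steps_prefix:
  assumes "w \<in> words r" "i \<le> length w"
  shows "flow (steps N \<one>\<^bsub>G\<^esub> (take i w)) (v, x) =
    label_flow (walk_edge (\<lambda>t. N #>\<^bsub>G\<^esub> free_reduce (take t w)) (word_ints w))
      (\<lambda>t. sgn (word_ints w t)) i (v, int x)"
  using assms(2)
proof (induction i)
  case (Suc i)
  then have i: "i < length w" by simp
  have w: "take i w \<in> words r" using assms(1) by (auto simp: words_def dest: in_set_takeD)
  have x: "w ! i \<in> letters r" using assms(1) i by (auto simp: words_def)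
  have fr: "free_reduce (take i w) \<otimes>\<^bsub>G\<^esub> [w ! i] = free_reduce (take (Suc i) w)"
    using i by (simp add: take_Suc_conv_app_nth mult_G)
  have "steps N \<one>\<^bsub>G\<^esub> (take (Suc i) w) = steps N \<one>\<^bsub>G\<^esub> (take i w) @ steps N (free_reduce (take i w)) [w ! i]"
    using i w by (simp add: take_Suc_conv_app_nth steps_append)
  moreover have "letter_int (w ! i) \<noteq> 0" using letter_int_letters[OF x] by blast
  ultimately show ?case using Suc fr
    by (auto simp: label_flow_Suc walk_edge_def word_ints_def letter_int_def)
qed simp

lemma word_flow_eq_label_flow:
  assumes "w \<in> words r" "i \<le> length w"
  shows "word_flow (D l) (take i w) (v, x) =
    label_flow (walk_edge (\<lambda>t. solvable_class r l (take t w)) (word_ints w))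
      (\<lambda>t. sgn (word_ints w t)) i (v, int x)"
  using steps_prefix[OF assms, of "D l" v x] by (simp add: solvable_class_def)

lemma label_flow_walk_edge_neg:
  "y < 0 \<Longrightarrow> label_flow (walk_edge I L) c n (v, y) = 0"
  unfolding label_flow_def walk_edge_def by (intro sum.neutral) auto

lemma all_edges_iff:
  assumes "\<And>v y. y < 0 \<Longrightarrow> f (v, y) = (0::int)"
  shows "(\<forall>e :: word set \<times> nat. f (fst e, int (snd e)) = 0) \<longleftrightarrow> (\<forall>e. f e = 0)"
proof (intro iffI allI)
  fix e :: "word set \<times> int"
  assume *: "\<forall>e :: word set \<times> nat. f (fst e, int (snd e)) = 0"
  obtain v y where e: "e = (v, y)" by force
  show "f e = 0"
  proof (cases "y < 0")
    case False
    then show ?thesis using *[rule_format, of "(v, nat y)"] by (simp add: e)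
  qed (simp add: e assms)
qed simp

end

text \<open>The classes of the prefixes modulo \<open>D (l + 1)\<close> can be read off from any labels that identify
  the edges of the walk, and these from any labels that identify the classes modulo \<open>D l\<close>.\<close>

locale labelled_walk = free_group_rank r for r +
  fixes w :: word and l :: nat and I :: "nat \<Rightarrow> 'v" and E :: "nat \<Rightarrow> 'e"
  assumes w: "w \<in> words r"
    and I: "\<And>s t. s \<le> length w \<Longrightarrow> t \<le> length w \<Longrightarrow>
      I s = I t \<longleftrightarrow> solvable_class r l (take s w) = solvable_class r l (take t w)"
    and E: "\<And>s t. s < length w \<Longrightarrow> t < length w \<Longrightarrow>
      E s = E t \<longleftrightarrow> walk_edge I (word_ints w) s = walk_edge I (word_ints w) t"

lemma (in free_group_rank) label_flow_zero_iff_classes: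
  assumes "labelled_walk r w l I E"
  shows "(\<forall>e. label_flow E c (length w) e = 0) \<longleftrightarrow>
    (\<forall>e. label_flow (walk_edge (\<lambda>t. solvable_class r l (take t w)) (word_ints w)) c (length w) e = 0)"
proof -
  interpret labelled_walk r w l I E by fact
  show ?thesis
  proof (rule label_flow_zero_iff)
    fix s t assume st: "s < length w" "t < length w"
    show "E s = E t \<longleftrightarrow> walk_edge (\<lambda>t. solvable_class r l (take t w)) (word_ints w) s
        = walk_edge (\<lambda>t. solvable_class r l (take t w)) (word_ints w) t"
      unfolding E[OF st] by (rule walk_edge_eq_iff[where n = "length w"]) (use I st in auto)
  qed
qed

text \<open>Both flows are written as flows along the whole word, with signs that vanish outside the prefix; their
  difference is then a single flow, which has to vanish.\<close>

lemma (in free_group_rank) solvable_class_Suc_iff_label_flow: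
  assumes W: "labelled_walk r w l I E" and i: "i \<le> length w" and j: "j \<le> length w"
  shows "solvable_class r (Suc l) (take i w) = solvable_class r (Suc l) (take j w) \<longleftrightarrow>
    (\<forall>e. label_flow E (\<lambda>t. sgn (word_ints w t)) i e = label_flow E (\<lambda>t. sgn (word_ints w t)) j e)"
proof -
  interpret labelled_walk r w l I E by fact
  let ?sg = "\<lambda>t. sgn (word_ints w t)"
  let ?c = "\<lambda>t. (if t < i then ?sg t else 0) - (if t < j then ?sg t else 0)"
  let ?F = "walk_edge (\<lambda>t. solvable_class r l (take t w)) (word_ints w)"
  have diff: "label_flow E' ?sg i e - label_flow E' ?sg j e = label_flow E' ?c (length w) e"
    for E' :: "nat \<Rightarrow> 'x" and e
    unfolding label_flow_prefix[OF i] label_flow_prefix[OF j] label_flow_diff ..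
  have ij: "take i w \<in> words r" "take j w \<in> words r"
    using w by (auto simp: words_def dest: in_set_takeD)
  have "solvable_class r (Suc l) (take i w) = solvable_class r (Suc l) (take j w) \<longleftrightarrow>
    (\<forall>e. word_flow (D l) (take i w) e = word_flow (D l) (take j w) e)"
    using solvable_class_Suc_eq_iff ij by simp
  also have "\<dots> \<longleftrightarrow> (\<forall>e :: word set \<times> nat. label_flow ?F ?c (length w) (fst e, int (snd e)) = 0)"
    by (simp add: word_flow_eq_label_flow w i j flip: diff)
  also have "\<dots> \<longleftrightarrow> (\<forall>e. label_flow ?F ?c (length w) e = 0)"
    by (rule all_edges_iff) (rule label_flow_walk_edge_neg)
  also have "\<dots> \<longleftrightarrow> (\<forall>e. label_flow E ?c (length w) e = 0)"
    using label_flow_zero_iff_classes[OF W] by simp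
  finally show ?thesis by (simp flip: diff)
qed

text \<open>As \<open>u\<close> lies in \<open>D l\<close>, the walk of \<open>v\<close> that starts where that of \<open>u\<close> ends has the flow of \<open>v\<close>.  Both are
  parts of the walk of \<open>u @ v @ w'\<close>, and the condition is again that a single flow vanishes.\<close>

lemma (in free_group_rank) proportional_flows_iff_label_flow:
  assumes W: "labelled_walk r (u @ v @ w') l I E" and u: "free_reduce u \<in> D l"
  shows "(\<forall>e. word_flow (D l) u e = k * word_flow (D l) v e) \<longleftrightarrow>
    (\<forall>e. label_flow E (\<lambda>t. sgn (word_ints (u @ v @ w') t)) (length u) e =
      k * (label_flow E (\<lambda>t. sgn (word_ints (u @ v @ w') t)) (length u + length v) e
        - label_flow E (\<lambda>t. sgn (word_ints (u @ v @ w') t)) (length u) e))"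
proof -
  let ?w = "u @ v @ w'"
  interpret labelled_walk r ?w l I E by fact
  let ?m = "length u" and ?n = "length u + length v"
  let ?sg = "\<lambda>t. sgn (word_ints ?w t)"
  let ?c = "\<lambda>t. (if t < ?m then ?sg t else 0)
    - (k * (if t < ?n then ?sg t else 0) - k * (if t < ?m then ?sg t else 0))"
  let ?F = "walk_edge (\<lambda>t. solvable_class r l (take t ?w)) (word_ints ?w)"
  have m: "?m \<le> length ?w" and n: "?n \<le> length ?w" by simp_all
  have diff: "label_flow E' ?sg ?m e - k * (label_flow E' ?sg ?n e - label_flow E' ?sg ?m e)
      = label_flow E' ?c (length ?w) e" for E' :: "nat \<Rightarrow> 'x" and e
    unfolding label_flow_prefix[OF m] label_flow_prefix[OF n]
    unfolding right_diff_distrib label_flow_mult label_flow_diff ..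
  have uv: "u \<in> words r" "v \<in> words r" "u @ v \<in> words r" using w by auto
  have wfu: "word_flow (D l) u (x, i) = label_flow ?F ?sg ?m (x, int i)" for x i
    using word_flow_eq_label_flow[OF w m, of l x i] by simp
  have wfuv: "word_flow (D l) (u @ v) (x, i) = label_flow ?F ?sg ?n (x, int i)" for x i
    using word_flow_eq_label_flow[OF w n, of l x i] by simp
  have "word_flow (D l) (u @ v) e = word_flow (D l) u e + word_flow (D l) v e" for e
  proof -
    have "word_flow (D l) (u @ v) e = word_flow (D l) (free_reduce u \<otimes>\<^bsub>G\<^esub> free_reduce v) e"
      using uv by (simp add: flow_steps_free_reduce derived_series_carrier flip: free_reduce_mult)
    also have "\<dots> = word_flow (D l) (free_reduce u) e + word_flow (D l) (free_reduce v) e"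
      using uv by (intro word_flow_mult derived_series_subgroup u) simp
    finally show ?thesis using uv by (simp add: flow_steps_free_reduce derived_series_carrier)
  qed
  then have wfv: "word_flow (D l) v (x, i) = label_flow ?F ?sg ?n (x, int i) - label_flow ?F ?sg ?m (x, int i)"
    for x i using wfu[of x i] wfuv[of x i] by (simp add: algebra_simps)
  have "(\<forall>e. word_flow (D l) u e = k * word_flow (D l) v e) \<longleftrightarrow>
    (\<forall>e :: word set \<times> nat. label_flow ?F ?c (length ?w) (fst e, int (snd e)) = 0)"
    by (simp add: wfu wfv del: length_append flip: diff)
  also have "\<dots> \<longleftrightarrow> (\<forall>e. label_flow ?F ?c (length ?w) e = 0)"
    by (rule all_edges_iff) (rule label_flow_walk_edge_neg)
  also have "\<dots> \<longleftrightarrow> (\<forall>e. label_flow E ?c (length ?w) e = 0)"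
    using label_flow_zero_iff_classes[OF W] by simp
  finally show ?thesis by (simp del: length_append flip: diff)
qed

section \<open>Hash-consed trees\<close>

text \<open>\<open>rep T h p g x\<close> says that \<open>x\<close> identifies the restriction of \<open>g\<close> to the leaves below the node
  \<open>p\<close>, which has height \<open>h\<close>.  The children of \<open>p\<close> are \<open>2 p\<close> and \<open>2 p + 1\<close>; the table \<open>T\<close> maps
  pairs of identifiers to identifiers, shifted by 1 since 0 marks undefined entries.\<close>

fun rep :: "(int \<Rightarrow> int \<Rightarrow> int) \<Rightarrow> nat \<Rightarrow> int \<Rightarrow> (int \<Rightarrow> int) \<Rightarrow> int \<Rightarrow> bool" where
  "rep T 0 p g x \<longleftrightarrow> x = g p"
| "rep T (Suc h) p g x \<longleftrightarrow>
     (\<exists>a b. T a b = x + 1 \<and> T a b > 0 \<and> rep T h (2 * p) g a \<and> rep T h (2 * p + 1) g b)"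

lemma rep_mono:
  assumes "\<And>a b. T a b > 0 \<Longrightarrow> T' a b = T a b" "rep T h p g x"
  shows "rep T' h p g x"
  using assms(2)
proof (induction h arbitrary: p x)
  case (Suc h)
  then show ?case using assms(1) by (metis rep.simps(2))
qed simp

lemma rep_unique: "rep T h p g x \<Longrightarrow> rep T h p g y \<Longrightarrow> x = y"
proof (induction h arbitrary: p x y)
  case (Suc h)
  from Suc.prems obtain a b a' b' where ab:
    "T a b = x + 1" "rep T h (2 * p) g a" "rep T h (2 * p + 1) g b"
    "T a' b' = y + 1" "rep T h (2 * p) g a'" "rep T h (2 * p + 1) g b'" by auto
  have "a = a'" "b = b'" using Suc.IH ab by blast+
  then show ?case using ab by simp
qed simp

lemma leaf_below_cases:
  fixes p q :: int
  assumes "p * 2 ^ Suc h \<le> q" "q < (p + 1) * 2 ^ Suc h"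
  shows "(2 * p) * 2 ^ h \<le> q \<and> q < (2 * p + 1) * 2 ^ h \<or> (2 * p + 1) * 2 ^ h \<le> q \<and> q < (2 * p + 1 + 1) * 2 ^ h"
  using assms by (auto simp: algebra_simps)

lemma rep_cong:
  assumes "rep T h p g x" "\<And>q. p * 2 ^ h \<le> q \<Longrightarrow> q < (p + 1) * 2 ^ h \<Longrightarrow> g q = g' q"
  shows "rep T h p g' x"
  using assms
proof (induction h arbitrary: p x)
  case (Suc h)
  from Suc.prems(1) obtain a b where ab: "T a b = x + 1" "T a b > 0"
    "rep T h (2 * p) g a" "rep T h (2 * p + 1) g b" by auto
  have "rep T h (2 * p) g' a"
    using ab(3) by (rule Suc.IH) (use Suc.prems(2) in \<open>auto simp: algebra_simps\<close>)
  moreover have "rep T h (2 * p + 1) g' b"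
    using ab(4) by (rule Suc.IH) (use Suc.prems(2) in \<open>auto simp: algebra_simps\<close>)
  ultimately show ?case using ab(1,2) unfolding rep.simps by blast
qed simp

text \<open>As \<open>T\<close> is injective, the identifier determines those of the two halves, and eventually the leaves.\<close>

lemma rep_inj:
  assumes inj: "\<And>a b a' b'. T a b > 0 \<Longrightarrow> T a b = T a' b' \<Longrightarrow> a = a' \<and> b = b'"
    and "rep T h p g x" "rep T h p g' x" "p * 2 ^ h \<le> q" "q < (p + 1) * 2 ^ h"
  shows "g q = g' q"
  using assms(2-)
proof (induction h arbitrary: p x)
  case (Suc h)
  from Suc.prems obtain a b a' b' where
    "T a b > 0" "T a b = x + 1" "rep T h (2 * p) g a" "rep T h (2 * p + 1) g b"
    "T a' b' = x + 1" "rep T h (2 * p) g' a'" "rep T h (2 * p + 1) g' b'" by auto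
  moreover from this have "a = a' \<and> b = b'" by (intro inj) auto
  ultimately show ?case using Suc.IH leaf_below_cases[OF Suc.prems(3,4)] by blast
qed simp

lemma rep_of_nodes:
  assumes node: "\<And>p. 1 \<le> p \<Longrightarrow> p < 2 ^ H \<Longrightarrow> T (f (2 * p)) (f (2 * p + 1)) = f p + 1 \<and> f p \<ge> 0"
    and "1 \<le> p" "(p + 1) * 2 ^ h \<le> 2 ^ Suc H"
  shows "rep T h p f (f p)"
  using assms(2,3)
proof (induction h arbitrary: p)
  case (Suc h)
  have "p + 1 \<le> (p + 1) * 2 ^ h" using Suc.prems mult_left_mono[of 1 "2 ^ h" "p + 1"] by simp
  moreover have "(p + 1) * 2 ^ h \<le> 2 ^ H" using Suc.prems by simp
  ultimately have "p < 2 ^ H" by linarith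
  then have "T (f (2 * p)) (f (2 * p + 1)) = f p + 1" "T (f (2 * p)) (f (2 * p + 1)) > 0"
    using node[of p] Suc.prems by auto
  moreover have "rep T h (2 * p) f (f (2 * p))"
    using Suc.prems order.trans[of "(2 * p + 1) * 2 ^ h" "(2 * p + 2) * 2 ^ h"]
    by (intro Suc.IH) (auto simp: algebra_simps)
  moreover have "rep T h (2 * p + 1) f (f (2 * p + 1))"
    using Suc.prems by (intro Suc.IH) (auto simp: algebra_simps)
  ultimately show ?case unfolding rep.simps by blast
qed simp

section \<open>Updating the tree\<close>

text \<open>
  The rows of the array hold, with the length \<open>n\<close> of the word \<open>w\<close> and the number \<open>N\<close> of leaves:
    \<^item> 1 and 2: the flows of \<open>u\<close> and \<open>v\<close>, by slots of edges; row 0 takes what is not to be recorded,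
    \<^item> 3: the letter with a given code, in row 4 the letters of \<open>w\<close>, and in row 5 for each position 1 within
      \<open>u\<close>, 2 within \<open>v\<close>, and 0 otherwise,
    \<^item> 6: the identifiers of the prefixes of \<open>w\<close>, modulo \<open>D l\<close> ahead of the current position and modulo
      \<open>D (l + 1)\<close> up to it,
    \<^item> 7: the nodes of the tree, in the order in which the node \<open>q\<close> has the children \<open>2 q\<close> and \<open>2 q + 1\<close>,
    \<^item> 8: the integers \<open>q div 2\<close>, as the machine cannot divide,
    \<^item> \<open>9 + x\<close> for \<open>x = 1, \<dots>, r\<close>: the slots of the edges with the label \<open>x\<close>, by the identifier of their
      origin; 0 means that there is none,
    \<^item> from \<open>10 + r\<close> on: the table of the identifiers.

  While the levels and the exponent are computed, the variables are
    \<^item> 0: the length of the input, 2: \<open>N\<close>, 7: the length of \<open>u\<close>, 9: that of \<open>u @ v\<close>, 10: \<open>n\<close>,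
    \<^item> 11: 1 as long as \<open>u\<close> and \<open>v\<close> both lie in \<open>D l\<close>, and 0 afterwards,
    \<^item> 12: the number of identifiers, 13: the number of slots, 14: the number of levels to go,
    \<^item> 5: the position in \<open>w\<close>, 15 and 16: the identifiers of the prefixes before and after the letter there,
      17 to 20: the label, origin, sign and slot of its edge,
    \<^item> 21: a node of the tree, 22 to 24: row, column and content of its entry in the table,
    \<^item> 1: the exponent, 25: a slot with nonzero flow of \<open>v\<close> if there is one, 27: 1 in case of failure,
    \<^item> 3, 4, 6, 8, 26, 28, 29: auxiliary values.
\<close>

text \<open>The leaves may be negative.  The shift by \<open>N\<close> makes indices out of them, and keeps the table away from
  the rows below \<open>10 + r\<close> as long as their absolute values are at most \<open>N - 10 - r\<close> (\<open>leaves_ok\<close>).\<close>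

definition hash :: "nat \<Rightarrow> int \<Rightarrow> (int \<Rightarrow> int \<Rightarrow> int) \<Rightarrow> int \<Rightarrow> int \<Rightarrow> int" where
  "hash r N M a b = (if N + a \<ge> 10 + int r \<and> N + b \<ge> 0 then M (N + a) (N + b) else 0)"

definition hash_ok :: "nat \<Rightarrow> int \<Rightarrow> (int \<Rightarrow> int \<Rightarrow> int) \<Rightarrow> int \<Rightarrow> bool" where
  "hash_ok r N M n \<longleftrightarrow> (\<forall>a b. 0 \<le> hash r N M a b \<and> hash r N M a b \<le> n) \<and>
     (\<forall>a b a' b'. hash r N M a b > 0 \<longrightarrow> hash r N M a b = hash r N M a' b' \<longrightarrow> a = a' \<and> b = b')"

definition hash_extends :: "nat \<Rightarrow> int \<Rightarrow> (int \<Rightarrow> int \<Rightarrow> int) \<Rightarrow> (int \<Rightarrow> int \<Rightarrow> int) \<Rightarrow> bool" where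
  "hash_extends r N M M' \<longleftrightarrow> (\<forall>a b. hash r N M a b > 0 \<longrightarrow> hash r N M' a b = hash r N M a b)"

lemma hash_extends_refl [simp]: "hash_extends r N M M"
  by (simp add: hash_extends_def)

lemma hash_cong: "(\<And>a. a \<ge> 10 + int r \<Longrightarrow> M a = M' a) \<Longrightarrow> hash r N M = hash r N M'"
  by (intro ext) (simp add: hash_def)

lemma hash_insert:
  assumes "hash_ok r N M n" "N + a \<ge> 10 + int r" "N + b \<ge> 0" "hash r N M a b = 0" "n \<ge> 0"
  defines "M' \<equiv> M(N + a := (M (N + a))(N + b := n + 1))"
  shows "hash_ok r N M' (n + 1)" "hash_extends r N M M'" "hash r N M' a b = n + 1"
proof -
  have h: "hash r N M' a' b' = (if a' = a \<and> b' = b then n + 1 else hash r N M a' b')" for a' b'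
    using assms(2,3) by (auto simp: hash_def M'_def)
  have le: "0 \<le> hash r N M a b \<and> hash r N M a b \<le> n" for a b using assms(1) by (simp add: hash_ok_def)
  have le': "hash r N M a b < n + 1" for a b using le[of a b] by simp
  show "hash r N M' a b = n + 1" by (simp add: h)
  show "hash_extends r N M M'" using assms(4) by (auto simp: hash_extends_def h)
  show "hash_ok r N M' (n + 1)"
    using assms(1) le le' unfolding hash_ok_def h
    by (smt (verit, ccfv_threshold))
qed

definition consistent_node :: "nat \<Rightarrow> int \<Rightarrow> (int \<Rightarrow> int \<Rightarrow> int) \<Rightarrow> int \<Rightarrow> bool" where
  "consistent_node r N M q \<longleftrightarrow> hash r N M (M 7 (2 * q)) (M 7 (2 * q + 1)) = M 7 q + 1 \<and> M 7 q \<ge> 0"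

definition halves :: "int \<Rightarrow> (int \<Rightarrow> int \<Rightarrow> int) \<Rightarrow> bool" where
  "halves N M \<longleftrightarrow> (\<forall>q. 2 \<le> q \<longrightarrow> q < 2 * N \<longrightarrow> M 8 q = q div 2)"

definition leaves_ok :: "nat \<Rightarrow> int \<Rightarrow> (int \<Rightarrow> int \<Rightarrow> int) \<Rightarrow> bool" where
  "leaves_ok r N M \<longleftrightarrow> (\<forall>q \<ge> N. \<bar>M 7 q\<bar> \<le> N - 10 - int r)"

definition node_bounds :: "int \<Rightarrow> (int \<Rightarrow> int \<Rightarrow> int) \<Rightarrow> int \<Rightarrow> bool" where
  "node_bounds N M n \<longleftrightarrow> (\<forall>q. 1 \<le> q \<longrightarrow> q < N \<longrightarrow> 0 \<le> M 7 q \<and> M 7 q < n)"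

definition ancestor :: "int \<Rightarrow> int \<Rightarrow> bool" where
  "ancestor p q \<longleftrightarrow> (\<exists>h \<ge> 1. q = p div 2 ^ h)"

lemma ancestor_iff: "ancestor p q \<longleftrightarrow> q = p div 2 \<or> ancestor (p div 2) q"
proof
  assume "ancestor p q"
  then obtain h where h: "h \<ge> 1" "q = p div 2 ^ h" by (auto simp: ancestor_def)
  then obtain h' where h': "h = Suc h'" by (cases h) auto
  then have q: "q = p div 2 div 2 ^ h'" using h by (simp add: zdiv_zmult2_eq)
  show "q = p div 2 \<or> ancestor (p div 2) q"
  proof (cases h')
    case 0 then show ?thesis using q by simp
  next
    case (Suc h'')
    then show ?thesis using q unfolding ancestor_def by (metis le_add1 plus_1_eq_Suc)
  qed
next
  assume "q = p div 2 \<or> ancestor (p div 2) q"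
  then show "ancestor p q"
  proof
    assume "q = p div 2"
    then show ?thesis unfolding ancestor_def by (intro exI[of _ 1]) simp
  next
    assume "ancestor (p div 2) q"
    then obtain h where h: "h \<ge> 1" "q = p div 2 div 2 ^ h" by (auto simp: ancestor_def)
    then show ?thesis unfolding ancestor_def by (intro exI[of _ "Suc h"]) (simp add: zdiv_zmult2_eq)
  qed
qed

lemma ancestor_le: "p \<ge> 1 \<Longrightarrow> ancestor p q \<Longrightarrow> q < p"
  unfolding ancestor_def
proof (elim exE conjE)
  fix h :: nat assume "p \<ge> 1" "1 \<le> h" "q = p div 2 ^ h"
  moreover have "(2::int) ^ 1 \<le> 2 ^ h" using \<open>1 \<le> h\<close> by (intro power_increasing) auto
  ultimately show "q < p" using int_div_less_self[of p "2 ^ h"] by simp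
qed

abbreviation skip :: com where "skip \<equiv> Assign 29 (Lit 0)"

definition climb_step :: com where
  "climb_step = seq [
     Assign 21 (Cell (Lit 8) (Reg 21)),
     Assign 22 (Add (Reg 2) (Cell (Lit 7) (Mul (Lit 2) (Reg 21)))),
     Assign 23 (Add (Reg 2) (Cell (Lit 7) (Add (Mul (Lit 2) (Reg 21)) (Lit 1)))),
     Assign 24 (Cell (Reg 22) (Reg 23)),
     If (Reg 24) skip (seq [
       Assign 12 (Add (Reg 12) (Lit 1)),
       Assign 24 (Reg 12),
       Write (Reg 22) (Reg 23) (Reg 24)]),
     Write (Lit 7) (Reg 21) (Sub (Reg 24) (Lit 1))]"

definition climb :: com where
  "climb = While (Sub (Reg 21) (Lit 1)) climb_step"

text \<open>On the way from a leaf to the root, exactly the ancestors of the current node \<open>R 21\<close> may have outdated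
  identifiers; \<open>k\<close> bounds the height that remains.\<close>

definition climb_inv :: "nat \<Rightarrow> nat \<Rightarrow> int \<Rightarrow> store \<Rightarrow> nat \<Rightarrow> store \<Rightarrow> bool" where
  "climb_inv r H Y s0 k s \<longleftrightarrow> (let N = 2 ^ H; R = fst s; M = snd s in
     k \<le> H \<and> 1 \<le> R 21 \<and> R 21 < 2 ^ Suc k \<and>
     1 \<le> R 12 \<and> fst s0 12 \<le> R 12 \<and> R 12 + int k \<le> Y \<and>
     (\<forall>q. 1 \<le> q \<longrightarrow> q < N \<longrightarrow> \<not> ancestor (R 21) q \<longrightarrow> consistent_node r N M q) \<and>
     hash_ok r N M (R 12) \<and> hash_extends r N (snd s0) M \<and> node_bounds N M (R 12) \<and>
     (\<forall>x. x \<notin> {12, 21, 22, 23, 24, 29} \<longrightarrow> R x = fst s0 x) \<and>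
     (\<forall>a. a \<noteq> 7 \<longrightarrow> a < 10 + int r \<longrightarrow> M a = snd s0 a) \<and>
     (\<forall>q \<ge> N. M 7 q = snd s0 7 q))"

lemma climb_invD:
  assumes "climb_inv r H Y s0 k s"
  shows "k \<le> H" "1 \<le> fst s 21" "fst s 21 < 2 ^ Suc k" "1 \<le> fst s 12" "fst s0 12 \<le> fst s 12"
    "fst s 12 + int k \<le> Y"
    "\<And>q. 1 \<le> q \<Longrightarrow> q < 2 ^ H \<Longrightarrow> \<not> ancestor (fst s 21) q \<Longrightarrow> consistent_node r (2 ^ H) (snd s) q"
    "hash_ok r (2 ^ H) (snd s) (fst s 12)" "hash_extends r (2 ^ H) (snd s0) (snd s)"
    "node_bounds (2 ^ H) (snd s) (fst s 12)"
    "\<And>x. x \<notin> {12, 21, 22, 23, 24, 29} \<Longrightarrow> fst s x = fst s0 x"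
    "\<And>a. a \<noteq> 7 \<Longrightarrow> a < 10 + int r \<Longrightarrow> snd s a = snd s0 a"
    "\<And>q. 2 ^ H \<le> q \<Longrightarrow> snd s 7 q = snd s0 7 q"
  using assms unfolding climb_inv_def Let_def by blast+

lemma climb_step_correct:
  assumes inv: "climb_inv r H Y s0 k (R, M)" and pos: "R 21 > 1"
    and N: "fst s0 2 = 2 ^ H" "2 ^ H \<ge> 10 + int r" and half: "halves (2 ^ H) (snd s0)"
    and leaves: "leaves_ok r (2 ^ H) (snd s0)" and Y: "Y + 2 * 2 ^ H \<le> X"
  shows "k > 0 \<and> terminates inp X climb_step (R, M) 10 (climb_inv r H Y s0 (k - 1))"
proof -
  define N :: int where "N = 2 ^ H"
  note inv' = climb_invD[OF inv, unfolded fst_conv snd_conv, folded N_def]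
  have N10: "N \<ge> 10 + int r" using N by (simp add: N_def)
  have k: "k > 0" using inv' pos by (cases k) auto
  define p where "p = R 21 div 2"
  define n where "n = R 12"
  have R2: "R 2 = N" using inv' N by (simp add: N_def)
  have "R 21 < 2 ^ Suc k" using inv' by simp
  also have "(2::int) ^ Suc k \<le> 2 ^ Suc H" using inv' by (intro power_increasing) auto
  finally have R21: "2 \<le> R 21" "R 21 < 2 * N" using pos by (simp_all add: N_def)
  have p1: "1 \<le> p" "p < N" using R21 by (auto simp: p_def)
  have "R 21 < 2 * 2 ^ k" using inv' by simp
  moreover have "2 * p \<le> R 21" by (simp add: p_def)
  ultimately have pk: "p < 2 ^ Suc (k - 1)" using k by simp
  have M8: "M 8 (R 21) = p"
  proof -
    have "M 8 = snd s0 8" using inv' by simp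
    then show ?thesis using half R21 by (simp add: halves_def p_def flip: N_def)
  qed
  have hok: "hash_ok r N M n" using inv' by (simp add: n_def)
  have node: "\<bar>M 7 q\<bar> \<le> N - 10 - int r \<or> 0 \<le> M 7 q \<and> M 7 q < n" if "q \<ge> 1" for q
  proof (cases "q < N")
    case True then show ?thesis using inv' that by (simp add: node_bounds_def n_def)
  next
    case False then show ?thesis using inv' leaves by (simp add: leaves_ok_def N_def)
  qed
  have n: "1 \<le> n" "n + int k \<le> Y" using inv' by (simp_all add: n_def)
  have XN: "Y + 2 * N \<le> X" using Y by (simp add: N_def)
  define a where "a = M 7 (2 * p)"
  define b where "b = M 7 (2 * p + 1)"
  have ab: "N + a \<ge> 10 + int r" "N + b \<ge> 10 + int r" "\<bar>N + a\<bar> \<le> X" "\<bar>N + b\<bar> \<le> X"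
    using node[of "2 * p"] node[of "2 * p + 1"] p1 n N10 XN by (auto simp: a_def b_def)
  have hab: "M (N + a) (N + b) = hash r N M a b" using ab by (simp add: hash_def)
  define h where "h = hash r N M a b"
  have h0: "0 \<le> h" "h \<le> n" using hok by (auto simp: hash_ok_def h_def)
  define M1 where "M1 = (if h > 0 then M else M(N + a := (M (N + a))(N + b := n + 1)))"
  define n1 where "n1 = (if h > 0 then n else n + 1)"
  define h1 where "h1 = (if h > 0 then h else n + 1)"
  have 1: "hash_ok r N M1 n1" "hash_extends r N M M1" "hash r N M1 a b = h1"
    using hash_insert[OF hok ab(1), of b] ab h0 n hok by (auto simp: M1_def n1_def h1_def h_def)
  have h1: "1 \<le> h1" "h1 \<le> n1" "1 \<le> n1" "n \<le> n1" "n1 \<le> n + 1" using h0 n by (auto simp: h1_def n1_def)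
  define M2 where "M2 = M1(7 := (M1 7)(p := h1 - 1))"
  have M1_low: "M1 c = M c" if "c < 10 + int r" for c using that ab by (auto simp: M1_def)
  have M2_7: "M2 7 q = (if q = p then h1 - 1 else M 7 q)" for q
    using M1_low[of 7] by (auto simp: M2_def)
  have hash2: "hash r N M2 = hash r N M1" by (rule hash_cong) (auto simp: M2_def)
  have cons: "consistent_node r N M2 q" if q: "1 \<le> q" "q < N" "\<not> ancestor p q" for q
  proof (cases "q = p")
    case True
    have "M2 7 (2 * p) = a" "M2 7 (2 * p + 1) = b" "M2 7 p = h1 - 1"
      using p1 by (auto simp: M2_7 a_def b_def)
    then show ?thesis using True 1 h1 by (simp add: consistent_node_def hash2)
  next
    case False
    then have "\<not> ancestor (R 21) q" using q ancestor_iff[of "R 21" q] by (simp add: p_def)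
    then have c: "consistent_node r N M q" using inv' q by blast
    have "q \<noteq> p div 2" using q(3) ancestor_iff[of p q] by blast
    then have "2 * q \<noteq> p" "2 * q + 1 \<noteq> p" by auto
    then have "M2 7 (2 * q) = M 7 (2 * q)" "M2 7 (2 * q + 1) = M 7 (2 * q + 1)" "M2 7 q = M 7 q"
      using False by (auto simp: M2_7)
    then show ?thesis using c 1(2) by (auto simp: consistent_node_def hash2 hash_extends_def)
  qed
  have final: "climb_inv r H Y s0 (k - 1) (R', M2)"
    if "R' 21 = p" "R' 12 = n1" "\<forall>x. x \<notin> {12, 21, 22, 23, 24, 29} \<longrightarrow> R' x = R x" for R'
    unfolding climb_inv_def Let_def fst_conv snd_conv N_def[symmetric]
  proof (intro conjI)
    show "k - 1 \<le> H" using inv' by simp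
    show "1 \<le> R' 21" "R' 21 < 2 ^ Suc (k - 1)" using that p1 pk by simp_all
    show "1 \<le> R' 12" "fst s0 12 \<le> R' 12" "R' 12 + int (k - 1) \<le> Y"
      using that h1 n k inv' by (auto simp: n_def)
    show "\<forall>q. 1 \<le> q \<longrightarrow> q < N \<longrightarrow> \<not> ancestor (R' 21) q \<longrightarrow> consistent_node r N M2 q"
      using cons that by simp
    show "hash_ok r N M2 (R' 12)" using 1(1) that by (simp add: hash_ok_def hash2)
    show "hash_extends r N (snd s0) M2"
      using inv' 1(2) hash2 by (auto simp: hash_extends_def)
    show "node_bounds N M2 (R' 12)"
      using inv' h1 that by (auto simp: node_bounds_def M2_7 n_def)
    show "\<forall>x. x \<notin> {12, 21, 22, 23, 24, 29} \<longrightarrow> R' x = fst s0 x" using that inv' by simp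
    show "\<forall>a. a \<noteq> 7 \<longrightarrow> a < 10 + int r \<longrightarrow> M2 a = snd s0 a"
      using inv' M1_low by (simp add: M2_def)
    show "\<forall>q\<ge>N. M2 7 q = snd s0 7 q" using inv' p1 by (auto simp: M2_7)
  qed
  have "wp inp X climb_step (climb_inv r H Y s0 (k - 1)) (R, M)"
  proof (cases "h > 0")
    case True
    have M2: "M2 = M(7 := (M 7)(p := h - 1))" using True by (simp add: M2_def M1_def h1_def)
    then show ?thesis
      using True R2 R21 M8 p1 ab h0 n XN N10 k hab
      by (simp add: climb_step_def flip: a_def b_def h_def n_def,
          intro final[unfolded M2 One_nat_def], simp_all add: n1_def n_def)
  next
    case False
    have M2: "M2 = (M(N + a := (M (N + a))(N + b := n + 1)))(7 := (M 7)(p := n))"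
      using False M1_low[of 7] by (simp add: M2_def M1_def h1_def)
    then show ?thesis
      using False R2 R21 M8 p1 ab h0 n XN N10 k hab
      by (simp add: climb_step_def flip: a_def b_def h_def n_def,
          intro final[unfolded M2 One_nat_def], simp_all add: n1_def n_def)
  qed
  from wp_terminates[OF _ this] have "terminates inp X climb_step (R, M) 10 (climb_inv r H Y s0 (k - 1))"
    by (rule terminates_mono) (simp_all add: climb_step_def)
  then show ?thesis using k by simp
qed

lemma climb_correct:
  assumes N: "R 2 = 2 ^ H" "2 ^ H \<ge> 10 + int r" and half: "halves (2 ^ H) M"
    and leaves: "leaves_ok r (2 ^ H) M" and Y: "Y + 2 * 2 ^ H \<le> X"
    and inv: "climb_inv r H Y (R, M) H (R, M)"
  shows "terminates inp X climb (R, M) (H * 11 + 1) (climb_inv r H Y (R, M) 0)"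
proof -
  have "terminates inp X climb (R, M) (H * (10 + 1) + 1) (climb_inv r H Y (R, M) 0)"
    unfolding climb_def
  proof (rule terminates_While[of "climb_inv r H Y (R, M)"])
    fix k s assume I: "climb_inv r H Y (R, M) k s" and pos: "aval inp s (Sub (Reg 21) (Lit 1)) > 0"
    obtain R' M' where s: "s = (R', M')" by force
    show "k > 0 \<and> terminates inp X climb_step s 10 (climb_inv r H Y (R, M) (k - 1))"
      unfolding s using assms I pos by (intro climb_step_correct) (auto simp: s)
  next
    fix k s assume I: "climb_inv r H Y (R, M) k s" and neg: "aval inp s (Sub (Reg 21) (Lit 1)) \<le> 0"
    have "R 12 \<le> fst s 12" using I by (auto simp: climb_inv_def Let_def)
    then show "climb_inv r H Y (R, M) 0 s" using I neg by (auto simp: climb_inv_def Let_def)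
  qed (use inv in simp_all)
  then show ?thesis by simp
qed

section \<open>One level\<close>

definition edge_read :: com where
  "edge_read = seq [
     Assign 17 (Cell (Lit 4) (Reg 5)),
     Assign 16 (Cell (Lit 6) (Add (Reg 5) (Lit 1))),
     If (Reg 17)
       (seq [Assign 18 (Reg 15), Assign 19 (Lit 1)])
       (seq [Assign 18 (Reg 16), Assign 19 (Lit (-1)), Assign 17 (Sub (Lit 0) (Reg 17))])]"

definition edge_slot :: com where
  "edge_slot = seq [
     Assign 20 (Cell (Add (Lit 9) (Reg 17)) (Reg 18)),
     If (Reg 20) skip (seq [
       Assign 13 (Add (Reg 13) (Lit 1)),
       Assign 20 (Reg 13),
       Write (Add (Lit 9) (Reg 17)) (Reg 18) (Reg 20)])]"

definition edge_count :: com where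
  "edge_count = seq [
     Assign 28 (Mul (Reg 11) (Cell (Lit 5) (Reg 5))),
     Write (Reg 28) (Reg 20) (Add (Cell (Reg 28) (Reg 20)) (Reg 19)),
     Assign 21 (Add (Reg 2) (Reg 20)),
     Write (Lit 7) (Reg 21) (Add (Cell (Lit 7) (Reg 21)) (Reg 19))]"

definition edge_step :: com where
  "edge_step = Seq edge_read (Seq edge_slot edge_count)"

definition edge_end :: com where
  "edge_end = seq [
     Write (Lit 6) (Add (Reg 5) (Lit 1)) (Cell (Lit 7) (Lit 1)),
     Assign 15 (Reg 16),
     Assign 5 (Add (Reg 5) (Lit 1))]"

definition pass_body :: com where
  "pass_body = Seq edge_step (Seq climb edge_end)"

definition pass :: com where
  "pass = While (Sub (Reg 10) (Reg 5)) pass_body"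

definition slot :: "(int \<Rightarrow> int \<Rightarrow> int) \<Rightarrow> int \<times> int \<Rightarrow> int" where
  "slot M e = M (9 + snd e) (fst e)"

text \<open>Slots are distinct positive numbers; they number the edges that the walk has met.\<close>

definition slots_ok :: "nat \<Rightarrow> (int \<Rightarrow> int \<Rightarrow> int) \<Rightarrow> int \<Rightarrow> bool" where
  "slots_ok r M n \<longleftrightarrow>
     (\<forall>e \<in> {0..} \<times> {1..int r}. 0 \<le> slot M e \<and> slot M e \<le> n) \<and>
     (\<forall>e \<in> {0..} \<times> {1..int r}. \<forall>e' \<in> {0..} \<times> {1..int r}.
        slot M e > 0 \<longrightarrow> slot M e = slot M e' \<longrightarrow> e = e')"

lemma edge_read_correct:
  assumes "M 4 (R 5) = l" "M 6 (R 5 + 1) = b" "0 \<le> R 5" "\<bar>l\<bar> \<le> X" "\<bar>b\<bar> \<le> X" "\<bar>R 15\<bar> \<le> X" "1 \<le> X"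
  shows "terminates inp X edge_read (R, M) 6 (\<lambda>(R', M'). M' = M \<and> R' 16 = b \<and> R' 17 = \<bar>l\<bar> \<and>
    R' 18 = (if l > 0 then R 15 else b) \<and> R' 19 = (if l > 0 then 1 else -1) \<and>
    (\<forall>y. y \<notin> {16, 17, 18, 19} \<longrightarrow> R' y = R y))" (is "terminates _ _ _ _ _ ?Q")
proof -
  have "wp inp X edge_read ?Q (R, M)"
    using assms by (cases "l > 0") (simp_all add: edge_read_def)
  from wp_terminates[OF _ this] show ?thesis
    by (rule terminates_mono) (simp_all add: edge_read_def)
qed

lemma edge_slot_correct:
  assumes "R 17 = x" "R 18 = y" "0 \<le> x" "0 \<le> y" "\<bar>M (9 + x) y\<bar> \<le> X" "\<bar>R 13 + 1\<bar> \<le> X" "0 \<le> X"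
  defines "s \<equiv> if M (9 + x) y > 0 then M (9 + x) y else R 13 + 1"
  shows "terminates inp X edge_slot (R, M) 5 (\<lambda>(R', M'). M' = M(9 + x := (M (9 + x))(y := s)) \<and> R' 20 = s \<and>
    R' 13 = (if M (9 + x) y > 0 then R 13 else R 13 + 1) \<and>
    (\<forall>y. y \<notin> {13, 20, 29} \<longrightarrow> R' y = R y))" (is "terminates _ _ _ _ _ ?Q")
proof -
  have "wp inp X edge_slot ?Q (R, M)"
  proof (cases "M (9 + x) y > 0")
    case True
    then show ?thesis using assms(1-7) by (simp add: edge_slot_def s_def)
  next
    case False
    then show ?thesis using assms(1-7) by (simp add: edge_slot_def s_def)
  qed
  from wp_terminates[OF _ this] show ?thesis
    by (rule terminates_mono) (simp_all add: edge_slot_def)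
qed

lemma edge_count_correct:
  assumes "R 11 * M 5 (R 5) = rw" "R 20 = s" "R 19 = d" "R 2 = N" "0 \<le> R 5" "0 \<le> rw" "rw \<noteq> 7" "0 \<le> s" "0 \<le> N"
    "\<bar>rw\<bar> \<le> X" "\<bar>N + s\<bar> \<le> X" "\<bar>M rw s + d\<bar> \<le> X" "\<bar>M 7 (N + s) + d\<bar> \<le> X"
  defines "M2 \<equiv> M(rw := (M rw)(s := M rw s + d))"
  shows "terminates inp X edge_count (R, M) 4 (\<lambda>(R', M').
    M' = M2(7 := (M2 7)(N + s := M2 7 (N + s) + d)) \<and> R' 21 = N + s \<and>
    (\<forall>y. y \<notin> {21, 28} \<longrightarrow> R' y = R y))" (is "terminates _ _ _ _ _ ?Q")
proof -
  have "wp inp X edge_count ?Q (R, M)"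
    using assms(1-13) by (simp add: edge_count_def M2_def)
  from wp_terminates[OF _ this] show ?thesis
    by (rule terminates_mono) (simp_all add: edge_count_def)
qed

lemma edge_end_correct:
  assumes "R 5 = i" "0 \<le> i" "R 16 = b" "\<bar>M 7 1\<bar> \<le> X" "\<bar>b\<bar> \<le> X" "\<bar>i + 1\<bar> \<le> X"
    "Q (R(15 := b, 5 := i + 1), M(6 := (M 6)(i + 1 := M 7 1)))"
  shows "terminates inp X edge_end (R, M) 3 Q"
proof -
  have "wp inp X edge_end Q (R, M)"
    using assms by (simp add: edge_end_def)
  from wp_terminates[OF _ this] show ?thesis
    by (rule terminates_mono) (simp_all add: edge_end_def)
qed

locale pass_params =
  fixes r H n B :: nat and L seg :: "nat \<Rightarrow> int" and X :: int and inp :: "int list"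
  assumes L: "\<And>t. t < n \<Longrightarrow> L t \<noteq> 0 \<and> \<bar>L t\<bar> \<le> int r"
    and seg: "\<And>t. t < n \<Longrightarrow> seg t \<in> {0, 1, 2}"
    and B: "int B + 10 + int r \<le> 2 ^ H"
    and X: "1 + int B * int H + 2 * 2 ^ H \<le> X" and nX: "int n \<le> X"
begin

abbreviation "N \<equiv> (2::int) ^ H"

text \<open>\<open>T\<close> counts the letters processed at all levels.  It bounds the number of slots and the size of the flows,
  and \<open>1 + T H\<close> bounds the number of identifiers.\<close>

definition good :: "nat \<Rightarrow> store \<Rightarrow> bool" where
  "good T s \<longleftrightarrow> (let R = fst s; M = snd s in
     T \<le> B \<and> R 2 = N \<and> R 10 = int n \<and> halves N M \<and>
     (\<forall>t<n. M 4 (int t) = L t \<and> M 5 (int t) = seg t) \<and>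
     hash_ok r N M (R 12) \<and> node_bounds N M (R 12) \<and>
     (\<forall>q. 1 \<le> q \<longrightarrow> q < N \<longrightarrow> consistent_node r N M q) \<and>
     1 \<le> R 12 \<and> R 12 \<le> 1 + int T * int H \<and>
     slots_ok r M (R 13) \<and> 0 \<le> R 13 \<and> R 13 \<le> int T \<and>
     (\<forall>q \<ge> N. \<bar>M 7 q\<bar> \<le> int T) \<and>
     (\<forall>a \<in> {0, 1, 2}. \<forall>s \<ge> 0. \<bar>M a s\<bar> \<le> int T) \<and>
     (\<forall>i \<le> n. 0 \<le> M 6 (int i) \<and> M 6 (int i) < R 12))"

abbreviation sg :: "nat \<Rightarrow> int" where "sg t \<equiv> sgn (L t)"

text \<open>The leaves are not cleared between levels: the flow at the current level is added to whatever the leaves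
  contained at its beginning, which does not affect comparisons.\<close>

definition leaf_values :: "(int \<Rightarrow> int \<Rightarrow> int) \<Rightarrow> (nat \<Rightarrow> int \<times> int) \<Rightarrow> (int \<Rightarrow> int \<Rightarrow> int) \<Rightarrow> nat \<Rightarrow> int \<Rightarrow> int" where
  "leaf_values M0 E M i q = M0 7 q + label_flow (\<lambda>t. N + slot M (E t)) sg i q"

definition pass_inv :: "nat \<Rightarrow> store \<Rightarrow> nat \<Rightarrow> store \<Rightarrow> bool" where
  "pass_inv T s0 j s \<longleftrightarrow> (let R0 = fst s0; M0 = snd s0; R = fst s; M = snd s;
       I = (\<lambda>i. M0 6 (int i)); E = walk_edge I L in
     j \<le> n \<and> good (T + j) s \<and> R 5 = int j \<and> R 15 = I j \<and>
     (\<forall>i. j < i \<longrightarrow> i \<le> n \<longrightarrow> M 6 (int i) = I i) \<and>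
     (\<forall>t<j. slot M (E t) > 0) \<and>
     (\<forall>i \<le> j. rep (hash r N M) H 1 (leaf_values M0 E M i) (M 6 (int i))) \<and>
     (\<forall>q. N \<le> q \<longrightarrow> q < 2 * N \<longrightarrow> M 7 q = leaf_values M0 E M j q) \<and>
     (\<forall>a \<in> {1, 2}. \<forall>s. M a s = M0 a s
        + R0 11 * label_flow (\<lambda>t. slot M (E t)) (\<lambda>t. if seg t = a then sg t else 0) j s) \<and>
     (\<forall>x \<in> {7, 9, 11, 14}. R x = R0 x))"

text \<open>The memory after \<open>edge_step\<close>, when the edge \<open>e\<close> has the slot \<open>s\<close> and is traversed with the sign \<open>d\<close>,
  which is recorded in row \<open>rw\<close>.\<close>

definition edge_mem :: "(int \<Rightarrow> int \<Rightarrow> int) \<Rightarrow> int \<times> int \<Rightarrow> int \<Rightarrow> int \<Rightarrow> int \<Rightarrow> (int \<Rightarrow> int \<Rightarrow> int)" where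
  "edge_mem M e s rw d =
     (let M1 = M(9 + snd e := (M (9 + snd e))(fst e := s));
          M2 = M1(rw := (M1 rw)(s := M1 rw s + d))
      in M2(7 := (M2 7)(N + s := M2 7 (N + s) + d)))"

definition new_slot :: "store \<Rightarrow> int \<times> int \<Rightarrow> int" where
  "new_slot s e = (if slot (snd s) e > 0 then slot (snd s) e else fst s 13 + 1)"

lemma edge_step_correct:
  assumes I: "\<And>i. i \<le> n \<Longrightarrow> 0 \<le> I i \<and> I i \<le> X" and j: "j < n"
    and L4: "M 4 (int j) = L j" and M5: "M 5 (int j) = seg j" and M6: "M 6 (int j + 1) = I (Suc j)"
    and R: "R 5 = int j" "R 15 = I j" "R 2 = N" "R 11 \<in> {0, 1}" "0 \<le> R 13" "R 13 < int B"
    and sl: "slots_ok r M (R 13)"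
    and b: "\<And>a s. a \<in> {0, 1, 2} \<Longrightarrow> s \<ge> 0 \<Longrightarrow> \<bar>M a s\<bar> < X" "\<And>q. q \<ge> N \<Longrightarrow> \<bar>M 7 q\<bar> < X"
  defines "e \<equiv> walk_edge I L j"
  shows "terminates inp X edge_step (R, M) 15 (\<lambda>(R', M').
    M' = edge_mem M e (new_slot (R, M) e) (R 11 * seg j) (sg j) \<and>
    R' 16 = I (Suc j) \<and> R' 21 = N + new_slot (R, M) e \<and>
    R' 13 = (if slot M e > 0 then R 13 else R 13 + 1) \<and>
    (\<forall>x. x \<notin> {13, 16, 17, 18, 19, 20, 21, 28, 29} \<longrightarrow> R' x = R x))"
    (is "terminates _ _ _ _ _ ?Q")
proof -
  have "0 \<le> int B * int H" "0 \<le> N" by simp_all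
  then have bound: "int B + 10 + int r \<le> X" "2 * N + 1 \<le> X" "10 \<le> N" "int B \<le> N"
    using X B by linarith+
  have Lj: "L j \<noteq> 0" "\<bar>L j\<bar> \<le> int r" using L j by auto
  have Ij: "0 \<le> I j" "I j \<le> X" "0 \<le> I (Suc j)" "I (Suc j) \<le> X" using I[of j] I[of "Suc j"] j by auto
  have segj: "seg j = 0 \<or> seg j = 1 \<or> seg j = 2" using seg[OF j] by auto
  have e: "fst e = (if L j > 0 then I j else I (Suc j))" "snd e = \<bar>L j\<bar>" by (simp_all add: e_def walk_edge_def)
  have e_in: "e \<in> {0..} \<times> {1..int r}" using Ij Lj e by (auto simp: mem_Times_iff)
  have s: "0 \<le> slot M e" "slot M e \<le> R 13" using sl e_in by (auto simp: slots_ok_def)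
  have b012: "\<bar>M 0 s\<bar> < X" "\<bar>M 1 s\<bar> < X" "\<bar>M 2 s\<bar> < X" if "s \<ge> 0" for s using b(1) that by auto
  have e1: "1 \<le> snd e" "0 \<le> fst e" "snd e \<le> int r" "fst e \<le> X" using e_in e Ij by (auto simp: mem_Times_iff)
  define x where "x = \<bar>L j\<bar>"
  define rw where "rw = R 11 * seg j"
  have x: "1 \<le> x" "x \<le> int r" "x \<le> X" using Lj bound by (auto simp: x_def)
  have rw: "0 \<le> rw" "rw \<le> 2" using R(4) segj by (auto simp: rw_def)
  then have rw012: "rw \<in> {0, 1, 2}" by auto
  have ne: "9 + x \<noteq> rw" "rw \<noteq> 9 + x" "9 + x \<noteq> 5" "9 + x \<noteq> 7" "rw \<noteq> 7" "7 \<noteq> rw" "5 \<noteq> 9 + x" "7 \<noteq> 9 + x"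
    using x rw by auto
  have brow: "\<bar>M rw s + d\<bar> \<le> X" if "s \<ge> 0" "\<bar>d\<bar> \<le> 1" for s d
    using b(1)[OF rw012 that(1)] that(2) by linarith
  have b7: "\<bar>M 7 (N + s) + d\<bar> \<le> X" if "s \<ge> 0" "\<bar>d\<bar> \<le> 1" for s d
    using b(2)[of "N + s"] that by linarith
  have sl: "slot M e = M (9 + x) (fst e)" by (simp add: slot_def e x_def)
  have bounds: "0 \<le> fst e" "\<bar>fst e\<bar> \<le> X" "\<bar>rw\<bar> \<le> X" "\<bar>1\<bar> \<le> X" using e1 rw bound by auto
  have NX: "N + M (9 + x) (fst e) \<le> X" "N + (R 13 + 1) \<le> X"
    using s bound R(6) B unfolding sl by linarith+
  define k where "k = new_slot (R, M) e"
  have k: "k = (if M (9 + x) (fst e) > 0 then M (9 + x) (fst e) else R 13 + 1)"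
    by (simp add: k_def new_slot_def sl)
  have k1: "0 \<le> k" "N + k \<le> X" using s sl R(5) NX by (auto simp: k)
  have N0: "0 \<le> N" by simp
  have e': "snd e = x" "fst e = (if L j > 0 then I j else I (Suc j))" using e by (simp_all add: x_def)
  have d: "sg j = (if L j > 0 then 1 else - 1)" "\<bar>sg j\<bar> \<le> 1" using Lj by (auto simp: sgn_if)
  have "terminates inp X edge_step (R, M) (6 + (5 + 4)) ?Q"
    unfolding edge_step_def
  proof (rule terminates_Seq, rule terminates_mono[OF _ order.refl])
    show "terminates inp X edge_read (R, M) 6 (\<lambda>(R', M'). M' = M \<and> R' 16 = I (Suc j) \<and> R' 17 = \<bar>L j\<bar> \<and>
      R' 18 = (if L j > 0 then R 15 else I (Suc j)) \<and> R' 19 = (if L j > 0 then 1 else -1) \<and>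
      (\<forall>y. y \<notin> {16, 17, 18, 19} \<longrightarrow> R' y = R y))"
      using L4 M6 R(1,2) Ij bound x by (intro edge_read_correct) (simp_all add: x_def)
    fix s1 :: store assume A: "case s1 of (R', M') \<Rightarrow> M' = M \<and> R' 16 = I (Suc j) \<and> R' 17 = \<bar>L j\<bar> \<and>
      R' 18 = (if L j > 0 then R 15 else I (Suc j)) \<and> R' 19 = (if L j > 0 then 1 else -1) \<and>
      (\<forall>y. y \<notin> {16, 17, 18, 19} \<longrightarrow> R' y = R y)"
    then obtain R1 where s1: "s1 = (R1, M)" by (cases s1) auto
    have R1: "R1 16 = I (Suc j)" "R1 17 = x" "R1 18 = fst e" "R1 19 = sg j"
      "\<forall>y. y \<notin> {16, 17, 18, 19} \<longrightarrow> R1 y = R y"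
      using A R(2) by (simp_all add: s1 x_def e d)
    define M1 where "M1 = M(9 + x := (M (9 + x))(fst e := k))"
    show "terminates inp X (Seq edge_slot edge_count) s1 (5 + 4) ?Q"
      unfolding s1
    proof (rule terminates_Seq, rule terminates_mono[OF _ order.refl])
      show "terminates inp X edge_slot (R1, M) 5 (\<lambda>(R', M'). M' = M1 \<and> R' 20 = k \<and>
        R' 13 = (if M (9 + x) (fst e) > 0 then R1 13 else R1 13 + 1) \<and>
        (\<forall>y. y \<notin> {13, 20, 29} \<longrightarrow> R' y = R1 y))"
      proof -
        have R13: "R1 13 = R 13" using R1(5) by simp
        have b: "\<bar>M (9 + x) (fst e)\<bar> \<le> X" "\<bar>R1 13 + 1\<bar> \<le> X"
          using s R(5,6) bound NX N0 unfolding sl R13 by linarith+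
        show ?thesis
          using edge_slot_correct[of R1 x "fst e" M X inp, OF R1(2,3) _ _ b] x e1 bound unfolding M1_def k R13 by simp
      qed
      fix s2 :: store assume A2: "case s2 of (R', M') \<Rightarrow> M' = M1 \<and> R' 20 = k \<and>
        R' 13 = (if M (9 + x) (fst e) > 0 then R1 13 else R1 13 + 1) \<and>
        (\<forall>y. y \<notin> {13, 20, 29} \<longrightarrow> R' y = R1 y)"
      then obtain R2 where s2: "s2 = (R2, M1)" by (cases s2) auto
      have R2: "R2 20 = k" "R2 13 = (if slot M e > 0 then R 13 else R 13 + 1)"
        "\<forall>y. y \<notin> {13, 20, 29} \<longrightarrow> R2 y = R1 y"
        using A2 R1(5) by (simp_all add: s2 sl)
      have R2': "R2 y = R y" if "y \<notin> {13, 16, 17, 18, 19, 20, 29}" for y using R2(3) R1(5) that by simp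
      have M1: "M1 5 = M 5" "M1 rw = M rw" "M1 7 = M 7" using ne by (simp_all add: M1_def)
      have c: "terminates inp X edge_count (R2, M1) 4 (\<lambda>(R', M').
         M' = (M1(rw := (M1 rw)(k := M1 rw k + sg j)))
           (7 := ((M1(rw := (M1 rw)(k := M1 rw k + sg j))) 7)
             (N + k := (M1(rw := (M1 rw)(k := M1 rw k + sg j))) 7 (N + k) + sg j)) \<and> R' 21 = N + k \<and>
         (\<forall>y. y \<notin> {21, 28} \<longrightarrow> R' y = R2 y))"
      proof (rule edge_count_correct)
        show "R2 11 * M1 5 (R2 5) = rw" using R2'[of 11] R2'[of 5] M5 R(1) by (simp add: M1 rw_def)
        show "R2 20 = k" by (rule R2)
        show "R2 19 = sg j" using R2(3) R1(4) by simp
        show "R2 2 = N" "0 \<le> R2 5" using R2'[of 2] R2'[of 5] R by simp_all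
        show "\<bar>rw\<bar> \<le> X" "\<bar>N + k\<bar> \<le> X" using bounds k1 N0 by auto
        show "\<bar>M1 rw k + sg j\<bar> \<le> X" "\<bar>M1 7 (N + k) + sg j\<bar> \<le> X"
          unfolding M1 using brow[OF k1(1) d(2)] b7[OF k1(1) d(2)] by blast+
      qed (use rw ne k1 in simp_all)
      have mem: "edge_mem M e k rw (sg j) = (M1(rw := (M1 rw)(k := M1 rw k + sg j)))
           (7 := ((M1(rw := (M1 rw)(k := M1 rw k + sg j))) 7)
             (N + k := (M1(rw := (M1 rw)(k := M1 rw k + sg j))) 7 (N + k) + sg j))"
        by (simp only: edge_mem_def Let_def e'(1) M1_def)
      show "terminates inp X edge_count s2 4 ?Q"
        unfolding s2
      proof (rule terminates_mono[OF c order.refl])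
        fix s3 :: store assume A3: "case s3 of (R', M') \<Rightarrow>
         M' = (M1(rw := (M1 rw)(k := M1 rw k + sg j)))
           (7 := ((M1(rw := (M1 rw)(k := M1 rw k + sg j))) 7)
             (N + k := (M1(rw := (M1 rw)(k := M1 rw k + sg j))) 7 (N + k) + sg j)) \<and> R' 21 = N + k \<and>
         (\<forall>y. y \<notin> {21, 28} \<longrightarrow> R' y = R2 y)"
        obtain R3 M3 where s3: "s3 = (R3, M3)" by force
        have R3: "M3 = edge_mem M e k rw (sg j)" "R3 21 = N + k" "\<forall>y. y \<notin> {21, 28} \<longrightarrow> R3 y = R2 y"
          using A3 unfolding s3 mem by auto
        have "R3 16 = I (Suc j)" "R3 13 = (if slot M e > 0 then R 13 else R 13 + 1)"
          using R3(3) R2 R1 by simp_all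
        moreover have "R3 x = R x" if "x \<notin> {13, 16, 17, 18, 19, 20, 21, 28, 29}" for x
          using R3(3) R2'[of x] that by simp
        ultimately show "?Q s3" using R3 unfolding s3 k_def rw_def by auto
      qed
    qed
  qed
  then show ?thesis by simp
qed

lemma edge_mem_simps:
  assumes "rw \<in> {0, 1, 2}" "1 \<le> snd e"
  shows "c \<noteq> 7 \<Longrightarrow> c \<noteq> rw \<Longrightarrow> c \<noteq> 9 + snd e \<Longrightarrow> edge_mem M e s rw d c = M c"
    "edge_mem M e s rw d 7 = (M 7)(N + s := M 7 (N + s) + d)"
    "c \<in> {0, 1, 2} \<Longrightarrow> edge_mem M e s rw d c t = M c t + (if c = rw \<and> t = s then d else 0)"
    "1 \<le> snd e' \<Longrightarrow> slot (edge_mem M e s rw d) e' = (if e' = e then s else slot M e')"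
proof -
  have ne: "9 + snd e \<noteq> rw" "9 + snd e \<noteq> 7" "rw \<noteq> 7" using assms by auto
  show "c \<noteq> 7 \<Longrightarrow> c \<noteq> rw \<Longrightarrow> c \<noteq> 9 + snd e \<Longrightarrow> edge_mem M e s rw d c = M c"
    by (simp add: edge_mem_def Let_def)
  show "edge_mem M e s rw d 7 = (M 7)(N + s := M 7 (N + s) + d)"
    using ne by (simp add: edge_mem_def Let_def)
  show "edge_mem M e s rw d c t = M c t + (if c = rw \<and> t = s then d else 0)" if "c \<in> {0, 1, 2}"
  proof -
    have "c \<noteq> 7" "c \<noteq> 9 + snd e" using that assms by auto
    then show ?thesis using ne by (simp add: edge_mem_def Let_def)
  qed
  show "slot (edge_mem M e s rw d) e' = (if e' = e then s else slot M e')" if "1 \<le> snd e'"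
  proof -
    have "9 + snd e' \<noteq> rw" "9 + snd e' \<noteq> 7" using that assms by auto
    then show ?thesis using ne by (auto simp: slot_def edge_mem_def Let_def prod_eq_iff)
  qed
qed

lemma new_slot_ok:
  assumes ok: "slots_ok r M (R 13)" and R13: "R 13 \<ge> 0" and e: "e \<in> {0..} \<times> {1..int r}" and rw: "rw \<in> {0, 1, 2}"
  defines "s \<equiv> new_slot (R, M) e"
  defines "k \<equiv> (if slot M e > 0 then R 13 else R 13 + 1)"
  shows "1 \<le> s" "s \<le> k" "slots_ok r (edge_mem M e s rw d) k"
proof -
  have rng: "0 \<le> slot M e' \<and> slot M e' \<le> R 13" if "e' \<in> {0..} \<times> {1..int r}" for e'
    using ok that unfolding slots_ok_def by blast
  have inj: "e' = e''" if "e' \<in> {0..} \<times> {1..int r}" "e'' \<in> {0..} \<times> {1..int r}"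
    "slot M e' > 0" "slot M e' = slot M e''" for e' e''
    using ok that unfolding slots_ok_def by blast
  show s: "1 \<le> s" "s \<le> k" using rng[OF e] R13 by (auto simp: s_def k_def new_slot_def)
  have snd1: "1 \<le> snd e'" if "e' \<in> {0..} \<times> {1..int r}" for e' :: "int \<times> int" using that by auto
  have sl: "slot (edge_mem M e s rw d) e' = (if e' = e then s else slot M e')" if "e' \<in> {0..} \<times> {1..int r}" for e'
    using edge_mem_simps(4)[OF rw snd1[OF e] snd1[OF that]] .
  have fresh: "e' = e" if "e' \<in> {0..} \<times> {1..int r}" "slot M e' = s" for e'
    using inj[OF that(1) e] rng[OF that(1)] that s unfolding s_def new_slot_def
    by (auto split: if_splits)
  show "slots_ok r (edge_mem M e s rw d) k"
    unfolding slots_ok_def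
  proof (intro conjI ballI impI)
    fix e' :: "int \<times> int" assume "e' \<in> {0..} \<times> {1..int r}"
    then show "0 \<le> slot (edge_mem M e s rw d) e'" "slot (edge_mem M e s rw d) e' \<le> k"
      using s sl rng[of e'] by (auto simp: k_def)
  next
    fix e' e'' :: "int \<times> int"
    assume *: "e' \<in> {0..} \<times> {1..int r}" "e'' \<in> {0..} \<times> {1..int r}"
      "slot (edge_mem M e s rw d) e' > 0" "slot (edge_mem M e s rw d) e' = slot (edge_mem M e s rw d) e''"
    then show "e' = e''"
      using fresh[of e'] fresh[of e''] inj[of e' e''] by (auto simp: sl split: if_splits)
  qed
qed

lemma goodD:
  assumes "good T s"
  shows "T \<le> B" "fst s 2 = N" "fst s 10 = int n" "halves N (snd s)"
    "\<And>t. t < n \<Longrightarrow> snd s 4 (int t) = L t" "\<And>t. t < n \<Longrightarrow> snd s 5 (int t) = seg t"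
    "hash_ok r N (snd s) (fst s 12)" "node_bounds N (snd s) (fst s 12)"
    "\<And>q. 1 \<le> q \<Longrightarrow> q < N \<Longrightarrow> consistent_node r N (snd s) q"
    "1 \<le> fst s 12" "fst s 12 \<le> 1 + int T * int H"
    "slots_ok r (snd s) (fst s 13)" "0 \<le> fst s 13" "fst s 13 \<le> int T"
    "\<And>q. N \<le> q \<Longrightarrow> \<bar>snd s 7 q\<bar> \<le> int T"
    "\<And>a t. a \<in> {0, 1, 2} \<Longrightarrow> 0 \<le> t \<Longrightarrow> \<bar>snd s a t\<bar> \<le> int T"
    "\<And>i. i \<le> n \<Longrightarrow> 0 \<le> snd s 6 (int i) \<and> snd s 6 (int i) < fst s 12"
  using assms unfolding good_def Let_def by blast+

lemma pass_invD:
  assumes "pass_inv T s0 j s"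
  defines "I \<equiv> \<lambda>i. snd s0 6 (int i)"
  defines "E \<equiv> walk_edge I L"
  shows "j \<le> n" "good (T + j) s" "fst s 5 = int j" "fst s 15 = I j"
    "\<And>i. j < i \<Longrightarrow> i \<le> n \<Longrightarrow> snd s 6 (int i) = I i"
    "\<And>t. t < j \<Longrightarrow> slot (snd s) (E t) > 0"
    "\<And>i. i \<le> j \<Longrightarrow> rep (hash r N (snd s)) H 1 (leaf_values (snd s0) E (snd s) i) (snd s 6 (int i))"
    "\<And>q. N \<le> q \<Longrightarrow> q < 2 * N \<Longrightarrow> snd s 7 q = leaf_values (snd s0) E (snd s) j q"
    "\<And>a t. a \<in> {1, 2} \<Longrightarrow> snd s a t = snd s0 a t
        + fst s0 11 * label_flow (\<lambda>t. slot (snd s) (E t)) (\<lambda>t. if seg t = a then sg t else 0) j t"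
    "\<And>x. x \<in> {7, 9, 11, 14} \<Longrightarrow> fst s x = fst s0 x"
  using assms(1) unfolding pass_inv_def Let_def E_def I_def by blast+

text \<open>The step \<open>edge_step\<close> changes a single leaf, so that only its ancestors become inconsistent, and \<open>climb\<close>
  repairs them.  Earlier identifiers retain their meaning because the table is only extended, and the slots of
  edges met before do not change.\<close>

lemma pass_body_correct:
  assumes inv: "pass_inv T s0 j (R, M)" and j: "j < n" and T: "T + n \<le> B" and F: "fst s0 11 \<in> {0, 1}"
    and Ibd: "\<And>i. i \<le> n \<Longrightarrow> 0 \<le> snd s0 6 (int i) \<and> snd s0 6 (int i) \<le> X"
  shows "terminates inp X pass_body (R, M) (11 * H + 20) (pass_inv T s0 (Suc j))"
proof -
  define I where "I = (\<lambda>i. snd s0 6 (int i))"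
  define E where "E = walk_edge I L"
  note P = pass_invD[OF inv, unfolded fst_conv snd_conv, folded I_def, folded E_def]
  note G = goodD[OF P(2), unfolded fst_conv snd_conv]
  define e where "e = E j"
  have Lr: "1 \<le> \<bar>L t\<bar> \<and> \<bar>L t\<bar> \<le> int r" if "t < n" for t using L[OF that] by auto
  have E_in: "E t \<in> {0..} \<times> {1..int r}" if "t < n" for t
    using Ibd[of t] Ibd[of "Suc t"] Lr[OF that] that by (auto simp: E_def walk_edge_def I_def mem_Times_iff)
  have E1: "1 \<le> snd (E t)" "snd (E t) \<le> int r" if "t < n" for t using E_in[OF that] by auto
  define s where "s = new_slot (R, M) e"
  define rw where "rw = R 11 * seg j"
  have F': "R 11 = fst s0 11" using P(10)[of 11] by simp
  have rw: "rw \<in> {0, 1, 2}" using F seg[OF j] by (auto simp: rw_def F')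
  define k where "k = (if slot M e > 0 then R 13 else R 13 + 1)"
  define M1 where "M1 = edge_mem M e s rw (sg j)"
  have Tj: "T + j < B" using T j by simp
  define Y where "Y = 1 + int (T + Suc j) * int H"
  have YX: "Y + 2 * N \<le> X"
  proof -
    have "int (T + Suc j) * int H \<le> int B * int H" using Tj by (intro mult_right_mono) auto
    then show ?thesis using X by (simp add: Y_def)
  qed
  have "0 \<le> int B * int H" "1 \<le> N" by simp_all
  then have XB: "int B < X" "N \<le> X" using X B by linarith+
  note S = new_slot_ok(1,2)[of M R e rw, OF G(12,13) E_in[OF j, folded e_def] rw, folded s_def k_def]
  have S3: "slots_ok r M1 k" unfolding M1_def s_def k_def
    by (rule new_slot_ok(3)[of M R e rw, OF G(12,13) E_in[OF j, folded e_def] rw])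
  note M1 = edge_mem_simps[OF rw E1(1)[OF j, folded e_def], where M = M and s = s and d = "sg j", folded M1_def]
  have k: "0 \<le> k" "k \<le> int (T + Suc j)" using G(13,14) by (auto simp: k_def)
  have sN: "1 \<le> s" "s < N" using S(1,2) k Tj B by auto
  have step: "terminates inp X edge_step (R, M) 15 (\<lambda>(R', M').
    M' = M1 \<and> R' 16 = I (Suc j) \<and> R' 21 = N + s \<and> R' 13 = k \<and>
    (\<forall>x. x \<notin> {13, 16, 17, 18, 19, 20, 21, 28, 29} \<longrightarrow> R' x = R x))"
    unfolding M1_def s_def e_def rw_def k_def E_def
  proof (rule edge_step_correct)
    show "M 6 (int j + 1) = I (Suc j)" using P(5)[of "Suc j"] j by (simp add: add.commute I_def)
    show "R 13 < int B" using G(14) Tj by simp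
    show "\<bar>M a t\<bar> < X" if "a \<in> {0, 1, 2}" "0 \<le> t" for a t
      using G(16)[OF that] Tj XB by linarith
    show "\<bar>M 7 q\<bar> < X" if "N \<le> q" for q using G(15)[OF that] Tj XB by linarith
    show "0 \<le> I i \<and> I i \<le> X" if "i \<le> n" for i using Ibd[OF that] by (simp add: I_def)
  qed (use j G P F F' in \<open>auto simp: I_def\<close>)
  have hash1: "hash r N M1 = hash r N M"
  proof (rule hash_cong)
    fix c assume "10 + int r \<le> c"
    then show "M1 c = M c" using rw E1(2)[OF j] by (intro M1(1)) (auto simp: e_def)
  qed
  have M1_7: "M1 7 q = (if q = N + s then M 7 q + sg j else M 7 q)" for q by (simp add: M1(2))
  have M1_8: "M1 8 = M 8" and M1_4: "M1 4 = M 4" and M1_5: "M1 5 = M 5" and M1_6: "M1 6 = M 6"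
    using rw E1(1)[OF j] by (intro M1(1); auto simp: e_def)+
  have sg1: "\<bar>sg t\<bar> \<le> 1" for t by (simp add: sgn_if)
  have sg_add: "\<bar>y + sg t\<bar> \<le> \<bar>y\<bar> + 1" for y t
    using abs_triangle_ineq[of y "sg t"] sg1[of t] by linarith
  have leaf1: "\<bar>M1 7 q\<bar> \<le> int (T + Suc j)" if "N \<le> q" for q
    using G(15)[OF that] sg_add[of "M 7 q" j] by (auto simp: M1_7)
  have climb: "terminates inp X climb (R1, M1) (H * 11 + 1) (climb_inv r H Y (R1, M1) 0)"
    if R1: "R1 21 = N + s" "\<forall>x. x \<notin> {13, 16, 17, 18, 19, 20, 21, 28, 29} \<longrightarrow> R1 x = R x" for R1
  proof (rule climb_correct)
    show "R1 2 = N" using R1 G(2) by simp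
    show "10 + int r \<le> N" using B by simp
    show "halves N M1" using G(4) by (simp add: halves_def M1_8)
    show "leaves_ok r N M1" unfolding leaves_ok_def
    proof (intro allI impI)
      fix q assume "N \<le> q"
      then show "\<bar>M1 7 q\<bar> \<le> N - 10 - int r" using leaf1[of q] Tj B by linarith
    qed
    show "Y + 2 * N \<le> X" by (rule YX)
    have R12: "R1 12 = R 12" using R1 by simp
    have "int (T + j) * int H + int H = int (T + Suc j) * int H" by (simp add: algebra_simps)
    then have Y: "R 12 + int H \<le> Y" using G(11) unfolding Y_def by linarith
    show "climb_inv r H Y (R1, M1) H (R1, M1)"
      unfolding climb_inv_def Let_def fst_conv snd_conv
    proof (intro conjI allI impI)
      show "1 \<le> R1 21" "R1 21 < 2 ^ Suc H" using R1 sN by simp_all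
      show "1 \<le> R1 12" "R1 12 + int H \<le> Y" using Y G(10) R12 by simp_all
      show "hash_ok r N M1 (R1 12)" using G(7) R12 by (simp add: hash_ok_def hash1)
      show "node_bounds N M1 (R1 12)"
        using G(8) sN by (auto simp: node_bounds_def R12 M1_7)
      fix q :: int assume q: "1 \<le> q" "q < N" "\<not> ancestor (R1 21) q"
      have "2 * q \<noteq> N + s" "2 * q + 1 \<noteq> N + s"
        using q(3) ancestor_iff[of "N + s" q] R1 by auto
      moreover have "q \<noteq> N + s" using q sN by simp
      ultimately show "consistent_node r N M1 q"
        using G(9)[OF q(1,2)] by (simp add: consistent_node_def hash1 M1_7)
    qed auto
  qed
  have final: "pass_inv T s0 (Suc j) (R2(15 := I (Suc j), 5 := int j + 1), M2(6 := (M2 6)(int j + 1 := M2 7 1)))"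
    if R1: "R1 13 = k" "\<forall>x. x \<notin> {13, 16, 17, 18, 19, 20, 21, 28, 29} \<longrightarrow> R1 x = R x"
    and C: "climb_inv r H Y (R1, M1) 0 (R2, M2)" for R1 R2 M2
  proof -
    note C = climb_invD[OF C, unfolded fst_conv snd_conv]
    define M3 where "M3 = M2(6 := (M2 6)(int j + 1 := M2 7 1))"
    define R3 where "R3 = R2(15 := I (Suc j), 5 := int j + 1)"
    have R2: "R2 x = R x" if "x \<notin> {12, 13, 16, 17, 18, 19, 20, 21, 22, 23, 24, 28, 29}" for x
      using C(11)[of x] R1(2) that by auto
    have R13: "R2 13 = k" using C(11)[of 13] R1 by simp
    have M2: "M2 c = M1 c" if "c \<noteq> 7" "c < 10 + int r" for c using C(12) that by blast
    have M3: "M3 c = M1 c" if "c \<noteq> 7" "c \<noteq> 6" "c < 10 + int r" for c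
      using M2[OF that(1,3)] that by (simp add: M3_def)
    have M3_7: "M3 7 = M2 7" by (simp add: M3_def)
    have M2_6: "M2 6 = M 6" using M2[of 6] M1_6 by simp
    have M3_6: "M3 6 i = (if i = int j + 1 then M2 7 1 else M 6 i)" for i by (simp add: M3_def M2_6)
    have hash3: "hash r N M3 = hash r N M2" by (rule hash_cong) (auto simp: M3_def)
    have ext: "hash_extends r N M M3" using C(9) by (simp add: hash_extends_def hash1 hash3)
    have cons: "consistent_node r N M2 q" if "1 \<le> q" "q < N" for q
    proof (rule C(7)[OF that])
      have "R2 21 = 1" using C(2,3) by simp
      then show "\<not> ancestor (R2 21) q" using ancestor_le[of 1 q] that by auto
    qed
    have slot3: "slot M3 (E t) = (if E t = e then s else slot M (E t))" if "t < n" for t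
    proof -
      have "slot M3 (E t) = slot M1 (E t)" using E1[OF that] M3[of "9 + snd (E t)"] by (simp add: slot_def)
      then show ?thesis using M1(4)[OF E1(1)[OF that]] by simp
    qed
    have slot_eq: "slot M3 (E t) = slot M (E t)" if "t < j" for t
      using slot3[of t] P(6)[OF that] that j by (auto simp: s_def new_slot_def)
    have slot_j: "slot M3 (E j) = s" using slot3[OF j] by (simp add: e_def)
    have leaf_eq: "leaf_values (snd s0) E M3 i q = leaf_values (snd s0) E M i q" if "i \<le> j" for i q
      unfolding leaf_values_def using slot_eq that by (intro arg_cong2[where f = plus] label_flow_cong) auto
    have leaf_Suc: "leaf_values (snd s0) E M3 (Suc j) q = leaf_values (snd s0) E M j q + (if q = N + s then sg j else 0)" for q
      using leaf_eq[of j q] by (auto simp: leaf_values_def label_flow_Suc slot_j)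
    have leaves: "M3 7 q = leaf_values (snd s0) E M3 (Suc j) q" if "N \<le> q" "q < 2 * N" for q
      using C(13)[OF that(1)] P(8)[OF that] by (auto simp: M3_7 leaf_Suc M1_7)
    have rep_new: "rep (hash r N M3) H 1 (leaf_values (snd s0) E M3 (Suc j)) (M2 7 1)"
    proof (rule rep_cong)
      show "rep (hash r N M3) H 1 (M3 7) (M2 7 1)"
        unfolding M3_7[symmetric]
      proof (rule rep_of_nodes[where H = H])
        fix p :: int assume "1 \<le> p" "p < 2 ^ H"
        then show "hash r N M3 (M3 7 (2 * p)) (M3 7 (2 * p + 1)) = M3 7 p + 1 \<and> 0 \<le> M3 7 p"
          using cons[of p] by (simp add: consistent_node_def hash3 M3_7)
      qed simp_all
    qed (use leaves in simp)
    have Suc: "int (Suc j) = int j + 1" by simp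
    have good: "good (T + Suc j) (R3, M3)"
      unfolding good_def Let_def fst_conv snd_conv
    proof (intro conjI allI impI ballI)
      show "T + Suc j \<le> B" using Tj by simp
      show "R3 2 = N" "R3 10 = int n" using R2[of 2] R2[of 10] G(2,3) by (simp_all add: R3_def)
      show "halves N M3" using G(4) M3[of 8] by (simp add: halves_def M1_8)
      show "M3 4 (int t) = L t" "M3 5 (int t) = seg t" if "t < n" for t
        using G(5,6)[OF that] M3[of 4] M3[of 5] by (simp_all add: M1_4 M1_5)
      show "hash_ok r N M3 (R3 12)" using C(8) by (simp add: hash_ok_def hash3 R3_def)
      show "node_bounds N M3 (R3 12)" using C(10) by (simp add: node_bounds_def M3_7 R3_def)
      show "consistent_node r N M3 q" if "1 \<le> q" "q < N" for q
        using cons[OF that] by (simp add: consistent_node_def hash3 M3_7)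
      show "1 \<le> R3 12" using C(4) by (simp add: R3_def)
      show "slots_ok r M3 (R3 13)"
      proof -
        have "slot M3 e' = slot M1 e'" if "e' \<in> {0..} \<times> {1..int r}" for e'
          using that M3[of "9 + snd e'"] by (auto simp: slot_def)
        then show ?thesis using S3 R13 by (simp add: slots_ok_def R3_def)
      qed
      show "0 \<le> R3 13" "R3 13 \<le> int (T + Suc j)" using k R13 by (simp_all add: R3_def)
      show "\<bar>M3 7 q\<bar> \<le> int (T + Suc j)" if "N \<le> q" for q
        using leaf1[OF that] C(13)[OF that] by (simp add: M3_7)
      show "\<bar>M3 a t\<bar> \<le> int (T + Suc j)" if "a \<in> {0, 1, 2}" "0 \<le> t" for a t
      proof -
        have "M3 a = M1 a" using that by (intro M3) auto
        then show ?thesis using G(16)[OF that] sg_add[of "M a t" j] M1(3)[OF that(1), of t] by auto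
      qed
      show "R3 12 \<le> 1 + int (T + Suc j) * int H" using C(6) by (simp add: R3_def Y_def)
      have R12: "R1 12 = R 12" using R1(2) by simp
      have "1 < N" using B by linarith
      then have new: "0 \<le> M2 7 1" "M2 7 1 < R2 12" using C(10) by (simp_all add: node_bounds_def)
      show "0 \<le> M3 6 (int i)" "M3 6 (int i) < R3 12" if "i \<le> n" for i
        using G(17)[OF that] C(5) new by (auto simp: M3_6 R3_def R12)
    qed
    have "pass_inv T s0 (Suc j) (R3, M3)"
      unfolding pass_inv_def Let_def fst_conv snd_conv
      unfolding I_def[symmetric] unfolding E_def[symmetric]
    proof (intro conjI allI impI ballI)
      show "Suc j \<le> n" using j by simp
      show "good (T + Suc j) (R3, M3)" by (rule good)
      show "R3 5 = int (Suc j)" "R3 15 = snd s0 6 (int (Suc j))" by (simp_all add: R3_def I_def)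
      show "M3 6 (int i) = snd s0 6 (int i)" if "Suc j < i" "i \<le> n" for i
        using P(5)[of i] that by (auto simp: M3_6 I_def)
      show "slot M3 (E t) > 0" if "t < Suc j" for t
        using that P(6)[of t] slot_eq[of t] slot_j sN by (cases "t = j") auto
      show "rep (hash r N M3) H 1 (leaf_values (snd s0) E M3 i) (M3 6 (int i))" if "i \<le> Suc j" for i
      proof (cases "i = Suc j")
        case True
        then show ?thesis using rep_new by (simp add: M3_6)
      next
        case False
        then have i: "i \<le> j" using that by simp
        have "rep (hash r N M3) H 1 (leaf_values (snd s0) E M i) (M 6 (int i))"
          using ext unfolding hash_extends_def by (intro rep_mono[OF _ P(7)[OF i]]) blast
        moreover have "leaf_values (snd s0) E M3 i = leaf_values (snd s0) E M i"
          using leaf_eq[OF i] by (simp add: fun_eq_iff)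
        moreover have "M3 6 (int i) = M 6 (int i)" using i by (simp add: M3_6)
        ultimately show ?thesis by simp
      qed
      show "M3 7 q = leaf_values (snd s0) E M3 (Suc j) q" if "N \<le> q" "q < 2 * N" for q
        using leaves that by blast
      show "M3 a t = snd s0 a t + fst s0 11 * label_flow (\<lambda>t. slot M3 (E t)) (\<lambda>t. if seg t = a then sg t else 0) (Suc j) t"
        if "a \<in> {1, 2}" for a t
      proof -
        have "M3 a = M1 a" using that by (intro M3) auto
        then have "M3 a t = M a t + (if a = rw \<and> t = s then sg j else 0)" using M1(3)[of a t] that by auto
        also have "M a t = snd s0 a t + fst s0 11 * label_flow (\<lambda>t. slot M (E t)) (\<lambda>t. if seg t = a then sg t else 0) j t"
          using P(9)[OF that] .
        also have "label_flow (\<lambda>t. slot M (E t)) (\<lambda>t. if seg t = a then sg t else 0) j t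
          = label_flow (\<lambda>t. slot M3 (E t)) (\<lambda>t. if seg t = a then sg t else 0) j t"
          using slot_eq by (intro label_flow_cong) auto
        also have "(if a = rw \<and> t = s then sg j else 0)
          = fst s0 11 * (if slot M3 (E j) = t then (if seg j = a then sg j else 0) else 0)"
          using F that by (auto simp: rw_def F' slot_j)
        finally show ?thesis by (simp add: label_flow_Suc algebra_simps)
      qed
      show "R3 x = fst s0 x" if "x \<in> {7, 9, 11, 14}" for x
        using P(10)[OF that] R2[of x] that by (auto simp: R3_def)
    qed
    then show ?thesis by (simp add: R3_def M3_def)
  qed
  have "terminates inp X (Seq edge_step (Seq climb edge_end)) (R, M) (15 + ((H * 11 + 1) + 3)) (pass_inv T s0 (Suc j))"
  proof (rule terminates_Seq, rule terminates_mono[OF step order.refl])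
    fix s1 :: store
    assume *: "case s1 of (R', M') \<Rightarrow> M' = M1 \<and> R' 16 = I (Suc j) \<and> R' 21 = N + s \<and> R' 13 = k \<and>
      (\<forall>x. x \<notin> {13, 16, 17, 18, 19, 20, 21, 28, 29} \<longrightarrow> R' x = R x)"
    then obtain R1 where s1: "s1 = (R1, M1)" by (cases s1) auto
    have R1: "R1 16 = I (Suc j)" "R1 21 = N + s" "R1 13 = k"
      "\<forall>x. x \<notin> {13, 16, 17, 18, 19, 20, 21, 28, 29} \<longrightarrow> R1 x = R x"
      using * unfolding s1 by auto
    show "terminates inp X (Seq climb edge_end) s1 ((H * 11 + 1) + 3) (pass_inv T s0 (Suc j))"
      unfolding s1
    proof (rule terminates_Seq, rule terminates_mono[OF climb[OF R1(2,4)] order.refl])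
      fix s2 :: store
      assume "climb_inv r H Y (R1, M1) 0 s2"
      moreover obtain R2 M2 where s2: "s2 = (R2, M2)" by force
      ultimately have C': "climb_inv r H Y (R1, M1) 0 (R2, M2)" by simp
      note C = climb_invD[OF C', unfolded fst_conv snd_conv]
      have R2: "R2 16 = I (Suc j)" "R2 5 = int j" using C(11)[of 16] C(11)[of 5] R1 P(3) by auto
      have "0 \<le> M2 7 1 \<and> M2 7 1 < R2 12 \<or> \<bar>M2 7 1\<bar> \<le> int (T + Suc j)"
      proof (cases "1 < N")
        case True
        then show ?thesis using C(10) by (simp add: node_bounds_def)
      next
        case False
        then have "N \<le> 1" by simp
        then show ?thesis using C(13)[of 1] leaf1[of 1] by simp
      qed
      moreover have "0 \<le> N" by simp
      moreover have "int (T + Suc j) \<le> X" using Tj XB by linarith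
      ultimately have le: "\<bar>M2 7 1\<bar> \<le> X" using C(6) YX by linarith
      have Ij: "\<bar>I (Suc j)\<bar> \<le> X" "\<bar>int j + 1\<bar> \<le> X"
        using Ibd[of "Suc j"] j nX by (auto simp: I_def)
      show "terminates inp X edge_end s2 3 (pass_inv T s0 (Suc j))"
        unfolding s2 by (rule edge_end_correct[of R2 "int j" "I (Suc j)" M2 X "pass_inv T s0 (Suc j)", OF R2(2) _ R2(1) le Ij final[OF R1(3,4) C']]) simp
    qed
  qed
  then show ?thesis unfolding pass_body_def by (rule terminates_mono) simp_all
qed

end

section \<open>All levels\<close>

definition level_start :: com where
  "level_start = seq [
     Assign 15 (Cell (Lit 6) (Lit 0)),
     Write (Lit 6) (Lit 0) (Cell (Lit 7) (Lit 1)),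
     Assign 5 (Lit 0)]"

text \<open>The sum of squares is positive unless both differences vanish, that is, unless \<open>u\<close> and \<open>v\<close> are both trivial at
  the new level.\<close>

definition level_end :: com where
  "level_end = seq [
     Assign 26 (Sub (Cell (Lit 6) (Lit 0)) (Cell (Lit 6) (Reg 7))),
     Assign 28 (Sub (Cell (Lit 6) (Reg 7)) (Cell (Lit 6) (Reg 9))),
     If (Add (Mul (Reg 26) (Reg 26)) (Mul (Reg 28) (Reg 28))) (Assign 11 (Lit 0)) skip,
     Assign 14 (Sub (Reg 14) (Lit 1))]"

definition level :: com where
  "level = Seq level_start (Seq pass level_end)"

definition levels :: com where
  "levels = While (Reg 14) level"

lemma level_start_correct:
  assumes "\<bar>M 6 0\<bar> \<le> X" "\<bar>M 7 1\<bar> \<le> X" "0 \<le> X" "Q (R(15 := M 6 0, 5 := 0), M(6 := (M 6)(0 := M 7 1)))"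
  shows "terminates inp X level_start (R, M) 3 Q"
proof -
  have "wp inp X level_start Q (R, M)"
    using assms by (simp add: level_start_def)
  from wp_terminates[OF _ this] show ?thesis
    by (rule terminates_mono) (simp_all add: level_start_def)
qed

lemma square_sum_pos_iff: "0 < y * y + z * z \<longleftrightarrow> y \<noteq> 0 \<or> z \<noteq> (0::int)"
  using sum_squares_gt_zero_iff[of y z] by simp

lemma level_end_correct:
  assumes "0 \<le> R 7" "0 \<le> R 9" "\<bar>M 6 0 - M 6 (R 7)\<bar> \<le> X" "\<bar>M 6 (R 7) - M 6 (R 9)\<bar> \<le> X" "\<bar>R 14 - 1\<bar> \<le> X" "0 \<le> X"
    "\<And>R'. R' 11 = (if M 6 0 = M 6 (R 7) \<and> M 6 (R 7) = M 6 (R 9) then R 11 else 0) \<Longrightarrow> R' 14 = R 14 - 1 \<Longrightarrow>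
       (\<forall>y. y \<notin> {11, 14, 26, 28, 29} \<longrightarrow> R' y = R y) \<Longrightarrow> Q (R', M)"
  shows "terminates inp X level_end (R, M) 5 Q"
proof -
  have "wp inp X level_end Q (R, M)"
  proof (cases "M 6 0 = M 6 (R 7) \<and> M 6 (R 7) = M 6 (R 9)")
    case True
    have "Q (R(26 := 0, 28 := 0, 29 := 0, 14 := R 14 - 1), M)"
      by (rule assms(7)) (use True in auto)
    then show ?thesis using True assms(1-6) by (simp add: level_end_def)
  next
    case False
    let ?y = "M 6 0 - M 6 (R 7)" and ?z = "M 6 (R 7) - M 6 (R 9)"
    have pos: "0 < ?y * ?y + ?z * ?z" using False unfolding square_sum_pos_iff by auto
    have "Q (R(26 := ?y, 28 := ?z, 11 := 0, 14 := R 14 - 1), M)"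
      by (rule assms(7)) (use False in auto)
    then show ?thesis using pos assms(1-6) by (simp add: level_end_def)
  qed
  from wp_terminates[OF _ this] show ?thesis
    by (rule terminates_mono) (simp_all add: level_end_def)
qed

context pass_params
begin

lemma good_bounds:
  assumes "good T s"
  shows "fst s 12 \<le> 1 + int B * int H" "fst s 12 \<le> X" "int B \<le> X" "1 \<le> X"
    "\<And>i. i \<le> n \<Longrightarrow> 0 \<le> snd s 6 (int i) \<and> snd s 6 (int i) \<le> X"
    "0 \<le> snd s 7 1" "snd s 7 1 < fst s 12" "1 < N"
proof -
  note G = goodD[OF assms]
  have "int T * int H \<le> int B * int H" using G(1) by (intro mult_right_mono) auto
  then show 1: "fst s 12 \<le> 1 + int B * int H" using G(11) by linarith
  have "0 \<le> N" "0 \<le> int B * int H" by simp_all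
  then show "fst s 12 \<le> X" "int B \<le> X" "1 \<le> X" using 1 X B by linarith+
  then show "0 \<le> snd s 6 (int i) \<and> snd s 6 (int i) \<le> X" if "i \<le> n" for i using G(17)[OF that] by linarith
  show "1 < N" using B by linarith
  then show "0 \<le> snd s 7 1" "snd s 7 1 < fst s 12" using G(8) by (auto simp: node_bounds_def)
qed

lemma good_frame:
  assumes "good T (R, M)" "\<And>x. x \<in> {2, 10, 12, 13} \<Longrightarrow> R' x = R x"
  shows "good T (R', M)"
  using assms by (simp add: good_def)

lemma pass_start:
  assumes g: "good T (R, M)"
  shows "pass_inv T (R, M) 0 (R(15 := M 6 0, 5 := 0), M(6 := (M 6)(0 := M 7 1)))"
proof -
  define M' where "M' = M(6 := (M 6)(0 := M 7 1))"
  note G = goodD[OF g, unfolded fst_conv snd_conv]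
  note b = good_bounds[OF g, unfolded fst_conv snd_conv]
  have M': "M' a = M a" if "a \<noteq> 6" for a using that by (simp add: M'_def)
  have M'6: "M' 6 i = (if i = 0 then M 7 1 else M 6 i)" for i by (simp add: M'_def)
  have hash: "hash r N M' = hash r N M" by (rule hash_cong) (auto simp: M'_def)
  have slot: "slot M' e = slot M e" if "e \<in> {0..} \<times> {1..int r}" for e
    using that M'[of "9 + snd e"] by (auto simp: slot_def)
  have good: "good T (R(15 := M 6 0, 5 := 0), M')"
    unfolding good_def Let_def fst_conv snd_conv
  proof (intro conjI allI impI ballI)
    fix q assume "1 \<le> q" "q < N"
    then show "consistent_node r N M' q" using G(9)[of q] by (simp add: consistent_node_def hash M')
  next
    fix i assume "i \<le> n"
    then show "0 \<le> M' 6 (int i)" "M' 6 (int i) < (R(15 := M 6 0, 5 := 0)) 12"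
      using G(17)[of i] b(6,7) by (auto simp: M'6)
  next
    show "slots_ok r M' ((R(15 := M 6 0, 5 := 0)) 13)" using G(12) by (simp add: slots_ok_def slot)
  next
    fix a t :: int assume "a \<in> {0, 1, 2}" "0 \<le> t"
    then show "\<bar>M' a t\<bar> \<le> int T" using G(16)[of a t] M'[of a] by auto
  qed (use G in \<open>simp_all add: halves_def M' hash_ok_def hash node_bounds_def\<close>)
  have "rep (hash r N M) H 1 (M 7) (M 7 1)"
  proof (rule rep_of_nodes[where H = H])
    fix p :: int assume "1 \<le> p" "p < 2 ^ H"
    then show "hash r N M (M 7 (2 * p)) (M 7 (2 * p + 1)) = M 7 p + 1 \<and> 0 \<le> M 7 p"
      using G(9)[of p] by (simp add: consistent_node_def)
  qed simp_all
  moreover have "leaf_values M E M' 0 = M 7" for E by (simp add: leaf_values_def fun_eq_iff)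
  ultimately have rep: "rep (hash r N M') H 1 (leaf_values M E M' 0) (M' 6 0)" for E
    by (simp add: hash M'6)
  show ?thesis
    unfolding M'_def[symmetric] pass_inv_def Let_def fst_conv snd_conv
    using good rep by (auto simp: M'6 M' leaf_values_def)
qed

lemma pass_correct:
  assumes inv: "pass_inv T s0 0 s" and T: "T + n \<le> B" and F: "fst s0 11 \<in> {0, 1}"
    and Ibd: "\<And>i. i \<le> n \<Longrightarrow> 0 \<le> snd s0 6 (int i) \<and> snd s0 6 (int i) \<le> X"
  shows "terminates inp X pass s (n * (11 * H + 21) + 1) (pass_inv T s0 n)"
proof -
  have "terminates inp X pass s (n * ((11 * H + 20) + 1) + 1) (pass_inv T s0 n)"
    unfolding pass_def
  proof (rule terminates_While[where I = "\<lambda>k s. k \<le> n \<and> pass_inv T s0 (n - k) s"])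
    show "n \<le> n \<and> pass_inv T s0 (n - n) s" using inv by simp
    fix k s assume I: "k \<le> n \<and> pass_inv T s0 (n - k) s"
    then have P: "pass_inv T s0 (n - k) s" by simp
    have R: "fst s 10 = int n" "fst s 5 = int (n - k)"
      using pass_invD(3)[OF P] goodD(3)[OF pass_invD(2)[OF P]] by auto
    show "safe inp s (Sub (Reg 10) (Reg 5))" by simp
    show "k > 0 \<and> terminates inp X pass_body s (11 * H + 20) (\<lambda>s. k - 1 \<le> n \<and> pass_inv T s0 (n - (k - 1)) s)"
      if "aval inp s (Sub (Reg 10) (Reg 5)) > 0"
    proof -
      have k: "k > 0" using that R I by (cases k) auto
      obtain R M where s: "s = (R, M)" by force
      have "terminates inp X pass_body (R, M) (11 * H + 20) (pass_inv T s0 (Suc (n - k)))"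
        using P k I T F Ibd by (intro pass_body_correct) (auto simp: s)
      moreover have "Suc (n - k) = n - (k - 1)" using k I by auto
      ultimately have t: "terminates inp X pass_body s (11 * H + 20) (pass_inv T s0 (n - (k - 1)))"
        unfolding s by metis
      show ?thesis using k I by (intro conjI k terminates_mono[OF t order.refl]) auto
    qed
    show "pass_inv T s0 n s" if "aval inp s (Sub (Reg 10) (Reg 5)) \<le> 0"
    proof -
      have "k = 0" using that R I by (auto simp: of_nat_diff)
      then show ?thesis using P by simp
    qed
  qed
  then show ?thesis by (rule terminates_mono) (simp_all add: ac_simps)
qed

lemma label_flow_notin: "(\<And>t. t < i \<Longrightarrow> E t \<noteq> e) \<Longrightarrow> label_flow E c i e = 0"
  unfolding label_flow_def by (intro sum.neutral) auto

text \<open>By \<open>rep_inj\<close>, equal identifiers mean equal leaves, and by \<open>rep_unique\<close> conversely.  Since slots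
  correspond to edges, the leaves give the flows.\<close>

lemma pass_result:
  assumes P: "pass_inv T s0 n s"
    and Ibd: "\<And>i. i \<le> n \<Longrightarrow> 0 \<le> snd s0 6 (int i)"
  defines "E \<equiv> walk_edge (\<lambda>i. snd s0 6 (int i)) L"
  shows "\<And>t. t < n \<Longrightarrow> slot (snd s) (E t) \<in> {1..fst s 13}"
    "\<And>t t'. t < n \<Longrightarrow> t' < n \<Longrightarrow> slot (snd s) (E t) = slot (snd s) (E t') \<longleftrightarrow> E t = E t'"
    "\<And>i i'. i \<le> n \<Longrightarrow> i' \<le> n \<Longrightarrow> snd s 6 (int i) = snd s 6 (int i') \<longleftrightarrow>
      (\<forall>e. label_flow (\<lambda>t. slot (snd s) (E t)) sg i e = label_flow (\<lambda>t. slot (snd s) (E t)) sg i' e)"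
proof -
  note P' = pass_invD[OF P, folded E_def]
  note G = goodD[OF P'(2)]
  let ?slot = "\<lambda>t. slot (snd s) (E t)"
  have Lr: "1 \<le> \<bar>L t\<bar> \<and> \<bar>L t\<bar> \<le> int r" if "t < n" for t using L[OF that] by auto
  have E_in: "E t \<in> {0..} \<times> {1..int r}" if "t < n" for t
    using Ibd[of t] Ibd[of "Suc t"] Lr[OF that] that by (auto simp: E_def walk_edge_def mem_Times_iff)
  have "slot (snd s) (E t) \<le> fst s 13" if "t < n" for t
    using G(12)[unfolded slots_ok_def, THEN conjunct1, THEN bspec, OF E_in[OF that]] by simp
  then show rng: "?slot t \<in> {1..fst s 13}" if "t < n" for t
    using P'(6)[OF that] that by auto
  show "?slot t = ?slot t' \<longleftrightarrow> E t = E t'" if "t < n" "t' < n" for t t'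
    using G(12) E_in[OF that(1)] E_in[OF that(2)] P'(6)[OF that(1)] unfolding slots_ok_def by metis
  have R13: "fst s 13 < N" using G(14) G(1) B by linarith
  have inj: "a = a' \<and> b = b'" if "hash r N (snd s) a b > 0" "hash r N (snd s) a b = hash r N (snd s) a' b'" for a b a' b'
    using G(7) that unfolding hash_ok_def by blast
  have shift: "label_flow (\<lambda>t. N + ?slot t) sg i q = label_flow ?slot sg i (q - N)" for i q
    unfolding label_flow_def by (intro sum.cong) auto
  show "snd s 6 (int i) = snd s 6 (int i') \<longleftrightarrow> (\<forall>e. label_flow ?slot sg i e = label_flow ?slot sg i' e)"
    if i: "i \<le> n" "i' \<le> n" for i i'
  proof
    assume eq: "snd s 6 (int i) = snd s 6 (int i')"
    show "\<forall>e. label_flow ?slot sg i e = label_flow ?slot sg i' e"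
    proof
      fix e
      show "label_flow ?slot sg i e = label_flow ?slot sg i' e"
      proof (cases "e \<in> {1..fst s 13}")
        case True
        have "leaf_values (snd s0) E (snd s) i (N + e) = leaf_values (snd s0) E (snd s) i' (N + e)"
          using True R13 by (intro rep_inj[OF inj P'(7)[OF i(1)] P'(7)[OF i(2), folded eq]]) auto
        then show ?thesis by (simp add: leaf_values_def shift)
      next
        case False
        have "label_flow ?slot sg j e = 0" if "j \<le> n" for j
          using False rng that by (intro label_flow_notin) (metis order.strict_trans2)
        then show ?thesis using i by simp
      qed
    qed
  next
    assume eq: "\<forall>e. label_flow ?slot sg i e = label_flow ?slot sg i' e"
    have "leaf_values (snd s0) E (snd s) i = leaf_values (snd s0) E (snd s) i'"
      using eq by (simp add: leaf_values_def shift fun_eq_iff)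
    then show "snd s 6 (int i) = snd s 6 (int i')"
      using rep_unique P'(7)[OF i(1)] P'(7)[OF i(2)] by metis
  qed
qed

end

locale power_run = free_group_rank r for r +
  fixes d H :: nat and u v :: word and X :: int and inp :: "int list"
  assumes u: "u \<in> words r" and v: "v \<in> words r"
    and B: "int (d * (2 * (length u + length v))) + 10 + int r \<le> 2 ^ H"
    and X: "1 + int (d * (2 * (length u + length v))) * int H + 2 * 2 ^ H \<le> X"
    and nX: "int (2 * (length u + length v)) \<le> X"
    and dX: "int d \<le> X"
begin

abbreviation "w \<equiv> u @ v @ inv_word u @ inv_word v"
abbreviation "m \<equiv> length u"
abbreviation "mq \<equiv> length u + length v"
abbreviation "n \<equiv> 2 * (length u + length v)"

definition seg :: "nat \<Rightarrow> int" where
  "seg t = (if t < m then 1 else if t < mq then 2 else 0)"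

lemma w: "w \<in> words r" and length_w: "length w = n"
  using u v by simp_all

lemma word_ints_letters: "t < n \<Longrightarrow> word_ints w t \<noteq> 0 \<and> \<bar>word_ints w t\<bar> \<le> int r"
proof -
  assume "t < n"
  then have "w ! t \<in> letters r" using w length_w by (metis in_listsD nth_mem words_def)
  then show ?thesis using letter_int_letters[of "w ! t" r] unfolding word_ints_def by auto
qed

sublocale pass_params r H n "d * n" "word_ints w" seg X inp
  using word_ints_letters B X nX by unfold_locales (auto simp: seg_def)

text \<open>Here \<open>k\<close> levels remain and \<open>l = d - k\<close> are done.  Either \<open>u\<close> and \<open>v\<close> are still trivial and no flow of them has
  been recorded, as closed walks without flow leave zeros behind; or the flows recorded are those at the first
  level \<open>l'\<close> after which they are not both trivial.\<close>

definition level_inv :: "nat \<Rightarrow> store \<Rightarrow> bool" where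
  "level_inv k s \<longleftrightarrow> (let R = fst s; M = snd s; l = d - k in
     k \<le> d \<and> good (l * n) s \<and> R 14 = int k \<and> R 7 = int m \<and> R 9 = int mq \<and> R 11 \<in> {0, 1} \<and>
     (\<forall>i j. i \<le> n \<longrightarrow> j \<le> n \<longrightarrow>
        M 6 (int i) = M 6 (int j) \<longleftrightarrow> solvable_class r l (take i w) = solvable_class r l (take j w)) \<and>
     (R 11 = 1 \<longrightarrow> free_reduce u \<in> D l \<and> free_reduce v \<in> D l \<and> (\<forall>t. M 1 t = 0 \<and> M 2 t = 0)) \<and>
     (R 11 = 0 \<longrightarrow> (\<exists>l' < l. free_reduce u \<in> D l' \<and> free_reduce v \<in> D l' \<and>
        \<not> (free_reduce u \<in> D (Suc l') \<and> free_reduce v \<in> D (Suc l')) \<and>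
        (\<forall>k. (\<forall>t. M 1 t = k * M 2 t) \<longleftrightarrow> (\<forall>e. word_flow (D l') u e = k * word_flow (D l') v e)))) \<and>
     (\<forall>t. \<bar>M 1 t\<bar> \<le> int n) \<and> (\<forall>t. t \<notin> {1..int (d * n)} \<longrightarrow> M 1 t = 0 \<and> M 2 t = 0))"

lemma level_invD:
  assumes "level_inv k s"
  defines "l \<equiv> d - k"
  shows "k \<le> d" "good (l * n) s" "fst s 14 = int k" "fst s 7 = int m" "fst s 9 = int mq" "fst s 11 \<in> {0, 1}"
    "\<And>i j. i \<le> n \<Longrightarrow> j \<le> n \<Longrightarrow> snd s 6 (int i) = snd s 6 (int j) \<longleftrightarrow>
        solvable_class r l (take i w) = solvable_class r l (take j w)"
    "fst s 11 = 1 \<Longrightarrow> free_reduce u \<in> D l \<and> free_reduce v \<in> D l \<and> (\<forall>t. snd s 1 t = 0 \<and> snd s 2 t = 0)"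
    "fst s 11 = 0 \<Longrightarrow> (\<exists>l' < l. free_reduce u \<in> D l' \<and> free_reduce v \<in> D l' \<and>
        \<not> (free_reduce u \<in> D (Suc l') \<and> free_reduce v \<in> D (Suc l')) \<and>
        (\<forall>k. (\<forall>t. snd s 1 t = k * snd s 2 t) \<longleftrightarrow> (\<forall>e. word_flow (D l') u e = k * word_flow (D l') v e)))"
    "\<And>t. \<bar>snd s 1 t\<bar> \<le> int n" "\<And>t. t \<notin> {1..int (d * n)} \<Longrightarrow> snd s 1 t = 0 \<and> snd s 2 t = 0"
  using assms(1) unfolding level_inv_def Let_def l_def by blast+

text \<open>The comparisons that tell when \<open>u\<close>, \<open>v\<close>, and their commutator are trivial.\<close>

lemma trivial_classes:
  shows "solvable_class r l (take 0 w) = solvable_class r l (take m w) \<longleftrightarrow> free_reduce u \<in> D l"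
    "solvable_class r l (take m w) = solvable_class r l (take mq w) \<longleftrightarrow> free_reduce v \<in> D l"
    "solvable_class r l (take 0 w) = solvable_class r l (take n w) \<longleftrightarrow> free_reduce w \<in> D l"
proof -
  interpret N: normal "D l" G by (rule derived_series_normal)
  have U: "free_reduce u \<in> carrier G" "free_reduce v \<in> carrier G" "free_reduce w \<in> carrier G" using u v by simp_all
  have 1: "solvable_class r l x = solvable_class r l (x @ y) \<longleftrightarrow> free_reduce y \<in> D l"
    if "x \<in> words r" "y \<in> words r" for x y
  proof -
    have "solvable_class r l x = solvable_class r l (x @ y) \<longleftrightarrow>
        D l #>\<^bsub>G\<^esub> (free_reduce x \<otimes>\<^bsub>G\<^esub> \<one>\<^bsub>G\<^esub>) = D l #>\<^bsub>G\<^esub> (free_reduce x \<otimes>\<^bsub>G\<^esub> free_reduce y)"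
      using that by (simp add: solvable_class_def free_reduce_mult)
    also have "\<dots> \<longleftrightarrow> D l #>\<^bsub>G\<^esub> \<one>\<^bsub>G\<^esub> = D l #>\<^bsub>G\<^esub> free_reduce y"
      using that by (intro normal_coset_left_cancel N.normal_axioms) auto
    also have "\<dots> \<longleftrightarrow> inv\<^bsub>G\<^esub> free_reduce y \<in> D l"
      using that by (simp add: coset_eq_iff N.subgroup_axioms)
    also have "\<dots> \<longleftrightarrow> free_reduce y \<in> D l"
      using that N.m_inv_closed[of "free_reduce y"] N.m_inv_closed[of "inv\<^bsub>G\<^esub> free_reduce y"] by auto
    finally show ?thesis .
  qed
  show "solvable_class r l (take 0 w) = solvable_class r l (take m w) \<longleftrightarrow> free_reduce u \<in> D l"
    using 1[of "[]" u] u by simp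
  show "solvable_class r l (take m w) = solvable_class r l (take mq w) \<longleftrightarrow> free_reduce v \<in> D l"
    using 1[of u v] u v by simp
  show "solvable_class r l (take 0 w) = solvable_class r l (take n w) \<longleftrightarrow> free_reduce w \<in> D l"
    using 1[of "[]" w] w length_w by simp
qed

lemma level_result:
  assumes inv: "level_inv (Suc k) s0" and P: "pass_inv ((d - Suc k) * n) s0 n s"
  defines "l \<equiv> d - Suc k"
  shows "\<And>i j. i \<le> n \<Longrightarrow> j \<le> n \<Longrightarrow> snd s 6 (int i) = snd s 6 (int j) \<longleftrightarrow>
        solvable_class r (Suc l) (take i w) = solvable_class r (Suc l) (take j w)"
    "fst s0 11 = 1 \<Longrightarrow> (\<forall>t. snd s 1 t = k' * snd s 2 t) \<longleftrightarrow> (\<forall>e. word_flow (D l) u e = k' * word_flow (D l) v e)"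
    "fst s0 11 = 0 \<Longrightarrow> snd s 1 t = snd s0 1 t \<and> snd s 2 t = snd s0 2 t"
    "\<bar>snd s 1 t\<bar> \<le> int n" "t \<notin> {1..int (d * n)} \<Longrightarrow> snd s 1 t = 0 \<and> snd s 2 t = 0"
proof -
  note Lv = level_invD[OF inv, folded l_def]
  note g0 = good_bounds[OF Lv(2)]
  define E where "E = walk_edge (\<lambda>i. snd s0 6 (int i)) (word_ints w)"
  let ?slot = "\<lambda>t. slot (snd s) (E t)"
  note P' = pass_invD[OF P, folded E_def]
  have pos: "0 \<le> snd s0 6 (int i)" if "i \<le> n" for i using g0(5)[OF that] by simp
  have res1: "?slot t \<in> {1..fst s 13}" if "t < n" for t
    unfolding E_def by (rule pass_result(1)[OF P]) (use pos that in auto)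
  have res2: "?slot t = ?slot t' \<longleftrightarrow> E t = E t'" if "t < n" "t' < n" for t t'
    unfolding E_def by (rule pass_result(2)[OF P]) (use pos that in auto)
  have res3: "snd s 6 (int i) = snd s 6 (int i') \<longleftrightarrow>
      (\<forall>e. label_flow ?slot sg i e = label_flow ?slot sg i' e)" if "i \<le> n" "i' \<le> n" for i i'
    unfolding E_def by (rule pass_result(3)[OF P]) (use pos that in auto)
  have W: "labelled_walk r w l (\<lambda>i. snd s0 6 (int i)) ?slot"
    using w length_w Lv(7) res2 by unfold_locales (auto simp: E_def)
  show "snd s 6 (int i) = snd s 6 (int j) \<longleftrightarrow>
        solvable_class r (Suc l) (take i w) = solvable_class r (Suc l) (take j w)" if "i \<le> n" "j \<le> n" for i j
    using solvable_class_Suc_iff_label_flow[OF W, of i j] res3[OF that] that length_w by simp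
  have A: "snd s a t = snd s0 a t + fst s0 11 * label_flow ?slot (\<lambda>t. if seg t = a then sg t else 0) n t"
    if "a \<in> {1, 2}" for a t
    using P'(9)[OF that] .
  have mn: "m \<le> n" and mqn: "mq \<le> n" by simp_all
  have 1: "label_flow ?slot (\<lambda>t. if seg t = 1 then sg t else 0) n t = label_flow ?slot sg m t" for t
    unfolding label_flow_prefix[OF mn] by (intro label_flow_cong) (auto simp: seg_def)
  have 2: "label_flow ?slot (\<lambda>t. if seg t = 2 then sg t else 0) n t
      = label_flow ?slot sg mq t - label_flow ?slot sg m t" for t
    unfolding label_flow_prefix[OF mn] label_flow_prefix[OF mqn] label_flow_diff
    by (intro label_flow_cong) (auto simp: seg_def)
  show "(\<forall>t. snd s 1 t = k' * snd s 2 t) \<longleftrightarrow> (\<forall>e. word_flow (D l) u e = k' * word_flow (D l) v e)"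
    if F: "fst s0 11 = 1"
  proof -
    have "snd s 1 t = label_flow ?slot sg m t" "snd s 2 t = label_flow ?slot sg mq t - label_flow ?slot sg m t" for t
      using A[of 1 t] A[of 2 t] Lv(8)[OF F] F unfolding 1 2 by simp_all
    then show ?thesis
      using proportional_flows_iff_label_flow[OF W, of k'] Lv(8)[OF F] by simp
  qed
  show "snd s 1 t = snd s0 1 t \<and> snd s 2 t = snd s0 2 t" if F: "fst s0 11 = 0"
    using A[of 1 t] A[of 2 t] F by simp
  have sg1: "\<bar>if b then sg t else 0\<bar> \<le> 1" for b t by (simp add: sgn_if)
  show "\<bar>snd s 1 t\<bar> \<le> int n"
  proof (cases "fst s0 11 = 1")
    case True
    then show ?thesis using A[of 1 t] Lv(8) label_flow_abs_le[of n "\<lambda>t. if seg t = 1 then sg t else 0" ?slot t] sg1 by simp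
  next
    case False
    then have "fst s0 11 = 0" using Lv(6) by simp
    then show ?thesis using A[of 1 t] Lv(10)[of t] by simp
  qed
  show "snd s 1 t = 0 \<and> snd s 2 t = 0" if t: "t \<notin> {1..int (d * n)}"
  proof (cases "fst s0 11 = 1")
    case True
    have "fst s 13 \<le> int (d * n)"
      using goodD(1)[OF P'(2)] goodD(14)[OF P'(2)] by linarith
    then have "?slot t' \<noteq> t" if "t' < n" for t' using t res1[OF that] by auto
    then have "label_flow ?slot c n t = 0" for c by (intro label_flow_notin) blast
    then show ?thesis using True A[of 1 t] A[of 2 t] Lv(8) by simp
  next
    case False
    then have F: "fst s0 11 = 0" using Lv(6) by simp
    then show ?thesis using A[of 1 t] A[of 2 t] Lv(11)[OF t] by simp
  qed
qed

end

context power_run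
begin

lemma level_correct:
  assumes inv: "level_inv (Suc k) (R, M)"
  shows "terminates inp X level (R, M) (n * (11 * H + 21) + 9) (level_inv k)"
proof -
  define l where "l = d - Suc k"
  note Lv = level_invD[OF inv, unfolded fst_conv snd_conv, folded l_def]
  have l: "l < d" "d - k = Suc l" using Lv(1) by (auto simp: l_def)
  have lB: "l * n + n \<le> d * n" using l(1) mult_le_mono1[of "Suc l" d n] by simp
  note g = good_bounds[OF Lv(2), unfolded fst_conv snd_conv]
  have g0: "\<bar>M 6 0\<bar> \<le> X" "\<bar>M 7 1\<bar> \<le> X" "0 \<le> X"
    using g(2-4,6,7) g(5)[of 0] by auto
  have start: "terminates inp X level_start (R, M) 3 (pass_inv (l * n) (R, M) 0)"
    by (rule level_start_correct[where R = R and M = M and X = X and Q = "pass_inv (l * n) (R, M) 0", OF g0 pass_start[OF Lv(2)]])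
  have "terminates inp X (Seq level_start (Seq pass level_end)) (R, M) (3 + ((n * (11 * H + 21) + 1) + 5)) (level_inv k)"
  proof (rule terminates_Seq, rule terminates_mono[OF start order.refl], rule terminates_Seq)
    fix s1 assume P1: "pass_inv (l * n) (R, M) 0 s1"
    show "terminates inp X pass s1 (n * (11 * H + 21) + 1) (\<lambda>s. terminates inp X level_end s 5 (level_inv k))"
    proof (rule terminates_mono[OF pass_correct[OF P1 lB] order.refl])
      show "fst (R, M) 11 \<in> {0, 1}" using Lv(6) by simp
      show "0 \<le> snd (R, M) 6 (int i) \<and> snd (R, M) 6 (int i) \<le> X" if "i \<le> n" for i
        using g(5)[OF that] by simp
      fix s2 assume P2: "pass_inv (l * n) (R, M) n s2"
      obtain R2 M2 where s2: "s2 = (R2, M2)" by (cases s2)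
      note P' = pass_invD[OF P2[unfolded s2], unfolded fst_conv snd_conv]
      note res = level_result[OF inv, folded l_def, OF P2[unfolded s2], unfolded fst_conv snd_conv]
      have good2: "good (Suc l * n) (R2, M2)" using P'(2) by (simp add: add.commute)
      note g2 = good_bounds[OF good2, unfolded fst_conv snd_conv]
      have R2: "R2 7 = int m" "R2 9 = int mq" "R2 11 = R 11" "R2 14 = int (Suc k)"
        using P'(10)[of 7] P'(10)[of 9] P'(10)[of 11] P'(10)[of 14] Lv(3-5) by simp_all
      have cond: "M2 6 0 = M2 6 (int m) \<and> M2 6 (int m) = M2 6 (int mq) \<longleftrightarrow>
          free_reduce u \<in> D (Suc l) \<and> free_reduce v \<in> D (Suc l)"
        using res(1)[of 0 m] res(1)[of m mq] trivial_classes(1,2)[of "Suc l"] by simp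
      have final: "level_inv k (R3, M2)"
        if R3: "R3 11 = (if M2 6 0 = M2 6 (int m) \<and> M2 6 (int m) = M2 6 (int mq) then R2 11 else 0)"
          "R3 14 = R2 14 - 1" "\<forall>y. y \<notin> {11, 14, 26, 28, 29} \<longrightarrow> R3 y = R2 y" for R3
        unfolding level_inv_def Let_def fst_conv snd_conv l(2)
      proof (intro conjI impI)
        show "k \<le> d" using Lv(1) by simp
        show "good (Suc l * n) (R3, M2)" by (rule good_frame[OF good2]) (use R3(3) in auto)
        show "R3 14 = int k" "R3 7 = int m" "R3 9 = int mq" using R3 R2 by simp_all
        show "R3 11 \<in> {0, 1}" using R3(1) R2(3) Lv(6) by auto
        show "\<forall>i j. i \<le> n \<longrightarrow> j \<le> n \<longrightarrow> M2 6 (int i) = M2 6 (int j) \<longleftrightarrow>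
          solvable_class r (Suc l) (take i w) = solvable_class r (Suc l) (take j w)"
          using res(1) by blast
        show "\<forall>t. \<bar>M2 1 t\<bar> \<le> int n" using res(4) by blast
        show "\<forall>t. t \<notin> {1..int (d * n)} \<longrightarrow> M2 1 t = 0 \<and> M2 2 t = 0" using res(5) by blast
      next
        assume F: "R3 11 = 1"
        then have c: "free_reduce u \<in> D (Suc l)" "free_reduce v \<in> D (Suc l)" and F0: "R 11 = 1"
          using R3(1) cond R2(3) by (auto split: if_splits)
        show "free_reduce u \<in> D (Suc l)" "free_reduce v \<in> D (Suc l)" by (rule c)+
        have "word_flow (D l) u e = 0" "word_flow (D l) v e = 0" for e
          using c u v mem_derived_series_Suc_iff[of "free_reduce u" l] mem_derived_series_Suc_iff[of "free_reduce v" l]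
          by (cases e; simp add: flow_steps_free_reduce derived_series_carrier)+
        then have "\<forall>t. M2 1 t = k' * M2 2 t" for k' using res(2)[OF F0, of k'] by simp
        from this[of 0] this[of 1] show "\<forall>t. M2 1 t = 0 \<and> M2 2 t = 0" by simp
      next
        assume F: "R3 11 = 0"
        show "\<exists>l'<Suc l. free_reduce u \<in> D l' \<and> free_reduce v \<in> D l' \<and>
          \<not> (free_reduce u \<in> D (Suc l') \<and> free_reduce v \<in> D (Suc l')) \<and>
          (\<forall>k. (\<forall>t. M2 1 t = k * M2 2 t) \<longleftrightarrow> (\<forall>e. word_flow (D l') u e = k * word_flow (D l') v e))"
        proof (cases "R 11 = 0")
          case True
          then obtain l' where l': "l' < l" "free_reduce u \<in> D l'" "free_reduce v \<in> D l'"
            "\<not> (free_reduce u \<in> D (Suc l') \<and> free_reduce v \<in> D (Suc l'))"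
            "\<And>k. (\<forall>t. M 1 t = k * M 2 t) \<longleftrightarrow> (\<forall>e. word_flow (D l') u e = k * word_flow (D l') v e)"
            using Lv(9) by blast
          have eq: "M2 1 t = M 1 t" "M2 2 t = M 2 t" for t using res(3)[OF True] by simp_all
          show ?thesis unfolding eq using l' less_SucI by blast
        next
          case False
          then have F0: "R 11 = 1" using Lv(6) by simp
          then have nt: "\<not> (free_reduce u \<in> D (Suc l) \<and> free_reduce v \<in> D (Suc l))"
            using F R3(1) cond R2(3) by (auto split: if_splits)
          show ?thesis using Lv(8)[OF F0] nt res(2)[OF F0] lessI by blast
        qed
      qed
      have b: "\<bar>M2 6 0 - M2 6 (R2 7)\<bar> \<le> X" "\<bar>M2 6 (R2 7) - M2 6 (R2 9)\<bar> \<le> X"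
        using g2(5)[of 0] g2(5)[of m] g2(5)[of mq] by (auto simp: R2)
      have b14: "\<bar>R2 14 - 1\<bar> \<le> X" using R2(4) Lv(1) dX by simp
      show "terminates inp X level_end s2 5 (level_inv k)"
        unfolding s2
      proof (rule level_end_correct[where R = R2 and M = M2 and X = X and Q = "level_inv k", OF _ _ b b14 g0(3)])
        show "0 \<le> R2 7" "0 \<le> R2 9" by (simp_all add: R2)
      qed (use final R2(1,2) in simp)
    qed
  qed
  then show ?thesis unfolding level_def by (rule terminates_mono) simp_all
qed

lemma levels_correct:
  assumes inv: "level_inv d s"
  shows "terminates inp X levels s (d * (n * (11 * H + 21) + 10) + 1) (level_inv 0)"
proof -
  have "terminates inp X levels s (d * ((n * (11 * H + 21) + 9) + 1) + 1) (level_inv 0)"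
    unfolding levels_def
  proof (rule terminates_While[of level_inv])
    show "level_inv d s" by (rule inv)
    fix k s assume I: "level_inv k s"
    obtain R M where s: "s = (R, M)" by (cases s)
    have R14: "R 14 = int k" using level_invD(3)[OF I] by (simp add: s)
    show "safe inp s (Reg 14)" by simp
    show "k > 0 \<and> terminates inp X level s (n * (11 * H + 21) + 9) (level_inv (k - 1))"
      if "aval inp s (Reg 14) > 0"
      using that R14 I level_correct[of "k - 1" R M] by (simp add: s)
    show "level_inv 0 s" if "aval inp s (Reg 14) \<le> 0"
      using that R14 I by (simp add: s)
  qed
  then show ?thesis by (rule terminates_mono) simp_all
qed

end

section \<open>Reading off the exponent\<close>

definition find_nonzero :: "nat \<Rightarrow> com" where
  "find_nonzero d = Seq (seq [Assign 25 (Lit 0), Assign 3 (Lit 1)])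
     (While (Sub (Add (Mul (Lit (int d)) (Reg 10)) (Lit 1)) (Reg 3)) (seq [
        If (Mul (Cell (Lit 2) (Reg 3)) (Cell (Lit 2) (Reg 3))) (Assign 25 (Reg 3)) skip,
        Assign 3 (Add (Reg 3) (Lit 1))]))"

text \<open>Instead of dividing the flow of \<open>u\<close> through the slot by that of \<open>v\<close>, all exponents from \<open>- n\<close> to \<open>n\<close> are tried.
  No other one is possible, since \<open>n\<close> bounds the flow of \<open>u\<close>.\<close>

definition find_exponent :: com where
  "find_exponent = Seq (seq [Assign 1 (Lit 0), Assign 3 (Sub (Lit 0) (Reg 10))])
     (While (Sub (Add (Reg 10) (Lit 1)) (Reg 3)) (seq [
        Assign 26 (Sub (Mul (Reg 3) (Cell (Lit 2) (Reg 25))) (Cell (Lit 1) (Reg 25))),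
        If (Mul (Reg 26) (Reg 26)) skip (Assign 1 (Reg 3)),
        Assign 3 (Add (Reg 3) (Lit 1))]))"

definition check_exponent :: "nat \<Rightarrow> com" where
  "check_exponent d = Seq (seq [
       Assign 27 (Lit 0),
       Assign 26 (Sub (Cell (Lit 6) (Lit 0)) (Cell (Lit 6) (Reg 10))),
       If (Mul (Reg 26) (Reg 26)) (Assign 27 (Lit 1)) skip,
       Assign 3 (Lit 1)])
     (While (Sub (Add (Mul (Lit (int d)) (Reg 10)) (Lit 1)) (Reg 3)) (seq [
        Assign 26 (Sub (Mul (Reg 1) (Cell (Lit 2) (Reg 3))) (Cell (Lit 1) (Reg 3))),
        If (Mul (Reg 26) (Reg 26)) (Assign 27 (Lit 1)) skip,
        Assign 3 (Add (Reg 3) (Lit 1))]))"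

lemma square_pos_iff: "0 < y * y \<longleftrightarrow> y \<noteq> (0::int)"
  using square_sum_pos_iff[of y 0] by simp

lemma find_nonzero_correct:
  assumes R10: "R 10 = int n" and X: "int (d * n) + 1 \<le> X" and zero: "\<And>t. t \<notin> {1..int (d * n)} \<Longrightarrow> M 2 t = 0"
  shows "terminates inp X (find_nonzero d) (R, M) (d * n * 4 + 3) (\<lambda>(R', M'). M' = M \<and>
    0 \<le> R' 25 \<and> (M 2 (R' 25) = 0 \<longrightarrow> (\<forall>t. M 2 t = 0)) \<and> (\<forall>x. x \<notin> {3, 25, 29} \<longrightarrow> R' x = R x))"
    (is "terminates _ _ _ _ _ ?Q")
proof -
  define I where "I k s \<longleftrightarrow> (case s of (R', M') \<Rightarrow> M' = M \<and> k \<le> d * n \<and> R' 3 = int (d * n - k) + 1 \<and>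
    0 \<le> R' 25 \<and> (M 2 (R' 25) = 0 \<longrightarrow> (\<forall>t \<le> int (d * n - k). M 2 t = 0)) \<and>
    (\<forall>x. x \<notin> {3, 25, 29} \<longrightarrow> R' x = R x))" for k and s :: store
  let ?body = "seq [If (Mul (Cell (Lit 2) (Reg 3)) (Cell (Lit 2) (Reg 3))) (Assign 25 (Reg 3)) skip,
        Assign 3 (Add (Reg 3) (Lit 1))]"
  let ?e = "Sub (Add (Mul (Lit (int d)) (Reg 10)) (Lit 1)) (Reg 3)"
  have X1: "0 \<le> X" "1 \<le> X" using X of_nat_0_le_iff[of "d * n", where 'a = int] by linarith+
  have "wp inp X (seq [Assign 25 (Lit 0), Assign 3 (Lit 1)]) (I (d * n)) (R, M)"
    using X1 zero by (simp add: I_def)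
  from wp_terminates[OF _ this] have 1: "terminates inp X (seq [Assign 25 (Lit 0), Assign 3 (Lit 1)]) (R, M) 2 (I (d * n))"
    by (rule terminates_mono) simp_all
  have "terminates inp X (find_nonzero d) (R, M) (2 + (d * n * (3 + 1) + 1)) ?Q"
    unfolding find_nonzero_def
  proof (rule terminates_Seq, rule terminates_mono[OF 1 order.refl], rule terminates_While[of I])
    fix k s assume I: "I k s"
    obtain R1 M1 where s: "s = (R1, M1)" by (cases s)
    have R1: "M1 = M" "k \<le> d * n" "R1 3 = int (d * n - k) + 1" "0 \<le> R1 25" "R1 10 = int n"
      "M 2 (R1 25) = 0 \<Longrightarrow> t \<le> int (d * n - k) \<Longrightarrow> M 2 t = 0"
      "x \<notin> {3, 25, 29} \<Longrightarrow> R1 x = R x" for t x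
      using I R10 by (simp_all add: I_def s)
    show "safe inp s ?e" by simp
    have e: "aval inp s ?e = int k" using R1 by (simp add: s of_nat_diff)
    show "k > 0 \<and> terminates inp X ?body s 3 (I (k - 1))" if "aval inp s ?e > 0"
    proof -
      have k: "k > 0" using that e by simp
      have i: "int (d * n - (k - 1)) = R1 3" using R1(2,3) k by (simp add: of_nat_diff)
      have "int (d * n - k) = int (d * n) - int k" "int k \<le> int (d * n)" "1 \<le> int k"
        using R1(2) k by (simp_all add: of_nat_diff del: of_nat_mult)
      then have b: "1 \<le> R1 3" "R1 3 + 1 \<le> X" using R1(3) X by linarith+
      have "wp inp X ?body (I (k - 1)) (R1, M)"
      proof (cases "M 2 (R1 3) = 0")
        case True
        have new: "\<forall>t \<le> R1 3. M 2 t = 0" if "M 2 (R1 25) = 0"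
        proof (intro allI impI)
          fix t assume "t \<le> R1 3"
          then show "M 2 t = 0" using R1(3,6) True that by (cases "t = R1 3") auto
        qed
        have "I (k - 1) (R1(29 := 0, 3 := R1 3 + 1), M)"
          using R1(2,4,7) k new unfolding I_def prod.case i by simp
        then show ?thesis using True b by simp
      next
        case False
        have "I (k - 1) (R1(25 := R1 3, 3 := R1 3 + 1), M)"
          using R1(2,7) k False b unfolding I_def prod.case i by simp
        then show ?thesis using False b by (simp add: square_pos_iff)
      qed
      from wp_terminates[OF _ this] have "terminates inp X ?body s 3 (I (k - 1))"
        unfolding s R1(1) by (rule terminates_mono) simp_all
      then show ?thesis using k by simp
    qed
    show "?Q s" if "aval inp s ?e \<le> 0"
    proof -
      have "k = 0" using that e by simp
      then have "M 2 (R1 25) = 0 \<Longrightarrow> M 2 t = 0" for t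
        using R1(6)[of t] zero[of t] by (cases "t \<le> int (d * n)") auto
      then show ?thesis using R1(1,4,7) by (simp add: s)
    qed
  qed
  then show ?thesis by (rule terminates_mono) simp_all
qed

lemma find_exponent_correct:
  assumes R: "R 10 = int n" "0 \<le> R 25" and X: "int n + 1 \<le> X" "\<And>k. \<bar>k\<bar> \<le> int n \<Longrightarrow> \<bar>k * M 2 (R 25) - M 1 (R 25)\<bar> \<le> X"
  shows "terminates inp X find_exponent (R, M) ((2 * n + 1) * 5 + 3) (\<lambda>(R', M'). M' = M \<and> \<bar>R' 1\<bar> \<le> int n \<and>
    (\<forall>k. \<bar>k\<bar> \<le> int n \<longrightarrow> k * M 2 (R 25) = M 1 (R 25) \<longrightarrow> R' 1 * M 2 (R 25) = M 1 (R 25)) \<and>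
    (\<forall>x. x \<notin> {1, 3, 26, 29} \<longrightarrow> R' x = R x))"
    (is "terminates _ _ _ _ _ ?Q")
proof -
  let ?a = "M 1 (R 25)" and ?b = "M 2 (R 25)"
  define I where "I k s \<longleftrightarrow> (case s of (R', M') \<Rightarrow> M' = M \<and> k \<le> 2 * n + 1 \<and> R' 3 = int n + 1 - int k \<and> \<bar>R' 1\<bar> \<le> int n \<and>
    (\<forall>j. - int n \<le> j \<longrightarrow> j < R' 3 \<longrightarrow> j * ?b = ?a \<longrightarrow> R' 1 * ?b = ?a) \<and>
    (\<forall>x. x \<notin> {1, 3, 26, 29} \<longrightarrow> R' x = R x))" for k and s :: store
  let ?body = "seq [Assign 26 (Sub (Mul (Reg 3) (Cell (Lit 2) (Reg 25))) (Cell (Lit 1) (Reg 25))),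
        If (Mul (Reg 26) (Reg 26)) skip (Assign 1 (Reg 3)),
        Assign 3 (Add (Reg 3) (Lit 1))]"
  let ?e = "Sub (Add (Reg 10) (Lit 1)) (Reg 3)"
  have "wp inp X (seq [Assign 1 (Lit 0), Assign 3 (Sub (Lit 0) (Reg 10))]) (I (2 * n + 1)) (R, M)"
    using X R by (simp add: I_def)
  from wp_terminates[OF _ this]
  have 1: "terminates inp X (seq [Assign 1 (Lit 0), Assign 3 (Sub (Lit 0) (Reg 10))]) (R, M) 2 (I (2 * n + 1))"
    by (rule terminates_mono) simp_all
  have "terminates inp X find_exponent (R, M) (2 + ((2 * n + 1) * (4 + 1) + 1)) ?Q"
    unfolding find_exponent_def
  proof (rule terminates_Seq, rule terminates_mono[OF 1 order.refl], rule terminates_While[of I])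
    fix k s assume I: "I k s"
    obtain R1 M1 where s: "s = (R1, M1)" by (cases s)
    have R1: "M1 = M" "k \<le> 2 * n + 1" "R1 3 = int n + 1 - int k" "\<bar>R1 1\<bar> \<le> int n" "R1 10 = int n" "R1 25 = R 25"
      "- int n \<le> j \<Longrightarrow> j < R1 3 \<Longrightarrow> j * ?b = ?a \<Longrightarrow> R1 1 * ?b = ?a"
      "x \<notin> {1, 3, 26, 29} \<Longrightarrow> R1 x = R x" for j x
      using I R by (auto simp: I_def s)
    show "safe inp s ?e" by simp
    have e: "aval inp s ?e = int k" using R1 by (simp add: s)
    show "k > 0 \<and> terminates inp X ?body s 4 (I (k - 1))" if "aval inp s ?e > 0"
    proof -
      have k: "k > 0" using that e by simp
      have b: "\<bar>R1 3\<bar> \<le> int n" using R1(2,3) k by auto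
      let ?y = "R1 3 * ?b - ?a"
      have y: "\<bar>?y\<bar> \<le> X" using X(2)[OF b] .
      have r3: "R1 3 + 1 = int n + 1 - int (k - 1)" using R1(3) k by simp
      have "wp inp X ?body (I (k - 1)) (R1, M)"
      proof (cases "?y = 0")
        case True
        have "I (k - 1) (R1(26 := ?y, 1 := R1 3, 3 := R1 3 + 1), M)"
          using R1 r3 True b unfolding I_def by auto
        then show ?thesis using True b y X R(2) R1(6) by simp
      next
        case False
        have "j < R1 3" if "j < R1 3 + 1" "j * ?b = ?a" for j
          using False that by (cases "j = R1 3") auto
        then have new: "\<forall>j. - int n \<le> j \<longrightarrow> j < R1 3 + 1 \<longrightarrow> j * ?b = ?a \<longrightarrow> R1 1 * ?b = ?a"
          using R1(7) by blast
        have "I (k - 1) (R1(26 := ?y, 29 := 0, 3 := R1 3 + 1), M)"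
          using R1(2,4,8) r3 new unfolding I_def prod.case by simp
        then show ?thesis using False b y X R(2) R1(6) by (simp add: square_pos_iff)
      qed
      from wp_terminates[OF _ this] have "terminates inp X ?body s 4 (I (k - 1))"
        unfolding s R1(1) by (rule terminates_mono) simp_all
      then show ?thesis using k by simp
    qed
    show "?Q s" if "aval inp s ?e \<le> 0"
    proof -
      have "k = 0" using that e by simp
      then have "R1 1 * ?b = ?a" if "\<bar>j\<bar> \<le> int n" "j * ?b = ?a" for j
        using R1(3) R1(7)[of j] that by auto
      then show ?thesis using R1(1,4,8) by (simp add: s)
    qed
  qed
  then show ?thesis by (rule terminates_mono) simp_all
qed

lemma check_exponent_correct:
  assumes R: "R 10 = int n" and X: "int (d * n) + 1 \<le> X" "\<And>t. \<bar>R 1 * M 2 t - M 1 t\<bar> \<le> X" "\<bar>M 6 0 - M 6 (int n)\<bar> \<le> X"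
    and zero: "\<And>t. t \<notin> {1..int (d * n)} \<Longrightarrow> M 1 t = 0 \<and> M 2 t = 0"
  shows "terminates inp X (check_exponent d) (R, M) (d * n * 5 + 6) (\<lambda>(R', M'). R' 1 = R 1 \<and>
    R' 27 = (if M 6 0 = M 6 (int n) \<and> (\<forall>t. R 1 * M 2 t = M 1 t) then 0 else 1))"
    (is "terminates _ _ _ _ _ ?Q")
proof -
  define I where "I k s \<longleftrightarrow> (case s of (R', M') \<Rightarrow> M' = M \<and> k \<le> d * n \<and> R' 3 = int (d * n - k) + 1 \<and> R' 1 = R 1 \<and> R' 10 = R 10 \<and>
    R' 27 = (if M 6 0 = M 6 (int n) \<and> (\<forall>t < R' 3. R 1 * M 2 t = M 1 t) then 0 else 1))" for k and s :: store
  let ?body = "seq [Assign 26 (Sub (Mul (Reg 1) (Cell (Lit 2) (Reg 3))) (Cell (Lit 1) (Reg 3))),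
        If (Mul (Reg 26) (Reg 26)) (Assign 27 (Lit 1)) skip,
        Assign 3 (Add (Reg 3) (Lit 1))]"
  let ?start = "seq [Assign 27 (Lit 0),
       Assign 26 (Sub (Cell (Lit 6) (Lit 0)) (Cell (Lit 6) (Reg 10))),
       If (Mul (Reg 26) (Reg 26)) (Assign 27 (Lit 1)) skip,
       Assign 3 (Lit 1)]"
  let ?e = "Sub (Add (Mul (Lit (int d)) (Reg 10)) (Lit 1)) (Reg 3)"
  let ?z = "M 6 0 - M 6 (int n)"
  have X1: "0 \<le> X" "1 \<le> X" using X(1) of_nat_0_le_iff[of "d * n", where 'a = int] by linarith+
  have "wp inp X ?start (I (d * n)) (R, M)"
  proof (cases "?z = 0")
    case True
    have "I (d * n) (R(27 := 0, 26 := ?z, 29 := 0, 3 := 1), M)"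
      using True zero R by (simp add: I_def)
    then show ?thesis using True X X1 R by simp
  next
    case False
    have "I (d * n) (R(26 := ?z, 27 := 1, 3 := 1), M)"
      using False R by (simp add: I_def)
    then show ?thesis using False X X1 R by (simp add: square_pos_iff)
  qed
  from wp_terminates[OF _ this] have 1: "terminates inp X ?start (R, M) 5 (I (d * n))"
    by (rule terminates_mono) simp_all
  have "terminates inp X (check_exponent d) (R, M) (5 + (d * n * (4 + 1) + 1)) ?Q"
    unfolding check_exponent_def
  proof (rule terminates_Seq, rule terminates_mono[OF 1 order.refl], rule terminates_While[of I])
    fix k s assume I: "I k s"
    obtain R1 M1 where s: "s = (R1, M1)" by (cases s)
    have R1: "M1 = M" "k \<le> d * n" "R1 3 = int (d * n - k) + 1" "R1 1 = R 1" "R1 10 = int n"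
      "R1 27 = (if M 6 0 = M 6 (int n) \<and> (\<forall>t < R1 3. R 1 * M 2 t = M 1 t) then 0 else 1)"
      using I R by (simp_all add: I_def s)
    show "safe inp s ?e" by simp
    have e: "aval inp s ?e = int k" using R1 by (simp add: s of_nat_diff)
    show "k > 0 \<and> terminates inp X ?body s 4 (I (k - 1))" if "aval inp s ?e > 0"
    proof -
      have k: "k > 0" using that e by simp
      have i: "int (d * n - (k - 1)) + 1 = R1 3 + 1" using R1(2,3) k by (simp add: of_nat_diff)
      have "int (d * n - k) = int (d * n) - int k" "int k \<le> int (d * n)" "1 \<le> int k"
        using R1(2) k by (simp_all add: of_nat_diff del: of_nat_mult)
      then have b: "1 \<le> R1 3" "R1 3 + 1 \<le> X" using R1(3) X(1) by linarith+
      let ?y = "R 1 * M 2 (R1 3) - M 1 (R1 3)"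
      have all: "(\<forall>t < R1 3 + 1. R 1 * M 2 t = M 1 t) \<longleftrightarrow> (\<forall>t < R1 3. R 1 * M 2 t = M 1 t) \<and> ?y = 0"
        by (auto simp: order_le_less)
      have "wp inp X ?body (I (k - 1)) (R1, M)"
      proof (cases "?y = 0")
        case True
        have "I (k - 1) (R1(26 := ?y, 29 := 0, 3 := R1 3 + 1), M)"
          using R1 R k i True all unfolding I_def by simp
        then show ?thesis using True b X R1(4) by simp
      next
        case False
        have "I (k - 1) (R1(26 := ?y, 27 := 1, 3 := R1 3 + 1), M)"
          using R1 R k i False all unfolding I_def by simp
        then show ?thesis using False b X R1(4) by (simp add: square_pos_iff)
      qed
      from wp_terminates[OF _ this] have "terminates inp X ?body s 4 (I (k - 1))"
        unfolding s R1(1) by (rule terminates_mono) simp_all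
      then show ?thesis using k by simp
    qed
    show "?Q s" if "aval inp s ?e \<le> 0"
    proof -
      have "R1 3 = int (d * n) + 1" using that e R1(3) by simp
      then have "R 1 * M 2 t = M 1 t" if "R1 3 \<le> t" for t using zero[of t] that by simp
      then have "(\<forall>t < R1 3. R 1 * M 2 t = M 1 t) \<longleftrightarrow> (\<forall>t. R 1 * M 2 t = M 1 t)"
        by (meson not_le)
      then show ?thesis using R1(4,6) by (simp add: s)
    qed
  qed
  then show ?thesis by (rule terminates_mono) simp_all
qed

section \<open>Reading the input\<close>

fun table :: "(int \<times> int) list \<Rightarrow> com" where
  "table [] = skip"
| "table (p # ps) = Seq (Write (Lit 3) (Lit (fst p)) (Lit (snd p))) (table ps)"

lemma table_correct:
  assumes "distinct (map fst ps)" "\<And>p. p \<in> set ps \<Longrightarrow> 0 \<le> fst p \<and> \<bar>snd p\<bar> \<le> X" "0 \<le> X"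
  shows "terminates inp X (table ps) (R, M) (length ps + 1) (\<lambda>(R', M').
    (\<forall>x. x \<noteq> 29 \<longrightarrow> R' x = R x) \<and> (\<forall>a. a \<noteq> 3 \<longrightarrow> M' a = M a) \<and>
    (\<forall>z. z \<notin> fst ` set ps \<longrightarrow> M' 3 z = M 3 z) \<and> (\<forall>p \<in> set ps. M' 3 (fst p) = snd p))"
  using assms(1,2)
proof (induction ps arbitrary: M)
  case Nil
  have "wp inp X skip (\<lambda>(R', M').
    (\<forall>x. x \<noteq> 29 \<longrightarrow> R' x = R x) \<and> (\<forall>a. a \<noteq> 3 \<longrightarrow> M' a = M a) \<and>
    (\<forall>z. z \<notin> fst ` set [] \<longrightarrow> M' 3 z = M 3 z) \<and> (\<forall>p \<in> set []. M' 3 (fst p) = snd p)) (R, M)"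
    using assms(3) by simp
  from wp_terminates[OF _ this] show ?case by simp
next
  case (Cons p ps)
  obtain z y where p: "p = (z, y)" by (cases p)
  have zy: "0 \<le> z" "\<bar>y\<bar> \<le> X" using Cons.prems(2)[of p] by (auto simp: p)
  define M1 where "M1 = M(3 := (M 3)(z := y))"
  have IH: "terminates inp X (table ps) (R, M1) (length ps + 1) (\<lambda>(R', M').
    (\<forall>x. x \<noteq> 29 \<longrightarrow> R' x = R x) \<and> (\<forall>a. a \<noteq> 3 \<longrightarrow> M' a = M1 a) \<and>
    (\<forall>z. z \<notin> fst ` set ps \<longrightarrow> M' 3 z = M1 3 z) \<and> (\<forall>p \<in> set ps. M' 3 (fst p) = snd p))"
    using Cons.prems by (intro Cons.IH) auto
  have "terminates inp X (table (p # ps)) (R, M) (1 + (length ps + 1)) (\<lambda>(R', M').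
    (\<forall>x. x \<noteq> 29 \<longrightarrow> R' x = R x) \<and> (\<forall>a. a \<noteq> 3 \<longrightarrow> M' a = M1 a) \<and>
    (\<forall>z. z \<notin> fst ` set ps \<longrightarrow> M' 3 z = M1 3 z) \<and> (\<forall>p \<in> set ps. M' 3 (fst p) = snd p))"
    unfolding table.simps
    by (rule terminates_Seq, rule terminates_Write) (use zy IH in \<open>simp_all add: p M1_def\<close>)
  then show ?case
  proof (rule terminates_mono)
    fix s' assume *: "case s' of (R', M') \<Rightarrow>
      (\<forall>x. x \<noteq> 29 \<longrightarrow> R' x = R x) \<and> (\<forall>a. a \<noteq> 3 \<longrightarrow> M' a = M1 a) \<and>
      (\<forall>z. z \<notin> fst ` set ps \<longrightarrow> M' 3 z = M1 3 z) \<and> (\<forall>p \<in> set ps. M' 3 (fst p) = snd p)"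
    have "z \<notin> fst ` set ps" using Cons.prems(1) by (simp add: p)
    then show "case s' of (R', M') \<Rightarrow>
      (\<forall>x. x \<noteq> 29 \<longrightarrow> R' x = R x) \<and> (\<forall>a. a \<noteq> 3 \<longrightarrow> M' a = M a) \<and>
      (\<forall>z. z \<notin> fst ` set (p # ps) \<longrightarrow> M' 3 z = M 3 z) \<and> (\<forall>p \<in> set (p # ps). M' 3 (fst p) = snd p)"
      using * by (cases s') (simp add: p M1_def)
  qed simp
qed

text \<open>Doubling yields the least power of 2 that is at least \<open>a s + b\<close>, where \<open>s\<close> is the length of the input.\<close>

definition grow :: "nat \<Rightarrow> nat \<Rightarrow> com" where
  "grow a b = Seq (Assign 2 (Lit 1))
     (While (Sub (Add (Mul (Lit (int a)) (Reg 0)) (Lit (int b))) (Reg 2)) (Assign 2 (Add (Reg 2) (Reg 2))))"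

lemma grow_correct:
  assumes R: "R 0 = int s" and K: "a * s + b > 0" and X: "2 ^ ceillog2 (a * s + b) \<le> X" and "1 \<le> X"
  shows "terminates inp X (grow a b) (R, M) (ceillog2 (a * s + b) * 2 + 2)
    (\<lambda>(R', M'). M' = M \<and> R' = R(2 := 2 ^ ceillog2 (a * s + b)))"
    (is "terminates _ _ _ _ _ ?Q")
proof -
  define h where "h = ceillog2 (a * s + b)"
  define I where "I k st \<longleftrightarrow> k \<le> h \<and> st = (R(2 := 2 ^ (h - k)), M)" for k and st :: store
  let ?e = "Sub (Add (Mul (Lit (int a)) (Reg 0)) (Lit (int b))) (Reg 2)"
  have "terminates inp X (grow a b) (R, M) (1 + (h * (1 + 1) + 1)) ?Q"
    unfolding grow_def
  proof (rule terminates_Seq, rule terminates_Assign)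
    show "terminates inp X (While ?e (Assign 2 (Add (Reg 2) (Reg 2)))) (R(2 := aval inp (R, M) (Lit 1)), M) (h * (1 + 1) + 1) ?Q"
    proof (rule terminates_While[of I])
      show "I h (R(2 := aval inp (R, M) (Lit 1)), M)" by (simp add: I_def)
      fix k st assume I: "I k st"
      show "safe inp st ?e" by simp
      have e: "aval inp st ?e = int (a * s + b) - 2 ^ (h - k)" using I R by (simp add: I_def)
      have pos: "aval inp st ?e > 0 \<longleftrightarrow> k > 0"
      proof -
        have "aval inp st ?e > 0 \<longleftrightarrow> \<not> a * s + b \<le> 2 ^ (h - k)"
          unfolding e by (simp add: not_le flip: of_nat_less_iff[where 'a = int])
        also have "a * s + b \<le> 2 ^ (h - k) \<longleftrightarrow> h \<le> h - k"
          unfolding h_def using K by (simp add: ceillog2_le_iff)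
        also have "\<not> h \<le> h - k \<longleftrightarrow> k > 0" using I by (auto simp: I_def)
        finally show ?thesis .
      qed
      show "k > 0 \<and> terminates inp X (Assign 2 (Add (Reg 2) (Reg 2))) st 1 (I (k - 1))" if "aval inp st ?e > 0"
      proof -
        have k: "k > 0" using that pos by simp
        have "(2::int) ^ (h - k) + 2 ^ (h - k) = 2 ^ Suc (h - k)" by simp
        also have "Suc (h - k) = h - (k - 1)" using k I by (auto simp: I_def)
        finally have eq: "(2::int) ^ (h - k) + 2 ^ (h - k) = 2 ^ (h - (k - 1))" .
        have kh: "k \<le> h" using I by (simp add: I_def)
        have "(2::int) ^ (h - (k - 1)) \<le> 2 ^ h" by (intro power_increasing) auto
        then have le: "(2::int) ^ (h - (k - 1)) \<le> X" using X unfolding h_def by linarith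
        have st: "st = (R(2 := 2 ^ (h - k)), M)" using I by (simp add: I_def)
        have "terminates inp X (Assign 2 (Add (Reg 2) (Reg 2))) st 1 (I (k - 1))"
          unfolding st by (rule terminates_Assign) (use eq le kh in \<open>simp_all add: I_def\<close>)
        then show ?thesis using k by simp
      qed
      show "?Q st" if "aval inp st ?e \<le> 0"
      proof -
        have "k = 0" using that pos by auto
        then show ?thesis using I by (simp add: I_def h_def)
      qed
    qed
  qed (use assms(4) in simp_all)
  then show ?thesis unfolding h_def by (rule terminates_mono) simp_all
qed

definition fill_halves :: com where
  "fill_halves = Seq (Assign 3 (Lit 1)) (While (Sub (Reg 2) (Reg 3)) (seq [
     Write (Lit 8) (Mul (Lit 2) (Reg 3)) (Reg 3),
     Write (Lit 8) (Add (Mul (Lit 2) (Reg 3)) (Lit 1)) (Reg 3),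
     Assign 3 (Add (Reg 3) (Lit 1))]))"

lemma fill_halves_correct:
  assumes R: "R 2 = int N" and N: "1 \<le> N" and X: "int N \<le> X"
  shows "terminates inp X fill_halves (R, M) (N * 4 + 2)
    (\<lambda>(R', M'). (\<forall>x. x \<noteq> 3 \<longrightarrow> R' x = R x) \<and> (\<forall>a. a \<noteq> 8 \<longrightarrow> M' a = M a) \<and> halves (int N) M')"
    (is "terminates _ _ _ _ _ ?Q")
proof -
  define I where "I k s \<longleftrightarrow> (case s of (R', M') \<Rightarrow> k < N \<and> R' 3 = int (N - k) \<and> (\<forall>x. x \<noteq> 3 \<longrightarrow> R' x = R x) \<and>
    (\<forall>a. a \<noteq> 8 \<longrightarrow> M' a = M a) \<and> (\<forall>q. 2 \<le> q \<longrightarrow> q < 2 * R' 3 \<longrightarrow> M' 8 q = q div 2))" for k and s :: store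
  let ?body = "seq [Write (Lit 8) (Mul (Lit 2) (Reg 3)) (Reg 3),
     Write (Lit 8) (Add (Mul (Lit 2) (Reg 3)) (Lit 1)) (Reg 3),
     Assign 3 (Add (Reg 3) (Lit 1))]"
  let ?e = "Sub (Reg 2) (Reg 3)"
  have X1: "1 \<le> X" using N X by linarith
  have "terminates inp X fill_halves (R, M) (1 + ((N - 1) * (3 + 1) + 1)) ?Q"
    unfolding fill_halves_def
  proof (rule terminates_Seq, rule terminates_Assign)
    show "terminates inp X (While ?e ?body) (R(3 := aval inp (R, M) (Lit 1)), M) ((N - 1) * (3 + 1) + 1) ?Q"
    proof (rule terminates_While[of I])
      show "I (N - 1) (R(3 := aval inp (R, M) (Lit 1)), M)" using N by (simp add: I_def of_nat_diff)
      fix k s assume I: "I k s"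
      obtain R1 M1 where s: "s = (R1, M1)" by (cases s)
      have R1: "k < N" "R1 3 = int (N - k)" "R1 2 = int N" "\<forall>x. x \<noteq> 3 \<longrightarrow> R1 x = R x"
        "\<forall>a. a \<noteq> 8 \<longrightarrow> M1 a = M a" "\<And>q. 2 \<le> q \<Longrightarrow> q < 2 * R1 3 \<Longrightarrow> M1 8 q = q div 2"
        using I R by (auto simp: I_def s)
      show "safe inp s ?e" by simp
      have e: "aval inp s ?e = int k" using R1 by (simp add: s of_nat_diff)
      show "k > 0 \<and> terminates inp X ?body s 3 (I (k - 1))" if "aval inp s ?e > 0"
      proof -
        have k: "k > 0" using that e by simp
        have i: "R1 3 + 1 = int (N - (k - 1))" using R1(1,2) k by (simp add: of_nat_diff)
        have b: "1 \<le> R1 3" "R1 3 + 1 \<le> X" using R1(1,2) k X by (auto simp: of_nat_diff)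
        define M2 where "M2 = M1(8 := (M1 8)(2 * R1 3 := R1 3, 2 * R1 3 + 1 := R1 3))"
        have h: "M2 8 q = q div 2" if q: "2 \<le> q" "q < 2 * (R1 3 + 1)" for q
        proof -
          have "y < 2 * x \<or> y = 2 * x \<or> y = 2 * x + 1" if "y < 2 * (x + 1)" for x y :: int
            using that by presburger
          from this[OF q(2)] have "q < 2 * R1 3 \<or> q = 2 * R1 3 \<or> q = 2 * R1 3 + 1" .
          then show ?thesis using R1(6)[of q] q by (auto simp: M2_def)
        qed
        have "I (k - 1) (R1(3 := R1 3 + 1), M2)"
          unfolding I_def prod.case
        proof (intro conjI allI impI)
          show "k - 1 < N" using R1(1) by simp
          show "(R1(3 := R1 3 + 1)) 3 = int (N - (k - 1))" using i by simp
          fix q assume "2 \<le> q" "q < 2 * (R1(3 := R1 3 + 1)) 3"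
          then show "M2 8 q = q div 2" using h by simp
        qed (use R1 in \<open>simp_all add: M2_def\<close>)
        then have "wp inp X ?body (I (k - 1)) (R1, M1)" using b by (simp add: M2_def)
        from wp_terminates[OF _ this] have "terminates inp X ?body s 3 (I (k - 1))"
          unfolding s by (rule terminates_mono) simp_all
        then show ?thesis using k by simp
      qed
      show "?Q s" if "aval inp s ?e \<le> 0"
      proof -
        have "k = 0" using that e by simp
        then show ?thesis using R1 by (simp add: s halves_def)
      qed
    qed
  qed (use X1 in simp_all)
  then show ?thesis by (rule terminates_mono) (use N in simp_all)
qed

text \<open>The value of a bit string in binary, most significant bit first, after the digits of \<open>z\<close>.\<close>

definition code_value :: "int \<Rightarrow> bool list \<Rightarrow> int" where
  "code_value z bs = foldl (\<lambda>z b. 2 * z + of_bool b) z bs"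

lemma code_value_simps [simp]:
  "code_value z [] = z" "code_value z (b # bs) = code_value (2 * z + of_bool b) bs"
  by (simp_all add: code_value_def)

lemma code_value_bounds: "z * 2 ^ length bs \<le> code_value z bs \<and> code_value z bs < (z + 1) * 2 ^ length bs"
proof (induction bs arbitrary: z)
  case (Cons b bs)
  let ?P = "2 ^ length bs :: int"
  have "z * 2 ^ length (b # bs) = (2 * z) * ?P" "(z + 1) * 2 ^ length (b # bs) = (2 * z + 2) * ?P" by simp_all
  moreover have "(2 * z) * ?P \<le> (2 * z + of_bool b) * ?P" "(2 * z + of_bool b + 1) * ?P \<le> (2 * z + 2) * ?P"
    by (intro mult_right_mono; simp)+
  ultimately show ?case using Cons[of "2 * z + of_bool b"] unfolding code_value_simps by linarith
qed simp

lemma code_value_inj: "length bs = length bs' \<Longrightarrow> code_value z bs = code_value z' bs' \<Longrightarrow> z = z' \<and> bs = bs'"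
proof (induction bs bs' arbitrary: z z' rule: list_induct2)
  case (Cons b bs b' bs')
  have "code_value (2 * z + of_bool b) bs = code_value (2 * z' + of_bool b') bs'"
    using Cons.prems by (simp only: code_value_simps)
  then have "2 * z + of_bool b = 2 * z' + of_bool b' \<and> bs = bs'" by (rule Cons.IH)
  then have eq: "2 * z + of_bool b = 2 * z' + of_bool b'" and bs: "bs = bs'" by blast+
  have "b = b'" using arg_cong[OF eq, of even] by (cases b; cases b') auto
  then show ?case using eq bs by simp
qed simp

fun horner :: "nat \<Rightarrow> com" where
  "horner 0 = skip"
| "horner (Suc c) = Seq (Assign 8 (Add (Mul (Lit 2) (Reg 8)) (Inp (Reg 4))))
     (Seq (Assign 4 (Add (Reg 4) (Lit 1))) (horner c))"

lemma horner_correct: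
  assumes "R 4 = int p" "0 \<le> R 8" "(R 8 + 1) * 2 ^ length bs \<le> X" "p + length bs \<le> length inp" "int (length inp) \<le> X"
    "\<And>i. i < length bs \<Longrightarrow> inp ! (p + i) = of_bool (bs ! i)"
  shows "terminates inp X (horner (length bs)) (R, M) (2 * length bs + 1) (\<lambda>(R', M'). M' = M \<and>
    R' 8 = code_value (R 8) bs \<and> R' 4 = int (p + length bs) \<and> (\<forall>x. x \<notin> {4, 8, 29} \<longrightarrow> R' x = R x))"
  using assms(1-4,6)
proof (induction bs arbitrary: R p)
  case Nil
  have "0 \<le> X" using assms(5) by linarith
  then have "wp inp X skip (\<lambda>(R', M'). M' = M \<and>
    R' 8 = code_value (R 8) [] \<and> R' 4 = int (p + length []) \<and> (\<forall>x. x \<notin> {4, 8, 29} \<longrightarrow> R' x = R x)) (R, M)"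
    using Nil by simp
  from wp_terminates[OF _ this] show ?case by simp
next
  case (Cons b bs)
  let ?z = "2 * R 8 + of_bool b"
  let ?R = "R(8 := ?z, 4 := int (p + 1))"
  have inp: "inp ! p = of_bool b" using Cons.prems(5)[of 0] by simp
  have one: "(1::int) \<le> 2 ^ length bs" by simp
  have le: "(?z + 1) * 2 ^ length bs \<le> (R 8 + 1) * 2 ^ length (b # bs)"
    by (cases b) (simp_all add: algebra_simps)
  also note Cons.prems(3)
  finally have zX: "(?z + 1) * 2 ^ length bs \<le> X" .
  have z: "0 \<le> ?z" using Cons.prems(2) by simp
  have "?z + 1 \<le> (?z + 1) * 2 ^ length bs" using z one mult_left_mono[of 1 "2 ^ length bs" "?z + 1"] by simp
  then have zX': "\<bar>?z\<bar> \<le> X" using z zX by linarith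
  have IH: "terminates inp X (horner (length bs)) (?R, M) (2 * length bs + 1) (\<lambda>(R', M'). M' = M \<and>
    R' 8 = code_value (?R 8) bs \<and> R' 4 = int (p + 1 + length bs) \<and> (\<forall>x. x \<notin> {4, 8, 29} \<longrightarrow> R' x = ?R x))"
  proof (rule Cons.IH)
    fix i assume "i < length bs"
    then show "inp ! (p + 1 + i) = of_bool (bs ! i)" using Cons.prems(5)[of "Suc i"] by simp
  qed (use z zX Cons.prems(4) in simp_all)
  have "terminates inp X (horner (length (b # bs))) (R, M) (1 + (1 + (2 * length bs + 1))) (\<lambda>(R', M'). M' = M \<and>
    R' 8 = code_value (?R 8) bs \<and> R' 4 = int (p + 1 + length bs) \<and> (\<forall>x. x \<notin> {4, 8, 29} \<longrightarrow> R' x = ?R x))"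
    unfolding list.size add_0_right add_Suc_right horner.simps
  proof (rule terminates_Seq, rule terminates_Assign)
    show "safe inp (R, M) (Add (Mul (Lit 2) (Reg 8)) (Inp (Reg 4)))" using Cons.prems(1,4) by simp
    show "\<bar>aval inp (R, M) (Add (Mul (Lit 2) (Reg 8)) (Inp (Reg 4)))\<bar> \<le> X"
      using Cons.prems(1) inp zX' by simp
    have R1: "R(8 := aval inp (R, M) (Add (Mul (Lit 2) (Reg 8)) (Inp (Reg 4)))) = R(8 := ?z)"
      using Cons.prems(1) inp by simp
    show "terminates inp X (Seq (Assign 4 (Add (Reg 4) (Lit 1))) (horner (length bs)))
      (R(8 := aval inp (R, M) (Add (Mul (Lit 2) (Reg 8)) (Inp (Reg 4)))), M) (1 + (2 * length bs + 1)) (\<lambda>(R', M'). M' = M \<and>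
    R' 8 = code_value (?R 8) bs \<and> R' 4 = int (p + 1 + length bs) \<and> (\<forall>x. x \<notin> {4, 8, 29} \<longrightarrow> R' x = ?R x))"
      unfolding R1
    proof (rule terminates_Seq, rule terminates_Assign)
      have R2: "(R(8 := ?z))(4 := aval inp (R(8 := ?z), M) (Add (Reg 4) (Lit 1))) = ?R"
        using Cons.prems(1) by (simp add: ac_simps)
      show "terminates inp X (horner (length bs)) ((R(8 := ?z))(4 := aval inp (R(8 := ?z), M) (Add (Reg 4) (Lit 1))), M)
        (2 * length bs + 1) (\<lambda>(R', M'). M' = M \<and>
    R' 8 = code_value (?R 8) bs \<and> R' 4 = int (p + 1 + length bs) \<and> (\<forall>x. x \<notin> {4, 8, 29} \<longrightarrow> R' x = ?R x))"
        unfolding R2 by (rule IH)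
    qed (use Cons.prems(1,4) assms(5) in simp_all)
  qed
  then show ?case
    by (rule terminates_mono) auto
qed

lemma nth_concat_uniform:
  assumes "\<And>xs. xs \<in> set xss \<Longrightarrow> length xs = c" "i < length xss" "b < c"
  shows "concat xss ! (c * i + b) = xss ! i ! b"
  using assms
proof (induction xss arbitrary: i)
  case (Cons xs xss)
  show ?case
  proof (cases i)
    case 0
    then show ?thesis using Cons.prems by (simp add: nth_append)
  next
    case (Suc i')
    then show ?thesis using Cons by (simp add: nth_append)
  qed
qed simp

lemma length_concat_uniform: "(\<And>xs. xs \<in> set xss \<Longrightarrow> length xs = c) \<Longrightarrow> length (concat xss) = c * length xss"
  by (induction xss) auto

text \<open>Appends to the letters, from position \<open>R 15\<close> on, the inverse of the word that consists of the \<open>R 17\<close> letters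
  before position \<open>R 16\<close>.\<close>

definition negate_reversed :: com where
  "negate_reversed = Seq (Assign 3 (Lit 0)) (While (Sub (Reg 17) (Reg 3)) (seq [
     Write (Lit 4) (Add (Reg 15) (Reg 3)) (Sub (Lit 0) (Cell (Lit 4) (Sub (Sub (Reg 16) (Lit 1)) (Reg 3)))),
     Assign 3 (Add (Reg 3) (Lit 1))]))"

lemma negate_reversed_correct:
  assumes R: "R 15 = int a" "R 16 = int b" "R 17 = int k" and le: "b \<le> a" "k \<le> b"
    and X: "\<And>t. t < b \<Longrightarrow> \<bar>M 4 (int t)\<bar> \<le> X" "int b \<le> X"
  shows "terminates inp X negate_reversed (R, M) (k * 3 + 2) (\<lambda>(R', M'). (\<forall>x. x \<noteq> 3 \<longrightarrow> R' x = R x) \<and>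
    (\<forall>c. c \<noteq> 4 \<longrightarrow> M' c = M c) \<and> (\<forall>t < a. M' 4 (int t) = M 4 (int t)) \<and>
    (\<forall>t < k. M' 4 (int (a + t)) = - M 4 (int (b - 1 - t))))"
    (is "terminates _ _ _ _ _ ?Q")
proof -
  define I where "I j s \<longleftrightarrow> (case s of (R', M') \<Rightarrow> j \<le> k \<and> R' 3 = int (k - j) \<and> (\<forall>x. x \<noteq> 3 \<longrightarrow> R' x = R x) \<and>
    (\<forall>c. c \<noteq> 4 \<longrightarrow> M' c = M c) \<and> (\<forall>t < a. M' 4 (int t) = M 4 (int t)) \<and>
    (\<forall>t < k - j. M' 4 (int (a + t)) = - M 4 (int (b - 1 - t))))" for j and s :: store
  let ?body = "seq [Write (Lit 4) (Add (Reg 15) (Reg 3)) (Sub (Lit 0) (Cell (Lit 4) (Sub (Sub (Reg 16) (Lit 1)) (Reg 3)))),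
     Assign 3 (Add (Reg 3) (Lit 1))]"
  let ?e = "Sub (Reg 17) (Reg 3)"
  have "terminates inp X negate_reversed (R, M) (1 + (k * (2 + 1) + 1)) ?Q"
    unfolding negate_reversed_def
  proof (rule terminates_Seq, rule terminates_Assign)
    show "terminates inp X (While ?e ?body) (R(3 := aval inp (R, M) (Lit 0)), M) (k * (2 + 1) + 1) ?Q"
    proof (rule terminates_While[of I])
      show "I k (R(3 := aval inp (R, M) (Lit 0)), M)" by (simp add: I_def)
      fix j s assume I: "I j s"
      obtain R1 M1 where s: "s = (R1, M1)" by (cases s)
      have R1: "j \<le> k" "R1 3 = int (k - j)" "R1 15 = int a" "R1 16 = int b" "R1 17 = int k" "\<forall>x. x \<noteq> 3 \<longrightarrow> R1 x = R x"
        "\<forall>c. c \<noteq> 4 \<longrightarrow> M1 c = M c" "\<And>t. t < a \<Longrightarrow> M1 4 (int t) = M 4 (int t)"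
        "\<And>t. t < k - j \<Longrightarrow> M1 4 (int (a + t)) = - M 4 (int (b - 1 - t))"
        using I R by (auto simp: I_def s)
      show "safe inp s ?e" by simp
      have e: "aval inp s ?e = int j" using R1 by (simp add: s of_nat_diff)
      show "j > 0 \<and> terminates inp X ?body s 2 (I (j - 1))" if "aval inp s ?e > 0"
      proof -
        have j: "j > 0" using that e by simp
        define i where "i = k - j"
        have i: "R1 3 = int i" "i < b" "k - (j - 1) = Suc i" using R1(1,2) j le by (auto simp: i_def)
        have idx: "int b - 1 - int i = int (b - 1 - i)" using i by (simp add: of_nat_diff)
        have val: "M1 4 (int b - 1 - int i) = M 4 (int (b - 1 - i))"
          unfolding idx using R1(8)[of "b - 1 - i"] i le by simp
        have vX: "\<bar>M 4 (int (b - 1 - i))\<bar> \<le> X" using X(1)[of "b - 1 - i"] i by simp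
        define M2 where "M2 = M1(4 := (M1 4)(int a + int i := - M 4 (int (b - 1 - i))))"
        have "I (j - 1) (R1(3 := int i + 1), M2)"
          unfolding I_def prod.case i(3)
        proof (intro conjI allI impI)
          show "j - 1 \<le> k" using R1(1) by simp
          fix t assume "t < Suc i"
          then show "M2 4 (int (a + t)) = - M 4 (int (b - 1 - t))"
            using R1(9)[of t] by (cases "t = i") (auto simp: M2_def i_def)
        next
          fix t assume "t < a"
          then show "M2 4 (int t) = M 4 (int t)" using R1(8)[of t] by (simp add: M2_def)
        qed (use R1 in \<open>simp_all add: M2_def\<close>)
        then have "wp inp X ?body (I (j - 1)) (R1, M1)"
          using R1(3,4) i(1,2) val vX idx X(2) by (simp add: M2_def)
        from wp_terminates[OF _ this] have "terminates inp X ?body s 2 (I (j - 1))"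
          unfolding s by (rule terminates_mono) simp_all
        then show ?thesis using j by simp
      qed
      show "?Q s" if "aval inp s ?e \<le> 0"
      proof -
        have "j = 0" using that e by simp
        then show ?thesis using R1 by (simp add: s)
      qed
    qed
  qed (use X(2) in simp_all)
  then show ?thesis by (rule terminates_mono) simp_all
qed

definition parse_letter :: "nat \<Rightarrow> com" where
  "parse_letter c = Seq (Assign 8 (Lit 0)) (Seq (horner c) (seq [
     Write (Lit 4) (Reg 5) (Cell (Lit 3) (Reg 8)),
     Write (Lit 5) (Reg 5) (Reg 6),
     Assign 5 (Add (Reg 5) (Lit 1))]))"

definition parse_separator :: com where
  "parse_separator = seq [Assign 7 (Reg 5), Assign 6 (Lit 2), Assign 4 (Add (Reg 4) (Lit 1))]"

definition parse :: "nat \<Rightarrow> com" where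
  "parse c = Seq (seq [Assign 4 (Lit 0), Assign 5 (Lit 0), Assign 6 (Lit 1), Assign 7 (Lit 0)])
     (While (Sub (Reg 0) (Reg 4)) (If (Sub (Inp (Reg 4)) (Lit 1)) parse_separator (parse_letter c)))"

lemma parse_letter_correct:
  assumes R: "R 4 = int p" "R 5 = int j" "\<bar>R 6\<bar> \<le> X" and bs: "p + length bs \<le> length inp"
    "\<And>i. i < length bs \<Longrightarrow> inp ! (p + i) = of_bool (bs ! i)"
    and X: "2 ^ length bs \<le> X" "int (length inp) \<le> X" "int j + 1 \<le> X" "\<bar>M 3 (code_value 0 bs)\<bar> \<le> X"
  shows "terminates inp X (parse_letter (length bs)) (R, M) (2 * length bs + 5) (\<lambda>(R', M').
    M' = M(4 := (M 4)(int j := M 3 (code_value 0 bs)), 5 := (M 5)(int j := R 6)) \<and>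
    R' 4 = int (p + length bs) \<and> R' 5 = int j + 1 \<and> (\<forall>x. x \<notin> {4, 5, 8, 29} \<longrightarrow> R' x = R x))"
    (is "terminates _ _ _ _ _ ?Q")
proof -
  have X0: "0 \<le> X" using X(3) by linarith
  have h: "terminates inp X (horner (length bs)) (R(8 := 0), M) (2 * length bs + 1) (\<lambda>(R', M'). M' = M \<and>
    R' 8 = code_value ((R(8 := 0)) 8) bs \<and> R' 4 = int (p + length bs) \<and> (\<forall>x. x \<notin> {4, 8, 29} \<longrightarrow> R' x = (R(8 := 0)) x))"
    by (rule horner_correct) (use R bs X in simp_all)
  have "terminates inp X (parse_letter (length bs)) (R, M) (1 + ((2 * length bs + 1) + 3)) ?Q"
    unfolding parse_letter_def
  proof (rule terminates_Seq, rule terminates_Assign)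
    show "terminates inp X (Seq (horner (length bs)) (seq [
       Write (Lit 4) (Reg 5) (Cell (Lit 3) (Reg 8)),
       Write (Lit 5) (Reg 5) (Reg 6),
       Assign 5 (Add (Reg 5) (Lit 1))])) (R(8 := aval inp (R, M) (Lit 0)), M) ((2 * length bs + 1) + 3) ?Q"
      unfolding aval.simps(1)
    proof (rule terminates_Seq_via[OF h])
      fix s1 assume *: "case s1 of (R', M') \<Rightarrow> M' = M \<and>
        R' 8 = code_value ((R(8 := 0)) 8) bs \<and> R' 4 = int (p + length bs) \<and> (\<forall>x. x \<notin> {4, 8, 29} \<longrightarrow> R' x = (R(8 := 0)) x)"
      obtain R1 M1 where s1: "s1 = (R1, M1)" by (cases s1)
      have R1: "M1 = M" "R1 8 = code_value 0 bs" "R1 4 = int (p + length bs)" "\<forall>x. x \<notin> {4, 8, 29} \<longrightarrow> R1 x = R x"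
        using * by (simp_all add: s1)
      have R1': "R1 5 = int j" "R1 6 = R 6" using R1(4) R by simp_all
      have cv: "0 \<le> code_value 0 bs" using code_value_bounds[of 0 bs] by simp
      have "?Q (R1(5 := int j + 1), M(4 := (M 4)(int j := M 3 (code_value 0 bs)), 5 := (M 5)(int j := R 6)))"
        using R1 by simp
      then have "wp inp X (seq [
         Write (Lit 4) (Reg 5) (Cell (Lit 3) (Reg 8)),
         Write (Lit 5) (Reg 5) (Reg 6),
         Assign 5 (Add (Reg 5) (Lit 1))]) ?Q (R1, M1)"
        using R1(1,2) R1' cv X R(3) by simp
      from wp_terminates[OF _ this] show "terminates inp X (seq [
         Write (Lit 4) (Reg 5) (Cell (Lit 3) (Reg 8)),
         Write (Lit 5) (Reg 5) (Reg 6),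
         Assign 5 (Add (Reg 5) (Lit 1))]) s1 3 ?Q"
        unfolding s1 by (rule terminates_mono) simp_all
    qed
  qed (use X0 in simp_all)
  then show ?thesis by (rule terminates_mono) simp_all
qed

lemma parse_separator_correct:
  assumes "\<bar>R 5\<bar> \<le> X" "2 \<le> X" "\<bar>R 4 + 1\<bar> \<le> X" "Q (R(7 := R 5, 6 := 2, 4 := R 4 + 1), M)"
  shows "terminates inp X parse_separator (R, M) 3 Q"
proof -
  have "wp inp X parse_separator Q (R, M)" using assms by (simp add: parse_separator_def)
  from wp_terminates[OF _ this] show ?thesis by (rule terminates_mono) (simp_all add: parse_separator_def)
qed

locale coded_words =
  fixes r c :: nat and code :: "letter \<Rightarrow> bool list" and u v :: word
  assumes code: "\<And>x. x \<in> letters r \<Longrightarrow> length (code x) = c" and c: "1 \<le> c"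
    and u: "u \<in> words r" and v: "v \<in> words r"
begin

abbreviation "m \<equiv> length u"
abbreviation "mq \<equiv> length u + length v"
abbreviation "inp \<equiv> encode_pair code u v"

text \<open>The loop handles \<open>mq + 1\<close> items, one for each letter and one for the separator, which is item \<open>m\<close>.  Before item
  \<open>i\<close>, the program is at position \<open>pos i\<close> of the input and has read \<open>cnt i\<close> letters.\<close>

definition pos :: "nat \<Rightarrow> nat" where
  "pos i = (if i \<le> m then c * i else c * (i - 1) + 1)"

definition cnt :: "nat \<Rightarrow> nat" where
  "cnt i = (if i \<le> m then i else i - 1)"

lemma code_in: "x \<in> set (map code u) \<Longrightarrow> length x = c" "x \<in> set (map code v) \<Longrightarrow> length x = c"
  using u v code by (auto simp: words_def)

lemma length_codes: "length (concat (map code u)) = c * m" "length (concat (map code v)) = c * length v"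
  using length_concat_uniform[of "map code u" c] length_concat_uniform[of "map code v" c] code_in by auto

lemma length_inp: "length inp = c * mq + 1"
  by (simp add: encode_pair_def encode_word_def length_codes algebra_simps)

lemma inp_separator: "inp ! pos m = 2"
  by (simp add: pos_def encode_pair_def encode_word_def nth_append length_codes)

lemma block_le: "i < k \<Longrightarrow> b < c \<Longrightarrow> c * i + b < c * k"
proof -
  assume "i < k" "b < c"
  then have "c * i + b < c * (i + 1)" by simp
  also have "\<dots> \<le> c * k" using \<open>i < k\<close> by (intro mult_le_mono2) simp
  finally show ?thesis .
qed

lemma inp_letter:
  assumes "i \<le> mq" "i \<noteq> m" "b < c"
  shows "inp ! (pos i + b) = of_bool (code ((u @ v) ! cnt i) ! b)"
proof (cases "i < m")
  case True
  have "concat (map code u) ! (c * i + b) = map code u ! i ! b"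
    using True assms(3) code_in by (intro nth_concat_uniform) auto
  then show ?thesis using True assms(3) block_le[OF True assms(3)]
    by (simp add: pos_def cnt_def encode_pair_def encode_word_def nth_append length_codes)
next
  case False
  define j where "j = i - 1 - m"
  have j: "j < length v" "i = m + 1 + j" using False assms by (auto simp: j_def)
  have p: "pos i + b = c * m + 1 + (c * j + b)" using j by (simp add: pos_def algebra_simps)
  have "concat (map code v) ! (c * j + b) = map code v ! j ! b"
    using j assms(3) code_in by (intro nth_concat_uniform) auto
  then show ?thesis using j assms(3) block_le[OF j(1) assms(3)] unfolding p
    by (simp add: cnt_def encode_pair_def encode_word_def nth_append length_codes)
qed

lemma pos_cnt_step:
  assumes "i \<le> mq"
  shows "i \<noteq> m \<Longrightarrow> pos (Suc i) = pos i + c" "i \<noteq> m \<Longrightarrow> cnt (Suc i) = cnt i + 1" "i \<noteq> m \<Longrightarrow> cnt i < mq"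
    "pos (Suc m) = pos m + 1" "cnt (Suc m) = cnt m" "cnt i \<le> mq" "pos i + 1 \<le> length inp"
    "i \<noteq> m \<Longrightarrow> pos i + c \<le> length inp"
proof -
  show *: "pos (Suc i) = pos i + c" if im: "i \<noteq> m"
  proof (cases "i < m")
    case False
    then obtain j where "i = Suc j" using im by (cases i) auto
    then show ?thesis using False im by (simp add: pos_def)
  qed (simp add: pos_def)
  show "i \<noteq> m \<Longrightarrow> cnt (Suc i) = cnt i + 1" "i \<noteq> m \<Longrightarrow> cnt i < mq" "cnt i \<le> mq"
    using assms by (auto simp: cnt_def)
  show "pos (Suc m) = pos m + 1" "cnt (Suc m) = cnt m" by (simp_all add: pos_def cnt_def)
  have le: "pos j \<le> c * mq + 1" if "j \<le> mq + 1" for j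
  proof (cases "j \<le> m")
    case True
    then have "c * j \<le> c * mq" by (intro mult_le_mono2) simp
    then have "c * j \<le> c * mq + 1" by (rule trans_le_add1)
    moreover have "pos j = c * j" using True by (simp add: pos_def)
    ultimately show ?thesis by (simp only:)
  next
    case False
    then have "c * (j - 1) \<le> c * mq" using that by (intro mult_le_mono2) simp
    moreover have "pos j = c * (j - 1) + 1" using False by (simp add: pos_def)
    ultimately show ?thesis by (simp only: add_le_mono1)
  qed
  show 1: "i \<noteq> m \<Longrightarrow> pos i + c \<le> length inp" using * le[of "Suc i"] assms length_inp by simp
  show "pos i + 1 \<le> length inp"
  proof (cases "i = m")
    case True
    have "c * m \<le> c * mq" by (intro mult_le_mono2) simp
    moreover have "pos i = c * m" using True by (simp add: pos_def)
    ultimately show ?thesis unfolding length_inp by (simp only: add_le_mono1)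
  next
    case False
    then show ?thesis using 1 c by simp
  qed
qed

definition segment :: "nat \<Rightarrow> int" where
  "segment t = (if t < m then 1 else if t < mq then 2 else 0)"

lemma parse_correct:
  assumes R0: "R 0 = int (length inp)" and table: "\<And>x. x \<in> letters r \<Longrightarrow> M 3 (code_value 0 (code x)) = letter_int x"
    and X: "2 ^ c \<le> X" "int (length inp) \<le> X" "int r \<le> X" "2 \<le> X"
  shows "terminates inp X (parse c) (R, M) ((mq + 1) * (2 * c + 7) + 5) (\<lambda>(R', M').
    R' 5 = int mq \<and> R' 7 = int m \<and> (\<forall>x. x \<notin> {4, 5, 6, 7, 8, 29} \<longrightarrow> R' x = R x) \<and>
    (\<forall>a. a \<notin> {4, 5} \<longrightarrow> M' a = M a) \<and>
    (\<forall>t < mq. M' 4 (int t) = letter_int ((u @ v) ! t) \<and> M' 5 (int t) = segment t) \<and>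
    (\<forall>t \<ge> mq. M' 5 (int t) = M 5 (int t)))"
    (is "terminates _ _ _ _ _ ?Q")
proof -
  have mqX: "int mq + 1 \<le> X"
  proof -
    have "1 * mq \<le> c * mq" by (rule mult_le_mono1) (rule c)
    then have "int (mq + 1) \<le> int (length inp)" unfolding length_inp of_nat_le_iff by simp
    then show ?thesis using X(2) by simp
  qed
  define I where "I k s \<longleftrightarrow> (case s of (R', M') \<Rightarrow> let i = mq + 1 - k in k \<le> mq + 1 \<and>
    R' 4 = int (pos i) \<and> R' 5 = int (cnt i) \<and> R' 6 = (if i \<le> m then 1 else 2) \<and> R' 7 = (if i \<le> m then 0 else int m) \<and>
    (\<forall>x. x \<notin> {4, 5, 6, 7, 8, 29} \<longrightarrow> R' x = R x) \<and> (\<forall>a. a \<notin> {4, 5} \<longrightarrow> M' a = M a) \<and>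
    (\<forall>t < cnt i. M' 4 (int t) = letter_int ((u @ v) ! t) \<and> M' 5 (int t) = segment t) \<and>
    (\<forall>t \<ge> cnt i. M' 5 (int t) = M 5 (int t)))" for k and s :: store
  let ?e = "Sub (Reg 0) (Reg 4)"
  let ?body = "If (Sub (Inp (Reg 4)) (Lit 1)) parse_separator (parse_letter c)"
  have "I (mq + 1) (R(4 := 0, 5 := 0, 6 := 1, 7 := 0), M)"
    by (simp add: I_def pos_def cnt_def)
  then have "wp inp X (seq [Assign 4 (Lit 0), Assign 5 (Lit 0), Assign 6 (Lit 1), Assign 7 (Lit 0)]) (I (mq + 1)) (R, M)"
    using X(4) by simp
  from wp_terminates[OF _ this]
  have 1: "terminates inp X (seq [Assign 4 (Lit 0), Assign 5 (Lit 0), Assign 6 (Lit 1), Assign 7 (Lit 0)]) (R, M) 4 (I (mq + 1))"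
    by (rule terminates_mono) simp_all
  have "terminates inp X (parse c) (R, M) (4 + ((mq + 1) * ((2 * c + 5 + 1) + 1) + 1)) ?Q"
    unfolding parse_def
  proof (rule terminates_Seq_via[OF 1], rule terminates_While[of I])
    fix k s assume I: "I k s"
    define i where "i = mq + 1 - k"
    obtain R1 M1 where s: "s = (R1, M1)" by (cases s)
    have R1: "k \<le> mq + 1" "R1 4 = int (pos i)" "R1 5 = int (cnt i)" "R1 6 = (if i \<le> m then 1 else 2)"
      "R1 7 = (if i \<le> m then 0 else int m)" "\<forall>x. x \<notin> {4, 5, 6, 7, 8, 29} \<longrightarrow> R1 x = R x" "\<forall>a. a \<notin> {4, 5} \<longrightarrow> M1 a = M a"
      "\<And>t. t < cnt i \<Longrightarrow> M1 4 (int t) = letter_int ((u @ v) ! t) \<and> M1 5 (int t) = segment t"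
      "\<And>t. cnt i \<le> t \<Longrightarrow> M1 5 (int t) = M 5 (int t)"
      using I by (simp_all add: I_def s i_def Let_def)
    show "safe inp s ?e" by simp
    have e: "aval inp s ?e = int (length inp) - int (pos i)" using R1(2,6) R0 by (simp add: s)
    have pos_end: "pos (mq + 1) = length inp" "cnt (mq + 1) = mq" by (simp_all add: pos_def cnt_def length_inp)
    have k: "aval inp s ?e > 0 \<longleftrightarrow> k > 0"
    proof (cases "k = 0")
      case True
      then show ?thesis using e pos_end by (simp add: i_def)
    next
      case False
      then have "i \<le> mq" by (simp add: i_def)
      from pos_cnt_step(7)[OF this] show ?thesis using e False by simp
    qed
    show "k > 0 \<and> terminates inp X ?body s (2 * c + 5 + 1) (I (k - 1))" if "aval inp s ?e > 0"
    proof -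
      have k0: "k > 0" using that k by simp
      have i: "i \<le> mq" "mq + 1 - (k - 1) = Suc i" using k0 R1(1) by (auto simp: i_def)
      note st = pos_cnt_step[OF i(1)]
      have "terminates inp X ?body (R1, M1) (2 * c + 5 + 1) (I (k - 1))"
      proof (rule terminates_If)
        have lt: "pos i < length inp" using st(7) by simp
        then show "safe inp (R1, M1) (Sub (Inp (Reg 4)) (Lit 1))" using R1(2) by simp
        have val: "aval inp (R1, M1) (Sub (Inp (Reg 4)) (Lit 1)) = inp ! pos i - 1" using R1(2) by simp
        have le1: "inp ! pos i \<le> 1" if "i \<noteq> m" using inp_letter[OF i(1) that, of 0] c by simp
        {
          assume "0 < aval inp (R1, M1) (Sub (Inp (Reg 4)) (Lit 1))"
          then have im: "i = m" using val le1 by force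
          have "I (k - 1) (R1(7 := R1 5, 6 := 2, 4 := R1 4 + 1), M1)"
            unfolding I_def prod.case Let_def i(2)
          proof (intro conjI allI impI)
            show "k - 1 \<le> mq + 1" using R1(1) by simp
            show "(R1(7 := R1 5, 6 := 2, 4 := R1 4 + 1)) 4 = int (pos (Suc i))" using R1(2) st(4) im by simp
            show "(R1(7 := R1 5, 6 := 2, 4 := R1 4 + 1)) 5 = int (cnt (Suc i))" using R1(3) st(5) im by simp
            show "(R1(7 := R1 5, 6 := 2, 4 := R1 4 + 1)) 6 = (if Suc i \<le> m then 1 else 2)" using im by simp
            show "(R1(7 := R1 5, 6 := 2, 4 := R1 4 + 1)) 7 = (if Suc i \<le> m then 0 else int m)"
              using R1(3) im by (simp add: cnt_def)
            show "M1 4 (int t) = letter_int ((u @ v) ! t)" "M1 5 (int t) = segment t" if "t < cnt (Suc i)" for t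
              using R1(8)[of t] that st(5) im by simp_all
            show "M1 5 (int t) = M 5 (int t)" if "cnt (Suc i) \<le> t" for t
              using R1(9)[of t] that st(5) im by simp
          qed (use R1(6,7) in simp_all)
          moreover have "\<bar>R1 5\<bar> \<le> X" "\<bar>R1 4 + 1\<bar> \<le> X" using R1(2,3) st(6,7) X(2) mqX by simp_all
          ultimately have "terminates inp X parse_separator (R1, M1) 3 (I (k - 1))"
            using X(4) by (intro parse_separator_correct)
          then show "terminates inp X parse_separator (R1, M1) (2 * c + 5) (I (k - 1))"
            by (rule terminates_mono) simp_all
        }
        {
          assume "aval inp (R1, M1) (Sub (Inp (Reg 4)) (Lit 1)) \<le> 0"
          then have im: "i \<noteq> m" using val inp_separator by auto
          define j where "j = cnt i"
          define y where "y = (u @ v) ! j"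
          have j: "j < mq" using st(3)[OF im] by (simp add: j_def)
          have y: "y \<in> letters r" using u v j nth_mem[of j "u @ v"] unfolding y_def words_def by auto
          have tb: "M1 3 (code_value 0 (code y)) = letter_int y" using R1(7) table[OF y] by simp
          have yX: "\<bar>letter_int y\<bar> \<le> X" using letter_int_letters[OF y] X(3) by auto
          have jX: "int j + 1 \<le> X" using j mqX by simp
          have bits: "\<And>b. b < length (code y) \<Longrightarrow> inp ! (pos i + b) = of_bool (code y ! b)"
            using inp_letter[OF i(1) im] code[OF y] by (simp add: y_def j_def)
          have "terminates inp X (parse_letter (length (code y))) (R1, M1) (2 * length (code y) + 5) (\<lambda>(R', M').
              M' = M1(4 := (M1 4)(int j := M1 3 (code_value 0 (code y))), 5 := (M1 5)(int j := R1 6)) \<and>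
              R' 4 = int (pos i + length (code y)) \<and> R' 5 = int j + 1 \<and> (\<forall>x. x \<notin> {4, 5, 8, 29} \<longrightarrow> R' x = R1 x))"
            using R1(2-4) st(8)[OF im] code[OF y] X bits tb yX jX
            by (intro parse_letter_correct) (simp_all add: j_def)
          then show "terminates inp X (parse_letter c) (R1, M1) (2 * c + 5) (I (k - 1))"
            unfolding code[OF y] tb
          proof (rule terminates_mono)
            fix s' assume A: "case s' of (R', M') \<Rightarrow>
              M' = M1(4 := (M1 4)(int j := letter_int y), 5 := (M1 5)(int j := R1 6)) \<and>
              R' 4 = int (pos i + c) \<and> R' 5 = int j + 1 \<and> (\<forall>x. x \<notin> {4, 5, 8, 29} \<longrightarrow> R' x = R1 x)"
            obtain R2 M2 where s': "s' = (R2, M2)" by (cases s')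
            have R2: "M2 = M1(4 := (M1 4)(int j := letter_int y), 5 := (M1 5)(int j := R1 6))"
              "R2 4 = int (pos i + c)" "R2 5 = int j + 1" "\<forall>x. x \<notin> {4, 5, 8, 29} \<longrightarrow> R2 x = R1 x"
              using A by (simp_all add: s')
            have seg_j: "R1 6 = segment j" using R1(4) im j i(1) by (auto simp: segment_def j_def cnt_def)
            have S: "cnt (Suc i) = Suc j" "pos (Suc i) = pos i + c" using st(1,2) im by (simp_all add: j_def)
            have Sm: "Suc i \<le> m \<longleftrightarrow> i \<le> m" using im by auto
            show "I (k - 1) s'"
              unfolding s' I_def prod.case Let_def i(2) S Sm
            proof (intro conjI allI impI)
              show "k - 1 \<le> mq + 1" using R1(1) by simp
              show "R2 4 = int (pos i + c)" "R2 5 = int (Suc j)" using R2(2,3) by simp_all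
              show "R2 6 = (if i \<le> m then 1 else 2)" "R2 7 = (if i \<le> m then 0 else int m)" using R2(4) R1(4,5) by simp_all
              show "M2 4 (int t) = letter_int ((u @ v) ! t)" "M2 5 (int t) = segment t" if "t < Suc j" for t
                using R1(8)[of t] that seg_j by (cases "t = j"; simp add: R2(1) y_def j_def)+
              show "M2 5 (int t) = M 5 (int t)" if "Suc j \<le> t" for t
                using R1(9)[of t] that by (simp add: R2(1) j_def)
              show "R2 x = R x" if "x \<notin> {4, 5, 6, 7, 8, 29}" for x using R2(4) R1(6) that by simp
              show "M2 a = M a" if "a \<notin> {4, 5}" for a using R1(7) that by (simp add: R2(1))
            qed
          qed simp
        }
      qed
      then show ?thesis using k0 by (simp add: s)
    qed
    show "?Q s" if "aval inp s ?e \<le> 0"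
    proof -
      have "k = 0" using that k by auto
      then have im: "i = mq + 1" by (simp add: i_def)
      have "\<not> i \<le> m" using im by simp
      then show ?thesis using R1(3,5-9) pos_end(2) by (simp add: s im)
    qed
  qed
  then show ?thesis by (rule terminates_mono) simp_all
qed

end

section \<open>The algorithm\<close>

definition letter_list :: "nat \<Rightarrow> letter list" where
  "letter_list r = List.product [1..<Suc r] [True, False]"

lemma set_letter_list: "set (letter_list r) = letters r" and distinct_letter_list: "distinct (letter_list r)"
  by (auto simp: letter_list_def letters_def distinct_product)

lemma length_letter_list: "length (letter_list r) = 2 * r"
  by (simp add: letter_list_def)

definition code_table :: "nat \<Rightarrow> (letter \<Rightarrow> bool list) \<Rightarrow> (int \<times> int) list" where
  "code_table r code = map (\<lambda>x. (code_value 0 (code x), letter_int x)) (letter_list r)"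

definition read_input :: "nat \<Rightarrow> nat \<Rightarrow> (letter \<Rightarrow> bool list) \<Rightarrow> com" where
  "read_input r c code = Seq (table (code_table r code)) (parse c)"

text \<open>Turns \<open>u v\<close> into \<open>u v u\<inverse> v\<inverse>\<close>.\<close>

definition append_inverses :: com where
  "append_inverses = Seq
     (seq [Assign 9 (Reg 5), Assign 10 (Add (Reg 5) (Reg 5)), Assign 15 (Reg 5), Assign 16 (Reg 7), Assign 17 (Reg 7)])
     (Seq negate_reversed (Seq
       (seq [Assign 15 (Add (Reg 9) (Reg 7)), Assign 16 (Reg 9), Assign 17 (Sub (Reg 9) (Reg 7))])
       negate_reversed))"

text \<open>The number \<open>N\<close> of leaves has to exceed the number \<open>d n\<close> of letters processed at all levels by at least \<open>10 + r\<close>.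
  The entry of the table that maps the pair \<open>(0, 0)\<close> to 0, stored as 1, makes 0 the identifier of the zero
  flow at nodes of any height; so the cells of the tree have the right content initially.\<close>

definition prepare :: "nat \<Rightarrow> nat \<Rightarrow> com" where
  "prepare r d = Seq (grow (2 * d + 2) (r + 11)) (Seq fill_halves (seq [
     Write (Reg 2) (Reg 2) (Lit 1),
     Assign 11 (Lit 1), Assign 12 (Lit 1), Assign 13 (Lit 0), Assign 14 (Lit (int d))]))"

definition exponent_com :: "nat \<Rightarrow> com" where
  "exponent_com d = Seq (find_nonzero d) (Seq find_exponent (check_exponent d))"

definition main :: "nat \<Rightarrow> nat \<Rightarrow> nat \<Rightarrow> (letter \<Rightarrow> bool list) \<Rightarrow> com" where
  "main r d c code = Seq (read_input r c code) (Seq append_inverses (Seq (prepare r d) (Seq levels (exponent_com d))))"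

context coded_words
begin

lemma read_input_correct:
  assumes inj: "inj_on code (letters r)" and R0: "R 0 = int (length inp)" and M0: "M = (\<lambda>_ _. 0)"
    and X: "2 ^ c \<le> X" "int (length inp) \<le> X" "int r \<le> X" "2 \<le> X"
  shows "terminates inp X (read_input r c code) (R, M) ((2 * r + 1) + ((mq + 1) * (2 * c + 7) + 5)) (\<lambda>(R', M').
    R' 5 = int mq \<and> R' 7 = int m \<and> R' 0 = R 0 \<and>
    (\<forall>a. a \<notin> {3, 4, 5} \<longrightarrow> M' a = (\<lambda>_. 0)) \<and>
    (\<forall>t < mq. M' 4 (int t) = letter_int ((u @ v) ! t) \<and> M' 5 (int t) = segment t) \<and>
    (\<forall>t \<ge> mq. M' 5 (int t) = 0))"
    (is "terminates _ _ _ _ _ ?Q")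
  unfolding read_input_def
proof (rule terminates_Seq_via)
  have len: "length (code x) = c" if "x \<in> letters r" for x using code that .
  have "inj_on (\<lambda>x. code_value 0 (code x)) (letters r)"
  proof (rule inj_onI)
    fix x y assume xy: "x \<in> letters r" "y \<in> letters r" "code_value 0 (code x) = code_value 0 (code y)"
    then have "code x = code y" using code_value_inj[of "code x" "code y"] len by simp
    then show "x = y" using inj xy by (simp add: inj_on_def)
  qed
  then have dist: "distinct (map fst (code_table r code))"
    by (simp add: code_table_def comp_def distinct_map distinct_letter_list set_letter_list)
  have ok: "0 \<le> fst p \<and> \<bar>snd p\<bar> \<le> X" if pm: "p \<in> set (code_table r code)" for p
  proof -
    obtain x where x: "x \<in> letters r" "p = (code_value 0 (code x), letter_int x)"
      using pm by (auto simp: code_table_def set_letter_list)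
    then show ?thesis using code_value_bounds[of 0 "code x"] letter_int_letters[OF x(1)] X(3) by auto
  qed
  have "terminates inp X (table (code_table r code)) (R, M) (length (code_table r code) + 1) (\<lambda>(R', M').
    (\<forall>x. x \<noteq> 29 \<longrightarrow> R' x = R x) \<and> (\<forall>a. a \<noteq> 3 \<longrightarrow> M' a = M a) \<and>
    (\<forall>z. z \<notin> fst ` set (code_table r code) \<longrightarrow> M' 3 z = M 3 z) \<and> (\<forall>p \<in> set (code_table r code). M' 3 (fst p) = snd p))"
    using dist ok X(4) by (intro table_correct) auto
  then show "terminates inp X (table (code_table r code)) (R, M) (2 * r + 1) (\<lambda>(R', M').
    (\<forall>x. x \<noteq> 29 \<longrightarrow> R' x = R x) \<and> (\<forall>a. a \<noteq> 3 \<longrightarrow> M' a = M a) \<and>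
    (\<forall>z. z \<notin> fst ` set (code_table r code) \<longrightarrow> M' 3 z = M 3 z) \<and> (\<forall>p \<in> set (code_table r code). M' 3 (fst p) = snd p))"
    by (simp add: code_table_def length_letter_list)
  fix s1 assume *: "case s1 of (R', M') \<Rightarrow>
    (\<forall>x. x \<noteq> 29 \<longrightarrow> R' x = R x) \<and> (\<forall>a. a \<noteq> 3 \<longrightarrow> M' a = M a) \<and>
    (\<forall>z. z \<notin> fst ` set (code_table r code) \<longrightarrow> M' 3 z = M 3 z) \<and> (\<forall>p \<in> set (code_table r code). M' 3 (fst p) = snd p)"
  obtain R1 M1 where s1: "s1 = (R1, M1)" by (cases s1)
  have R1: "R1 0 = R 0" "\<And>a. a \<noteq> 3 \<Longrightarrow> M1 a = M a" "\<And>p. p \<in> set (code_table r code) \<Longrightarrow> M1 3 (fst p) = snd p"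
    using * by (simp_all add: s1)
  have tb: "M1 3 (code_value 0 (code x)) = letter_int x" if "x \<in> letters r" for x
    using R1(3)[of "(code_value 0 (code x), letter_int x)"] that by (auto simp: code_table_def set_letter_list)
  have R10: "R1 0 = int (length inp)" using R1(1) R0 by simp
  show "terminates inp X (parse c) s1 ((mq + 1) * (2 * c + 7) + 5) ?Q"
    unfolding s1
  proof (rule terminates_mono[OF parse_correct[where R = R1 and M = M1, OF R10 tb X] order.refl])
    fix s2 assume A: "case s2 of (R', M') \<Rightarrow>
      R' 5 = int mq \<and> R' 7 = int m \<and> (\<forall>x. x \<notin> {4, 5, 6, 7, 8, 29} \<longrightarrow> R' x = R1 x) \<and>
      (\<forall>a. a \<notin> {4, 5} \<longrightarrow> M' a = M1 a) \<and>
      (\<forall>t < mq. M' 4 (int t) = letter_int ((u @ v) ! t) \<and> M' 5 (int t) = segment t) \<and>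
      (\<forall>t \<ge> mq. M' 5 (int t) = M1 5 (int t))"
    obtain R2 M2 where s2: "s2 = (R2, M2)" by (cases s2)
    show "?Q s2" using A R1(1,2) M0 by (simp add: s2)
  qed
qed

end

locale power_run_coded = power_run r d H u v X "encode_pair code u v" + input: coded_words r c code u v
  for r c code u v d H X +
  assumes inj: "inj_on code (letters r)"
    and H: "H = ceillog2 ((2 * d + 2) * length (encode_pair code u v) + (r + 11))"
    and X2: "2 ^ c \<le> X" "int (length (encode_pair code u v)) \<le> X" "int r \<le> X"
    and X3: "(int n + 1) * int (d * n + 1) \<le> X"
begin

abbreviation "inp \<equiv> encode_pair code u v"

lemma word_ints_first: "t < mq \<Longrightarrow> word_ints w t = letter_int ((u @ v) ! t)"
proof -
  assume "t < mq"
  then have "((u @ v) @ inv_word u @ inv_word v) ! t = (u @ v) ! t" by (subst nth_append) simp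
  then show ?thesis by (simp add: word_ints_def)
qed

lemma word_ints_inverses:
  shows "t < m \<Longrightarrow> word_ints w (mq + t) = - word_ints w (m - 1 - t)"
    "t < length v \<Longrightarrow> word_ints w (mq + m + t) = - word_ints w (mq - 1 - t)"
proof -
  have split: "w ! (mq + t) = (inv_word u @ inv_word v) ! t" for t
  proof -
    have "((u @ v) @ inv_word u @ inv_word v) ! (mq + t) = (inv_word u @ inv_word v) ! t"
      by (subst nth_append) simp
    then show ?thesis by simp
  qed
  show "word_ints w (mq + t) = - word_ints w (m - 1 - t)" if "t < m"
  proof -
    have "w ! (mq + t) = inv_letter (u ! (m - 1 - t))"
      unfolding split using that by (simp add: nth_append inv_word_def rev_nth)
    moreover have "word_ints w (m - 1 - t) = letter_int (u ! (m - 1 - t))"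
      using word_ints_first[of "m - 1 - t"] that by (cases "m - 1 - t < m") (simp_all add: nth_append)
    ultimately show ?thesis by (simp add: word_ints_def letter_int_inv)
  qed
  show "word_ints w (mq + m + t) = - word_ints w (mq - 1 - t)" if "t < length v"
  proof -
    have "w ! (mq + (m + t)) = inv_letter (v ! (length v - 1 - t))"
      unfolding split using that by (simp add: nth_append inv_word_def rev_nth)
    moreover have "mq - 1 - t = m + (length v - 1 - t)" "m + (length v - 1 - t) < mq" using that by simp_all
    then have "word_ints w (mq - 1 - t) = letter_int (v ! (length v - 1 - t))"
      using word_ints_first[of "m + (length v - 1 - t)"] by (simp only: nth_append_length_plus)
    ultimately show ?thesis by (simp add: word_ints_def letter_int_inv add.assoc)
  qed
qed

lemma word_ints_abs_le: "t < n \<Longrightarrow> \<bar>word_ints w t\<bar> \<le> X"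
  using word_ints_letters[of t] X2(3) by linarith

lemma segment_seg: "input.segment t = seg t"
  by (simp add: input.segment_def seg_def)

lemma append_inverses_correct:
  assumes R: "R 5 = int mq" "R 7 = int m" and M4: "\<And>t. t < mq \<Longrightarrow> M 4 (int t) = word_ints w t"
  shows "terminates inp X append_inverses (R, M) (5 + ((m * 3 + 2) + (3 + (length v * 3 + 2)))) (\<lambda>(R', M').
    R' 0 = R 0 \<and> R' 7 = int m \<and> R' 9 = int mq \<and> R' 10 = int n \<and>
    (\<forall>a. a \<noteq> 4 \<longrightarrow> M' a = M a) \<and> (\<forall>t < n. M' 4 (int t) = word_ints w t))"
    (is "terminates _ _ _ _ _ ?Q")
  unfolding append_inverses_def
proof (rule terminates_Seq_via)
  let ?R = "R(9 := int mq, 10 := int mq + int mq, 15 := int mq, 16 := int m, 17 := int m)"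
  have nX': "int mq + int mq \<le> X" using nX by simp
  show "terminates inp X (seq [Assign 9 (Reg 5), Assign 10 (Add (Reg 5) (Reg 5)), Assign 15 (Reg 5), Assign 16 (Reg 7), Assign 17 (Reg 7)])
    (R, M) 5 (\<lambda>s. s = (?R, M))"
    by (rule loop_free_terminates) (use R nX' in simp_all)
  fix s1 assume s1: "s1 = (?R, M)"
  have M4X: "\<bar>M 4 (int t)\<bar> \<le> X" if "t < mq" for t using M4[OF that] word_ints_abs_le[of t] that by simp
  show "terminates inp X (Seq negate_reversed (Seq
       (seq [Assign 15 (Add (Reg 9) (Reg 7)), Assign 16 (Reg 9), Assign 17 (Sub (Reg 9) (Reg 7))])
       negate_reversed)) s1 ((m * 3 + 2) + (3 + (length v * 3 + 2))) ?Q"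
    unfolding s1
  proof (rule terminates_Seq_via)
    show "terminates inp X negate_reversed (?R, M) (m * 3 + 2) (\<lambda>(R', M'). (\<forall>x. x \<noteq> 3 \<longrightarrow> R' x = ?R x) \<and>
      (\<forall>c. c \<noteq> 4 \<longrightarrow> M' c = M c) \<and> (\<forall>t < mq. M' 4 (int t) = M 4 (int t)) \<and>
      (\<forall>t < m. M' 4 (int (mq + t)) = - M 4 (int (m - 1 - t))))"
      using M4X nX' by (intro negate_reversed_correct) simp_all
    fix s2 assume A: "case s2 of (R', M') \<Rightarrow> (\<forall>x. x \<noteq> 3 \<longrightarrow> R' x = ?R x) \<and>
      (\<forall>c. c \<noteq> 4 \<longrightarrow> M' c = M c) \<and> (\<forall>t < mq. M' 4 (int t) = M 4 (int t)) \<and>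
      (\<forall>t < m. M' 4 (int (mq + t)) = - M 4 (int (m - 1 - t)))"
    obtain R2 M2 where s2: "s2 = (R2, M2)" by (cases s2)
    have R2: "\<And>x. x \<noteq> 3 \<Longrightarrow> R2 x = ?R x" "\<And>c. c \<noteq> 4 \<Longrightarrow> M2 c = M c" "\<And>t. t < mq \<Longrightarrow> M2 4 (int t) = M 4 (int t)"
      "\<And>t. t < m \<Longrightarrow> M2 4 (int (mq + t)) = - M 4 (int (m - 1 - t))"
      using A by (simp_all add: s2)
    have M2: "M2 4 (int t) = word_ints w t" if "t < mq + m" for t
    proof (cases "t < mq")
      case True
      then show ?thesis using R2(3) M4 by simp
    next
      case False
      then have t: "t = mq + (t - mq)" "t - mq < m" using that by auto
      have "M2 4 (int (mq + (t - mq))) = - word_ints w (m - 1 - (t - mq))"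
        using R2(4)[OF t(2)] M4[of "m - 1 - (t - mq)"] t(2) by simp
      also have "\<dots> = word_ints w (mq + (t - mq))" using word_ints_inverses(1)[OF t(2)] by simp
      finally show ?thesis using t(1) by simp
    qed
    have Rv: "R2 9 = int mq" "R2 7 = int m" "R2 0 = R 0" "R2 10 = int mq + int mq"
      using R2(1)[of 9] R2(1)[of 7] R2(1)[of 0] R2(1)[of 10] R by simp_all
    let ?R2 = "R2(15 := int (mq + m), 16 := int mq, 17 := int (length v))"
    show "terminates inp X (Seq
       (seq [Assign 15 (Add (Reg 9) (Reg 7)), Assign 16 (Reg 9), Assign 17 (Sub (Reg 9) (Reg 7))])
       negate_reversed) s2 (3 + (length v * 3 + 2)) ?Q"
      unfolding s2
    proof (rule terminates_Seq_via)
      show "terminates inp X (seq [Assign 15 (Add (Reg 9) (Reg 7)), Assign 16 (Reg 9), Assign 17 (Sub (Reg 9) (Reg 7))])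
        (R2, M2) 3 (\<lambda>s. s = (?R2, M2))"
        by (rule loop_free_terminates) (use Rv nX' in simp_all)
      fix s3 assume s3: "s3 = (?R2, M2)"
      show "terminates inp X negate_reversed s3 (length v * 3 + 2) ?Q"
        unfolding s3
      proof (rule terminates_mono[OF negate_reversed_correct[where a = "mq + m" and b = mq and k = "length v"] order.refl])
        show "\<bar>M2 4 (int t)\<bar> \<le> X" if "t < mq" for t using M2[of t] word_ints_abs_le[of t] that by simp
        fix s4 assume A4: "case s4 of (R', M') \<Rightarrow> (\<forall>x. x \<noteq> 3 \<longrightarrow> R' x = ?R2 x) \<and>
          (\<forall>c. c \<noteq> 4 \<longrightarrow> M' c = M2 c) \<and> (\<forall>t < mq + m. M' 4 (int t) = M2 4 (int t)) \<and>
          (\<forall>t < length v. M' 4 (int (mq + m + t)) = - M2 4 (int (mq - 1 - t)))"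
        obtain R4 M4' where s4: "s4 = (R4, M4')" by (cases s4)
        have R4: "\<And>x. x \<noteq> 3 \<Longrightarrow> R4 x = ?R2 x" "\<And>c. c \<noteq> 4 \<Longrightarrow> M4' c = M2 c" "\<And>t. t < mq + m \<Longrightarrow> M4' 4 (int t) = M2 4 (int t)"
          "\<And>t. t < length v \<Longrightarrow> M4' 4 (int (mq + m + t)) = - M2 4 (int (mq - 1 - t))"
          using A4 by (simp_all add: s4)
        have "M4' 4 (int t) = word_ints w t" if "t < n" for t
        proof (cases "t < mq + m")
          case True
          then show ?thesis using R4(3) M2 by simp
        next
          case False
          then have t: "t = mq + m + (t - (mq + m))" "t - (mq + m) < length v" using that by auto
          have "M4' 4 (int (mq + m + (t - (mq + m)))) = - word_ints w (mq - 1 - (t - (mq + m)))"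
            using R4(4)[OF t(2)] M2[of "mq - 1 - (t - (mq + m))"] t(2) by simp
          also have "\<dots> = word_ints w (mq + m + (t - (mq + m)))" using word_ints_inverses(2)[OF t(2)] by simp
          finally show ?thesis using t(1) by simp
        qed
        then show "?Q s4" using R4(1)[of 0] R4(1)[of 7] R4(1)[of 9] R4(1)[of 10] R4(2) R2(2) Rv by (simp add: s4)
      qed (use nX' in simp_all)
    qed
  qed
qed

lemma N_large: "int ((2 * d + 2) * length inp + (r + 11)) \<le> N"
proof -
  have "(2 * d + 2) * length inp + (r + 11) \<le> 2 ^ H" unfolding H by (subst ceillog2_le_iff[symmetric]) simp_all
  then have "int ((2 * d + 2) * length inp + (r + 11)) \<le> int (2 ^ H)" by (rule of_nat_mono)
  then show ?thesis by simp
qed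

lemma prepare_correct:
  assumes R: "R 0 = int (length inp)" "R 7 = int m" "R 9 = int mq" "R 10 = int n"
    and M: "\<And>a. a \<notin> {3, 4, 5} \<Longrightarrow> M a = (\<lambda>_. 0)" "\<And>t. t < n \<Longrightarrow> M 4 (int t) = word_ints w t"
      "\<And>t. t < n \<Longrightarrow> M 5 (int t) = seg t"
  shows "terminates inp X (prepare r d) (R, M) ((H * 2 + 2) + ((2 ^ H * 4 + 2) + 5)) (level_inv d)"
  unfolding prepare_def
proof (rule terminates_Seq_via)
  have NX: "2 * N \<le> X" "1 \<le> X" "N \<le> X"
  proof -
    have "0 \<le> int (d * n) * int H" "1 \<le> N" by simp_all
    then show "2 * N \<le> X" "1 \<le> X" "N \<le> X" using X by linarith+
  qed
  have "10 + r \<le> (2 * d + 2) * length inp + (r + 11)" by simp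
  then have "int (10 + r) \<le> N" using N_large by (rule order.trans[OF of_nat_mono])
  then have N10: "10 + int r \<le> N" by simp
  have N1: "1 \<le> N" by simp
  let ?R = "R(2 := N)"
  have "terminates inp X (grow (2 * d + 2) (r + 11)) (R, M) (H * 2 + 2) (\<lambda>(R', M'). M' = M \<and> R' = ?R)"
    using grow_correct[where R = R and s = "length inp" and a = "2 * d + 2" and b = "r + 11" and X = X and inp = inp and M = M, OF R(1)] NX(2,3)
    unfolding H[symmetric] by simp
  then show "terminates inp X (grow (2 * d + 2) (r + 11)) (R, M) (H * 2 + 2) (\<lambda>s. s = (?R, M))"
    by (rule terminates_mono) auto
  fix s1 assume s1: "s1 = (?R, M)"
  show "terminates inp X (Seq fill_halves (seq [
     Write (Reg 2) (Reg 2) (Lit 1),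
     Assign 11 (Lit 1), Assign 12 (Lit 1), Assign 13 (Lit 0), Assign 14 (Lit (int d))])) s1 ((2 ^ H * 4 + 2) + 5) (level_inv d)"
    unfolding s1
  proof (rule terminates_Seq_via)
    show "terminates inp X fill_halves (?R, M) (2 ^ H * 4 + 2)
      (\<lambda>(R', M'). (\<forall>x. x \<noteq> 3 \<longrightarrow> R' x = ?R x) \<and> (\<forall>a. a \<noteq> 8 \<longrightarrow> M' a = M a) \<and> halves (int (2 ^ H)) M')"
      using NX(3) by (intro fill_halves_correct) simp_all
    fix s2 assume A: "case s2 of (R', M') \<Rightarrow> (\<forall>x. x \<noteq> 3 \<longrightarrow> R' x = ?R x) \<and> (\<forall>a. a \<noteq> 8 \<longrightarrow> M' a = M a) \<and> halves (int (2 ^ H)) M'"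
    obtain R2 M2 where s2: "s2 = (R2, M2)" by (cases s2)
    have R2: "\<And>x. x \<noteq> 3 \<Longrightarrow> R2 x = ?R x" "\<And>a. a \<noteq> 8 \<Longrightarrow> M2 a = M a" "halves N M2"
      using A by (simp_all add: s2)
    define R3 where "R3 = R2(11 := 1, 12 := 1, 13 := 0, 14 := int d)"
    define M3 where "M3 = M2(N := (M2 N)(N := 1))"
    have M3_eq: "M3 a = M a" if "a \<noteq> 8" "a \<noteq> N" for a using R2(2)[OF that(1)] that(2) by (simp add: M3_def)
    have M3_0: "M3 a = (\<lambda>_. 0)" if "a \<notin> {3, 4, 5, 8, N}" for a using M3_eq[of a] M(1)[of a] that by simp
    have M3_0': "M3 0 = (\<lambda>_. 0)" "M3 1 = (\<lambda>_. 0)" "M3 2 = (\<lambda>_. 0)" "M3 6 = (\<lambda>_. 0)" "M3 7 = (\<lambda>_. 0)"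
    proof -
      have *: "M3 a = (\<lambda>_. 0)" if "a \<notin> {3, 4, 5, 8}" "a < 10" for a
      proof (rule M3_0)
        have "a \<noteq> N" using that(2) N10 by linarith
        then show "a \<notin> {3, 4, 5, 8, N}" using that(1) by blast
      qed
      show "M3 0 = (\<lambda>_. 0)" "M3 1 = (\<lambda>_. 0)" "M3 2 = (\<lambda>_. 0)" "M3 6 = (\<lambda>_. 0)" "M3 7 = (\<lambda>_. 0)"
        by (rule *; simp)+
    qed
    have hash: "hash r N M3 a b = (if a = 0 \<and> b = 0 then 1 else 0)" for a b
    proof (cases "a = 0")
      case True
      have "M2 N = (\<lambda>_. 0)" using R2(2)[of N] M(1)[of N] N10 by auto
      then show ?thesis using True N10 by (simp add: hash_def M3_def)
    next
      case False
      then have "M3 (N + a) = (\<lambda>_. 0)" if "N + a \<ge> 10 + int r" using that by (intro M3_0) auto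
      then show ?thesis using False by (simp add: hash_def)
    qed
    have slot: "slot M3 e = 0" if "e \<in> {0..} \<times> {1..int r}" for e
    proof -
      have "M3 (9 + snd e) = (\<lambda>_. 0)" using that N10 by (intro M3_0) auto
      then show ?thesis by (simp add: slot_def)
    qed
    have R3: "R3 2 = N" "R3 7 = int m" "R3 9 = int mq" "R3 10 = int n" "R3 11 = 1" "R3 12 = 1" "R3 13 = 0" "R3 14 = int d"
      using R2(1)[of 2] R2(1)[of 7] R2(1)[of 9] R2(1)[of 10] R by (simp_all add: R3_def)
    have good: "good (0 * n) (R3, M3)"
      unfolding good_def Let_def fst_conv snd_conv
    proof (intro conjI allI impI ballI)
      have "M3 8 = M2 8" using N10 by (simp add: M3_def)
      then show "halves N M3" using R2(3) by (simp add: halves_def)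
      fix t assume "t < n"
      then show "M3 4 (int t) = word_ints w t" "M3 5 (int t) = seg t" using M3_eq[of 4] M3_eq[of 5] M(2,3) N10 by simp_all
    next
      show "hash_ok r N M3 (R3 12)" using R3 by (simp add: hash_ok_def hash)
      show "node_bounds N M3 (R3 12)" using R3 by (simp add: node_bounds_def M3_0')
      fix q show "consistent_node r N M3 q" by (simp add: consistent_node_def hash M3_0')
    next
      show "slots_ok r M3 (R3 13)" unfolding slots_ok_def using R3 slot by simp
    next
      fix a t :: int assume "a \<in> {0, 1, 2}"
      then show "\<bar>M3 a t\<bar> \<le> int (0 * n)" using M3_0' by auto
    qed (use R3 M3_0' in simp_all)
    have "level_inv d (R3, M3)"
      unfolding level_inv_def Let_def fst_conv snd_conv diff_self_eq_0
    proof (intro conjI allI impI)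
      show "good (0 * n) (R3, M3)" by (rule good)
      fix i j
      have "take i w \<in> words r" "take j w \<in> words r" using w by (auto simp: words_def dest: in_set_takeD)
      then show "M3 6 (int i) = M3 6 (int j) \<longleftrightarrow> solvable_class r 0 (take i w) = solvable_class r 0 (take j w)"
        by (simp add: M3_0' solvable_class_eq_iff)
    qed (use R3 M3_0' u v in simp_all)
    moreover have "int d \<le> X" by (rule dX)
    ultimately have "wp inp X (seq [
     Write (Reg 2) (Reg 2) (Lit 1),
     Assign 11 (Lit 1), Assign 12 (Lit 1), Assign 13 (Lit 0), Assign 14 (Lit (int d))]) (level_inv d) (R2, M2)"
      using R2(1)[of 2] N1 NX by (simp add: R3_def M3_def)
    then show "terminates inp X (seq [
     Write (Reg 2) (Reg 2) (Lit 1),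
     Assign 11 (Lit 1), Assign 12 (Lit 1), Assign 13 (Lit 0), Assign 14 (Lit (int d))]) s2 5 (level_inv d)"
      unfolding s2 by (rule loop_free_terminates) simp_all
  qed
qed

text \<open>If \<open>v\<close> has a nonzero flow through a slot, the exponent is determined by the flows through this slot
  alone, and bounded by that of \<open>u\<close>.  If \<open>v\<close> has no flow, it suffices to check any exponent.\<close>

lemma exponent_correct:
  assumes inv: "level_inv 0 s"
  shows "terminates inp X (exponent_com d) s ((d * n * 4 + 3) + (((2 * n + 1) * 5 + 3) + (d * n * 5 + 6)))
    (\<lambda>s. fst s 27 \<in> {0, 1} \<and> correct_answer r d u v (if fst s 27 = 0 then Some (fst s 1) else None))"
    (is "terminates _ _ _ _ _ ?Q")
proof -
  obtain R M where s: "s = (R, M)" by (cases s)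
  have zero1: "M 1 t = 0" and zero2: "M 2 t = 0" if "t \<notin> {1..int (d * n)}" for t using level_invD(11)[OF inv that] by (simp_all add: s)
  have M1: "\<bar>M 1 t\<bar> \<le> int n" for t using level_invD(10)[OF inv, of t] by (simp add: s)
  have M2: "\<bar>M 2 t\<bar> \<le> int (d * n)" for t
  proof (cases "t \<in> {1..int (d * n)}")
    case True
    then show ?thesis using goodD(16)[OF level_invD(2)[OF inv], of 2 t] by (simp add: s)
  next
    case False
    then show ?thesis using zero2[OF False] by simp
  qed
  have R10: "R 10 = int n" using goodD(3)[OF level_invD(2)[OF inv]] by (simp add: s)
  have prod_le: "\<bar>k * M 2 t - M 1 t\<bar> \<le> X" if "\<bar>k\<bar> \<le> int n" for k t
  proof -
    have "\<bar>k * M 2 t\<bar> \<le> int n * int (d * n)" unfolding abs_mult using that M2[of t] by (intro mult_mono) auto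
    moreover have "int n * int (d * n) + int n \<le> (int n + 1) * int (d * n + 1)" by (simp add: algebra_simps)
    ultimately show ?thesis using M1[of t] X3 by linarith
  qed
  have X1: "int (d * n) + 1 \<le> X" "int n + 1 \<le> X"
  proof -
    have "0 \<le> int n * int (d * n)" "0 \<le> int (d * n)" by (simp_all del: of_nat_mult)
    moreover have "(int n + 1) * int (d * n + 1) = int n * int (d * n) + int n + int (d * n) + 1" by (simp add: algebra_simps)
    ultimately show "int (d * n) + 1 \<le> X" "int n + 1 \<le> X" using X3 by linarith+
  qed
  have ids: "\<bar>M 6 0 - M 6 (int n)\<bar> \<le> X"
    using good_bounds(5)[OF level_invD(2)[OF inv], of 0] good_bounds(5)[OF level_invD(2)[OF inv], of n] by (auto simp: s)
  have comm: "M 6 0 = M 6 (int n) \<longleftrightarrow> free_reduce w \<in> D d"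
    using level_invD(7)[OF inv, of 0 n] trivial_classes(3)[of d] by (simp add: s)
  show ?thesis
    unfolding exponent_com_def s
  proof (rule terminates_Seq_via[OF find_nonzero_correct[where R = R and d = d and n = n and X = X and inp = inp and M = M, OF R10 X1(1) zero2]])
    fix s1 assume A1: "case s1 of (R', M') \<Rightarrow> M' = M \<and> 0 \<le> R' 25 \<and> (M 2 (R' 25) = 0 \<longrightarrow> (\<forall>t. M 2 t = 0)) \<and>
      (\<forall>x. x \<notin> {3, 25, 29} \<longrightarrow> R' x = R x)"
    obtain R1 M1' where s1: "s1 = (R1, M1')" by (cases s1)
    have R1: "M1' = M" "0 \<le> R1 25" "M 2 (R1 25) = 0 \<Longrightarrow> M 2 t = 0" "R1 10 = int n" for t
      using A1 R10 by (simp_all add: s1)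
    show "terminates inp X (Seq find_exponent (check_exponent d)) s1 (((2 * n + 1) * 5 + 3) + (d * n * 5 + 6)) ?Q"
      unfolding s1 R1(1)
    proof (rule terminates_Seq_via[OF find_exponent_correct[where R = R1 and n = n and X = X and inp = inp and M = M, OF R1(4,2) X1(2) prod_le]])
      fix s2 assume A2: "case s2 of (R', M') \<Rightarrow> M' = M \<and> \<bar>R' 1\<bar> \<le> int n \<and>
        (\<forall>k. \<bar>k\<bar> \<le> int n \<longrightarrow> k * M 2 (R1 25) = M 1 (R1 25) \<longrightarrow> R' 1 * M 2 (R1 25) = M 1 (R1 25)) \<and>
        (\<forall>x. x \<notin> {1, 3, 26, 29} \<longrightarrow> R' x = R1 x)"
      obtain R2 M2' where s2: "s2 = (R2, M2')" by (cases s2)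
      have R2: "M2' = M" "\<bar>R2 1\<bar> \<le> int n" "R2 10 = int n"
        "\<bar>k\<bar> \<le> int n \<Longrightarrow> k * M 2 (R1 25) = M 1 (R1 25) \<Longrightarrow> R2 1 * M 2 (R1 25) = M 1 (R1 25)" for k
        using A2 R1(4) by (auto simp: s2)
      have unique: "R2 1 * M 2 t = M 1 t" if k: "\<forall>t. k * M 2 t = M 1 t" for k t
      proof (cases "M 2 (R1 25) = 0")
        case True
        then have "M 2 t = 0" by (rule R1(3))
        then show ?thesis using k[rule_format, of t] by simp
      next
        case False
        have "\<bar>k\<bar> * 1 \<le> \<bar>k\<bar> * \<bar>M 2 (R1 25)\<bar>" using False by (intro mult_left_mono) auto
        also have "\<dots> = \<bar>M 1 (R1 25)\<bar>" using k[rule_format, of "R1 25"] by (simp flip: abs_mult)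
        finally have "\<bar>k\<bar> \<le> int n" using M1[of "R1 25"] by simp
        then have "R2 1 * M 2 (R1 25) = k * M 2 (R1 25)" using R2(4) k by simp
        then have "R2 1 = k" using False by simp
        then show ?thesis using k by simp
      qed
      show "terminates inp X (check_exponent d) s2 (d * n * 5 + 6) ?Q"
        unfolding s2 R2(1)
      proof (rule terminates_mono[OF check_exponent_correct[where R = R2 and d = d and n = n and X = X and inp = inp and M = M, OF R2(3) X1(1) prod_le[OF R2(2)] ids] order.refl])
        show "M 1 t = 0 \<and> M 2 t = 0" if "t \<notin> {1..int (d * n)}" for t using zero1[OF that] zero2[OF that] by simp
        fix s3 :: store assume A3: "case s3 of (R', M') \<Rightarrow> R' 1 = R2 1 \<and>
          R' 27 = (if M 6 0 = M 6 (int n) \<and> (\<forall>t. R2 1 * M 2 t = M 1 t) then 0 else 1)"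
        obtain R3 M3 where s3: "s3 = (R3, M3)" by (cases s3)
        have R3: "R3 1 = R2 1" "R3 27 = (if free_reduce w \<in> D d \<and> (\<forall>t. R2 1 * M 2 t = M 1 t) then 0 else 1)"
          using A3 unfolding s3 comm by simp_all
        have exp: "is_exponent r d u v k \<longleftrightarrow> (\<forall>t. k * M 2 t = M 1 t) \<and> free_reduce w \<in> D d" for k
        proof (cases "R 11 = 1")
          case True
          then have triv: "free_reduce u \<in> D d" "free_reduce v \<in> D d" "\<And>t. M 1 t = 0 \<and> M 2 t = 0"
            using level_invD(8)[OF inv] by (simp_all add: s)
          have "free_reduce w \<in> D d"
            using triv(1,2) u v derived_series_subgroup[of d]
            by (simp add: free_reduce_mult free_reduce_inv subgroup.m_closed subgroup.m_inv_closed)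
          then show ?thesis using triv is_exponent_trivial[OF u v triv(1,2)] by simp
        next
          case False
          then have F: "R 11 = 0" using level_invD(6)[OF inv] by (simp add: s)
          then obtain l where l: "l < d" "free_reduce u \<in> D l" "free_reduce v \<in> D l"
            "\<not> (free_reduce u \<in> D (Suc l) \<and> free_reduce v \<in> D (Suc l))"
            "\<And>k. (\<forall>t. M 1 t = k * M 2 t) \<longleftrightarrow> (\<forall>e. word_flow (D l) u e = k * word_flow (D l) v e)"
            using level_invD(9)[OF inv] unfolding s fst_conv snd_conv diff_zero by blast
          have "is_exponent r d u v k \<longleftrightarrow> (\<forall>e. word_flow (D l) u e = k * word_flow (D l) v e) \<and> free_reduce w \<in> D d"
            using is_exponent_iff_flow[OF u v l(1-4)] .
          then show ?thesis unfolding l(5)[symmetric] by (simp add: eq_commute)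
        qed
        show "?Q s3"
        proof (cases "free_reduce w \<in> D d \<and> (\<forall>t. R2 1 * M 2 t = M 1 t)")
          case True
          then show ?thesis using R3 exp[of "R2 1"] by (simp add: s3)
        next
          case False
          then have "\<nexists>k. is_exponent r d u v k" using exp unique by blast
          then show ?thesis using R3 False by (auto simp: s3)
        qed
      qed
    qed
  qed
qed

definition run_time :: nat where
  "run_time = ((2 * r + 1) + ((mq + 1) * (2 * c + 7) + 5)) + ((5 + ((m * 3 + 2) + (3 + (length v * 3 + 2)))) +
    (((H * 2 + 2) + ((2 ^ H * 4 + 2) + 5)) + ((d * (n * (11 * H + 21) + 10) + 1) +
      ((d * n * 4 + 3) + (((2 * n + 1) * 5 + 3) + (d * n * 5 + 6))))))"

theorem main_correct:
  assumes R0: "R 0 = int (length inp)"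
  shows "terminates inp X (main r d c code) (R, \<lambda>_ _. 0) run_time
    (\<lambda>s. fst s 27 \<in> {0, 1} \<and> correct_answer r d u v (if fst s 27 = 0 then Some (fst s 1) else None))"
    (is "terminates _ _ _ _ _ ?Q")
  unfolding main_def run_time_def
proof (rule terminates_Seq_via)
  have X22: "2 \<le> X"
  proof -
    have "0 \<le> int (d * n) * int H" "1 \<le> N" by simp_all
    then show ?thesis using X by linarith
  qed
  show "terminates inp X (read_input r c code) (R, \<lambda>_ _. 0) ((2 * r + 1) + ((mq + 1) * (2 * c + 7) + 5)) (\<lambda>(R', M').
    R' 5 = int mq \<and> R' 7 = int m \<and> R' 0 = R 0 \<and>
    (\<forall>a. a \<notin> {3, 4, 5} \<longrightarrow> M' a = (\<lambda>_. 0)) \<and>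
    (\<forall>t < mq. M' 4 (int t) = letter_int ((u @ v) ! t) \<and> M' 5 (int t) = input.segment t) \<and>
    (\<forall>t \<ge> mq. M' 5 (int t) = 0))"
    using inj R0 X2 X22 by (intro input.read_input_correct) simp_all
  fix s1 :: store assume A1: "case s1 of (R', M') \<Rightarrow>
    R' 5 = int mq \<and> R' 7 = int m \<and> R' 0 = R 0 \<and>
    (\<forall>a. a \<notin> {3, 4, 5} \<longrightarrow> M' a = (\<lambda>_. 0)) \<and>
    (\<forall>t < mq. M' 4 (int t) = letter_int ((u @ v) ! t) \<and> M' 5 (int t) = input.segment t) \<and>
    (\<forall>t \<ge> mq. M' 5 (int t) = 0)"
  obtain R1 M1 where s1: "s1 = (R1, M1)" by (cases s1)
  have R1: "R1 5 = int mq" "R1 7 = int m" "R1 0 = R 0" "\<And>a. a \<notin> {3, 4, 5} \<Longrightarrow> M1 a = (\<lambda>_. 0)"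
    "\<And>t. t < mq \<Longrightarrow> M1 4 (int t) = word_ints w t" "\<And>t. M1 5 (int t) = seg t"
  proof -
    show "R1 5 = int mq" "R1 7 = int m" "R1 0 = R 0" using A1 by (simp_all add: s1)
    show "M1 a = (\<lambda>_. 0)" if "a \<notin> {3, 4, 5}" for a using A1 that by (simp add: s1)
    show "M1 4 (int t) = word_ints w t" if "t < mq" for t using A1 that word_ints_first[OF that] by (simp add: s1)
    show "M1 5 (int t) = seg t" for t
    proof (cases "t < mq")
      case True
      then show ?thesis using A1 by (simp add: s1 segment_seg)
    next
      case False
      then show ?thesis using A1 by (simp add: s1 seg_def)
    qed
  qed
  show "terminates inp X (Seq append_inverses (Seq (prepare r d) (Seq levels (exponent_com d)))) s1 ((5 + ((m * 3 + 2) + (3 + (length v * 3 + 2)))) +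
    (((H * 2 + 2) + ((2 ^ H * 4 + 2) + 5)) + ((d * (n * (11 * H + 21) + 10) + 1) +
      ((d * n * 4 + 3) + (((2 * n + 1) * 5 + 3) + (d * n * 5 + 6)))))) ?Q"
    unfolding s1
  proof (rule terminates_Seq_via[OF append_inverses_correct[where R = R1 and M = M1, OF R1(1,2,5)]])
    fix s2 :: store assume A2: "case s2 of (R', M') \<Rightarrow> R' 0 = R1 0 \<and> R' 7 = int m \<and> R' 9 = int mq \<and> R' 10 = int n \<and>
      (\<forall>a. a \<noteq> 4 \<longrightarrow> M' a = M1 a) \<and> (\<forall>t < n. M' 4 (int t) = word_ints w t)"
    obtain R2 M2 where s2: "s2 = (R2, M2)" by (cases s2)
    have R2: "R2 0 = int (length inp)" "R2 7 = int m" "R2 9 = int mq" "R2 10 = int n"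
      "\<And>a. a \<notin> {3, 4, 5} \<Longrightarrow> M2 a = (\<lambda>_. 0)" "\<And>t. t < n \<Longrightarrow> M2 4 (int t) = word_ints w t"
      "\<And>t. t < n \<Longrightarrow> M2 5 (int t) = seg t"
      using A2 R1 R0 by (simp_all add: s2)
    show "terminates inp X (Seq (prepare r d) (Seq levels (exponent_com d))) s2
      (((H * 2 + 2) + ((2 ^ H * 4 + 2) + 5)) + ((d * (n * (11 * H + 21) + 10) + 1) +
        ((d * n * 4 + 3) + (((2 * n + 1) * 5 + 3) + (d * n * 5 + 6))))) ?Q"
      unfolding s2
    proof (rule terminates_Seq_via[OF prepare_correct[where R = R2 and M = M2, OF R2]])
      fix s3 assume "level_inv d s3"
      then show "terminates inp X (Seq levels (exponent_com d)) s3 ((d * (n * (11 * H + 21) + 10) + 1) +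
        ((d * n * 4 + 3) + (((2 * n + 1) * 5 + 3) + (d * n * 5 + 6)))) ?Q"
      proof (rule terminates_Seq_via[OF levels_correct])
        fix s4 assume "level_inv 0 s4"
        then show "terminates inp X (exponent_com d) s4 ((d * n * 4 + 3) + (((2 * n + 1) * 5 + 3) + (d * n * 5 + 6))) ?Q"
          by (rule exponent_correct)
      qed
    qed
  qed
qed

end

section \<open>The program\<close>

lemma wf_table: "wf_com 30 (table ps)" and wf_horner: "wf_com 30 (horner k)"
  by (induction ps, simp_all) (induction k, simp_all)

lemma wf_main: "wf_com 30 (main r d c code)"
  by (simp add: main_def read_input_def append_inverses_def prepare_def exponent_com_def wf_table wf_horner
      parse_def parse_separator_def parse_letter_def negate_reversed_def grow_def fill_halves_def
      levels_def level_def level_start_def level_end_def pass_def pass_body_def edge_step_def edge_read_def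
      edge_slot_def edge_count_def edge_end_def climb_def climb_step_def
      find_nonzero_def find_exponent_def check_exponent_def)

lemma compile_aexp_deterministic: "Random a b \<notin> set (compile_aexp t e)"
  by (induction e arbitrary: t) (auto simp: cell_address_def)

lemma compile_deterministic: "Random a b \<notin> set (compile t i c)"
  by (induction c arbitrary: i) (auto simp: Let_def cell_address_def compile_aexp_deterministic)

definition code_length :: "nat \<Rightarrow> nat" where
  "code_length r = ceillog2 r + 1"

definition body :: "nat \<Rightarrow> nat \<Rightarrow> (letter \<Rightarrow> bool list) \<Rightarrow> program" where
  "body r d code = compile 30 0 (main r d (code_length r) code)"

text \<open>Variable 27 of \<open>main\<close> is 1 in case of failure, whereas register 0 of the machine has to be 0 then.\<close>

definition power_program :: "nat \<Rightarrow> nat \<Rightarrow> (letter \<Rightarrow> bool list) \<Rightarrow> program" where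
  "power_program r d code = body r d code @ [Const 30 1, Minus 0 30 27]"

lemma power_program_deterministic: "deterministic (power_program r d code)"
  using compile_deterministic by (auto simp: deterministic_def power_program_def body_def)

text \<open>The number up to which \<open>prepare\<close> lets the power of 2 grow, for an input of length \<open>code_length r * k + 1\<close>.\<close>

definition scale :: "nat \<Rightarrow> nat \<Rightarrow> nat \<Rightarrow> nat" where
  "scale r d k = (2 * d + 2) * (code_length r * k + 1) + (r + 11)"

definition height :: "nat \<Rightarrow> nat \<Rightarrow> nat \<Rightarrow> nat" where
  "height r d k = ceillog2 (scale r d k)"

text \<open>The tree has \<open>N = 2 ^ height r d k\<close> leaves, where \<open>k\<close> is the length of \<open>u @ v\<close>.  The first
  summand bounds the identifiers and the products of flows and exponents, the second one the codes of letters.\<close>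

definition value_bound :: "nat \<Rightarrow> nat \<Rightarrow> nat \<Rightarrow> int" where
  "value_bound r d k = (2 ^ height r d k) ^ 3 + 2 ^ code_length r"

text \<open>The sum of the bounds on the parts of \<open>main\<close>, as in \<open>run_time\<close>, with both words as long as \<open>u @ v\<close>.\<close>

definition step_bound :: "nat \<Rightarrow> nat \<Rightarrow> nat \<Rightarrow> nat" where
  "step_bound r d k = (let H = height r d k in
    ((2 * r + 1) + ((k + 1) * (2 * code_length r + 7) + 5)) + ((5 + ((k * 3 + 2) + (3 + (k * 3 + 2)))) +
    (((H * 2 + 2) + ((2 ^ H * 4 + 2) + 5)) + ((d * ((2 * k) * (11 * H + 21) + 10) + 1) +
      ((d * (2 * k) * 4 + 3) + (((2 * (2 * k) + 1) * 5 + 3) + (d * (2 * k) * 5 + 6)))))))"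

definition program_weight :: "nat \<Rightarrow> nat \<Rightarrow> (letter \<Rightarrow> bool list) \<Rightarrow> nat" where
  "program_weight r d code = com_weight (main r d (code_length r) code) + 1"

definition time_limit :: "nat \<Rightarrow> nat \<Rightarrow> (letter \<Rightarrow> bool list) \<Rightarrow> nat \<Rightarrow> nat" where
  "time_limit r d code k =
     (step_bound r d k * length (body r d code) + 2) * instr_cost (value_bound r d k) (program_weight r d code)"

lemma scale_pos: "0 < scale r d k"
  by (simp add: scale_def)

lemma scale_le: "scale r d k \<le> 2 ^ height r d k"
  unfolding height_def by (subst ceillog2_le_iff[OF scale_pos, symmetric]) simp

lemma height_less: "2 ^ height r d k < 2 * scale r d k"
  by (subst ceillog2_ge_iff[OF scale_pos, symmetric]) (simp add: height_def)

lemma scale_bounds: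
  "d * (2 * k) + 11 + r \<le> scale r d k" "2 * k + 11 \<le> scale r d k" "d \<le> scale r d k"
  "code_length r * k + 1 \<le> scale r d k"
proof -
  let ?c = "code_length r"
  have c: "1 \<le> ?c" by (simp add: code_length_def)
  have ck: "k \<le> ?c * k" using c by simp
  have "d * k \<le> d * (?c * k)" using ck by (rule mult_le_mono2)
  moreover have "d * (2 * k) = 2 * (d * k)" by simp
  moreover have "scale r d k = 2 * (d * (?c * k)) + 2 * (?c * k) + 2 * d + 2 + r + 11" by (simp add: scale_def algebra_simps)
  ultimately show "d * (2 * k) + 11 + r \<le> scale r d k" "2 * k + 11 \<le> scale r d k" "d \<le> scale r d k" "?c * k + 1 \<le> scale r d k"
    using ck by linarith+
qed

lemma value_bounds:
  fixes r d k :: nat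
  defines "N \<equiv> (2 :: int) ^ height r d k" and "X \<equiv> value_bound r d k"
  shows "int (scale r d k) \<le> N" "11 \<le> N" "N \<le> X" "N * N \<le> X" "2 ^ code_length r \<le> X"
    "1 + N * int (height r d k) + 2 * N \<le> X"
proof -
  have "int (scale r d k) \<le> int (2 ^ height r d k)" using scale_le by (rule of_nat_mono)
  then show 1: "int (scale r d k) \<le> N" by (simp add: N_def)
  show 11: "11 \<le> N" using 1 scale_bounds(2)[of k r d] by linarith
  have N3: "N ^ 3 = N * (N * N)" by (simp add: power3_eq_cube)
  have p: "0 < (2::int) ^ code_length r" by simp
  have NN: "11 * N \<le> N * N" using 11 by (intro mult_right_mono) auto
  have "11 * (N * N) \<le> N * (N * N)" using 11 by (intro mult_right_mono) auto
  then have X: "11 * (N * N) \<le> X" unfolding X_def value_bound_def N_def[symmetric] N3 using p by linarith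
  then show "N \<le> X" "N * N \<le> X" using NN 11 by linarith+
  have "0 \<le> N ^ 3" using 11 by simp
  then show "2 ^ code_length r \<le> X" unfolding X_def value_bound_def N_def[symmetric] by simp
  have "int (height r d k) \<le> N" unfolding N_def
    using less_exp[of "height r d k"] by (metis less_imp_le of_nat_le_iff of_nat_numeral of_nat_power)
  then have "N * int (height r d k) \<le> N * N" using 11 by (intro mult_left_mono) auto
  then show "1 + N * int (height r d k) + 2 * N \<le> X" using X NN 11 by linarith
qed

lemma program_correct:
  assumes code: "letter_code r code" and u: "u \<in> words r" and v: "v \<in> words r"
  shows "\<exists>a. correct_answer r d u v a \<and>
    outputs_within (power_program r d code) (encode_pair code u v) (time_limit r d code (length u + length v)) (return_pmf a)"
proof -
  define k where "k = length u + length v"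
  define c where "c = code_length r"
  define H where "H = height r d k"
  define X where "X = value_bound r d k"
  let ?inp = "encode_pair code u v"
  note vb = value_bounds[where r = r and d = d and k = k, folded H_def X_def]
  have c1: "1 \<le> c" by (simp add: c_def code_length_def)
  interpret input: coded_words r c code u v
    by unfold_locales (use code c1 u v in \<open>auto simp: letter_code_def c_def code_length_def\<close>)
  have len: "length ?inp = c * k + 1" by (simp add: input.length_inp k_def)
  have int_le: "int a \<le> 2 ^ H" if "a \<le> scale r d k" for a
    using vb(1) that by linarith
  have s1: "int (d * (2 * k)) + 11 + int r \<le> 2 ^ H" "int (2 * k) + 11 \<le> 2 ^ H" "int d \<le> 2 ^ H" "int (length ?inp) \<le> 2 ^ H"
    using int_le[OF scale_bounds(1)] int_le[OF scale_bounds(2)] int_le[OF scale_bounds(3)] int_le[OF scale_bounds(4)]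
    by (simp_all add: len c_def)
  have dn: "int (d * (2 * k)) \<le> 2 ^ H" using s1(1) by linarith
  interpret power_run_coded r c code u v d H X
  proof unfold_locales
    show "int (d * (2 * (length u + length v))) + 10 + int r \<le> 2 ^ H" using s1(1) unfolding k_def by linarith
    have "int (d * (2 * k)) * int H \<le> 2 ^ H * int H" using dn by (intro mult_right_mono) auto
    then show "1 + int (d * (2 * (length u + length v))) * int H + 2 * 2 ^ H \<le> X"
      using vb(6) unfolding k_def[symmetric] by linarith
    show "int (2 * (length u + length v)) \<le> X" using s1(2) vb(3) unfolding k_def[symmetric] by linarith
    show "int d \<le> X" using s1(3) vb(3) by linarith
    show "inj_on code (letters r)" using code by (simp add: letter_code_def)
    show "H = ceillog2 ((2 * d + 2) * length ?inp + (r + 11))" unfolding H_def height_def scale_def len c_def ..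
    show "2 ^ c \<le> X" using vb(5) by (simp add: c_def)
    show "int (length ?inp) \<le> X" using s1(4) vb(3) by linarith
    show "int r \<le> X" using s1(1) vb(3) by linarith
    have "(int (2 * k) + 1) * int (d * (2 * k) + 1) \<le> 2 ^ H * 2 ^ H"
      using s1(1,2) by (intro mult_mono) auto
    then show "(int (2 * (length u + length v)) + 1) * int (d * (2 * (length u + length v)) + 1) \<le> X"
      using vb(4) unfolding k_def[symmetric] by linarith
  qed (use u v in simp_all)
  let ?P = "power_program r d code" and ?C = "body r d code" and ?W = "program_weight r d code"
  let ?c0 = "init_config ?inp"
  have two_le: "2 \<le> X" using vb(2,3) by linarith
  have lenX: "int (length ?inp) \<le> X" using s1(4) vb(3) by linarith
  interpret compiled ?P 30 ?inp X ?W
  proof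
    show "2 \<le> X" by (rule two_le)
    show "\<bar>a\<bar> \<le> X" if "a \<in> set ?inp" for a
      using that two_le by (auto simp: encode_pair_def encode_word_def)
    show "int (length ?inp) \<le> X" by (rule lenX)
  qed simp
  have "terminates ?inp X (main r d c code) (regs ?c0, \<lambda>_ _. 0) run_time
    (\<lambda>s. fst s 27 \<in> {0, 1} \<and> correct_answer r d u v (if fst s 27 = 0 then Some (fst s 1) else None))"
    by (rule main_correct) (simp add: init_config_def)
  then obtain j s where j: "exec_com ?inp X (main r d c code) (regs ?c0, \<lambda>_ _. 0) j s" "j \<le> run_time"
    and s: "fst s 27 \<in> {0, 1}" "correct_answer r d u v (if fst s 27 = 0 then Some (fst s 1) else None)"
    unfolding terminates_def by blast
  have C: "compile 30 0 (main r d c code) = ?C" by (simp add: body_def c_def)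
  have code_at: "code_at ?P 0 ?C" "code_at ?P (length ?C) [Const 30 1]" "code_at ?P (Suc (length ?C)) [Minus 0 30 27]"
    by (auto simp: code_at_def power_program_def nth_append)
  have pc0: "pc ?c0 = 0" by (simp add: init_config_def)
  have rep: "represents 30 ?inp (regs ?c0, \<lambda>_ _. 0) ?c0"
    unfolding represents_def
  proof (intro conjI allI impI)
    fix a b :: int assume "0 \<le> a" "0 \<le> b"
    then have "int (length ?inp) \<le> address (length ?inp) a b" by (rule address_ge)
    then have "length ?inp \<le> nat (address (length ?inp) a b)" by simp
    then show "mem ?c0 (nat (address (length ?inp) a b)) = snd (regs ?c0, \<lambda>_ _. 0) a b"
      by (simp add: init_config_def)
  qed (simp_all add: init_config_def)
  have "bounded_store 30 X (regs ?c0, \<lambda>_ _. 0)"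
    using lenX two_le by (simp add: bounded_store_def init_config_def)
  then obtain i g where i: "i \<le> j * length ?C" "simulates ?c0 i s (length ?C) g"
    using compile_correct[OF j(1), where g = ?c0, unfolded pc0 C] code_at(1) rep wf_main
    by (auto simp: program_weight_def c_def)
  then have g: "reaches ?P K i ?c0 g" "pc g = length ?C" "regs g 1 = fst s 1" "regs g 27 = fst s 27"
    by (simp_all add: simulates_def represents_def)
  have XW: "1 \<le> X ^ ?W" using vb(2,3) by simp
  define g1 where "g1 = (det_exec (Const 30 1) g)\<lparr>time := time g + cost (Const 30 1) g\<rparr>"
  define g2 where "g2 = (det_exec (Minus 0 30 27) g1)\<lparr>time := time g1 + cost (Minus 0 30 27) g1\<rparr>"
  have g1: "pc g1 = Suc (length ?C)" "regs g1 30 = 1" "regs g1 27 = fst s 27" "regs g1 1 = fst s 1"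
    using g by (simp_all add: g1_def set_reg_def)
  have g2: "pc g2 = length ?C + 2" "regs g2 0 = 1 - fst s 27" "regs g2 1 = fst s 1"
    using g1 by (simp_all add: g2_def set_reg_def)
  have "reaches ?P K 1 g g1"
    unfolding g1_def using code_at(2) XW by (intro reaches_instr cost_le) (simp_all add: g(2))
  moreover have "reaches ?P K 1 g1 g2"
    unfolding g2_def using code_at(3) XW s(1) by (intro reaches_instr cost_le) (auto simp: g1)
  ultimately have all: "reaches ?P K (i + 1 + 1) ?c0 g2"
    using g(1) by (blast intro: reaches_add)
  have halted: "halted ?P g2" by (simp add: halted_def g2 power_program_def)
  have "run_time \<le> step_bound r d k"
    unfolding run_time_def step_bound_def Let_def H_def[symmetric] c_def[symmetric] k_def[symmetric]
    by (intro add_mono mult_le_mono order.refl) (simp_all add: k_def)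
  then have "i + 1 + 1 \<le> step_bound r d k * length ?C + 2"
    using order.trans[OF i(1) mult_le_mono1[OF order.trans[OF j(2)]]] by simp
  then have "(i + 1 + 1) * K \<le> time_limit r d code k"
    unfolding time_limit_def X_def[symmetric] by (rule mult_le_mono1)
  moreover have "time g2 \<le> (i + 1 + 1) * K" using all by (simp add: reaches_def init_config_def)
  ultimately have time: "time g2 \<le> time_limit r d code k" by linarith
  have run: "run ?P (i + 1 + 1) ?c0 = return_pmf g2"
    using all run_deterministic[OF power_program_deterministic] by (simp add: reaches_def del: run.simps)
  have out: "outputs_within ?P ?inp (time_limit r d code k) (return_pmf (answer g2))"
    unfolding outputs_within_def using halted time
    by (intro exI[of _ "i + 1 + 1"]) (simp only: run set_return_pmf map_return_pmf; simp)
  have ans: "answer g2 = (if fst s 27 = 0 then Some (fst s 1) else None)"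
    using s(1) by (auto simp: answer_def g2 simp del: One_nat_def)
  have "correct_answer r d u v (answer g2)" unfolding ans by (rule s(2))
  then show ?thesis using out unfolding k_def by blast
qed

section \<open>The running time\<close>

lemma floorlog_le: "floorlog 2 n \<le> n"
proof (cases "n = 0")
  case False
  then have "floorlog 2 n \<le> n \<longleftrightarrow> n < 2 ^ n" by (simp add: floorlog_le_iff)
  then show ?thesis by (simp add: less_exp)
qed (simp add: floorlog_def)

lemma instr_cost_le: "instr_cost X W \<le> 2 * bit_size (X ^ W) ^ 3"
proof -
  let ?b = "bit_size (X ^ W)"
  have "mul_cost ?b \<le> ?b * ?b * ?b"
    unfolding mul_cost_def by (intro mult_le_mono order.refl floorlog_le order.trans[OF floorlog_le floorlog_le])
  then show ?thesis by (simp add: instr_cost_def power3_eq_cube)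
qed

lemma bit_size_power: "bit_size (2 ^ j) = j + 2"
  by (simp add: bit_size_def bitlen_def floorlog_def nat_power_eq nat_add_distrib)

lemma value_bound_le: "value_bound r d k \<le> 2 ^ (3 * height r d k + code_length r + 1)"
proof -
  let ?H = "height r d k" and ?c = "code_length r"
  have "(2::int) ^ (3 * ?H) \<le> 2 ^ (3 * ?H + ?c)" "(2::int) ^ ?c \<le> 2 ^ (3 * ?H + ?c)"
    by (intro power_increasing; simp)+
  moreover have "value_bound r d k = 2 ^ (3 * ?H) + 2 ^ ?c" by (simp add: value_bound_def mult.commute flip: power_mult)
  moreover have "(2::int) ^ (3 * ?H + ?c + 1) = 2 * 2 ^ (3 * ?H + ?c)" by simp
  ultimately show ?thesis by linarith
qed

lemma bit_size_value_bound:
  "bit_size (value_bound r d k ^ W) \<le> (code_length r + 4) * (W + 2) * (height r d k + 1)"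
proof -
  let ?x = "3 * height r d k + code_length r + 1"
  have pos: "0 \<le> value_bound r d k" by (simp add: value_bound_def)
  have "value_bound r d k ^ W \<le> 2 ^ (?x * W)"
    unfolding power_mult by (rule power_mono[OF value_bound_le pos])
  then have "bit_size (value_bound r d k ^ W) \<le> bit_size (2 ^ (?x * W))"
    using pos by (intro bit_size_mono) simp
  also have "\<dots> = ?x * W + 2" by (rule bit_size_power)
  also have "\<dots> \<le> ?x * (W + 2)" by simp
  also have "\<dots> \<le> ((code_length r + 4) * (height r d k + 1)) * (W + 2)" by (intro mult_le_mono1) (simp add: add_mult_distrib)
  finally show ?thesis by (simp only: ac_simps)
qed

text \<open>All terms are at most linear in \<open>k\<close> and \<open>N\<close>, up to a factor \<open>H\<close> for the updates of the tree.\<close>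

lemma step_bound_le:
  obtains G where "\<And>k. step_bound r d k \<le> G * (2 ^ height r d k * (height r d k + 1))"
proof -
  define c where "c = code_length r"
  (* the constant term and the coefficient of k in step_bound *)
  define a where "a = 2 * r + (2 * c + 7) + 10 * d + 45"
  define b where "b = (2 * c + 7) + 6 + 42 * d + 8 * d + 20 + 10 * d"
  have "step_bound r d k \<le> (a + b + 2 + 4 + 22 * d) * (2 ^ height r d k * (height r d k + 1))" for k
  proof -
    let ?H = "height r d k"
    let ?Y = "2 ^ ?H * (?H + 1)"
    have kN: "k \<le> 2 ^ ?H" using scale_le[of r d k] scale_bounds(2)[of k r d] by linarith
    have N1: "1 \<le> (2::nat) ^ ?H" by simp
    have "1 \<le> ?Y" using mult_le_mono[OF N1, of 1 "?H + 1"] by simp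
    moreover have "k \<le> ?Y" using mult_le_mono[OF kN, of 1 "?H + 1"] by simp
    moreover have "?H \<le> ?Y" using mult_le_mono[OF N1, of ?H "?H + 1"] by simp
    moreover have "2 ^ ?H \<le> ?Y" by simp
    moreover have "k * ?H \<le> ?Y" using mult_le_mono[OF kN, of ?H "?H + 1"] by simp
    ultimately have "a * 1 + b * k + 2 * ?H + 4 * 2 ^ ?H + (22 * d) * (k * ?H) \<le>
      a * ?Y + b * ?Y + 2 * ?Y + 4 * ?Y + (22 * d) * ?Y"
      by (intro add_mono mult_le_mono2)
    moreover have "step_bound r d k = a * 1 + b * k + 2 * ?H + 4 * 2 ^ ?H + (22 * d) * (k * ?H)"
      by (simp add: step_bound_def Let_def a_def b_def c_def[symmetric] algebra_simps)
    ultimately show ?thesis by (simp only: add_mult_distrib)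
  qed
  then show ?thesis by (rule that)
qed

text \<open>The cost of an instruction is at most cubic in the number of bits, which is linear in the height.\<close>

lemma time_limit_le:
  obtains G where "\<And>k. time_limit r d code k \<le> G * (2 ^ height r d k * (height r d k + 1) ^ 4)"
proof -
  obtain G where G: "\<And>k. step_bound r d k \<le> G * (2 ^ height r d k * (height r d k + 1))"
    using step_bound_le[of r d] by blast
  define L where "L = length (body r d code)"
  define W where "W = program_weight r d code"
  define E where "E = (code_length r + 4) * (W + 2)"
  have "time_limit r d code k \<le> ((G * L + 2) * (2 * E ^ 3)) * (2 ^ height r d k * (height r d k + 1) ^ 4)" for k
  proof -
    let ?h = "height r d k + 1" and ?N = "(2::nat) ^ height r d k"
    have "bit_size (value_bound r d k ^ W) ^ 3 \<le> (E * ?h) ^ 3"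
      unfolding E_def by (intro power_mono bit_size_value_bound) simp
    then have "instr_cost (value_bound r d k) W \<le> 2 * (E * ?h) ^ 3"
      using instr_cost_le[of "value_bound r d k" W] by linarith
    then have cost: "instr_cost (value_bound r d k) W \<le> 2 * E ^ 3 * ?h ^ 3"
      by (simp only: power_mult_distrib mult.assoc)
    have "step_bound r d k * L \<le> (G * (?N * ?h)) * L" by (intro mult_le_mono1 G)
    moreover have "2 \<le> 2 * (?N * ?h)" using mult_le_mono[of 1 ?N 1 ?h] by simp
    ultimately have "step_bound r d k * L + 2 \<le> (G * L + 2) * (?N * ?h)" by (simp only: add_mult_distrib ac_simps add_mono)
    from mult_le_mono[OF this cost] show ?thesis
      unfolding time_limit_def L_def[symmetric] W_def[symmetric]
      by (simp only: ac_simps power4_eq_xxxx power3_eq_cube)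
  qed
  then show ?thesis by (rule that)
qed

text \<open>The number of leaves of the tree is linear in the length \<open>k\<close> of the input, so that its height is
  logarithmic.\<close>

lemma quasi_linear_time_limit: "quasi_linear (time_limit r d code)"
proof -
  obtain G where G: "\<And>k. time_limit r d code k \<le> G * (2 ^ height r d k * (height r d k + 1) ^ 4)"
    using time_limit_le[of r d code] by blast
  define a where "a = 2 * ((2 * d + 2) * (code_length r + 1) + (r + 11))"
  define b :: real where "b = 2 / ln 2 + 1"
  have N_le: "2 ^ height r d k \<le> a * k" if "1 \<le> k" for k
  proof -
    have "2 ^ height r d k \<le> 2 * scale r d k" using height_less[of r d k] by simp
    also have "scale r d k \<le> (2 * d + 2) * ((code_length r + 1) * k) + (r + 11) * k"
      unfolding scale_def using that by (intro add_mono mult_le_mono2) simp_all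
    also have "2 * \<dots> = a * k" by (simp add: a_def algebra_simps)
    finally show ?thesis by simp
  qed
  have ev: "eventually (\<lambda>k::nat. norm (real (time_limit r d code k)) \<le>
      (real G * real a * b ^ 4) * norm (real k * ln (real k) ^ 4)) at_top"
    using eventually_ge_at_top[of "max 3 a"]
  proof eventually_elim
    case (elim k)
    let ?h = "height r d k"
    have "exp 1 \<le> (3::real)" by (rule exp_le)
    then have "exp 1 \<le> real k" using elim by simp
    then have ln1: "1 \<le> ln (real k)" using elim by (subst ln_ge_iff) auto
    have "2 ^ ?h \<le> a * k" using elim by (intro N_le) simp
    also have "\<dots> \<le> k * k" using elim by simp
    finally have "real (2 ^ ?h) \<le> real (k * k)" by (rule of_nat_mono)
    then have "(2::real) ^ ?h \<le> real k * real k" by simp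
    then have "ln ((2::real) ^ ?h) \<le> ln (real k * real k)" using elim by (subst ln_le_cancel_iff) auto
    then have "real ?h * ln 2 \<le> 2 * ln (real k)" using elim by (simp add: ln_realpow ln_mult)
    then have "real ?h \<le> 2 / ln 2 * ln (real k)" by (simp add: field_simps)
    then have h: "real ?h + 1 \<le> b * ln (real k)" using ln1 by (simp add: b_def algebra_simps)
    have "real (time_limit r d code k) \<le> real (G * (2 ^ ?h * (?h + 1) ^ 4))" using G by (rule of_nat_mono)
    also have "\<dots> = real G * (real (2 ^ ?h) * (real ?h + 1) ^ 4)" by (simp add: add.commute)
    also have "\<dots> \<le> real G * (real (a * k) * (b * ln (real k)) ^ 4)"
      using h elim by (intro mult_left_mono mult_mono power_mono of_nat_mono N_le) auto
    also have "\<dots> = (real G * real a * b ^ 4) * (real k * ln (real k) ^ 4)" by (simp add: power_mult_distrib)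
    finally show ?case using ln1 by simp
  qed
  show ?thesis unfolding quasi_linear_def using bigoI[OF ev] by blast
qed

theorem theorem5p2:
  fixes r d :: nat and code :: "letter \<Rightarrow> bool list"
  assumes "letter_code r code"
  shows "\<exists>P T. quasi_linear T \<and>
    (\<forall>u \<in> words r. \<forall>v \<in> words r. \<exists>D.
       outputs_within P (encode_pair code u v) (T (length u + length v)) D \<and>
       measure_pmf.prob D {a. correct_answer r d u v a}
         \<ge> (1 - 1 / real (length u + length v)) powr (1 + log 3 (real (length u + length v))))"
proof (intro exI[of _ "power_program r d code"] exI[of _ "time_limit r d code"] conjI ballI)
  show "quasi_linear (time_limit r d code)" by (rule quasi_linear_time_limit)
  fix u v assume uv: "u \<in> words r" "v \<in> words r"
  obtain a where a: "correct_answer r d u v a"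
    "outputs_within (power_program r d code) (encode_pair code u v) (time_limit r d code (length u + length v)) (return_pmf a)"
    using program_correct[OF assms uv] by blast
  let ?k = "real (length u + length v)"
  have "(1 - 1 / ?k) powr (1 + log 3 ?k) \<le> 1"
  proof (cases "length u + length v = 0")
    case False
    then have "1 \<le> ?k" by linarith
    then have "0 \<le> log 3 ?k" "0 \<le> 1 - 1 / ?k" by simp_all
    then show ?thesis by (intro powr_le1) simp_all
  qed simp
  moreover have "measure_pmf.prob (return_pmf a) {a. correct_answer r d u v a} = 1"
    using a(1) by (simp add: measure_return_pmf)
  ultimately show "\<exists>D. outputs_within (power_program r d code) (encode_pair code u v) (time_limit r d code (length u + length v)) D \<and>
      (1 - 1 / ?k) powr (1 + log 3 ?k) \<le> measure_pmf.prob D {a. correct_answer r d u v a}"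
    using a(2) by (intro exI[of _ "return_pmf a"]) simp
qed

end
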